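(* Let $f\in BV$ and $V\in H^{+}$, and let $u$ be the solution to the initial value problem \[ iu_t+u_{xx}=V(x)u,\quad x\in\mathbb T,\ t\in\mathbb R,\qquad u(0,x)=f(x). \] If $f$ is continuous, then $u(t,x)$ is jointly continuous on $\mathbb R\times\mathbb T$. If $f$ is discontinuous, then: \begin{itemize} \item if $t\notin\pi\mathbb Q$, then $u(t,x)$ is continuous with respect to $x$; \item if $t\in\pi\mathbb Q$, then $u(t,x)$ is bounded (as a function of $x$) and necessarily contains discontinuities, and these are at most countable. \end{itemize}
   Context: $\mathbb T=\mathbb R/2\pi\mathbb Z$; functions on $\mathbb T$ are identified with $2\pi$-periodic functions. $BV$ is the space of functions of bounded variation on $\mathbb T$. The Fourier coefficients are $\widehat f(k)=\frac1{2\pi}\int_0^{2\pi}e^{-ikx}f(x)\,dx$, $k\in\mathbb Z$. For $s\ge0$, $H^s$ is the Sobolev space on $\mathbb T$ with norm $\|f\|_{H^s}=\big(\sum_{k\in\mathbb Z}\langle k\rangle^{2s}|\widehat f(k)|^2\big)^{1/2}$, where $\langle k\rangle=1+|k|$, and $H^{+}=\bigcup_{\epsilon>0}H^{\epsilon}$. Also $\pi\mathbb Q=\{\pi q: q\in\mathbb Q\}$. If $f\in BV$ then $f\in H^s$ for every $s<1/2$. Notion of solution. For $c\in\mathbb C$, $e^{it(\partial_{xx}-c)}$ is the Fourier multiplier with symbol $e^{-it(k^2+c)}$. For $s>0$ and $f\in H^s$, the solution $u$ is the function $u\in C(\mathbb R;H^s)$ satisfying the Duhamel formula \[ u(t)=e^{it(\partial_{xx}-\widehat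 V(0))}f-i\int_0^t e^{i(t-t')(\partial_{xx}-\widehat V(0))}\big[(V-\widehat V(0))u(t')\big]dt',\qquad t\in\mathbb R, \] and such that, for some $b>1/2$, $e^{it\widehat V(0)}u$ restricted to $I\times\mathbb T$ belongs to $X^{s,b}_I$ for every compact interval $I$. Here $X^{s,b}$ is the closure of $\mathcal S(\mathbb R)_tC^\infty(\mathbb T)_x$ under the norm $\|w\|_{X^{s,b}}=\|\langle k\rangle^s\langle\tau+k^2\rangle^b\widetilde w(\tau,k)\|_{L^2_\tau\ell^2_k(\mathbb R\times\mathbb Z)}$, with $\widetilde w(\tau,k)=\frac1{2\pi}\int_{\mathbb R}\int_0^{2\pi}e^{-i(\tau t+kx)}w(t,x)\,dx\,dt$ and $\langle\cdot\rangle=1+|\cdot|$, and $\|w\|_{X^{s,b}_I}=\inf\{\|W\|_{X^{s,b}}: W|_{I\times\mathbb T}=w\}$. In this theorem one may take any $s\in(0,1/2)$. Functions are identified when they agree almost everywhere: "continuous" means having a continuous representative and "discontinuous" means having none. The statement for $t\in\pi\mathbb Q$ means that $u(t,\cdot)$ has no continuous representative but has a bounded representative whose set of discontinuities is at most countable. *)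

theory Defs
  imports "HOL-Analysis.Analysis"
begin

text \<open>
  Functions on the torus \<open>T\<close> are \<open>2\<pi>\<close>-periodic functions on the real line. They are identified when
  they agree almost everywhere; continuity and boundedness of such a class therefore mean that of
  some representative. \<open>BV\<close> below consists of the representatives of bounded variation themselves.
\<close>

definition periodic :: "(real \<Rightarrow> complex) \<Rightarrow> bool" where
  "periodic f \<longleftrightarrow> (\<forall>x. f (x + 2 * pi) = f x)"

definition ae_eq :: "(real \<Rightarrow> complex) \<Rightarrow> (real \<Rightarrow> complex) \<Rightarrow> bool" where
  "ae_eq f g \<longleftrightarrow> (AE x in lebesgue. f x = g x)"

definition continuous_rep :: "(real \<Rightarrow> complex) \<Rightarrow> bool" where
  "continuous_rep f \<longleftrightarrow> (\<exists>g. periodic g \<and> continuous_on UNIV g \<and> ae_eq f g)"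

definition pi_rationals :: "real set" where
  "pi_rationals = {pi * q | q. q \<in> \<rat>}"

definition BV :: "(real \<Rightarrow> complex) set" where
  "BV = {f. periodic f \<and>
     (\<exists>B. \<forall>(n::nat) (x :: nat \<Rightarrow> real).
        mono_on {..n} x \<and> x ` {..n} \<subseteq> {0..2*pi} \<longrightarrow>
        (\<Sum>i<n. cmod (f (x (Suc i)) - f (x i))) \<le> B)}"

definition fourier_coeff :: "(real \<Rightarrow> complex) \<Rightarrow> int \<Rightarrow> complex" where
  "fourier_coeff f k =
     1 / (2 * pi) * (LINT x:{0..2*pi}|lebesgue. exp (- \<i> * of_int k * of_real x) * f x)"

definition japanese :: "real \<Rightarrow> real" where
  "japanese y = 1 + \<bar>y\<bar>"

definition Hs_norm :: "real \<Rightarrow> (real \<Rightarrow> complex) \<Rightarrow> real" where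
  "Hs_norm s f =
     sqrt (infsum (\<lambda>k::int. japanese k powr (2 * s) * (cmod (fourier_coeff f k))\<^sup>2) UNIV)"

text \<open>Used for \<open>s \<ge> 0\<close> only, where \<open>H\<^sup>s\<close> is a subspace of \<open>L\<^sup>2\<close>.\<close>

definition Hs :: "real \<Rightarrow> (real \<Rightarrow> complex) set" where
  "Hs s = {f. periodic f \<and> f \<in> borel_measurable lebesgue \<and>
     set_integrable lebesgue {0..2*pi} (\<lambda>x. (cmod (f x))\<^sup>2) \<and>
     (\<lambda>k::int. japanese k powr (2 * s) * (cmod (fourier_coeff f k))\<^sup>2) summable_on UNIV}"

definition Hplus :: "(real \<Rightarrow> complex) set" where
  "Hplus = (\<Union>\<epsilon>\<in>{0<..}. Hs \<epsilon>)"

definition continuous_in_Hs :: "real \<Rightarrow> (real \<Rightarrow> real \<Rightarrow> complex) \<Rightarrow> bool" where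
  "continuous_in_Hs s u \<longleftrightarrow> (\<forall>t. u t \<in> Hs s) \<and>
     (\<forall>t. ((\<lambda>t'. Hs_norm s (\<lambda>x. u t' x - u t x)) \<longlongrightarrow> 0) (at t))"

text \<open>
  The multiplier \<open>exp (it (\<partial>\<^sub>x\<^sub>x - c))\<close>, acting on sequences of Fourier coefficients. Working on
  the Fourier side lets it act on the product \<open>(V - V0) u(t')\<close>, where \<open>V0\<close> is the mean of \<open>V\<close>. That
  product is in general only in \<open>L\<^sup>1\<close>, so its image is a distribution and need not be a function.
\<close>

definition schroedinger_mult :: "real \<Rightarrow> complex \<Rightarrow> (int \<Rightarrow> complex) \<Rightarrow> int \<Rightarrow> complex" where
  "schroedinger_mult t c a k = exp (- \<i> * of_real t * ((of_int k)\<^sup>2 + c)) * a k"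

text \<open>
  The Duhamel formula as an identity of periodic distributions, that is, of all Fourier
  coefficients. The interval integral is oriented, so \<open>t < 0\<close> is covered.
\<close>

definition duhamel ::
  "(real \<Rightarrow> complex) \<Rightarrow> (real \<Rightarrow> complex) \<Rightarrow> (real \<Rightarrow> real \<Rightarrow> complex) \<Rightarrow> bool" where
  "duhamel f V u \<longleftrightarrow> (let V0 = fourier_coeff V 0 in
     \<forall>t k. fourier_coeff (u t) k =
       schroedinger_mult t V0 (fourier_coeff f) k
       - \<i> * (LBINT t'=ereal 0..ereal t.
           schroedinger_mult (t - t') V0 (fourier_coeff (\<lambda>x. (V x - V0) * u t' x)) k))"

text \<open>
  Schwartz in \<open>t\<close>, smooth and periodic in \<open>x\<close>: \<open>D j l\<close> is the mixed derivative of \<open>\<phi>\<close>, of order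
  \<open>j\<close> in \<open>t\<close> and \<open>l\<close> in \<open>x\<close>. Its continuity is automatic, since the first partial derivatives of
  \<open>D j l\<close> are bounded.
\<close>

definition test_fun :: "(real \<Rightarrow> real \<Rightarrow> complex) \<Rightarrow> bool" where
  "test_fun \<phi> \<longleftrightarrow> (\<forall>t. periodic (\<phi> t)) \<and>
     (\<exists>D :: nat \<Rightarrow> nat \<Rightarrow> real \<Rightarrow> real \<Rightarrow> complex. D 0 0 = \<phi> \<and>
       (\<forall>j l t x. ((\<lambda>t. D j l t x) has_vector_derivative D (Suc j) l t x) (at t) \<and>
                  ((\<lambda>x. D j l t x) has_vector_derivative D j (Suc l) t x) (at x)) \<and>
       (\<forall>m j l. \<exists>C. \<forall>t x. \<bar>t\<bar> ^ m * cmod (D j l t x) \<le> C))"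

definition spacetime_fourier :: "(real \<Rightarrow> real \<Rightarrow> complex) \<Rightarrow> real \<Rightarrow> int \<Rightarrow> complex" where
  "spacetime_fourier w \<tau> k =
     1 / (2 * pi) * (LBINT t. (LBINT x:{0..2*pi}. exp (- \<i> * of_real (\<tau> * t + k * x)) * w t x))"

text \<open>Only applied to test functions, for which the integrals and the sum converge.\<close>

definition Xsb_norm :: "real \<Rightarrow> real \<Rightarrow> (real \<Rightarrow> real \<Rightarrow> complex) \<Rightarrow> real" where
  "Xsb_norm s b w =
     sqrt (infsum (\<lambda>k::int. LBINT \<tau>.
       (japanese k powr s * japanese (\<tau> + k\<^sup>2) powr b * cmod (spacetime_fourier w \<tau> k))\<^sup>2) UNIV)"

text \<open>
  The closure of the test functions under \<open>Xsb_norm\<close>, used for \<open>s, b \<ge> 0\<close> only. There the norm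
  dominates the \<open>L\<^sup>2\<close> norm, so the completion is realised inside \<open>L\<^sup>2(\<real> \<times> T)\<close>: its elements are
  the \<open>L\<^sup>2\<close> limits of the sequences of test functions that are Cauchy for \<open>Xsb_norm\<close>.
\<close>

definition Xsb :: "real \<Rightarrow> real \<Rightarrow> (real \<Rightarrow> real \<Rightarrow> complex) set" where
  "Xsb s b = {w. (\<forall>t. periodic (w t)) \<and>
     (\<lambda>(t, x). w t x) \<in> borel_measurable borel \<and>
     (\<exists>\<phi> :: nat \<Rightarrow> real \<Rightarrow> real \<Rightarrow> complex.
        (\<forall>n. test_fun (\<phi> n)) \<and>
        (\<forall>e>0. \<exists>N. \<forall>m\<ge>N. \<forall>n\<ge>N. Xsb_norm s b (\<lambda>t x. \<phi> m t x - \<phi> n t x) < e) \<and>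
        (\<lambda>n. \<integral>\<^sup>+ (t, x) \<in> UNIV \<times> {0..2*pi}. ennreal ((cmod (\<phi> n t x - w t x))\<^sup>2) \<partial>lborel)
          \<longlonglongrightarrow> 0)}"

text \<open>
  The restriction space on \<open>I \<times> T\<close>: the infimum defining its norm is finite precisely if an
  extension in \<open>Xsb\<close> exists. Almost everywhere equality on \<open>I \<times> T\<close> is read slicewise, because the
  representatives of the classes \<open>w t\<close> may be chosen independently for different \<open>t\<close>.
\<close>

definition Xsb_on :: "real set \<Rightarrow> real \<Rightarrow> real \<Rightarrow> (real \<Rightarrow> real \<Rightarrow> complex) set" where
  "Xsb_on I s b = {w. \<exists>W \<in> Xsb s b. AE t in lebesgue. t \<in> I \<longrightarrow> ae_eq (W t) (w t)}"

definition solution ::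
  "real \<Rightarrow> (real \<Rightarrow> complex) \<Rightarrow> (real \<Rightarrow> complex) \<Rightarrow> (real \<Rightarrow> real \<Rightarrow> complex) \<Rightarrow> bool" where
  "solution s f V u \<longleftrightarrow> continuous_in_Hs s u \<and> duhamel f V u \<and>
     (\<exists>b>1/2. \<forall>\<alpha> \<beta>.
        (\<lambda>t x. exp (\<i> * of_real t * fourier_coeff V 0) * u t x) \<in> Xsb_on {\<alpha>..\<beta>} s b)"

text \<open>The representatives \<open>g t\<close> must agree with \<open>u t\<close> for every \<open>t\<close>, not just for almost every \<open>t\<close>.\<close>

definition jointly_continuous_rep :: "(real \<Rightarrow> real \<Rightarrow> complex) \<Rightarrow> bool" where
  "jointly_continuous_rep u \<longleftrightarrow>
     (\<exists>g. (\<forall>t. periodic (g t)) \<and> continuous_on UNIV (\<lambda>(t, x). g t x) \<and> (\<forall>t. ae_eq (u t) (g t)))"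

definition bounded_countably_discontinuous_rep :: "(real \<Rightarrow> complex) \<Rightarrow> bool" where
  "bounded_countably_discontinuous_rep h \<longleftrightarrow>
     (\<exists>g. periodic g \<and> ae_eq h g \<and> bounded (range g) \<and> countable {x. \<not> isCont g x})"

end

theory Submission
  imports Defs
begin

text \<open>
  Up to the factor \<open>exp (- \<i> t V0)\<close> the solution is the free evolution of \<open>f\<close> plus a correction.
  In the interaction picture the coefficients of the correction are time integrals of
  \<open>\<Sum>m. V(k - m) exp (\<i> t (k\<^sup>2 - m\<^sup>2)) u(m)\<close>. Integrating the terms with \<open>m\<^sup>2 \<noteq> k\<^sup>2\<close> by parts in time
  makes them absolutely summable in \<open>k\<close>; the resonance \<open>m = - k\<close> has the small factor \<open>V(2 k)\<close> and
  is absorbed, which leaves a product of two square summable sequences. Hence the correction is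
  jointly continuous, and everything depends on the free evolution.

  At a time in \<open>\<pi>\<rat>\<close> the free evolution is a finite combination of translations, which is
  invertible, so jumps can neither appear nor vanish. For other times let \<open>h\<^sub>t\<close> be the evolved
  sawtooth. It satisfies a functional equation relating \<open>t\<close> to \<open>- \<pi>\<^sup>2 / t\<close> up to a regular term
  and a factor \<open>sqrt (t / \<pi>)\<close>. Together with \<open>t \<mapsto> t + \<pi>\<close> and \<open>t \<mapsto> - t\<close> it bounds \<open>h\<^sub>t\<close>
  uniformly over all rational times, and it shows that the oscillation of \<open>h\<close> near an irrational
  time contracts by a fixed factor, hence is zero. A function of bounded variation is, up to
  its values at finitely many points, a combination of sawtooth functions weighted by its jumps, so
  these statements carry over with constants that depend on the variation only.
\<close>

subsection \<open>Fourier series of square integrable functions\<close>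

text \<open>The series of the evolved sawtooth, with terms cis (k x - t k^2) / k, converges too
  weakly to be estimated term by term. It is therefore handled in mean square, and its identities
  hold almost everywhere, along subsequences. At times in \<pi>\<rat> it is a finite sum of
  translates, hence a bounded function; irrational times are reached as limits. The functional
  equation comes from periodizing the evolution of a step on the line, a Fresnel integral. Its
  expansion at infinity starts with cis (a^2 / (4 t)) / a, and over the translates by 2 \<pi> n
  these terms add up to a sawtooth series at the dual time. In r = t / \<pi> the symmetries are r +
  1, - r and - 1 / r. The first two bring r into [0, 1/2], where the factor is at most sqrt (1/2) <
  3/4; this leaves room for continuity errors. The passage to bounded variation is exact: at a
  rational time an evolved value samples f at finitely many points, and the sawtooth jumps that
  reproduce f there can be placed off any null set.\<close>

abbreviation torus :: "real measure" where
  "torus \<equiv> lebesgue_on {0..2*pi}"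

definition char :: "int \<Rightarrow> real \<Rightarrow> complex" where
  "char k x = cis (of_int k * x)"

definition square_integrable :: "(real \<Rightarrow> complex) \<Rightarrow> bool" where
  "square_integrable g \<longleftrightarrow> g \<in> borel_measurable torus \<and> integrable torus (\<lambda>x. (cmod (g x))\<^sup>2)"

definition energy :: "(real \<Rightarrow> complex) \<Rightarrow> real" where
  "energy g = (LINT x|torus. (cmod (g x))\<^sup>2)"

definition partial_fourier :: "nat \<Rightarrow> (real \<Rightarrow> complex) \<Rightarrow> real \<Rightarrow> complex" where
  "partial_fourier M g x = (\<Sum>k\<in>{-int M..int M}. fourier_coeff g k * char k x)"

lemma finite_measure_torus: "finite_measure torus"
  by (intro finite_measureI) (simp add: emeasure_restrict_space space_restrict_space)

lemma measure_torus_space: "measure torus {0..2*pi} = 2*pi"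
  by (simp add: measure_restrict_space)

lemma norm_char [simp]: "cmod (char k x) = 1"
  by (simp add: char_def)

lemma char_exp: "exp (- \<i> * of_int k * of_real x) = char (-k) x"
  by (simp add: char_def cis_conv_exp algebra_simps)

lemma char_add: "char (j + k) x = char j x * char k x"
  by (simp add: char_def cis_mult algebra_simps)

lemma char_0 [simp]: "char 0 x = 1" by (simp add: char_def)

lemma cnj_char: "cnj (char k x) = char (-k) x"
  by (simp add: char_def cis_cnj)

lemma continuous_char [continuous_intros]: "continuous_on S (char k)"
  unfolding char_def by (intro continuous_intros)

lemma char_add_arg: "char k (x + y) = char k x * char k y"
  by (simp add: char_def cis_mult algebra_simps)

lemma char_periodic: "char k (x + 2 * pi) = char k x"
proof -
  have "of_int k * (x + 2*pi) = of_int k * x + 2 * pi * of_int k" by (simp add: algebra_simps)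
  then show ?thesis by (simp add: char_def flip: cis_mult)
qed

lemma fourier_coeff_torus:
  "fourier_coeff g k = 1 / (2*pi) * (LINT x|torus. char (-k) x * g x)"
  unfolding fourier_coeff_def char_exp set_lebesgue_integral_def
  by (subst integral_restrict_space) auto

lemma continuous_borel_torus: "continuous_on {0..2*pi} g \<Longrightarrow> (g :: real \<Rightarrow> 'a::euclidean_space) \<in> borel_measurable torus"
  by (intro continuous_imp_measurable_on_sets_lebesgue) auto

lemma char_borel_torus [measurable]: "char k \<in> borel_measurable torus"
  by (intro continuous_borel_torus continuous_char)

lemma bounded_integrable_torus:
  fixes g :: "real \<Rightarrow> 'a::{banach,second_countable_topology}"
  assumes "g \<in> borel_measurable torus" "\<And>x. x \<in> {0..2*pi} \<Longrightarrow> norm (g x) \<le> B"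
  shows "integrable torus g"
  by (rule finite_measure.integrable_const_bound[OF finite_measure_torus, of _ B])
     (use assms in \<open>auto intro!: AE_I2\<close>)

lemma bounded_square_integrable:
  assumes "g \<in> borel_measurable torus" "\<And>x. x \<in> {0..2*pi} \<Longrightarrow> cmod (g x) \<le> B"
  shows "square_integrable g"
  unfolding square_integrable_def
  using assms by (auto intro!: bounded_integrable_torus[of _ "B\<^sup>2"] power_mono borel_measurable_power)

lemma continuous_square_integrable:
  assumes "continuous_on {0..2*pi} g" shows "square_integrable g"
proof -
  have "bounded (g ` {0..2*pi})" by (intro compact_imp_bounded compact_continuous_image assms) auto
  then obtain B where "\<forall>x\<in>{0..2*pi}. cmod (g x) \<le> B" unfolding bounded_iff by auto
  then show ?thesis by (intro bounded_square_integrable[of g B] continuous_borel_torus assms) auto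
qed

lemma norm_add_squared_le: "(norm (a + b :: 'a::real_normed_vector))\<^sup>2 \<le> 2 * (norm a)\<^sup>2 + 2 * (norm b)\<^sup>2"
proof -
  have "(norm (a + b))\<^sup>2 \<le> (norm a + norm b)\<^sup>2" by (intro power_mono norm_triangle_ineq) auto
  also have "\<dots> \<le> 2 * (norm a)\<^sup>2 + 2 * (norm b)\<^sup>2"
    using sum_squares_bound[of "norm a" "norm b"] by (simp add: power2_sum)
  finally show ?thesis .
qed

lemma norm_mult_le_squares: "cmod (a * b) \<le> (cmod a)\<^sup>2 + (cmod b)\<^sup>2"
proof -
  have "0 \<le> cmod a * cmod b" by simp
  then show ?thesis using sum_squares_bound[of "cmod a" "cmod b"] unfolding norm_mult by linarith
qed

lemma square_integrable_add:
  assumes "square_integrable g" "square_integrable h"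
  shows "square_integrable (\<lambda>x. g x + h x)"
  unfolding square_integrable_def
proof
  show m: "(\<lambda>x. g x + h x) \<in> borel_measurable torus" using assms by (auto simp: square_integrable_def)
  have "integrable torus (\<lambda>x. 2 * (cmod (g x))\<^sup>2 + 2 * (cmod (h x))\<^sup>2)"
    using assms by (auto simp: square_integrable_def)
  then show "integrable torus (\<lambda>x. (cmod (g x + h x))\<^sup>2)"
    by (rule Bochner_Integration.integrable_bound)
       (use m in \<open>auto intro!: AE_I2 order.trans[OF norm_add_squared_le] borel_measurable_power\<close>)
qed

lemma square_integrable_mult_bounded:
  assumes "square_integrable g" "c \<in> borel_measurable torus" "\<And>x. x \<in> {0..2*pi} \<Longrightarrow> cmod (c x) \<le> B"
  shows "square_integrable (\<lambda>x. c x * g x)"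
  unfolding square_integrable_def
proof
  show m: "(\<lambda>x. c x * g x) \<in> borel_measurable torus" using assms by (auto simp: square_integrable_def)
  have bound: "(cmod (c x * g x))\<^sup>2 \<le> B\<^sup>2 * (cmod (g x))\<^sup>2" if "0 \<le> x" "x \<le> 2 * pi" for x
    using assms(3)[of x] that by (auto simp: norm_mult power_mult_distrib intro!: mult_right_mono power_mono)
  have "integrable torus (\<lambda>x. B\<^sup>2 * (cmod (g x))\<^sup>2)"
    using assms by (auto simp: square_integrable_def)
  then show "integrable torus (\<lambda>x. (cmod (c x * g x))\<^sup>2)"
    by (rule Bochner_Integration.integrable_bound)
       (use m assms(3) in \<open>auto intro!: AE_I2 borel_measurable_power borel_measurable_norm simp: bound\<close>)
qed

lemma square_integrable_cmult: "square_integrable g \<Longrightarrow> square_integrable (\<lambda>x. c * g x)"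
  by (rule square_integrable_mult_bounded[where B="cmod c"]) auto

lemma square_integrable_minus: "square_integrable g \<Longrightarrow> square_integrable h \<Longrightarrow> square_integrable (\<lambda>x. g x - h x)"
  using square_integrable_add[of g "\<lambda>x. (-1) * h x"] square_integrable_cmult[of h "-1"] by simp

lemma square_integrable_sum:
  assumes "\<And>i. i \<in> I \<Longrightarrow> square_integrable (g i)"
  shows "square_integrable (\<lambda>x. \<Sum>i\<in>I. g i x)"
  using assms
proof (induction I rule: infinite_finite_induct)
  case (insert i I)
  then show ?case by (auto intro: square_integrable_add)
qed (auto intro!: continuous_square_integrable)

lemma square_integrable_char [intro]: "square_integrable (\<lambda>x. c * char k x)"
  by (intro continuous_square_integrable continuous_intros)

lemma square_integrable_partial_fourier: "square_integrable (partial_fourier M g)"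
  unfolding partial_fourier_def by (intro continuous_square_integrable continuous_intros)

lemma square_integrable_mult_integrable:
  assumes "square_integrable g" "square_integrable h"
  shows "integrable torus (\<lambda>x. g x * h x)"
proof -
  have "integrable torus (\<lambda>x. (cmod (g x))\<^sup>2 + (cmod (h x))\<^sup>2)"
    using assms by (auto simp: square_integrable_def)
  then show ?thesis
    by (rule Bochner_Integration.integrable_bound)
       (use assms norm_mult_le_squares in \<open>auto simp: square_integrable_def intro!: AE_I2\<close>)
qed

lemma square_integrable_integrable: "square_integrable g \<Longrightarrow> integrable torus g"
  using square_integrable_mult_integrable[OF continuous_square_integrable[of "\<lambda>_. 1"], of g] by simp

lemma square_integrable_cnj: "square_integrable g \<Longrightarrow> square_integrable (\<lambda>x. cnj (g x))"
  unfolding square_integrable_def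
  by (auto intro: borel_measurable_continuous_on[of cnj] simp: continuous_on_cnj)

lemma integrable_char_mult: "square_integrable g \<Longrightarrow> integrable torus (\<lambda>x. char k x * g x)"
  by (intro square_integrable_mult_integrable) (use square_integrable_char[of 1] in auto)

lemma energy_nonneg: "energy g \<ge> 0" unfolding energy_def by (intro integral_nonneg_AE) auto

lemma energy_add_le:
  assumes "square_integrable g" "square_integrable h"
  shows "energy (\<lambda>x. g x + h x) \<le> 2 * energy g + 2 * energy h"
proof -
  have "energy (\<lambda>x. g x + h x) \<le> (LINT x|torus. 2 * (cmod (g x))\<^sup>2 + 2 * (cmod (h x))\<^sup>2)"
    unfolding energy_def using assms square_integrable_add[OF assms]
    by (intro integral_mono) (auto simp: square_integrable_def norm_add_squared_le)
  also have "\<dots> = 2 * energy g + 2 * energy h"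
    unfolding energy_def using assms
    by (subst Bochner_Integration.integral_add) (auto simp: square_integrable_def)
  finally show ?thesis .
qed

lemma Cauchy_Schwarz_torus:
  assumes "square_integrable g" "square_integrable h"
  shows "cmod (LINT x|torus. g x * h x) \<le> sqrt (energy g * energy h)"
proof -
  define X where "X = (LINT x|torus. cmod (g x * h x))"
  have iX: "integrable torus (\<lambda>x. cmod (g x * h x))"
    using square_integrable_mult_integrable[OF assms] by auto
  have ig: "integrable torus (\<lambda>x. (cmod (g x))\<^sup>2)" and ih: "integrable torus (\<lambda>x. (cmod (h x))\<^sup>2)"
    using assms by (auto simp: square_integrable_def)
  have q: "0 \<le> s\<^sup>2 * energy g - 2 * s * X + energy h" for s
  proof -
    have "(LINT x|torus. (s * cmod (g x) - cmod (h x))\<^sup>2) =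
      (LINT x|torus. s\<^sup>2 * (cmod (g x))\<^sup>2 - 2 * s * cmod (g x * h x) + (cmod (h x))\<^sup>2)"
      by (intro Bochner_Integration.integral_cong) (auto simp: power2_eq_square norm_mult algebra_simps)
    also have "\<dots> = s\<^sup>2 * energy g - 2 * s * X + energy h"
    proof -
      define a b c where abc: "a = (\<lambda>x. (cmod (g x))\<^sup>2)" "b = (\<lambda>x. cmod (g x * h x))" "c = (\<lambda>x. (cmod (h x))\<^sup>2)"
      have "integrable torus a" "integrable torus b" "integrable torus c" using iX ig ih unfolding abc by blast+
      then have "(LINT x|torus. s\<^sup>2 * a x - 2 * s * b x + c x) = s\<^sup>2 * integral\<^sup>L torus a - 2 * s * integral\<^sup>L torus b + integral\<^sup>L torus c"
        by simp
      then show ?thesis unfolding energy_def X_def abc .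
    qed
    finally have "(LINT x|torus. (s * cmod (g x) - cmod (h x))\<^sup>2) = s\<^sup>2 * energy g - 2 * s * X + energy h" .
    moreover have "0 \<le> (LINT x|torus. (s * cmod (g x) - cmod (h x))\<^sup>2)" by (intro integral_nonneg_AE AE_I2) simp
    ultimately show ?thesis by simp
  qed
  have X0: "X \<ge> 0" unfolding X_def by (intro integral_nonneg_AE) auto
  have "X\<^sup>2 \<le> energy g * energy h"
  proof (cases "energy g = 0")
    case True
    have "X = 0"
    proof (rule ccontr)
      assume "X \<noteq> 0"
      \<comment> \<open>With \<open>energy g = 0\<close> the quadratic in \<open>s\<close> is
        affine; this \<open>s\<close> makes it equal to -1.\<close>
      with q[of "(energy h + 1) / (2 * X)"] True X0 show False by auto
    qed
    then show ?thesis using True by simp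
  next
    case False
    then have g: "energy g > 0" using energy_nonneg[of g] by linarith
    have "0 \<le> (X / energy g)\<^sup>2 * energy g - 2 * (X / energy g) * X + energy h" by (rule q)
    also have "\<dots> = energy h - X\<^sup>2 / energy g" using g by (simp add: field_simps power2_eq_square)
    finally show ?thesis using g by (simp add: field_simps)
  qed
  then have "X \<le> sqrt (energy g * energy h)" by (rule real_le_rsqrt)
  moreover have "cmod (LINT x|torus. g x * h x) \<le> X" unfolding X_def by (rule integral_norm_bound)
  ultimately show ?thesis by linarith
qed

lemma integral_char: "(LINT x|torus. char k x) = (if k = 0 then 2 * pi else 0)"
proof (cases "k = 0")
  case True
  then show ?thesis by (simp add: measure_torus_space scaleR_conv_of_real)
next
  case False
  have "((\<lambda>x. - \<i> / of_int k * char k x) has_vector_derivative char k x) (at x within {0..2*pi})" for x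
    unfolding has_vector_derivative_def char_def using False
    by (auto intro!: derivative_eq_intros simp: fun_eq_iff complex_eq_iff)
  then have "(char k has_integral (- \<i> / of_int k * char k (2*pi) - - \<i> / of_int k * char k 0)) {0..2*pi}"
    by (intro fundamental_theorem_of_calculus) auto
  moreover have "char k (2*pi) = char k 0" using char_periodic[of k 0] by simp
  ultimately have "(char k has_integral 0) {0..2*pi}" by simp
  moreover have "integrable torus (char k)" using square_integrable_integrable[OF square_integrable_char[of 1]] by simp
  ultimately show ?thesis using False
    by (simp add: lebesgue_integral_eq_integral integral_unique)
qed

lemma integral_char_mult: "square_integrable g \<Longrightarrow> (LINT x|torus. char k x * g x) = 2 * pi * fourier_coeff g (-k)"
  by (simp add: fourier_coeff_torus)

lemma energy_trig_poly:
  assumes "finite K"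
  shows "energy (\<lambda>x. \<Sum>k\<in>K. c k * char k x) = 2 * pi * (\<Sum>k\<in>K. (cmod (c k))\<^sup>2)"
proof -
  have "complex_of_real (energy (\<lambda>x. \<Sum>k\<in>K. c k * char k x)) =
     (LINT x|torus. complex_of_real ((cmod (\<Sum>k\<in>K. c k * char k x))\<^sup>2))"
    unfolding energy_def by (rule integral_complex_of_real[symmetric])
  also have "\<dots> = (LINT x|torus. (\<Sum>k\<in>K. \<Sum>j\<in>K. (c k * cnj (c j)) * char (k - j) x))"
  proof (intro Bochner_Integration.integral_cong refl)
    fix x
    have "complex_of_real ((cmod (\<Sum>k\<in>K. c k * char k x))\<^sup>2) =
      (\<Sum>k\<in>K. c k * char k x) * cnj (\<Sum>k\<in>K. c k * char k x)" by (metis complex_norm_square)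
    also have "\<dots> = (\<Sum>k\<in>K. \<Sum>j\<in>K. (c k * cnj (c j)) * char (k - j) x)"
      by (simp add: sum_product cnj_char char_add[of k "-j" for k j, simplified] mult_ac)
    finally show "complex_of_real ((cmod (\<Sum>k\<in>K. c k * char k x))\<^sup>2) = \<dots>" .
  qed
  also have "\<dots> = (\<Sum>k\<in>K. \<Sum>j\<in>K. (c k * cnj (c j)) * (if k = j then 2 * pi else 0))"
    using square_integrable_integrable[OF square_integrable_char[of 1]]
    by (simp add: Bochner_Integration.integral_sum integral_char)
  also have "\<dots> = (\<Sum>k\<in>K. (c k * cnj (c k)) * (2*pi))"
    using assms by (intro sum.cong refl) (simp add: if_distrib if_distribR sum.delta cong: if_cong)
  also have "\<dots> = complex_of_real (2 * pi * (\<Sum>k\<in>K. (cmod (c k))\<^sup>2))"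
    by (simp add: sum_distrib_left complex_norm_square mult_ac del: of_real_power)
  finally show ?thesis using of_real_eq_iff by blast
qed

text \<open>Expanding the square shows that \<open>c\<close> enters only through its distance to the
  Fourier coefficients. Best approximation, the error of partial sums and Bessel's inequality are
  all read off from this identity.\<close>

lemma energy_diff_trig_poly:
  assumes g: "square_integrable g" and "finite K"
  shows "energy (\<lambda>x. g x - (\<Sum>k\<in>K. c k * char k x)) =
    energy g - 2 * pi * (\<Sum>k\<in>K. (cmod (fourier_coeff g k))\<^sup>2)
      + 2 * pi * (\<Sum>k\<in>K. (cmod (fourier_coeff g k - c k))\<^sup>2)"
proof -
  define p where "p = (\<lambda>x. \<Sum>k\<in>K. c k * char k x)"
  have p: "square_integrable p" unfolding p_def by (intro continuous_square_integrable continuous_intros)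
  have i: "integrable torus (\<lambda>x. cnj (p x) * g x)"
    by (intro square_integrable_mult_integrable square_integrable_cnj p g)
  have "(LINT x|torus. cnj (p x) * g x) = (LINT x|torus. (\<Sum>k\<in>K. cnj (c k) * (char (-k) x * g x)))"
    unfolding p_def by (intro Bochner_Integration.integral_cong refl) (simp add: sum_distrib_right cnj_char mult.assoc)
  also have "\<dots> = (\<Sum>k\<in>K. cnj (c k) * (2 * pi * fourier_coeff g k))"
    using integrable_char_mult[OF g] by (simp add: Bochner_Integration.integral_sum integral_char_mult[OF g])
  finally have ip: "(LINT x|torus. cnj (p x) * g x) = (\<Sum>k\<in>K. cnj (c k) * (2 * pi * fourier_coeff g k))" .
  have "energy (\<lambda>x. g x - p x) = (LINT x|torus. (cmod (g x))\<^sup>2 - 2 * Re (cnj (p x) * g x) + (cmod (p x))\<^sup>2)"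
    unfolding energy_def
    by (intro Bochner_Integration.integral_cong refl)
       (simp only: cmod_power2, simp add: power2_eq_square algebra_simps)
  also have "\<dots> = energy g - 2 * Re (LINT x|torus. cnj (p x) * g x) + energy p"
  proof -
    define r where "r x = Re (cnj (p x) * g x)" for x
    have "integrable torus r" "integral\<^sup>L torus r = Re (LINT x|torus. cnj (p x) * g x)"
      unfolding r_def[abs_def] using i by (auto simp del: times_complex.sel)
    then show ?thesis
      unfolding energy_def r_def[symmetric] using g p by (simp add: square_integrable_def)
  qed
  also have "\<dots> = energy g - 2 * Re (\<Sum>k\<in>K. cnj (c k) * (2 * pi * fourier_coeff g k)) + 2 * pi * (\<Sum>k\<in>K. (cmod (c k))\<^sup>2)"
    unfolding ip using energy_trig_poly[OF assms(2), of c] p_def by simp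
  also have "\<dots> = energy g - 2 * pi * (\<Sum>k\<in>K. (cmod (fourier_coeff g k))\<^sup>2)
      + 2 * pi * (\<Sum>k\<in>K. (cmod (fourier_coeff g k - c k))\<^sup>2)"
  proof -
    define r where "r k = Re (cnj (c k) * fourier_coeff g k)" for k
    have "(\<Sum>k\<in>K. (cmod (fourier_coeff g k - c k))\<^sup>2) =
      (\<Sum>k\<in>K. (cmod (fourier_coeff g k))\<^sup>2 - 2 * r k + (cmod (c k))\<^sup>2)"
      by (intro sum.cong refl) (simp only: cmod_power2 r_def, simp add: power2_eq_square algebra_simps)
    also have "\<dots> = (\<Sum>k\<in>K. (cmod (fourier_coeff g k))\<^sup>2) - 2 * sum r K + (\<Sum>k\<in>K. (cmod (c k))\<^sup>2)"
      by (simp add: sum.distrib sum_subtractf sum_distrib_left)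
    finally have 1: "(\<Sum>k\<in>K. (cmod (fourier_coeff g k - c k))\<^sup>2) = \<dots>" .
    have "Re (cnj (c k) * (2 * pi * fourier_coeff g k)) = 2 * pi * r k" for k
      unfolding r_def by (simp add: algebra_simps)
    then have "Re (\<Sum>k\<in>K. cnj (c k) * (2 * pi * fourier_coeff g k)) = 2 * pi * sum r K"
      by (simp only: Re_sum sum_distrib_left)
    then show ?thesis unfolding 1 by (simp only:) (simp add: algebra_simps)
  qed
  finally show ?thesis unfolding p_def .
qed

lemma energy_partial_fourier:
  assumes "square_integrable g"
  shows "energy (\<lambda>x. g x - partial_fourier M g x) = energy g - 2 * pi * (\<Sum>k\<in>{-int M..int M}. (cmod (fourier_coeff g k))\<^sup>2)"
  using energy_diff_trig_poly[OF assms, of "{-int M..int M}" "fourier_coeff g"]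
  unfolding partial_fourier_def by simp

section \<open>Density of trigonometric polynomials\<close>

inductive trig_poly :: "(real \<Rightarrow> complex) \<Rightarrow> bool" where
  single: "trig_poly (\<lambda>x. c * char k x)"
| add: "trig_poly p \<Longrightarrow> trig_poly q \<Longrightarrow> trig_poly (\<lambda>x. p x + q x)"

lemma trig_poly_mult_single: "trig_poly p \<Longrightarrow> trig_poly (\<lambda>x. c * char k x * p x)"
proof (induction rule: trig_poly.induct)
  case (single d j)
  have "(\<lambda>x. c * char k x * (d * char j x)) = (\<lambda>x. (c * d) * char (k + j) x)" by (simp add: char_add mult_ac fun_eq_iff)
  then show ?case using trig_poly.single by metis
next
  case (add p q)
  then show ?case using trig_poly.add by (simp add: distrib_left)
qed

text \<open>Closure under products is the point of the inductive description: polynomials on the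
  circle can be translated by induction on their structure.\<close>

lemma trig_poly_mult:
  assumes "trig_poly p" "trig_poly q" shows "trig_poly (\<lambda>x. p x * q x)"
  using assms(1)
proof (induction rule: trig_poly.induct)
  case (single d j)
  then show ?case using trig_poly_mult_single[OF assms(2)] .
next
  case (add p q)
  then show ?case using trig_poly.add by (simp add: distrib_right)
qed

text \<open>The coefficients are made to vanish off the index set, so that sums over different index
  sets extend to a common one.\<close>

lemma trig_poly_sum:
  assumes "trig_poly p"
  shows "\<exists>K c. finite K \<and> (\<forall>k. k \<notin> K \<longrightarrow> c k = 0) \<and> p = (\<lambda>x. \<Sum>k\<in>K. c k * char k x)"
  using assms
proof (induction rule: trig_poly.induct)
  case (single c k)
  show ?case by (rule exI[of _ "{k}"], rule exI[of _ "\<lambda>j. if j = k then c else 0"]) auto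
next
  case (add p q)
  then obtain K c J d where "finite K" "\<forall>k. k \<notin> K \<longrightarrow> c k = 0" and p: "p = (\<lambda>x. \<Sum>k\<in>K. c k * char k x)"
    and "finite J" "\<forall>k. k \<notin> J \<longrightarrow> d k = 0" and q: "q = (\<lambda>x. \<Sum>k\<in>J. d k * char k x)" by blast
  then have "p x = (\<Sum>k\<in>K \<union> J. c k * char k x)" "q x = (\<Sum>k\<in>K \<union> J. d k * char k x)" for x
    unfolding p q by (auto intro!: sum.mono_neutral_left)
  then have "(\<lambda>x. p x + q x) = (\<lambda>x. \<Sum>k\<in>K \<union> J. (c k + d k) * char k x)"
    by (simp add: sum.distrib distrib_right fun_eq_iff)
  then show ?case using \<open>finite K\<close> \<open>finite J\<close> \<open>\<forall>k. k \<notin> K \<longrightarrow> c k = 0\<close> \<open>\<forall>k. k \<notin> J \<longrightarrow> d k = 0\<close>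
    by (intro exI[of _ "K \<union> J"] exI[of _ "\<lambda>k. c k + d k"]) auto
qed

lemma trig_poly_best_approximation:
  assumes g: "square_integrable g" and "trig_poly p"
  shows "\<exists>M0. \<forall>M\<ge>M0. energy (\<lambda>x. g x - partial_fourier M g x) \<le> energy (\<lambda>x. g x - p x)"
proof -
  obtain K c where K: "finite K" "\<forall>k. k \<notin> K \<longrightarrow> c k = 0" "p = (\<lambda>x. \<Sum>k\<in>K. c k * char k x)"
    using trig_poly_sum[OF assms(2)] by blast
  define M0 where "M0 = Max (insert 0 ((\<lambda>k. nat \<bar>k\<bar>) ` K))"
  have "energy (\<lambda>x. g x - partial_fourier M g x) \<le> energy (\<lambda>x. g x - p x)" if "M \<ge> M0" for M
  proof -
    have "K \<subseteq> {-int M..int M}"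
    proof
      fix k assume "k \<in> K"
      then have "nat \<bar>k\<bar> \<le> M0" unfolding M0_def using K(1) by (intro Max_ge) auto
      with that show "k \<in> {-int M..int M}" by auto
    qed
    then have p: "p = (\<lambda>x. \<Sum>k\<in>{-int M..int M}. c k * char k x)"
      unfolding K(3) using K(2) by (auto intro!: sum.mono_neutral_left simp: fun_eq_iff)
    show ?thesis unfolding p energy_partial_fourier[OF g] energy_diff_trig_poly[OF g finite_atLeastAtMost_int]
      by (simp add: sum_nonneg)
  qed
  then show ?thesis by blast
qed

text \<open>Along the circle a real linear functional is
  \<open>cos x * f 1 + sin x * f \<i>\<close>, hence a combination of \<open>char 1\<close> and
  \<open>char (-1)\<close>.\<close>

lemma real_polynomial_trig_poly:
  fixes r :: "complex \<Rightarrow> real"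
  assumes "real_polynomial_function r"
  shows "trig_poly (\<lambda>x. of_real (r (cis x)))"
  using assms
proof (induction rule: real_polynomial_function.induct)
  case (linear f)
  interpret bounded_linear f by fact
  have "complex_of_real (f (cis x)) = (f 1 / 2 + f \<i> / (2 * \<i>)) * char 1 x + (f 1 / 2 - f \<i> / (2 * \<i>)) * char (-1) x" for x
  proof -
    have "cis x = cos x *\<^sub>R 1 + sin x *\<^sub>R \<i>" by (simp add: complex_eq_iff)
    then have "f (cis x) = cos x * f 1 + sin x * f \<i>" by (metis add scaleR real_scaleR_def)
    then show ?thesis by (simp add: char_def cis.code complex_eq_iff field_simps)
  qed
  then show ?case using trig_poly.add[OF trig_poly.single trig_poly.single] by presburger
next
  case (const c)
  then show ?case using trig_poly.single[of c 0] by simp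
next
  case (add f g)
  then show ?case using trig_poly.add by simp
next
  case (mult f g)
  then show ?case using trig_poly_mult by simp
qed

lemma trig_poly_cmult: "trig_poly p \<Longrightarrow> trig_poly (\<lambda>x. c * p x)"
  using trig_poly_mult_single[of p c 0] by simp

lemma polynomial_function_trig_poly:
  fixes P :: "complex \<Rightarrow> complex"
  assumes "polynomial_function P"
  shows "trig_poly (\<lambda>x. P (cis x))"
proof -
  have "real_polynomial_function (\<lambda>z. Re (P z))" "real_polynomial_function (\<lambda>z. Im (P z))"
    using assms unfolding polynomial_function_def o_def
    by (auto simp: bounded_linear_Re bounded_linear_Im)
  then have "trig_poly (\<lambda>x. of_real (Re (P (cis x))) + \<i> * of_real (Im (P (cis x))))"
    by (intro trig_poly.add trig_poly_cmult real_polynomial_trig_poly)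
  then show ?thesis by (simp flip: complex_eq)
qed

text \<open>Radial retraction onto the closed disc of radius \<open>B\<close>. Being continuous, it
  preserves continuity and measurability under composition.\<close>

definition clamp_norm :: "real \<Rightarrow> complex \<Rightarrow> complex" where
  "clamp_norm B z = of_real (B / max B (cmod z)) * z"

lemma norm_clamp_norm_le: "B > 0 \<Longrightarrow> cmod (clamp_norm B z) \<le> B"
  by (simp add: clamp_norm_def norm_mult norm_divide field_simps max_def)

lemma clamp_norm_id: "B > 0 \<Longrightarrow> cmod z \<le> B \<Longrightarrow> clamp_norm B z = z"
  by (simp add: clamp_norm_def max_def)

lemma norm_clamp_norm_le_norm: "B > 0 \<Longrightarrow> cmod (clamp_norm B z) \<le> cmod z"
  by (auto simp add: clamp_norm_def norm_mult norm_divide max_def field_simps mult_mono)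

lemma continuous_clamp_norm: "B > 0 \<Longrightarrow> continuous_on UNIV (clamp_norm B)"
  unfolding clamp_norm_def by (intro continuous_intros) (auto simp: max_def)

text \<open>For n > 0 this is 0 within distance 1/n of either end of [0, 2 \<pi>] and 1 at distance
  2/n or more, so that truncated functions pass to the circle without a break.\<close>

definition cutoff :: "nat \<Rightarrow> real \<Rightarrow> real" where
  "cutoff n x = max 0 (min 1 (real n * min x (2*pi - x) - 1))"

lemma cutoff_bounds: "0 \<le> cutoff n x" "cutoff n x \<le> 1" by (auto simp: cutoff_def)

lemma AE_torus_interior:
  assumes "negligible N" "\<And>x. 0 < x \<Longrightarrow> x < 2*pi \<Longrightarrow> x \<notin> N \<Longrightarrow> P x"
  shows "AE x in torus. P x"
proof -
  have "N \<union> {0,2*pi} \<in> null_sets lebesgue"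
    using assms(1) by (simp add: negligible_iff_null_sets[symmetric])
  then have "AE x in lebesgue. x \<notin> N \<union> {0,2*pi}" by (rule AE_not_in)
  then have "AE x in lebesgue. x \<in> {0..2*pi} \<longrightarrow> P x"
  proof eventually_elim
    case (elim x)
    then show ?case using assms(2)[of x] by auto
  qed
  then show ?thesis by (subst AE_restrict_space_iff) auto
qed

lemma energy_dominated_convergence:
  assumes "\<And>n. s n \<in> borel_measurable torus" "integrable torus w"
    and "negligible N" "\<And>x. 0 < x \<Longrightarrow> x < 2*pi \<Longrightarrow> x \<notin> N \<Longrightarrow> (\<lambda>n. s n x) \<longlonglongrightarrow> 0"
    and "\<And>n x. (cmod (s n x))\<^sup>2 \<le> w x"
  shows "(\<lambda>n. energy (s n)) \<longlonglongrightarrow> 0"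
proof -
  have "(\<lambda>n. LINT x|torus. (cmod (s n x))\<^sup>2) \<longlonglongrightarrow> (LINT x|torus. 0)"
  proof (rule integral_dominated_convergence[where w=w])
    show "AE x in torus. (\<lambda>n. (cmod (s n x))\<^sup>2) \<longlonglongrightarrow> 0"
      by (rule AE_torus_interior[OF assms(3)]) (use assms(4) in \<open>auto intro!: tendsto_eq_intros\<close>)
  qed (use assms in auto)
  then show ?thesis by (simp add: energy_def)
qed

text \<open>Clamping makes the function bounded. A bounded measurable function is an almost
  everywhere limit of continuous ones, which are clamped too and cut off near the ends. Both errors
  vanish by dominated convergence.\<close>

lemma square_integrable_approx_continuous:
  assumes g: "square_integrable g" and "e > 0"
  shows "\<exists>\<phi> \<delta>. continuous_on UNIV \<phi> \<and> 0 < \<delta> \<and> \<delta> < pi \<and> (\<forall>x. x \<notin> {\<delta>..2*pi-\<delta>} \<longrightarrow> \<phi> x = 0) \<and>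
    square_integrable \<phi> \<and> energy (\<lambda>x. g x - \<phi> x) < e"
proof -
  have gm: "g \<in> borel_measurable torus" and gi: "integrable torus (\<lambda>x. (cmod (g x))\<^sup>2)"
    using g by (auto simp: square_integrable_def)
  have cm: "(\<lambda>x. clamp_norm (real (Suc B)) (g x)) \<in> borel_measurable torus" for B
    using gm by (intro borel_measurable_continuous_on[OF continuous_clamp_norm]) auto
  have "(\<lambda>B. energy (\<lambda>x. g x - clamp_norm (real (Suc B)) (g x))) \<longlonglongrightarrow> 0"
  proof (rule energy_dominated_convergence[where w="\<lambda>x. 4 * (cmod (g x))\<^sup>2" and N="{}"])
    fix x
    have "\<forall>\<^sub>F B in sequentially. g x - clamp_norm (real (Suc B)) (g x) = 0"
      using eventually_ge_at_top[of "nat \<lceil>cmod (g x)\<rceil>"]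
      by eventually_elim (simp add: clamp_norm_id nat_ceiling_le_eq)
    then show "(\<lambda>B. g x - clamp_norm (real (Suc B)) (g x)) \<longlonglongrightarrow> 0" by (rule tendsto_eventually)
  next
    fix B x
    have "cmod (g x - clamp_norm (real (Suc B)) (g x)) \<le> cmod (g x) + cmod (clamp_norm (real (Suc B)) (g x))"
      by (rule norm_triangle_ineq4)
    also have "\<dots> \<le> 2 * cmod (g x)" using norm_clamp_norm_le_norm[of "real (Suc B)" "g x"] by simp
    finally have "(cmod (g x - clamp_norm (real (Suc B)) (g x)))\<^sup>2 \<le> (2 * cmod (g x))\<^sup>2" by (intro power_mono) auto
    then show "(cmod (g x - clamp_norm (real (Suc B)) (g x)))\<^sup>2 \<le> 4 * (cmod (g x))\<^sup>2" by (simp add: power_mult_distrib)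
  qed (use gm gi cm in auto)
  then have "\<forall>\<^sub>F B in sequentially. energy (\<lambda>x. g x - clamp_norm (real (Suc B)) (g x)) < e / 4"
    using \<open>e > 0\<close> by (intro order_tendstoD) auto
  then obtain B0 where B0: "energy (\<lambda>x. g x - clamp_norm (real (Suc B0)) (g x)) < e / 4"
    by (auto simp: eventually_sequentially)
  define B where "B = real (Suc B0)"
  have B: "B > 0" by (simp add: B_def)
  define h where "h = (\<lambda>x. clamp_norm B (g x))"
  have hm: "h \<in> borel_measurable torus" using cm[of B0] by (simp add: h_def B_def)
  have hB: "cmod (h x) \<le> B" for x unfolding h_def by (rule norm_clamp_norm_le[OF B])
  have hs: "square_integrable h" using hm hB by (rule bounded_square_integrable)
  have "g measurable_on {0..2*pi}" using gm by (simp add: measurable_on_iff_borel_measurable)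
  then obtain N \<psi> where N: "negligible N" and \<psi>: "\<And>n. continuous_on UNIV (\<psi> n)"
    and lim: "\<And>x. x \<notin> N \<Longrightarrow> (\<lambda>n. \<psi> n x) \<longlonglongrightarrow> (if x \<in> {0..2*pi} then g x else 0)"
    unfolding measurable_on_def by blast
  define \<theta> where "\<theta> n x = of_real (cutoff n x) * clamp_norm B (\<psi> n x)" for n x
  have \<theta>c: "continuous_on UNIV (\<theta> n)" for n
  proof -
    have "continuous_on UNIV (\<lambda>x. clamp_norm B (\<psi> n x))"
      by (rule continuous_on_compose2[OF continuous_clamp_norm[OF B] \<psi>]) auto
    then show ?thesis unfolding \<theta>_def cutoff_def by (intro continuous_intros)
  qed
  have \<theta>B: "cmod (\<theta> n x) \<le> B" for n x
  proof -
    have "cmod (\<theta> n x) \<le> 1 * B" unfolding \<theta>_def norm_mult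
      using cutoff_bounds[of n x] norm_clamp_norm_le[OF B] B by (intro mult_mono) auto
    then show ?thesis by simp
  qed
  have \<theta>m: "\<theta> n \<in> borel_measurable torus" for n
    using \<theta>c by (intro continuous_borel_torus) (auto intro: continuous_on_subset)
  have \<theta>s: "square_integrable (\<theta> n)" for n using \<theta>m \<theta>B by (rule bounded_square_integrable)
  have "(\<lambda>n. energy (\<lambda>x. h x - \<theta> n x)) \<longlonglongrightarrow> 0"
  proof (rule energy_dominated_convergence[where w="\<lambda>x. (2 * B)\<^sup>2" and N=N])
    fix x assume x: "0 < x" "x < 2*pi" "x \<notin> N"
    have "(\<lambda>n. \<psi> n x) \<longlonglongrightarrow> g x" using lim[of x] x by auto
    then have "(\<lambda>n. clamp_norm B (\<psi> n x)) \<longlonglongrightarrow> h x"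
      unfolding h_def by (rule continuous_on_tendsto_compose[OF continuous_clamp_norm[OF B]]) auto
    moreover have "(\<lambda>n. cutoff n x) \<longlonglongrightarrow> 1"
    proof (rule tendsto_eventually)
      define m where "m = min x (2*pi-x)"
      have m: "m > 0" using x by (auto simp: m_def)
      show "\<forall>\<^sub>F n in sequentially. cutoff n x = 1"
        using eventually_ge_at_top[of "nat \<lceil>2 / m\<rceil>"]
      proof eventually_elim
        case (elim n)
        then have "2 / m \<le> real n" by linarith
        then have "2 \<le> real n * m" using m by (simp add: field_simps)
        then show ?case unfolding cutoff_def m_def[symmetric] by simp
      qed
    qed
    ultimately have "(\<lambda>n. \<theta> n x) \<longlonglongrightarrow> of_real 1 * h x"
      unfolding \<theta>_def by (intro tendsto_intros)
    then show "(\<lambda>n. h x - \<theta> n x) \<longlonglongrightarrow> 0" by (auto intro!: tendsto_eq_intros)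
  next
    fix n x
    have "cmod (h x - \<theta> n x) \<le> 2 * B" using norm_triangle_ineq4[of "h x" "\<theta> n x"] hB[of x] \<theta>B[of n x] by linarith
    then show "(cmod (h x - \<theta> n x))\<^sup>2 \<le> (2 * B)\<^sup>2" by (intro power_mono) auto
  qed (use hm \<theta>m N finite_measure.integrable_const[OF finite_measure_torus] in auto)
  then have "\<forall>\<^sub>F n in sequentially. energy (\<lambda>x. h x - \<theta> n x) < e / 4"
    using \<open>e > 0\<close> by (intro order_tendstoD) auto
  then obtain n0 where n0: "\<And>n. n \<ge> n0 \<Longrightarrow> energy (\<lambda>x. h x - \<theta> n x) < e / 4"
    by (auto simp: eventually_sequentially)
  define n where "n = Suc n0"
  have "energy (\<lambda>x. g x - \<theta> n x) = energy (\<lambda>x. (g x - h x) + (h x - \<theta> n x))" by simp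
  also have "\<dots> \<le> 2 * energy (\<lambda>x. g x - h x) + 2 * energy (\<lambda>x. h x - \<theta> n x)"
    by (intro energy_add_le square_integrable_minus g hs \<theta>s)
  also have "\<dots> < e" using n0[of n] B0 unfolding n_def h_def B_def by simp
  finally have 1: "energy (\<lambda>x. g x - \<theta> n x) < e" .
  have "\<theta> n x = 0" if "x \<notin> {1/real n..2*pi-1/real n}" for x
  proof -
    have "min x (2*pi-x) < 1 / real n" using that by (auto simp: min_def)
    then have "real n * min x (2*pi-x) < 1" by (simp add: n_def field_simps)
    then show ?thesis unfolding \<theta>_def cutoff_def by simp
  qed
  moreover have "1 / real n < pi"
  proof -
    have "1 / real n \<le> 1" by (simp add: n_def)
    then show ?thesis using pi_gt3 by linarith
  qed
  ultimately show ?thesis using \<theta>c \<theta>s 1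
    by (intro exI[of _ "\<theta> n"] exI[of _ "1 / real n"]) (auto simp: n_def)
qed

text \<open>Stone-Weierstrass is applied on the unit circle to \<open>\<phi>\<close> composed with
  \<open>Arg2pi\<close>. On the circle \<open>Arg2pi\<close> breaks only at 1, and near there
  \<open>\<phi>\<close> contributes 0.\<close>

lemma continuous_approx_trig_poly:
  assumes \<phi>: "continuous_on UNIV \<phi>" and \<delta>: "0 < \<delta>" "\<delta> < pi"
    and supp: "\<And>x. x \<notin> {\<delta>..2*pi-\<delta>} \<Longrightarrow> \<phi> x = 0" and "e > 0"
  shows "\<exists>p. trig_poly p \<and> (\<forall>x\<in>{0..2*pi}. cmod (\<phi> x - p x) < e)"
proof -
  define \<Phi> where "\<Phi> z = \<phi> (Arg2pi z)" for z
  have "continuous (at z within sphere 0 1) \<Phi>" if z: "z \<in> sphere 0 1" for z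
  proof (cases "z = 1")
    case True
    have "open {w. Re w > cos \<delta>}" by (rule open_halfspace_Re_gt)
    moreover have "1 \<in> {w. Re w > cos \<delta>}" using cos_monotone_0_pi[of 0 \<delta>] \<delta> by auto
    ultimately have ev: "\<forall>\<^sub>F w in at z within sphere 0 1. Re w > cos \<delta>"
      unfolding True eventually_at_topological by blast
    have "\<Phi> w = 0" if w: "w \<in> sphere 0 1" "Re w > cos \<delta>" for w
    proof -
      define a where "a = Arg2pi w"
      have a: "0 \<le> a" "a < 2*pi" "w = exp (\<i> * of_real a)"
        using Arg2pi[of w] Arg2pi_eq[of w] w by (auto simp: a_def)
      then have "Re w = cos a" by (simp add: Re_exp)
      have "a \<notin> {\<delta>..2*pi-\<delta>}"
      proof
        assume *: "a \<in> {\<delta>..2*pi-\<delta>}"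
        have "cos a \<le> cos \<delta>"
        proof (cases "a \<le> pi")
          case True
          then show ?thesis using * \<delta> by (intro cos_monotone_0_pi_le) auto
        next
          case False
          have "cos (2*pi - a) \<le> cos \<delta>" using * \<delta> False by (intro cos_monotone_0_pi_le) auto
          then show ?thesis by simp
        qed
        then show False using w \<open>Re w = cos a\<close> by simp
      qed
      then show ?thesis using supp unfolding \<Phi>_def a_def by blast
    qed
    then have "\<forall>\<^sub>F w in at z within sphere 0 1. \<Phi> w = \<Phi> z"
      using ev \<delta> cos_monotone_0_pi[of 0 \<delta>] z True by (auto simp: eventually_at_filter elim!: eventually_mono)
    then show ?thesis unfolding continuous_within by (rule tendsto_eventually)
  next
    case False
    have "z \<notin> \<real>\<^sub>\<ge>\<^sub>0"
    proof
      assume "z \<in> \<real>\<^sub>\<ge>\<^sub>0"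
      then obtain r where "r \<ge> 0" "z = of_real r" by (auto elim: nonneg_Reals_cases)
      then show False using z False by auto
    qed
    then have "isCont Arg2pi z" by (rule continuous_at_Arg2pi)
    moreover have "isCont \<phi> (Arg2pi z)" using \<phi> by (simp add: continuous_on_eq_continuous_at)
    ultimately have "isCont (\<lambda>z. \<phi> (Arg2pi z)) z" by (rule isCont_o2)
    then show ?thesis unfolding \<Phi>_def by (rule continuous_at_imp_continuous_at_within)
  qed
  then have "continuous_on (sphere 0 1) \<Phi>" by (simp add: continuous_on_eq_continuous_within)
  then obtain P where P: "polynomial_function P" "\<forall>z\<in>sphere 0 1. norm (\<Phi> z - P z) < e"
    using Stone_Weierstrass_polynomial_function[OF compact_sphere _ \<open>e > 0\<close>] by blast
  have "\<Phi> (cis x) = \<phi> x" if "x \<in> {0..2*pi}" for x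
  proof (cases "x = 2*pi")
    case True
    have "\<phi> 0 = 0" "\<phi> (2*pi) = 0" using supp[of 0] supp[of "2*pi"] \<delta> by auto
    moreover have "Arg2pi (cis x) = 0" unfolding True by (intro Arg2pi_unique[of 1]) (auto)
    ultimately show ?thesis using True by (simp add: \<Phi>_def)
  next
    case False
    then have "Arg2pi (cis x) = x" using that by (intro Arg2pi_unique[of 1]) (auto simp: cis_conv_exp)
    then show ?thesis by (simp add: \<Phi>_def)
  qed
  moreover have "cis x \<in> sphere 0 1" for x by simp
  ultimately have "\<forall>x\<in>{0..2*pi}. cmod (\<phi> x - P (cis x)) < e" using P(2) by metis
  then show ?thesis using polynomial_function_trig_poly[OF P(1)]
    by (intro exI[of _ "\<lambda>x. P (cis x)"] conjI)
qed

theorem fourier_series_L2: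
  assumes g: "square_integrable g"
  shows "(\<lambda>M. energy (\<lambda>x. g x - partial_fourier M g x)) \<longlonglongrightarrow> 0"
proof (rule LIMSEQ_I)
  fix e :: real assume e: "e > 0"
  obtain \<phi> \<delta> where \<phi>: "continuous_on UNIV \<phi>" "0 < \<delta>" "\<delta> < pi" "\<And>x. x \<notin> {\<delta>..2*pi-\<delta>} \<Longrightarrow> \<phi> x = 0"
    "square_integrable \<phi>" "energy (\<lambda>x. g x - \<phi> x) < e / 4"
    using square_integrable_approx_continuous[OF g, of "e/4"] e by auto
  \<comment> \<open>Chosen so that \<open>\<eta>\<^sup>2\<close> times the length
    \<open>2 * pi\<close> is \<open>e / 8\<close>.\<close>
  define \<eta> where "\<eta> = sqrt (e / (16 * pi))"
  have \<eta>: "\<eta> > 0" using e by (simp add: \<eta>_def)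
  obtain p where p: "trig_poly p" "\<forall>x\<in>{0..2*pi}. cmod (\<phi> x - p x) < \<eta>"
    using continuous_approx_trig_poly[OF \<phi>(1-4) \<eta>] by blast
  have ps: "square_integrable p"
    using trig_poly_sum[OF p(1)] by (auto intro!: continuous_square_integrable continuous_intros)
  have "energy (\<lambda>x. \<phi> x - p x) \<le> (LINT x|torus. \<eta>\<^sup>2)"
    unfolding energy_def using less_imp_le[OF bspec[OF p(2)]] square_integrable_minus[OF \<phi>(5) ps] finite_measure.integrable_const[OF finite_measure_torus]
    by (intro integral_mono) (auto simp: square_integrable_def intro!: power_mono)
  also have "\<dots> = e / 8" using e by (simp add: measure_torus_space \<eta>_def)
  finally have 1: "energy (\<lambda>x. \<phi> x - p x) \<le> e / 8" .
  have "energy (\<lambda>x. g x - p x) = energy (\<lambda>x. (g x - \<phi> x) + (\<phi> x - p x))" by simp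
  also have "\<dots> \<le> 2 * energy (\<lambda>x. g x - \<phi> x) + 2 * energy (\<lambda>x. \<phi> x - p x)"
    by (intro energy_add_le square_integrable_minus g \<phi> ps)
  also have "\<dots> < e" using 1 \<phi>(6) e by simp
  finally have "energy (\<lambda>x. g x - p x) < e" .
  moreover obtain M0 where "\<forall>M\<ge>M0. energy (\<lambda>x. g x - partial_fourier M g x) \<le> energy (\<lambda>x. g x - p x)"
    using trig_poly_best_approximation[OF g p(1)] by blast
  ultimately show "\<exists>M0. \<forall>M\<ge>M0. norm (energy (\<lambda>x. g x - partial_fourier M g x) - 0) < e"
    using energy_nonneg by (intro exI[of _ M0]) (auto intro: le_less_trans)
qed

section \<open>Uniqueness, Parseval's identity and coefficients of products\<close>

lemma fourier_coeff_diff: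
  assumes "square_integrable g" "square_integrable h"
  shows "fourier_coeff (\<lambda>x. g x - h x) k = fourier_coeff g k - fourier_coeff h k"
  using integrable_char_mult[OF assms(1)] integrable_char_mult[OF assms(2)]
  by (simp add: fourier_coeff_torus right_diff_distrib diff_divide_distrib)

lemma fourier_coeff_eqI:
  assumes "square_integrable g" "square_integrable h" "\<And>k. fourier_coeff g k = fourier_coeff h k"
  shows "AE x in torus. g x = h x"
proof -
  define d where "d = (\<lambda>x. g x - h x)"
  have d: "square_integrable d" unfolding d_def by (intro square_integrable_minus assms)
  have "fourier_coeff d k = 0" for k unfolding d_def using fourier_coeff_diff[OF assms(1,2)] assms(3) by simp
  then have "partial_fourier M d = (\<lambda>x. 0)" for M by (simp add: partial_fourier_def fun_eq_iff)
  then have "energy d = 0" using fourier_series_L2[OF d] by (simp add: LIMSEQ_const_iff)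
  then have "AE x in torus. (cmod (d x))\<^sup>2 = 0"
    using d unfolding energy_def square_integrable_def by (subst (asm) integral_nonneg_eq_0_iff_AE) auto
  then show ?thesis by (auto simp: d_def elim!: eventually_mono)
qed

lemma parseval:
  assumes g: "square_integrable g"
  shows "(\<lambda>M. \<Sum>k\<in>{-int M..int M}. (cmod (fourier_coeff g k))\<^sup>2) \<longlonglongrightarrow> energy g / (2 * pi)"
proof -
  have "(\<Sum>k\<in>{-int M..int M}. (cmod (fourier_coeff g k))\<^sup>2) = (energy g - energy (\<lambda>x. g x - partial_fourier M g x)) / (2*pi)" for M
    using energy_partial_fourier[OF g, of M] by (simp add: field_simps)
  moreover have "(\<lambda>M. (energy g - energy (\<lambda>x. g x - partial_fourier M g x)) / (2*pi)) \<longlonglongrightarrow> (energy g - 0) / (2*pi)"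
    by (intro tendsto_intros fourier_series_L2[OF g]) auto
  ultimately show ?thesis by simp
qed

lemma finite_int_subset_interval: "finite (K :: int set) \<Longrightarrow> \<exists>M. K \<subseteq> {-int M..int M}"
proof -
  assume K: "finite K"
  have "k \<in> {-int (Max (insert 0 ((\<lambda>k. nat \<bar>k\<bar>) ` K)))..int (Max (insert 0 ((\<lambda>k. nat \<bar>k\<bar>) ` K)))}" if "k \<in> K" for k
  proof -
    have "nat \<bar>k\<bar> \<le> Max (insert 0 ((\<lambda>k. nat \<bar>k\<bar>) ` K))" using that K by (intro Max_ge) auto
    then show ?thesis by auto
  qed
  then show ?thesis by blast
qed

lemma bessel:
  assumes g: "square_integrable g" and K: "finite K"
  shows "2 * pi * (\<Sum>k\<in>K. (cmod (fourier_coeff g k))\<^sup>2) \<le> energy g"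
  using energy_diff_trig_poly[OF g K, of "fourier_coeff g"] energy_nonneg[of "\<lambda>x. g x - (\<Sum>k\<in>K. fourier_coeff g k * char k x)"]
  by simp

lemma fourier_coeff_summable:
  assumes g: "square_integrable g"
  shows "(\<lambda>k. (cmod (fourier_coeff g k))\<^sup>2) summable_on UNIV"
proof (rule nonneg_bdd_above_summable_on)
  show "bdd_above (sum (\<lambda>k. (cmod (fourier_coeff g k))\<^sup>2) ` {F. F \<subseteq> UNIV \<and> finite F})"
  proof (rule bdd_aboveI2[of _ _ "energy g / (2*pi)"])
    fix F :: "int set" assume "F \<in> {F. F \<subseteq> UNIV \<and> finite F}"
    then show "(\<Sum>k\<in>F. (cmod (fourier_coeff g k))\<^sup>2) \<le> energy g / (2*pi)"
      using bessel[OF g, of F] by (simp add: pos_le_divide_eq mult.commute)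
  qed
qed auto

text \<open>The product is merely integrable. Its coefficients are limits of truncated convolutions
  because the Fourier series of \<open>h\<close> converges in mean square and is paired, by
  Cauchy-Schwarz, with \<open>g\<close> times a character.\<close>

lemma fourier_coeff_mult:
  assumes g: "square_integrable g" and h: "square_integrable h"
  shows "(\<lambda>M. \<Sum>m\<in>{-int M..int M}. fourier_coeff g (k - m) * fourier_coeff h m) \<longlonglongrightarrow> fourier_coeff (\<lambda>x. g x * h x) k"
proof -
  define ek where "ek = (\<lambda>x. char (-k) x * g x)"
  have ek: "square_integrable ek" unfolding ek_def
    by (rule square_integrable_mult_bounded[OF g, where B=1]) auto
  have ee: "energy ek = energy g" unfolding ek_def energy_def by (simp add: norm_mult)
  have S: "square_integrable (\<lambda>x. h x - partial_fourier M h x)" for M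
    by (intro square_integrable_minus h square_integrable_partial_fourier)
  have "fourier_coeff (\<lambda>x. g x * h x) k - (\<Sum>m\<in>{-int M..int M}. fourier_coeff g (k - m) * fourier_coeff h m)
    = 1 / (2*pi) * (LINT x|torus. ek x * (h x - partial_fourier M h x))" for M
  proof -
    have i1: "integrable torus (\<lambda>x. ek x * h x)" by (intro square_integrable_mult_integrable ek h)
    have i2: "integrable torus (\<lambda>x. ek x * partial_fourier M h x)"
      by (intro square_integrable_mult_integrable ek square_integrable_partial_fourier)
    have "(LINT x|torus. ek x * partial_fourier M h x) =
      (LINT x|torus. (\<Sum>m\<in>{-int M..int M}. fourier_coeff h m * (char (-(k-m)) x * g x)))"
    proof (intro Bochner_Integration.integral_cong refl)
      fix x
      have "char (-(k-m)) x = char (-k) x * char m x" for m using char_add[of "-k" m x] by simp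
      then show "ek x * partial_fourier M h x = (\<Sum>m\<in>{-int M..int M}. fourier_coeff h m * (char (-(k-m)) x * g x))"
        unfolding ek_def partial_fourier_def by (simp add: sum_distrib_left mult_ac)
    qed
    also have "\<dots> = (\<Sum>m\<in>{-int M..int M}. fourier_coeff h m * (2 * pi * fourier_coeff g (k-m)))"
      by (subst Bochner_Integration.integral_sum)
         (use integrable_char_mult[OF g] integral_char_mult[OF g, of "-(k-m)" for m] in auto)
    finally have "(LINT x|torus. ek x * partial_fourier M h x) = 2 * pi * (\<Sum>m\<in>{-int M..int M}. fourier_coeff g (k-m) * fourier_coeff h m)"
      by (simp add: sum_distrib_left mult_ac)
    then show ?thesis using i1 i2
      by (simp add: fourier_coeff_torus right_diff_distrib diff_divide_distrib ek_def mult_ac)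
  qed note eq = this
  have "(\<lambda>M. fourier_coeff (\<lambda>x. g x * h x) k - (\<Sum>m\<in>{-int M..int M}. fourier_coeff g (k - m) * fourier_coeff h m)) \<longlonglongrightarrow> 0"
  proof (rule Lim_null_comparison)
    show "(\<lambda>M. 1/(2*pi) * sqrt (energy g * energy (\<lambda>x. h x - partial_fourier M h x))) \<longlonglongrightarrow> 0"
      by (auto intro!: tendsto_eq_intros fourier_series_L2[OF h])
    show "\<forall>\<^sub>F M in sequentially. norm (fourier_coeff (\<lambda>x. g x * h x) k - (\<Sum>m\<in>{-int M..int M}. fourier_coeff g (k - m) * fourier_coeff h m))
        \<le> 1/(2*pi) * sqrt (energy g * energy (\<lambda>x. h x - partial_fourier M h x))"
      unfolding eq norm_mult using Cauchy_Schwarz_torus[OF ek S] ee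
      by (intro always_eventually allI mult_mono) (auto simp: norm_divide)
  qed
  from tendsto_diff[OF tendsto_const[of "fourier_coeff (\<lambda>x. g x * h x) k"] this] show ?thesis by simp
qed

subsection \<open>The Fresnel integral\<close>

definition fresnel :: "real \<Rightarrow> complex" where
  "fresnel x = (LBINT y=ereal 0..ereal x. cis (y\<^sup>2))"

lemma fresnel_has_vector_derivative: "(fresnel has_vector_derivative cis (x\<^sup>2)) (at x within S)"
proof -
  define a where "a = \<bar>x\<bar> + 1"
  have "((\<lambda>u. LBINT y=ereal 0..ereal u. cis (y\<^sup>2)) has_vector_derivative cis (x\<^sup>2)) (at x within {-a..a})"
    by (rule interval_integral_FTC2) (auto simp: a_def intro!: continuous_intros)
  moreover have "at x within {-a..a} = at x"
    by (rule at_within_interior) (auto simp: a_def interior_atLeastAtMost_real)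
  ultimately show ?thesis unfolding fresnel_def[abs_def] by (metis has_vector_derivative_at_within)
qed

lemma fresnel_0 [simp]: "fresnel 0 = 0"
  by (simp add: fresnel_def)

lemma continuous_on_fresnel: "continuous_on S fresnel"
  using fresnel_has_vector_derivative
  by (meson continuous_on_vector_derivative)

lemma fresnel_compose_deriv:
  assumes "(f has_real_derivative f') (at x within S)"
  shows "((\<lambda>x. fresnel (f x)) has_vector_derivative of_real f' * cis ((f x)\<^sup>2)) (at x within S)"
  using vector_diff_chain_within[OF assms[unfolded has_real_derivative_iff_has_vector_derivative], of fresnel "cis ((f x)\<^sup>2)"]
    fresnel_has_vector_derivative[of "f x" "f ` S"]
  by (simp add: o_def scaleR_conv_of_real)

lemma constant_of_zero_derivative:
  fixes g :: "real \<Rightarrow> complex"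
  assumes "\<And>x. (g has_vector_derivative 0) (at x)"
  shows "g x = g y"
proof -
  obtain c where "\<And>x. x \<in> UNIV \<Longrightarrow> g x = c"
    by (rule has_vector_derivative_zero_constant[OF convex_UNIV, of g]) (use assms in blast)+
  then show ?thesis by simp
qed

lemma fresnel_minus: "fresnel (- x) = - fresnel x"
proof -
  have d: "(uminus has_real_derivative - 1) (at x)" for x :: real
    by (auto intro!: derivative_eq_intros)
  have "((\<lambda>x. fresnel x + fresnel (- x)) has_vector_derivative cis (x\<^sup>2) + of_real (-1) * cis ((- x)\<^sup>2)) (at x)" for x
    by (intro has_vector_derivative_add fresnel_has_vector_derivative fresnel_compose_deriv d)
  moreover have "cis (x\<^sup>2) + of_real (-1) * cis ((- x)\<^sup>2) = 0" for x by simp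
  ultimately have "((\<lambda>x. fresnel x + fresnel (- x)) has_vector_derivative 0) (at x)" for x
    by (simp only:)
  then have "fresnel x + fresnel (- x) = fresnel 0 + fresnel (- 0)" by (rule constant_of_zero_derivative)
  then show ?thesis by (simp add: eq_neg_iff_add_eq_0 add.commute)
qed

lemma norm_diff_le_integral_bound:
  fixes F :: "real \<Rightarrow> complex"
  assumes "a \<le> b" "\<And>x. x \<in> {a..b} \<Longrightarrow> (F has_vector_derivative F' x) (at x within {a..b})"
    "\<And>x. x \<in> {a..b} \<Longrightarrow> (G has_vector_derivative G' x) (at x within {a..b})"
    "\<And>x. x \<in> {a..b} \<Longrightarrow> cmod (F' x) \<le> G' x"
  shows "cmod (F b - F a) \<le> G b - G a"
proof -
  have F: "(F' has_integral (F b - F a)) {a..b}" by (intro fundamental_theorem_of_calculus assms)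
  have G: "(G' has_integral (G b - G a)) {a..b}" by (intro fundamental_theorem_of_calculus assms)
  have "norm (integral {a..b} F') \<le> integral {a..b} G'"
    using F G assms(4) by (intro integral_norm_bound_integral) auto
  then show ?thesis using F G by (simp add: integral_unique)
qed

lemma fresnel_lipschitz: "a \<le> b \<Longrightarrow> cmod (fresnel b - fresnel a) \<le> b - a"
  by (rule norm_diff_le_integral_bound[where F'="\<lambda>y. cis (y\<^sup>2)" and G="\<lambda>x. x" and G'="\<lambda>_. 1"])
     (auto intro!: fresnel_has_vector_derivative derivative_eq_intros has_vector_derivative_id)

text \<open>One integration by parts of \<open>cis (y\<^sup>2) = (2 \<i> y cis (y\<^sup>2)) / (2 \<i> y)\<close>.\<close>

lemma fresnel_asymptotic:
  assumes "0 < a" "a \<le> b"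
  shows "cmod (fresnel b - fresnel a - (cis (b\<^sup>2) / (2 * \<i> * b) - cis (a\<^sup>2) / (2 * \<i> * a))) \<le> 1 / (2 * a) - 1 / (2 * b)"
proof -
  define F where "F = (\<lambda>y::real. fresnel y - cis (y\<^sup>2) / (2 * \<i> * y))"
  have "cmod (F b - F a) \<le> (\<lambda>y. - 1 / (2 * y)) b - (\<lambda>y. - 1 / (2 * y)) a"
  proof (rule norm_diff_le_integral_bound[where F'="\<lambda>y. cis (y\<^sup>2) / (2 * \<i> * y\<^sup>2)" and G'="\<lambda>y. 1 / (2 * y\<^sup>2)"])
    fix x assume x: "x \<in> {a..b}"
    then have x0: "x > 0" using assms by auto
    have "((\<lambda>y. cis (y\<^sup>2) / (2 * \<i> * y)) has_vector_derivative (cis (x\<^sup>2) - cis (x\<^sup>2) / (2 * \<i> * x\<^sup>2))) (at x within {a..b})"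
      unfolding has_vector_derivative_def using x0
      by (auto intro!: derivative_eq_intros simp: fun_eq_iff scaleR_conv_of_real field_simps power2_eq_square)
    from has_vector_derivative_diff[OF fresnel_has_vector_derivative this]
    show "(F has_vector_derivative cis (x\<^sup>2) / (2 * \<i> * x\<^sup>2)) (at x within {a..b})" by (simp add: F_def)
    show "((\<lambda>y. - 1 / (2 * y)) has_vector_derivative 1 / (2 * x\<^sup>2)) (at x within {a..b})"
      using x0 unfolding has_real_derivative_iff_has_vector_derivative[symmetric]
      by (auto intro!: derivative_eq_intros simp: field_simps power2_eq_square)
    show "cmod (cis (x\<^sup>2) / (2 * \<i> * x\<^sup>2)) \<le> 1 / (2 * x\<^sup>2)" using x0 by (simp add: norm_divide norm_mult norm_power)
  qed (use assms in auto)
  then show ?thesis by (simp add: F_def algebra_simps)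
qed

lemma norm_le_norm_minus_diff: "norm (z::'a::real_normed_vector) \<le> norm (z - (p - q)) + norm p + norm q"
  using norm_triangle_ineq[of "z - (p - q)" "p - q"] norm_triangle_ineq4[of p q] by simp

lemma fresnel_diff_le:
  assumes "0 < a" "a \<le> b"
  shows "cmod (fresnel b - fresnel a) \<le> 1 / a"
proof -
  have b: "b > 0" using assms by auto
  have "cmod (fresnel b - fresnel a) \<le> cmod (fresnel b - fresnel a - (cis (b\<^sup>2) / (2 * \<i> * b) - cis (a\<^sup>2) / (2 * \<i> * a)))
      + cmod (cis (b\<^sup>2) / (2 * \<i> * b)) + cmod (cis (a\<^sup>2) / (2 * \<i> * a))"
    by (rule norm_le_norm_minus_diff)
  also have "\<dots> \<le> (1 / (2 * a) - 1 / (2 * b)) + 1 / (2 * b) + 1 / (2 * a)"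
    using fresnel_asymptotic[OF assms] assms b by (intro add_mono) (auto simp: norm_divide norm_mult)
  also have "\<dots> = 1 / a" by (simp add: field_simps)
  finally show ?thesis .
qed

text \<open>1 from the length of [0, 1] and 1 from the oscillatory tail beyond it.\<close>

lemma norm_fresnel_le: "cmod (fresnel x) \<le> 2"
proof -
  have *: "cmod (fresnel x) \<le> 2" if "x \<ge> 0" for x
  proof (cases "x \<le> 1")
    case True
    then show ?thesis using fresnel_lipschitz[of 0 x] that by simp
  next
    case False
    have "cmod (fresnel x) \<le> cmod (fresnel x - fresnel 1) + cmod (fresnel 1 - fresnel 0)" by simp norm
    also have "\<dots> \<le> 1 / 1 + (1 - 0)" using False by (intro add_mono fresnel_diff_le fresnel_lipschitz) auto
    finally show ?thesis by simp
  qed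
  show ?thesis using *[of x] *[of "-x"] by (cases "x \<ge> 0") (auto simp: fresnel_minus)
qed

definition fresnel_lim :: complex where
  "fresnel_lim = lim (\<lambda>n. fresnel (real n))"

lemma norm_fresnel_minus_lim_le:
  assumes "x > 0" shows "cmod (fresnel x - fresnel_lim) \<le> 1 / x"
proof -
  have "Cauchy (\<lambda>n. fresnel (real n))"
  proof (rule metric_CauchyI)
    fix e :: real assume e: "e > 0"
    obtain N :: nat where N: "N > 1 / e" using reals_Archimedean2 by blast
    then have N0: "N > 0" using e by (metis divide_pos_pos gr0I of_nat_0 order.asym zero_less_one)
    have *: "dist (fresnel (real m)) (fresnel (real n)) < e" if "N \<le> m" "m \<le> n" for m n
    proof -
      have "cmod (fresnel n - fresnel m) \<le> 1 / real m" using that N0 by (intro fresnel_diff_le) auto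
      also have "\<dots> \<le> 1 / real N" using that N0 by (intro divide_left_mono) auto
      also have "\<dots> < e" using N N0 e by (simp add: field_simps)
      finally show ?thesis by (simp add: dist_norm norm_minus_commute)
    qed
    show "\<exists>M. \<forall>m\<ge>M. \<forall>n\<ge>M. dist (fresnel (real m)) (fresnel (real n)) < e"
      by (rule exI[of _ N]) (metis * dist_commute nat_le_linear)
  qed
  then have lim: "(\<lambda>n. fresnel (real n)) \<longlonglongrightarrow> fresnel_lim"
    unfolding fresnel_lim_def by (simp add: Cauchy_convergent_iff convergent_LIMSEQ_iff)
  have "(\<lambda>n. cmod (fresnel x - fresnel (real n))) \<longlonglongrightarrow> cmod (fresnel x - fresnel_lim)"
    by (intro tendsto_intros lim)
  moreover have "\<forall>\<^sub>F n in sequentially. cmod (fresnel x - fresnel (real n)) \<le> 1 / x"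
    using eventually_ge_at_top[of "nat \<lceil>x\<rceil>"]
  proof eventually_elim
    case (elim n)
    then show ?case using fresnel_diff_le[of x "real n"] assms by (simp add: norm_minus_commute nat_le_iff ceiling_le_iff)
  qed
  ultimately show ?thesis by (intro tendsto_upperbound[where F=sequentially]) auto
qed

lemma fresnel_tendsto: "(fresnel \<longlongrightarrow> fresnel_lim) at_top"
proof (rule LIM_zero_cancel, rule Lim_null_comparison)
  show "\<forall>\<^sub>F x in at_top. norm (fresnel x - fresnel_lim) \<le> 1 / x"
    using eventually_gt_at_top[of 0] by eventually_elim (use norm_fresnel_minus_lim_le in auto)
  show "((\<lambda>x::real. 1 / x) \<longlongrightarrow> 0) at_top"
    by (intro tendsto_divide_0[OF tendsto_const] filterlim_at_top_imp_at_infinity filterlim_ident)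
qed

text \<open>Both sides have the same derivative in \<open>x\<close>; the left-hand side is
  \<open>\<integral>\<integral> cis (y\<^sup>2 + z\<^sup>2)\<close> over the square \<open>[0,x]\<^sup>2\<close>, the right-hand side integrates over rays.\<close>

lemma fresnel_squared:
  "(fresnel x)\<^sup>2 = integral {0..1} (\<lambda>s. (cis (x\<^sup>2 * (1 + s\<^sup>2)) - 1) / (\<i> * (1 + s\<^sup>2)))"
proof -
  define K where "K x = integral (cbox 0 1) (\<lambda>s. (cis (x\<^sup>2 * (1 + s\<^sup>2)) - 1) / (\<i> * of_real (1 + s\<^sup>2)))" for x :: real
  have nz: "1 + (s::real)\<^sup>2 \<noteq> 0" for s using add_pos_nonneg[of 1 "s\<^sup>2"] by simp
  have K: "(K has_vector_derivative integral (cbox 0 1) (\<lambda>s. 2 * of_real x * cis (x\<^sup>2 * (1 + s\<^sup>2)))) (at x within UNIV)" for x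
    unfolding K_def
  proof (rule leibniz_rule_vector_derivative[where fx="\<lambda>x s. 2 * of_real x * cis (x\<^sup>2 * (1 + s\<^sup>2))"])
    fix x s :: real
    have "((\<lambda>x. cis (x\<^sup>2 * (1 + s\<^sup>2))) has_vector_derivative of_real (2 * x * (1 + s\<^sup>2)) * (\<i> * cis (x\<^sup>2 * (1 + s\<^sup>2)))) (at x)"
      unfolding has_vector_derivative_def
      by (auto intro!: derivative_eq_intros simp: fun_eq_iff scaleR_conv_of_real algebra_simps)
    then have "((\<lambda>x. (cis (x\<^sup>2 * (1 + s\<^sup>2)) - 1) * (1 / (\<i> * of_real (1 + s\<^sup>2)))) has_vector_derivative
       (of_real (2 * x * (1 + s\<^sup>2)) * (\<i> * cis (x\<^sup>2 * (1 + s\<^sup>2))) - 0) * (1 / (\<i> * of_real (1 + s\<^sup>2)))) (at x)"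
      by (intro has_vector_derivative_mult_left has_vector_derivative_diff has_vector_derivative_const)
    moreover have "(of_real (2 * x * (1 + s\<^sup>2)) * (\<i> * cis (x\<^sup>2 * (1 + s\<^sup>2))) - 0) * (1 / (\<i> * of_real (1 + s\<^sup>2))) = 2 * of_real x * cis (x\<^sup>2 * (1 + s\<^sup>2))"
    proof -
      have "complex_of_real (1 + s\<^sup>2) \<noteq> 0" using nz[of s] of_real_eq_0_iff by blast
      then show ?thesis unfolding of_real_mult by (simp add: field_simps del: of_real_add)
    qed
    ultimately show "((\<lambda>x. (cis (x\<^sup>2 * (1 + s\<^sup>2)) - 1) / (\<i> * of_real (1 + s\<^sup>2))) has_vector_derivative
       2 * of_real x * cis (x\<^sup>2 * (1 + s\<^sup>2))) (at x within UNIV)" by simp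
  next
    fix x :: real
    show "(\<lambda>s. (cis (x\<^sup>2 * (1 + s\<^sup>2)) - 1) / (\<i> * of_real (1 + s\<^sup>2))) integrable_on cbox 0 1"
      using nz by (intro integrable_continuous continuous_intros) (auto simp flip: of_real_power of_real_add simp del: of_real_add)
  qed (auto intro!: continuous_intros simp: case_prod_unfold)
  have int: "integral (cbox 0 1) (\<lambda>s. 2 * of_real x * cis (x\<^sup>2 * (1 + s\<^sup>2))) = 2 * cis (x\<^sup>2) * fresnel x" for x
  proof -
    have "((\<lambda>s. 2 * cis (x\<^sup>2) * (x * cis ((x * s)\<^sup>2))) has_integral (2 * cis (x\<^sup>2) * (fresnel (x * 1) - fresnel (x * 0)))) {0..1}"
      by (intro has_integral_mult_right fundamental_theorem_of_calculus fresnel_compose_deriv)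
         (auto intro!: derivative_eq_intros)
    moreover have "(\<lambda>s. 2 * cis (x\<^sup>2) * (x * cis ((x * s)\<^sup>2))) = (\<lambda>s. 2 * of_real x * cis (x\<^sup>2 * (1 + s\<^sup>2)))"
      by (simp add: fun_eq_iff distrib_left power_mult_distrib flip: cis_mult)
    ultimately have "((\<lambda>s. 2 * of_real x * cis (x\<^sup>2 * (1 + s\<^sup>2))) has_integral (2 * cis (x\<^sup>2) * fresnel x)) (cbox 0 1)" by simp
    then show ?thesis by (rule integral_unique)
  qed
  have "((\<lambda>x. fresnel x * fresnel x - K x) has_vector_derivative 0) (at x)" for x
  proof -
    have "((\<lambda>x. fresnel x * fresnel x) has_vector_derivative fresnel x * cis (x\<^sup>2) + cis (x\<^sup>2) * fresnel x) (at x)"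
      by (intro has_vector_derivative_mult fresnel_has_vector_derivative)
    from has_vector_derivative_diff[OF this K[of x], unfolded int] show ?thesis by (simp add: mult.commute)
  qed
  then have "fresnel x * fresnel x - K x = fresnel 0 * fresnel 0 - K 0" by (rule constant_of_zero_derivative)
  moreover have "K 0 = 0" by (simp add: K_def)
  ultimately show ?thesis by (simp add: K_def power2_eq_square)
qed

text \<open>The phase splits as \<open>x\<^sup>2 + (x * s)\<^sup>2\<close>, and
  \<open>fresnel (x * s) / x\<close> is an antiderivative in \<open>s\<close> of
  \<open>cis ((x * s)\<^sup>2)\<close> of size O(1/x). Integration by parts against the smooth
  weight \<open>w\<close> gains the factor 1/x.\<close>

lemma fresnel_oscillatory_bound:
  assumes "x > 0"
  shows "cmod (integral {0..1} (\<lambda>s. cis (x\<^sup>2 * (1 + s\<^sup>2)) / (\<i> * (1 + s\<^sup>2)))) \<le> 8 / x"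
proof -
  have nz: "1 + (s::real)\<^sup>2 > 0" for s by (rule add_pos_nonneg) auto
  define w where "w s = inverse (1 + s\<^sup>2)" for s :: real
  have w': "(w has_real_derivative - (2 * s) * (w s)\<^sup>2) (at s within S)" for s S
  proof -
    have "((\<lambda>s. 1 + s\<^sup>2) has_real_derivative 2 * s) (at s within S)"
      by (auto intro!: derivative_eq_intros)
    from DERIV_inverse_fun[OF this] nz[of s] show ?thesis
      unfolding w_def by (simp add: power2_eq_square mult_ac)
  qed
  have wb: "0 \<le> w s" "w s \<le> 1" for s using nz[of s] by (auto simp: w_def inverse_le_1_iff)
  have wc: "continuous_on S w" for S by (rule DERIV_continuous_on[OF w'])
  define P where "P s = fresnel (x * s) / x * of_real (w s)" for s
  have P: "(P has_vector_derivative (fresnel (x * s) / x * of_real (- (2 * s) * (w s)\<^sup>2) + cis ((x * s)\<^sup>2) * of_real (w s))) (at s within {0..1})" for s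
  proof -
    have "((\<lambda>s. fresnel (x * s) * (1 / of_real x)) has_vector_derivative (of_real x * cis ((x * s)\<^sup>2)) * (1 / of_real x)) (at s within {0..1})"
      by (intro has_vector_derivative_mult_left fresnel_compose_deriv) (auto intro!: derivative_eq_intros)
    then have 1: "((\<lambda>s. fresnel (x * s) / x) has_vector_derivative cis ((x * s)\<^sup>2)) (at s within {0..1})" using assms by simp
    have "((\<lambda>s. of_real (w s)) has_vector_derivative complex_of_real (- (2 * s) * (w s)\<^sup>2)) (at s within {0..1})"
      using w'[of s "{0..1}"] by (intro has_vector_derivative_of_real) (simp add: has_real_derivative_iff_has_vector_derivative)
    from has_vector_derivative_mult[OF 1 this] show ?thesis unfolding P_def .
  qed
  have 1: "((\<lambda>s. fresnel (x * s) / x * of_real (- (2 * s) * (w s)\<^sup>2) + cis ((x * s)\<^sup>2) * of_real (w s)) has_integral (P 1 - P 0)) {0..1}"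
    by (intro fundamental_theorem_of_calculus P) auto
  have "continuous_on {0..1} (\<lambda>s. fresnel (x * s))"
    by (rule continuous_on_compose2[OF continuous_on_fresnel[of UNIV]]) (auto intro!: continuous_intros)
  then have 2: "(\<lambda>s. fresnel (x * s) / x * of_real (- (2 * s) * (w s)\<^sup>2)) integrable_on {0..1}" (is "?q integrable_on _")
    using assms by (intro integrable_continuous_real continuous_intros wc) auto
  have "cmod (integral {0..1} ?q) \<le> integral {0..1} (\<lambda>s::real. 4 / x)"
  proof (intro integral_norm_bound_integral 2)
    fix s :: real assume s: "s \<in> {0..1}"
    have "cmod (?q s) = cmod (fresnel (x * s)) * (2 * \<bar>s\<bar> * (w s)\<^sup>2) / x"
      using assms by (simp add: norm_mult norm_divide norm_power abs_mult)
    also have "\<dots> \<le> 2 * (2 * 1 * 1\<^sup>2) / x"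
      using s assms wb[of s] norm_fresnel_le by (intro divide_right_mono mult_mono power_mono) auto
    finally show "cmod (?q s) \<le> 4 / x" by simp
  qed auto
  then have 3: "cmod (integral {0..1} ?q) \<le> 4 / x" by simp
  have 4: "((\<lambda>s. cis ((x * s)\<^sup>2) * of_real (w s)) has_integral (P 1 - P 0 - integral {0..1} ?q)) {0..1}"
    using has_integral_diff[OF 1 integrable_integral[OF 2]] by simp
  have "cis (x\<^sup>2 * (1 + s\<^sup>2)) / (\<i> * of_real (1 + s\<^sup>2)) = cis (x\<^sup>2) / \<i> * (cis ((x * s)\<^sup>2) * of_real (w s))" for s
  proof -
    have "x\<^sup>2 * (1 + s\<^sup>2) = x\<^sup>2 + (x * s)\<^sup>2" by (simp add: algebra_simps power_mult_distrib)
    then have "cis (x\<^sup>2 * (1 + s\<^sup>2)) = cis (x\<^sup>2) * cis ((x * s)\<^sup>2)" by (simp add: cis_mult)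
    moreover have "complex_of_real (w s) = inverse (complex_of_real (1 + s\<^sup>2))" by (simp only: w_def of_real_inverse)
    ultimately show ?thesis by (simp only: divide_inverse inverse_mult_distrib mult_ac)
  qed
  note eq = this
  have "integral {0..1} (\<lambda>s. cis (x\<^sup>2 * (1 + s\<^sup>2)) / (\<i> * (1 + s\<^sup>2))) = cis (x\<^sup>2) / \<i> * (P 1 - P 0 - integral {0..1} ?q)"
    unfolding eq by (rule integral_unique[OF has_integral_mult_right[OF 4]])
  then have "cmod (integral {0..1} (\<lambda>s. cis (x\<^sup>2 * (1 + s\<^sup>2)) / (\<i> * (1 + s\<^sup>2)))) = cmod (P 1 - P 0 - integral {0..1} ?q)"
    by (simp add: norm_mult norm_divide)
  also have "\<dots> \<le> cmod (P 1) + cmod (P 0) + cmod (integral {0..1} ?q)"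
    using norm_triangle_ineq4[of "P 1 - P 0" "integral {0..1} ?q"] norm_triangle_ineq4[of "P 1" "P 0"] by linarith
  also have "\<dots> \<le> 2 / x + 0 + 4 / x"
  proof (intro add_mono 3)
    have "cmod (P 1) = cmod (fresnel x) * w 1 / x" using assms wb by (simp add: P_def norm_mult norm_divide)
    also have "\<dots> \<le> 2 * 1 / x" using assms wb[of 1] norm_fresnel_le[of x] by (intro divide_right_mono mult_mono) auto
    finally show "cmod (P 1) \<le> 2 / x" by simp
  qed (simp add: P_def)
  also have "\<dots> \<le> 8 / x" using assms by (simp add: field_simps)
  finally show ?thesis .
qed

text \<open>In \<open>fresnel_squared\<close> the oscillating part tends to 0 and the constant part
  is an arctangent integral. The modulus \<open>sqrt pi / 2\<close> that results fixes the factor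
  \<open>sqrt (t / pi)\<close> of the functional equation, and with it the contraction.\<close>

lemma fresnel_lim_squared: "fresnel_lim\<^sup>2 = \<i> * pi / 4"
proof -
  have nz: "complex_of_real (1 + s\<^sup>2) \<noteq> 0" for s
    by (metis of_real_eq_0_iff add_nonneg_eq_0_iff zero_le_one zero_le_power2 zero_neq_one)
  have a: "((\<lambda>s. 1 / (1 + s\<^sup>2)) has_integral (arctan 1 - arctan 0)) {0..1}"
    by (intro fundamental_theorem_of_calculus)
       (auto intro!: derivative_eq_intros simp: has_real_derivative_iff_has_vector_derivative[symmetric] inverse_eq_divide)
  have a': "((\<lambda>s. complex_of_real (1 / (1 + s\<^sup>2))) has_integral of_real (pi/4)) {0..1}"
    using has_integral_linear[OF a, of complex_of_real] by (simp only: o_def arctan_one bounded_linear_of_real arctan_zero_zero diff_0_right)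
  have e: "1 / (\<i> * complex_of_real (1 + s\<^sup>2)) = 1 / \<i> * complex_of_real (1 / (1 + s\<^sup>2))" for s
    by (simp only: of_real_divide of_real_1 times_divide_times_eq mult_1)
  have b: "((\<lambda>s. 1 / (\<i> * of_real (1 + s\<^sup>2))) has_integral (of_real (pi/4) / \<i>)) {0..1}"
    unfolding e using has_integral_mult_right[OF a', of "1/\<i>"] by (simp only: divide_inverse mult_1 mult.commute)
  have "(fresnel x)\<^sup>2 - \<i> * pi / 4 = integral {0..1} (\<lambda>s. cis (x\<^sup>2 * (1 + s\<^sup>2)) / (\<i> * (1 + s\<^sup>2)))" for x
  proof -
    have c: "(\<lambda>s. cis (x\<^sup>2 * (1 + s\<^sup>2)) / (\<i> * of_real (1 + s\<^sup>2))) integrable_on {0..1}"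
      using nz by (intro integrable_continuous_real continuous_intros) auto
    have "((\<lambda>s. cis (x\<^sup>2 * (1 + s\<^sup>2)) / (\<i> * of_real (1 + s\<^sup>2)) - 1 / (\<i> * of_real (1 + s\<^sup>2))) has_integral
       (integral {0..1} (\<lambda>s. cis (x\<^sup>2 * (1 + s\<^sup>2)) / (\<i> * of_real (1 + s\<^sup>2))) - of_real (pi/4) / \<i>)) {0..1}"
      by (rule has_integral_diff[OF integrable_integral[OF c] b])
    then have "(fresnel x)\<^sup>2 = integral {0..1} (\<lambda>s. cis (x\<^sup>2 * (1 + s\<^sup>2)) / (\<i> * of_real (1 + s\<^sup>2))) - of_real (pi/4) / \<i>"
      unfolding fresnel_squared diff_divide_distrib by (rule integral_unique)
    then show ?thesis by (simp only:) simp
  qed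
  then have "cmod ((fresnel x)\<^sup>2 - \<i> * pi / 4) \<le> 8 / x" if "x > 0" for x
    using fresnel_oscillatory_bound[OF that] by (simp only:)
  note bound = this
  have "((\<lambda>x. (fresnel x)\<^sup>2) \<longlongrightarrow> \<i> * pi / 4) at_top"
  proof (rule LIM_zero_cancel, rule Lim_null_comparison)
    show "\<forall>\<^sub>F x in at_top. norm ((fresnel x)\<^sup>2 - \<i> * pi / 4) \<le> 8 / x"
      using eventually_gt_at_top[of 0] by eventually_elim (rule bound)
    show "((\<lambda>x::real. 8 / x) \<longlongrightarrow> 0) at_top"
      by (intro tendsto_divide_0[OF tendsto_const] filterlim_at_top_imp_at_infinity filterlim_ident)
  qed
  moreover have "((\<lambda>x. (fresnel x)\<^sup>2) \<longlongrightarrow> fresnel_lim\<^sup>2) at_top"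
    by (intro tendsto_intros fresnel_tendsto)
  ultimately show ?thesis by (intro tendsto_unique[where F="at_top::real filter"]) auto
qed

lemma norm_fresnel_lim: "cmod fresnel_lim = sqrt pi / 2"
proof -
  have "(cmod fresnel_lim)\<^sup>2 = pi / 4"
    unfolding norm_power[symmetric] fresnel_lim_squared by (simp add: norm_mult norm_divide)
  then have "cmod fresnel_lim = sqrt (pi / 4)" by (metis norm_ge_zero real_sqrt_unique)
  then show ?thesis by (simp add: real_sqrt_divide)
qed

section \<open>Null sets under translation, and convergence read off from coefficients\<close>

lemma AE_lebesgue_affine:
  assumes "AE x in lebesgue. P x" and c: "c \<noteq> (0::real)"
  shows "AE x in lebesgue. P (c * x + d)"
proof -
  obtain N where N: "{x. \<not> P x} \<subseteq> N" "N \<in> null_sets lebesgue"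
    using assms(1) unfolding eventually_ae_filter by auto
  have "negligible ((\<lambda>y. (y - d) / c) ` N)"
    by (rule negligible_differentiable_image_negligible)
       (use N c in \<open>auto simp: negligible_iff_null_sets differentiable_on_def intro!: derivative_intros\<close>)
  then have n: "(\<lambda>y. (y - d) / c) ` N \<in> null_sets lebesgue" by (simp add: negligible_iff_null_sets)
  show ?thesis
  proof (rule AE_I'[OF n], rule subsetI)
    fix x assume "x \<in> {x \<in> space lebesgue. \<not> P (c * x + d)}"
    then have "c * x + d \<in> N" using N by auto
    then show "x \<in> (\<lambda>y. (y - d) / c) ` N" using c by (intro image_eqI[of _ _ "c * x + d"]) auto
  qed
qed

lemma real_mod_2pi: "\<exists>m::int. x + 2 * pi * of_int m \<in> {0..<2*pi}"
proof -
  define m where "m = - \<lfloor>x / (2*pi)\<rfloor>"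
  have "0 \<le> x / (2*pi) + of_int m" "x / (2*pi) + of_int m < 1" unfolding m_def by linarith+
  then show ?thesis by (intro exI[of _ m]) (auto simp: field_simps)
qed

lemma AE_torus_iff_lebesgue:
  "(AE x in torus. P x) \<longleftrightarrow> (AE x in lebesgue. x \<in> {0..2*pi} \<longrightarrow> P x)"
  by (subst AE_restrict_space_iff) auto

lemma AE_torus_periodic:
  assumes "AE x in torus. P x" and per: "\<And>x. P (x + 2*pi) = P x"
  shows "AE x in lebesgue. P x"
proof -
  have per_int: "P (x + 2*pi * of_int m) = P x" for x m
  proof -
    have 1: "P (x + 2*pi * real n) = P x" for x n
    proof (induction n)
      case (Suc n)
      then show ?case using per[of "x + 2*pi * real n"] by (simp add: algebra_simps)
    qed simp
    show ?thesis
    proof (cases "m \<ge> 0")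
      case True
      then show ?thesis using 1[of x "nat m"] by simp
    next
      case False
      then show ?thesis using 1[of "x + 2*pi * of_int m" "nat (-m)"] by simp
    qed
  qed
  have "AE x in lebesgue. \<forall>m::int. 1 * x + 2 * pi * of_int m \<in> {0..2*pi} \<longrightarrow> P (1 * x + 2 * pi * of_int m)"
    unfolding AE_all_countable using assms(1) AE_torus_iff_lebesgue
    by (intro allI AE_lebesgue_affine) auto
  then show ?thesis
  proof eventually_elim
    case (elim x)
    obtain m :: int where "x + 2 * pi * of_int m \<in> {0..<2*pi}" using real_mod_2pi by blast
    then show ?case using elim per_int[of x m] by auto
  qed
qed

lemma japanese_summable:
  assumes "p > 1" shows "(\<lambda>k::int. japanese k powr (-p)) summable_on UNIV"
proof -
  have s: "summable (\<lambda>n. real n powr (-p))" using assms by (simp add: summable_real_powr_iff)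
  then have "summable (\<lambda>n. real (Suc n) powr (-p))" by (simp only: summable_Suc_iff[of "\<lambda>n. real n powr (-p)"])
  then have n: "(\<lambda>n. real (Suc n) powr (-p)) summable_on UNIV"
    by (intro summable_nonneg_imp_summable_on) auto
  have eq: "japanese (real_of_int (int n)) = real (Suc n)" "japanese (real_of_int (- int n)) = real (Suc n)" for n
    by (simp_all add: japanese_def)
  have 1: "(\<lambda>k::int. japanese k powr (-p)) summable_on range int"
    using n eq by (subst summable_on_reindex) (auto simp: o_def)
  have 2: "(\<lambda>k::int. japanese k powr (-p)) summable_on range (\<lambda>n. - int n)"
    using n eq by (subst summable_on_reindex) (auto simp: o_def inj_on_def)
  have "(\<lambda>k::int. japanese k powr (-p)) summable_on range (\<lambda>n. - int n) - range int"
    by (rule summable_on_subset_banach[OF 2]) auto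
  from summable_on_Un_disjoint[OF 1 this] have "(\<lambda>k::int. japanese k powr (-p)) summable_on (range int \<union> range (\<lambda>n. - int n))" by auto
  moreover have "range int \<union> range (\<lambda>n. - int n) = UNIV"
  proof -
    have "k \<in> range int \<union> range (\<lambda>n. - int n)" for k by (cases k rule: int_cases2) auto
    then show ?thesis by blast
  qed
  ultimately show ?thesis by simp
qed

text \<open>At \<open>k = 0\<close> the summand is 0 by the convention for division by zero.\<close>

lemma inverse_square_summable: "(\<lambda>k::int. (C / of_int k)\<^sup>2 :: real) summable_on UNIV"
proof (rule summable_on_comparison_test)
  show "(\<lambda>k::int. 4 * C\<^sup>2 * japanese k powr (-2)) summable_on UNIV"
    using japanese_summable[of 2] by (intro summable_on_cmult_right) auto
  show "(C / of_int k)\<^sup>2 \<le> 4 * C\<^sup>2 * japanese k powr (-2)" for k :: int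
  proof (cases "k = 0")
    case False
    then have k: "\<bar>real_of_int k\<bar> \<ge> 1" by linarith
    then have j: "0 < japanese k" "japanese k \<le> 2 * \<bar>real_of_int k\<bar>" by (auto simp: japanese_def)
    have "(japanese k)\<^sup>2 \<le> (2 * \<bar>real_of_int k\<bar>)\<^sup>2" using j by (intro power_mono) auto
    then have "C\<^sup>2 * (japanese k)\<^sup>2 \<le> C\<^sup>2 * (4 * (real_of_int k)\<^sup>2)"
      by (intro mult_left_mono) (auto simp: power_mult_distrib)
    moreover have pw: "japanese k powr (-2) = 1 / (japanese k)\<^sup>2" using j by (simp add: powr_minus divide_inverse)
    ultimately show ?thesis using j False unfolding pw power_divide by (simp add: divide_simps mult_ac)
  qed (simp)
qed simp

text \<open>Dominated convergence on the Fourier side: off a finite set of frequencies the majorant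
  is small, on that set the coefficients tend to 0, and Parseval adds up.\<close>

lemma energy_tendsto_0:
  assumes Y: "\<And>N. square_integrable (Y N)"
    and lim: "\<And>k. (\<lambda>N. fourier_coeff (Y N) k) \<longlonglongrightarrow> 0"
    and le: "\<And>N k. (cmod (fourier_coeff (Y N) k))\<^sup>2 \<le> b k" and b: "b summable_on UNIV"
  shows "(\<lambda>N::nat. energy (Y N)) \<longlonglongrightarrow> 0"
proof (rule LIMSEQ_I)
  fix e :: real assume e: "e > 0"
  define e' where "e' = e / (8 * pi)"
  have e': "e' > 0" using e by (simp add: e'_def)
  have b0: "b k \<ge> 0" for k using le[of 0 k] by (smt (verit) zero_le_power2)
  have "(sum b \<longlongrightarrow> infsum b UNIV) (finite_subsets_at_top UNIV)"
    using b has_sum_def has_sum_infsum by blast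
  then have "\<forall>\<^sub>F F in finite_subsets_at_top UNIV. dist (sum b F) (infsum b UNIV) < e'"
    using e' tendstoD by blast
  then obtain K where K: "finite K" "dist (sum b K) (infsum b UNIV) < e'"
    unfolding eventually_finite_subsets_at_top by blast
  have tail: "sum b (F - K) \<le> e'" if "finite F" for F
  proof -
    have "sum b (F - K) + sum b K = sum b ((F - K) \<union> K)" using that K by (intro sum.union_disjoint[symmetric]) auto
    also have "\<dots> \<le> infsum b UNIV" using that K b b0 by (intro finite_sum_le_infsum) auto
    finally show ?thesis using K(2) by (auto simp: dist_real_def)
  qed
  have "(\<lambda>N. \<Sum>k\<in>K. (cmod (fourier_coeff (Y N) k))\<^sup>2) \<longlonglongrightarrow> (\<Sum>k\<in>K. (cmod 0)\<^sup>2)"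
    by (intro tendsto_intros lim)
  then have "\<forall>\<^sub>F N in sequentially. (\<Sum>k\<in>K. (cmod (fourier_coeff (Y N) k))\<^sup>2) < e'"
    using e' by (intro order_tendstoD) auto
  then obtain N0 where N0: "\<And>N. N \<ge> N0 \<Longrightarrow> (\<Sum>k\<in>K. (cmod (fourier_coeff (Y N) k))\<^sup>2) < e'"
    by (auto simp: eventually_sequentially)
  have "energy (Y N) < e" if N: "N \<ge> N0" for N
  proof -
    have "(\<Sum>k\<in>{-int M..int M}. (cmod (fourier_coeff (Y N) k))\<^sup>2) \<le> 2 * e'" for M
    proof -
      let ?F = "{-int M..int M}"
      have "(\<Sum>k\<in>?F. (cmod (fourier_coeff (Y N) k))\<^sup>2) \<le> (\<Sum>k\<in>K \<union> (?F - K). (cmod (fourier_coeff (Y N) k))\<^sup>2)"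
        using K by (intro sum_mono2) auto
      also have "\<dots> = (\<Sum>k\<in>K. (cmod (fourier_coeff (Y N) k))\<^sup>2) + (\<Sum>k\<in>?F - K. (cmod (fourier_coeff (Y N) k))\<^sup>2)"
        using K by (intro sum.union_disjoint) auto
      also have "\<dots> \<le> e' + sum b (?F - K)"
        using N0[OF N] by (intro add_mono sum_mono le) auto
      also have "\<dots> \<le> 2 * e'" using tail[of ?F] by simp
      finally show ?thesis .
    qed
    then have "energy (Y N) / (2*pi) \<le> 2 * e'"
      by (intro tendsto_upperbound[OF parseval[OF Y]]) auto
    then show ?thesis using e by (simp add: e'_def field_simps)
  qed
  then show "\<exists>N0. \<forall>N\<ge>N0. norm (energy (Y N) - 0) < e" using energy_nonneg by (intro exI[of _ N0]) auto
qed

text \<open>Mean square convergence controls points only along a subsequence; this is the origin of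
  the subsequences in the limits for \<open>step_sum\<close> and for partial Fourier sums.\<close>

lemma energy_AE_subseq:
  assumes Y: "\<And>N. square_integrable (Y N)" and "(\<lambda>N. energy (Y N)) \<longlonglongrightarrow> 0"
  shows "\<exists>r::nat\<Rightarrow>nat. strict_mono r \<and> (AE x in torus. (\<lambda>n. Y (r n) x) \<longlonglongrightarrow> 0)"
proof -
  have "(\<lambda>n. LINT x|torus. norm ((cmod (Y n x))\<^sup>2)) \<longlonglongrightarrow> 0" using assms(2) by (simp add: energy_def)
  then obtain r :: "nat \<Rightarrow> nat" where r: "strict_mono r" "AE x in torus. (\<lambda>n. (cmod (Y (r n) x))\<^sup>2) \<longlonglongrightarrow> 0"
    using tendsto_L1_AE_subseq[of torus "\<lambda>n x. (cmod (Y n x))\<^sup>2"] Y unfolding square_integrable_def by blast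
  from r(2) have "AE x in torus. (\<lambda>n. Y (r n) x) \<longlonglongrightarrow> 0"
  proof eventually_elim
    case (elim x)
    then have "(\<lambda>n. sqrt ((cmod (Y (r n) x))\<^sup>2)) \<longlonglongrightarrow> sqrt 0" by (intro tendsto_intros)
    then show ?case by (simp add: tendsto_norm_zero_iff)
  qed
  then show ?thesis using r(1) by blast
qed

lemma sum_int_symmetric:
  "(\<Sum>k\<in>{-int N..int N}. F k) = F 0 + (\<Sum>m<N. F (int (Suc m)) + F (- int (Suc m)) :: 'a::comm_monoid_add)"
proof (induction N)
  case (Suc N)
  have "{-int (Suc N)..int (Suc N)} = insert (int (Suc N)) (insert (- int (Suc N)) {-int N..int N})" by auto
  then have "(\<Sum>k\<in>{-int (Suc N)..int (Suc N)}. F k) = F (int (Suc N)) + (F (- int (Suc N)) + (\<Sum>k\<in>{-int N..int N}. F k))"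
    by simp
  then show ?case using Suc by (simp add: ac_simps)
qed simp

lemma sum_int_telescope:
  "(\<Sum>n\<in>{-int N+1..int N}. G (n - 1) - G n :: 'a::ab_group_add) = G (- int N) - G (int N)"
proof (induction N)
  case (Suc N)
  have "{-int (Suc N)+1..int (Suc N)} = insert (int (Suc N)) (insert (- int N) {-int N+1..int N})" by auto
  then have eq: "(\<Sum>n\<in>{-int (Suc N)+1..int (Suc N)}. G (n - 1) - G n) =
     (G (int N) - G (int (Suc N))) + ((G (- int N - 1) - G (- int N)) + (\<Sum>n\<in>{-int N+1..int N}. G (n - 1) - G n))"
    by simp
  have e: "- int (Suc N) = - int N - 1" by simp
  have "(\<Sum>n\<in>{-int (Suc N)+1..int (Suc N)}. G (n - 1) - G n) =
     (G (int N) - G (int (Suc N))) + ((G (- int N - 1) - G (- int N)) + (G (- int N) - G (int N)))"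
    using eq Suc.IH by (simp only:)
  then show ?case unfolding e by (simp only:) (simp add: algebra_simps)
qed simp

lemma diff_diff_eq_cancel_right: "(a - d) - (b - d) = a - (b :: 'a::ab_group_add)"
  by simp

lemma integral_torus_eq:
  assumes "square_integrable g" shows "(LINT x|torus. g x) = integral {0..2*pi} g"
  using square_integrable_integrable[OF assms] by (rule lebesgue_integral_eq_integral) auto

subsection \<open>Schroedinger evolution of a step on the line\<close>

text \<open>For t > 0 the substitution y = 2 sqrt t z turns this into the integral of
  \<open>cis (y\<^sup>2 / (4 * t))\<close> over [0, a]: up to a constant factor, the free evolution
  of the sign function on the line.\<close>

definition step_evolution :: "real \<Rightarrow> real \<Rightarrow> complex" where
  "step_evolution t a = 2 * of_real (sqrt t) * fresnel (a / (2 * sqrt t))"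

definition step_evolution_lim :: "real \<Rightarrow> complex" where
  "step_evolution_lim t = 2 * of_real (sqrt t) * fresnel_lim"

lemma step_evolution_minus: "step_evolution t (- a) = - step_evolution t a"
  by (simp add: step_evolution_def fresnel_minus)

lemma step_evolution_deriv:
  assumes "t > 0" "(f has_real_derivative f') (at x within S)"
  shows "((\<lambda>x. step_evolution t (f x)) has_vector_derivative of_real f' * cis ((f x)\<^sup>2 / (4 * t))) (at x within S)"
proof -
  have "((\<lambda>x. f x / (2 * sqrt t)) has_real_derivative f' / (2 * sqrt t)) (at x within S)"
    using assms(2) by (rule DERIV_cdivide)
  from has_vector_derivative_mult_right[OF fresnel_compose_deriv[OF this], of "2 * of_real (sqrt t)"]
  have "((\<lambda>x. step_evolution t (f x)) has_vector_derivative
    2 * of_real (sqrt t) * (of_real (f' / (2 * sqrt t)) * cis ((f x / (2 * sqrt t))\<^sup>2))) (at x within S)"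
    unfolding step_evolution_def .
  moreover have "(f x / (2 * sqrt t))\<^sup>2 = (f x)\<^sup>2 / (4 * t)" using assms(1) by (simp add: power_divide power_mult_distrib)
  moreover have "2 * of_real (sqrt t) * (of_real (f' / (2 * sqrt t)) * z) = of_real f' * z" for z :: complex
    using assms(1) by simp
  ultimately show ?thesis by (simp only:)
qed

lemma continuous_on_fresnel_compose:
  "continuous_on S f \<Longrightarrow> continuous_on S (\<lambda>x. fresnel (f x))"
  by (rule continuous_on_compose2[OF continuous_on_fresnel[of UNIV]]) auto

lemma continuous_step_evolution [continuous_intros]:
  assumes "continuous_on S f" shows "continuous_on S (\<lambda>x. step_evolution t (f x))"
proof -
  have "continuous_on S (\<lambda>x. f x * inverse (2 * sqrt t))" by (intro continuous_intros assms)
  from continuous_on_mult[OF continuous_on_const continuous_on_fresnel_compose[OF this]]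
  show ?thesis unfolding step_evolution_def divide_inverse .
qed

lemma norm_step_evolution_le: "t \<ge> 0 \<Longrightarrow> cmod (step_evolution t a) \<le> 4 * sqrt t"
  using mult_left_mono[OF norm_fresnel_le[of "a / (2 * sqrt t)"], of "2 * sqrt t"]
  by (simp add: step_evolution_def norm_mult)

lemma step_evolution_tendsto:
  assumes "t > 0" shows "(\<lambda>N. step_evolution t (2 * pi * real N + a)) \<longlonglongrightarrow> step_evolution_lim t"
proof -
  have "filterlim (\<lambda>N. (2 * pi * real N + a) / (2 * sqrt t)) at_top sequentially"
    using assms by real_asymp
  then show ?thesis unfolding step_evolution_def step_evolution_lim_def
    by (intro tendsto_intros filterlim_compose[OF fresnel_tendsto])
qed

lemma step_evolution_lim_nz: "t > 0 \<Longrightarrow> step_evolution_lim t \<noteq> 0"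
  using norm_fresnel_lim by (auto simp: step_evolution_lim_def)

lemma norm_step_evolution_lim: "t > 0 \<Longrightarrow> cmod (step_evolution_lim t) = sqrt (pi * t)"
  by (simp add: step_evolution_lim_def norm_mult norm_fresnel_lim real_sqrt_mult)

text \<open>Periodization of the evolved step. The centres are symmetric about \<pi>, which makes
  the sum odd about \<pi>; the linear term has the slope that restores equal values at 0 and 2
  \<pi>.\<close>

definition step_sum :: "real \<Rightarrow> nat \<Rightarrow> real \<Rightarrow> complex" where
  "step_sum t N x = (\<Sum>n\<in>{-int N+1..int N}. step_evolution t (x - 2 * pi * of_int n))
     - step_evolution t (2 * pi * real N) / pi * (x - pi)"

lemma continuous_step_sum: "continuous_on S (step_sum t N)"
  unfolding step_sum_def
  by (intro continuous_intros) auto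

lemma square_integrable_step_sum: "square_integrable (step_sum t N)"
  by (intro continuous_square_integrable continuous_step_sum)

lemma step_sum_reflect: "step_sum t N (2 * pi - x) = - step_sum t N x"
proof -
  have "(\<Sum>n\<in>{-int N+1..int N}. step_evolution t (2 * pi - x - 2 * pi * of_int n)) =
     (\<Sum>n\<in>{-int N+1..int N}. - step_evolution t (x - 2 * pi * of_int n))"
  proof (rule sum.reindex_bij_witness[of _ "\<lambda>n. 1 - n" "\<lambda>n. 1 - n"])
    fix n :: int
    have "2 * pi - x - 2 * pi * of_int n = - (x - 2 * pi * of_int (1 - n))" by (simp add: algebra_simps)
    then show "- step_evolution t (x - 2 * pi * of_int (1 - n)) = step_evolution t (2 * pi - x - 2 * pi * of_int n)"
      by (simp only: step_evolution_minus)
  qed auto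
  then show ?thesis unfolding step_sum_def by (simp add: sum_negf field_simps)
qed

text \<open>Oddness about \<pi>, seen after shifting the period to [-\<pi>, \<pi>].\<close>

lemma fourier_coeff_step_sum_0: "fourier_coeff (step_sum t N) 0 = 0"
proof -
  define h where "h y = step_sum t N (y + pi)" for y
  have "step_sum t N (- y + pi) = - step_sum t N (y + pi)" for y using step_sum_reflect[of t N "y + pi"] by (simp add: algebra_simps)
  then have "integral {-pi..pi} h = integral {-pi..pi} (\<lambda>y. - h (- y))" unfolding h_def by simp
  also have "\<dots> = - integral {-pi..pi} h" using Henstock_Kurzweil_Integration.integral_reflect_real[of pi "-pi" h] by simp
  finally have "integral {-pi..pi} h = 0" by simp
  moreover have "integral {-pi..pi} h = integral {0..2*pi} (step_sum t N)"
    unfolding h_def using integral_shift_real_ivl[of 0 pi "2*pi" "step_sum t N"] by simp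
  ultimately show ?thesis
    using integral_torus_eq[OF square_integrable_step_sum] by (simp add: fourier_coeff_torus)
qed

text \<open>The derivative of the sum consists of the waves cis ((x - 2 \<pi> n)^2 / (4 t)).
  Multiplying by \<open>char (-k)\<close> completes the square: each wave is shifted by 2 t k at the
  price of the phase cis (- t k^2), since cis (2 \<pi> k n) = 1. The contributions of the translates
  then telescope to one integral over a long interval.\<close>

lemma fourier_coeff_step_sum:
  assumes t: "t > 0" and k: "k \<noteq> 0"
  shows "fourier_coeff (step_sum t N) k = cis (- t * (of_int k)\<^sup>2) / (2 * pi * \<i> * of_int k) *
     (step_evolution t (2 * pi * real N - 2 * t * of_int k) - step_evolution t (- (2 * pi * real N) - 2 * t * of_int k))"
proof -
  define d where "d = step_evolution t (2 * pi * real N) / pi"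
  define I where "I = {-int N+1..int N}"
  \<comment> \<open>An antiderivative of \<open>char (-k) x * D x\<close>; together with one
    integration by parts it yields the antiderivative \<open>q\<close> used further down.\<close>
  define Z where "Z x = (\<Sum>n\<in>I. cis (- t * (of_int k)\<^sup>2) * step_evolution t (x - 2 * pi * of_int n - 2 * t * of_int k))
      - d * (char (-k) x / (- \<i> * of_int k))" for x
  define D where "D x = (\<Sum>n\<in>I. cis ((x - 2 * pi * of_int n)\<^sup>2 / (4 * t))) - d" for x
  have char': "(char (-k) has_vector_derivative (- \<i> * of_int k) * char (-k) x) (at x within S)" for x S
    unfolding has_vector_derivative_def char_def
    by (auto intro!: derivative_eq_intros simp: fun_eq_iff complex_eq_iff)
  have Y': "(step_sum t N has_vector_derivative D x) (at x within S)" for x S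
  proof -
    have "((\<lambda>x. \<Sum>n\<in>I. step_evolution t (x - 2 * pi * of_int n)) has_vector_derivative (\<Sum>n\<in>I. of_real 1 * cis ((x - 2 * pi * of_int n)\<^sup>2 / (4 * t)))) (at x within S)"
      by (intro has_vector_derivative_sum step_evolution_deriv t) (auto intro!: derivative_eq_intros)
    moreover have "((\<lambda>x. d * (of_real x - of_real pi)) has_vector_derivative d * (1 - 0)) (at x within S)"
      by (intro has_vector_derivative_mult_right has_vector_derivative_diff has_vector_derivative_const)
         (auto intro!: derivative_eq_intros simp: has_vector_derivative_def scaleR_conv_of_real)
    ultimately have "((\<lambda>x. (\<Sum>n\<in>I. step_evolution t (x - 2 * pi * of_int n)) - d * (of_real x - of_real pi)) has_vector_derivative
        (\<Sum>n\<in>I. of_real 1 * cis ((x - 2 * pi * of_int n)\<^sup>2 / (4 * t))) - d * (1 - 0)) (at x within S)"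
      by (rule has_vector_derivative_diff)
    then show ?thesis unfolding step_sum_def[abs_def] D_def I_def d_def by simp
  qed
  have Z': "(Z has_vector_derivative char (-k) x * D x) (at x within S)" for x S
  proof -
    have phase: "cis (- t * (of_int k)\<^sup>2) * (of_real 1 * cis ((x - 2 * pi * of_int n - 2 * t * of_int k)\<^sup>2 / (4 * t))) =
       char (-k) x * cis ((x - 2 * pi * of_int n)\<^sup>2 / (4 * t))" for n :: int
    proof -
      have "- t * (of_int k)\<^sup>2 + (x - 2 * pi * of_int n - 2 * t * of_int k)\<^sup>2 / (4 * t) =
        - of_int k * x + (x - 2 * pi * of_int n)\<^sup>2 / (4 * t) + 2 * pi * of_int (k * n)"
        using t by (simp add: field_simps power2_eq_square)
      then have "cis (- t * (of_int k)\<^sup>2) * cis ((x - 2 * pi * of_int n - 2 * t * of_int k)\<^sup>2 / (4 * t)) =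
        cis (- of_int k * x) * cis ((x - 2 * pi * of_int n)\<^sup>2 / (4 * t)) * cis (2 * pi * of_int (k * n))"
        by (simp only: cis_mult)
      then show ?thesis by (simp add: char_def del: of_int_mult)
    qed
    have "((\<lambda>x. \<Sum>n\<in>I. cis (- t * (of_int k)\<^sup>2) * step_evolution t (x - 2 * pi * of_int n - 2 * t * of_int k)) has_vector_derivative
       (\<Sum>n\<in>I. cis (- t * (of_int k)\<^sup>2) * (of_real 1 * cis ((x - 2 * pi * of_int n - 2 * t * of_int k)\<^sup>2 / (4 * t))))) (at x within S)"
      by (intro has_vector_derivative_sum has_vector_derivative_mult_right step_evolution_deriv t) (auto intro!: derivative_eq_intros)
    moreover have "((\<lambda>x. d * (char (-k) x / (- \<i> * of_int k))) has_vector_derivative d * ((- \<i> * of_int k) * char (-k) x / (- \<i> * of_int k))) (at x within S)"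
      by (intro has_vector_derivative_mult_right has_vector_derivative_divide char')
    ultimately have "(Z has_vector_derivative (\<Sum>n\<in>I. cis (- t * (of_int k)\<^sup>2) * (of_real 1 * cis ((x - 2 * pi * of_int n - 2 * t * of_int k)\<^sup>2 / (4 * t))))
        - d * ((- \<i> * of_int k) * char (-k) x / (- \<i> * of_int k))) (at x within S)"
      unfolding Z_def[abs_def] by (rule has_vector_derivative_diff)
    then show ?thesis unfolding phase D_def using k by (simp add: sum_distrib_left right_diff_distrib mult.commute)
  qed
  define q where "q x = char (-k) x / (- \<i> * of_int k) * step_sum t N x + 1 / (\<i> * of_int k) * Z x" for x
  have q': "(q has_vector_derivative char (-k) x * step_sum t N x) (at x within S)" for x S
  proof -
    have "(q has_vector_derivative (char (-k) x / (- \<i> * of_int k) * D x + (- \<i> * of_int k) * char (-k) x / (- \<i> * of_int k) * step_sum t N x)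
        + 1 / (\<i> * of_int k) * (char (-k) x * D x)) (at x within S)"
      unfolding q_def[abs_def]
      by (intro has_vector_derivative_add has_vector_derivative_mult has_vector_derivative_mult_right has_vector_derivative_divide char' Y' Z')
    then show ?thesis using k by simp
  qed
  have hi: "((\<lambda>x. char (-k) x * step_sum t N x) has_integral (q (2*pi) - q 0)) {0..2*pi}"
    by (intro fundamental_theorem_of_calculus q') auto
  have sq: "square_integrable (\<lambda>x. char (-k) x * step_sum t N x)"
    by (intro continuous_square_integrable continuous_intros continuous_step_sum)
  have "(LINT x|torus. char (-k) x * step_sum t N x) = q (2*pi) - q 0"
    by (rule trans[OF integral_torus_eq[OF sq] integral_unique[OF hi]])
  moreover have c: "char (-k) (2*pi) = char (-k) 0" using char_periodic[of "-k" 0] by simp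
  moreover have per: "step_sum t N (2*pi) = step_sum t N 0"
  proof -
    have "(\<Sum>n\<in>I. step_evolution t (2 * pi - 2 * pi * of_int n)) - (\<Sum>n\<in>I. step_evolution t (0 - 2 * pi * of_int n)) =
      (\<Sum>n\<in>I. step_evolution t (- 2 * pi * of_int (n - 1)) - step_evolution t (- 2 * pi * of_int n))"
      unfolding sum_subtractf[symmetric] by (intro sum.cong refl arg_cong2[of _ _ _ _ "(-)"] arg_cong[of _ _ "step_evolution t"]) (auto simp: algebra_simps)
    also have "\<dots> = step_evolution t (- 2 * pi * of_int (- int N)) - step_evolution t (- 2 * pi * of_int (int N))"
      unfolding I_def by (rule sum_int_telescope)
    also have "\<dots> = 2 * step_evolution t (2 * pi * real N)" using step_evolution_minus[of t "2 * pi * real N"] by simp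
    finally show ?thesis unfolding step_sum_def I_def[symmetric] by (simp add: algebra_simps)
  qed
  moreover have "q (2*pi) - q 0 = 1 / (\<i> * of_int k) * (Z (2*pi) - Z 0)"
    unfolding q_def c per by (simp add: right_diff_distrib)
  moreover have "Z (2*pi) - Z 0 = cis (- t * (of_int k)\<^sup>2) *
     (step_evolution t (2 * pi * real N - 2 * t * of_int k) - step_evolution t (- (2 * pi * real N) - 2 * t * of_int k))"
  proof -
    have "(\<Sum>n\<in>I. step_evolution t (2 * pi - 2 * pi * of_int n - 2 * t * of_int k)) - (\<Sum>n\<in>I. step_evolution t (0 - 2 * pi * of_int n - 2 * t * of_int k)) =
      (\<Sum>n\<in>I. step_evolution t (- 2 * pi * of_int (n - 1) - 2 * t * of_int k) - step_evolution t (- 2 * pi * of_int n - 2 * t * of_int k))"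
      unfolding sum_subtractf[symmetric] by (intro sum.cong refl arg_cong2[of _ _ _ _ "(-)"] arg_cong[of _ _ "step_evolution t"]) (auto simp: algebra_simps)
    also have "\<dots> = step_evolution t (- 2 * pi * of_int (- int N) - 2 * t * of_int k) - step_evolution t (- 2 * pi * of_int (int N) - 2 * t * of_int k)"
      unfolding I_def by (rule sum_int_telescope)
    finally have f: "(\<Sum>n\<in>I. step_evolution t (2 * pi - 2 * pi * of_int n - 2 * t * of_int k)) - (\<Sum>n\<in>I. step_evolution t (0 - 2 * pi * of_int n - 2 * t * of_int k)) =
      step_evolution t (2 * pi * real N - 2 * t * of_int k) - step_evolution t (- (2 * pi * real N) - 2 * t * of_int k)" by simp
    have "Z (2*pi) - Z 0 = cis (- t * (of_int k)\<^sup>2) * ((\<Sum>n\<in>I. step_evolution t (2 * pi - 2 * pi * of_int n - 2 * t * of_int k)) - (\<Sum>n\<in>I. step_evolution t (0 - 2 * pi * of_int n - 2 * t * of_int k)))"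
      unfolding Z_def c sum_distrib_left[symmetric] right_diff_distrib by (rule diff_diff_eq_cancel_right)
    then show ?thesis unfolding f .
  qed
  ultimately have "(LINT x|torus. char (-k) x * step_sum t N x) = 1 / (\<i> * of_int k) * (cis (- t * (of_int k)\<^sup>2) *
     (step_evolution t (2 * pi * real N - 2 * t * of_int k) - step_evolution t (- (2 * pi * real N) - 2 * t * of_int k)))"
    by (simp only:)
  then show ?thesis unfolding fourier_coeff_torus by simp
qed

lemma fourier_coeff_cmult: "fourier_coeff (\<lambda>x. c * g x) k = c * fourier_coeff g k"
  by (simp add: fourier_coeff_torus mult.left_commute[of _ c])

text \<open>\<open>free_kernel t g\<close>: \<open>g\<close> is the evolution at time \<open>t\<close> of the sawtooth with coefficients \<open>1 / k\<close>.\<close>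

definition free_kernel :: "real \<Rightarrow> (real \<Rightarrow> complex) \<Rightarrow> bool" where
  "free_kernel t g \<longleftrightarrow> periodic g \<and> bounded (range g) \<and> g \<in> borel_measurable borel \<and>
     (\<forall>k. fourier_coeff g k = (if k = 0 then 0 else cis (- t * (of_int k)\<^sup>2) / of_int k))"

lemma borel_torus: "(g :: real \<Rightarrow> complex) \<in> borel_measurable borel \<Longrightarrow> g \<in> borel_measurable torus"
  by (intro measurable_restrict_space1 measurable_completion) auto

lemma free_kernel_square_integrable:
  assumes "free_kernel t g" shows "square_integrable g"
proof -
  obtain B where "\<forall>x. cmod (g x) \<le> B" using assms unfolding free_kernel_def bounded_iff by auto
  then show ?thesis using assms by (intro bounded_square_integrable[of g B] borel_torus) (auto simp: free_kernel_def)
qed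

text \<open>Each coefficient of \<open>step_sum\<close> converges to the one on the right-hand side,
  and all are O(1/k) uniformly in the number of translates, so \<open>energy_tendsto_0\<close>
  applies.\<close>

lemma step_sum_kernel_AE:
  assumes t: "t > 0" and g: "free_kernel t g" and "strict_mono r0"
  shows "\<exists>r::nat\<Rightarrow>nat. strict_mono r \<and> (AE x in torus. (\<lambda>j. step_sum t (r0 (r j)) x) \<longlonglongrightarrow> step_evolution_lim t / (\<i> * pi) * g x)"
proof -
  define c where "c = step_evolution_lim t / (\<i> * pi)"
  define Y where "Y j x = step_sum t (r0 j) x - c * g x" for j x
  have gs: "square_integrable g" by (rule free_kernel_square_integrable[OF g])
  have Ys: "square_integrable (Y j)" for j
    unfolding Y_def by (intro square_integrable_minus square_integrable_step_sum square_integrable_cmult gs)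
  have fc: "fourier_coeff (Y j) k = fourier_coeff (step_sum t (r0 j)) k - c * fourier_coeff g k" for j k
    unfolding Y_def by (subst fourier_coeff_diff) (auto intro!: square_integrable_step_sum square_integrable_cmult gs simp: fourier_coeff_cmult)
  define e where "e N k = step_evolution t (2 * pi * real N - 2 * t * of_int k) - step_evolution t (- (2 * pi * real N) - 2 * t * of_int k)" for N and k :: int
  have Yk: "fourier_coeff (Y j) k = cis (- t * (of_int k)\<^sup>2) / (2 * pi * \<i> * of_int k) * (e (r0 j) k - 2 * step_evolution_lim t)" if "k \<noteq> 0" for j k
    unfolding fc fourier_coeff_step_sum[OF t that] e_def[symmetric] using g that
    by (simp add: free_kernel_def c_def field_simps)
  have Y0: "fourier_coeff (Y j) 0 = 0" for j
    unfolding fc fourier_coeff_step_sum_0 using g by (simp add: free_kernel_def)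
  have elim: "(\<lambda>N. e N k) \<longlonglongrightarrow> 2 * step_evolution_lim t" for k
  proof -
    have "(\<lambda>N. step_evolution t (2 * pi * real N + (- 2 * t * of_int k)) + step_evolution t (2 * pi * real N + 2 * t * of_int k)) \<longlonglongrightarrow> step_evolution_lim t + step_evolution_lim t"
      by (intro tendsto_add step_evolution_tendsto t)
    moreover have "e N k = step_evolution t (2 * pi * real N + (- 2 * t * of_int k)) + step_evolution t (2 * pi * real N + 2 * t * of_int k)" for N
    proof -
      have "- (2 * pi * real N) - 2 * t * of_int k = - (2 * pi * real N + 2 * t * of_int k)" by simp
      then show ?thesis unfolding e_def by (simp only: step_evolution_minus) simp
    qed
    ultimately show ?thesis by simp
  qed
  have "(\<lambda>j. energy (Y j)) \<longlonglongrightarrow> 0"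
  proof (rule energy_tendsto_0[where b="\<lambda>k. ((8 * sqrt t + 2 * cmod (step_evolution_lim t)) / of_int k)\<^sup>2"])
    show "(\<lambda>j. fourier_coeff (Y j) k) \<longlonglongrightarrow> 0" for k
    proof (cases "k = 0")
      case False
      have "(\<lambda>j. e (r0 j) k) \<longlonglongrightarrow> 2 * step_evolution_lim t"
        using LIMSEQ_subseq_LIMSEQ[OF elim assms(3)] by (simp add: o_def)
      then have "(\<lambda>j. cis (- t * (of_int k)\<^sup>2) / (2 * pi * \<i> * of_int k) * (e (r0 j) k - 2 * step_evolution_lim t))
        \<longlonglongrightarrow> cis (- t * (of_int k)\<^sup>2) / (2 * pi * \<i> * of_int k) * (2 * step_evolution_lim t - 2 * step_evolution_lim t)"
        by (intro tendsto_mult tendsto_const tendsto_diff)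
      then show ?thesis using Yk[OF False] by simp
    qed (simp add: Y0)
    show "(cmod (fourier_coeff (Y j) k))\<^sup>2 \<le> ((8 * sqrt t + 2 * cmod (step_evolution_lim t)) / of_int k)\<^sup>2" for j k
    proof (cases "k = 0")
      case False
      have "cmod (e (r0 j) k - 2 * step_evolution_lim t) \<le> cmod (e (r0 j) k) + cmod (2 * step_evolution_lim t)" by (rule norm_triangle_ineq4)
      moreover have "cmod (e (r0 j) k) \<le> 4 * sqrt t + 4 * sqrt t"
        unfolding e_def using t by (intro order.trans[OF norm_triangle_ineq4] add_mono norm_step_evolution_le) auto
      ultimately have "cmod (e (r0 j) k - 2 * step_evolution_lim t) \<le> 8 * sqrt t + 2 * cmod (step_evolution_lim t)" by (simp add: norm_mult)
      moreover have "1 \<le> 2 * pi" using pi_gt3 by simp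
      ultimately have "cmod (e (r0 j) k - 2 * step_evolution_lim t) / (2 * pi) \<le> (8 * sqrt t + 2 * cmod (step_evolution_lim t)) / 1"
        using t by (intro frac_le) auto
      then have "cmod (e (r0 j) k - 2 * step_evolution_lim t) / (2 * pi) / \<bar>of_int k\<bar> \<le> (8 * sqrt t + 2 * cmod (step_evolution_lim t)) / \<bar>of_int k\<bar>"
        by (intro divide_right_mono) auto
      then have "cmod (fourier_coeff (Y j) k) \<le> (8 * sqrt t + 2 * cmod (step_evolution_lim t)) / \<bar>of_int k\<bar>"
        unfolding Yk[OF False] by (simp add: norm_mult norm_divide)
      then have "(cmod (fourier_coeff (Y j) k))\<^sup>2 \<le> ((8 * sqrt t + 2 * cmod (step_evolution_lim t)) / \<bar>of_int k\<bar>)\<^sup>2"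
        by (intro power_mono) auto
      then show ?thesis by (simp add: power_divide)
    qed (simp add: Y0)
  qed (intro Ys inverse_square_summable)+
  from energy_AE_subseq[OF Ys this] obtain r :: "nat \<Rightarrow> nat" where r: "strict_mono r" "AE x in torus. (\<lambda>n. Y (r n) x) \<longlonglongrightarrow> 0" by blast
  from r(2) have "AE x in torus. (\<lambda>j. step_sum t (r0 (r j)) x) \<longlonglongrightarrow> c * g x"
    by eventually_elim (simp add: Y_def LIM_zero_iff)
  with r(1) show ?thesis unfolding c_def by blast
qed

text \<open>\<open>step_sum\<close> is not periodic, but its defect is a combination of values of
  the step evolution far out whose limits cancel. Convergence almost everywhere on one period
  therefore spreads to the line.\<close>

lemma step_sum_shift_tendsto:
  assumes t: "t > 0"
  shows "(\<lambda>N. step_sum t N (x + 2 * pi) - step_sum t N x) \<longlonglongrightarrow> 0"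
proof -
  have "step_sum t N (x + 2 * pi) - step_sum t N x = step_evolution t (2 * pi * real N + x) + step_evolution t (2 * pi * real N + (- x))
    - 2 * step_evolution t (2 * pi * real N + 0)" for N
  proof -
    have "(\<Sum>n\<in>{-int N+1..int N}. step_evolution t (x + 2 * pi - 2 * pi * of_int n)) - (\<Sum>n\<in>{-int N+1..int N}. step_evolution t (x - 2 * pi * of_int n)) =
      (\<Sum>n\<in>{-int N+1..int N}. step_evolution t (x - 2 * pi * of_int (n - 1)) - step_evolution t (x - 2 * pi * of_int n))"
      unfolding sum_subtractf[symmetric] by (intro sum.cong refl) (simp add: algebra_simps)
    also have "\<dots> = step_evolution t (x - 2 * pi * of_int (- int N)) - step_evolution t (x - 2 * pi * of_int (int N))"
      by (rule sum_int_telescope)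
    also have "\<dots> = step_evolution t (2 * pi * real N + x) + step_evolution t (2 * pi * real N + (- x))"
      using step_evolution_minus[of t "2 * pi * real N - x"] by (simp add: add.commute)
    finally show ?thesis unfolding step_sum_def by (simp add: field_simps)
  qed
  moreover have "(\<lambda>N. step_evolution t (2 * pi * real N + x) + step_evolution t (2 * pi * real N + (- x))
    - 2 * step_evolution t (2 * pi * real N + 0)) \<longlonglongrightarrow> step_evolution_lim t + step_evolution_lim t - 2 * step_evolution_lim t"
    by (intro tendsto_intros step_evolution_tendsto t)
  ultimately show ?thesis by simp
qed

lemma step_sum_kernel_AE_lebesgue:
  assumes t: "t > 0" and g: "free_kernel t g" and "strict_mono r0"
  shows "\<exists>r::nat\<Rightarrow>nat. strict_mono r \<and> (AE x in lebesgue. (\<lambda>j. step_sum t (r0 (r j)) x) \<longlonglongrightarrow> step_evolution_lim t / (\<i> * pi) * g x)"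
proof -
  obtain r :: "nat \<Rightarrow> nat" where r: "strict_mono r" "AE x in torus. (\<lambda>j. step_sum t (r0 (r j)) x) \<longlonglongrightarrow> step_evolution_lim t / (\<i> * pi) * g x"
    using step_sum_kernel_AE[OF assms] by blast
  have "AE x in lebesgue. (\<lambda>j. step_sum t (r0 (r j)) x) \<longlonglongrightarrow> step_evolution_lim t / (\<i> * pi) * g x"
  proof (rule AE_torus_periodic[OF r(2)])
    fix x
    have per: "g (x + 2 * pi) = g x" using g by (simp add: free_kernel_def periodic_def)
    have sm: "strict_mono (\<lambda>j. r0 (r j))" using assms(3) r(1) by (auto simp: strict_mono_def)
    have d: "(\<lambda>j. step_sum t (r0 (r j)) (x + 2 * pi) - step_sum t (r0 (r j)) x) \<longlonglongrightarrow> 0"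
      using LIMSEQ_subseq_LIMSEQ[OF step_sum_shift_tendsto[OF t] sm] by (simp add: o_def)
    show "((\<lambda>j. step_sum t (r0 (r j)) (x + 2 * pi)) \<longlonglongrightarrow> step_evolution_lim t / (\<i> * pi) * g (x + 2 * pi)) =
      ((\<lambda>j. step_sum t (r0 (r j)) x) \<longlonglongrightarrow> step_evolution_lim t / (\<i> * pi) * g x)" (is "?A = ?B")
    proof
      assume ?A from tendsto_diff[OF this d] show ?B by (simp add: per)
    next
      assume ?B from tendsto_add[OF this d] show ?A by (simp add: per)
    qed
  qed
  then show ?thesis using r(1) by blast
qed

text \<open>The scaling is meant for \<open>c = - pi / t\<close>, which gives the point where the
  dual kernel is evaluated. Starting from an arbitrary \<open>r0\<close> allows a subsequence common
  with that of \<open>step_sum\<close>.\<close>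

lemma kernel_partial_fourier_AE:
  assumes g: "free_kernel t g" and c: "c \<noteq> 0" and "strict_mono r0"
  shows "\<exists>r::nat\<Rightarrow>nat. strict_mono r \<and> (AE x in lebesgue. (\<lambda>j. partial_fourier (r0 (r j)) g (c * x)) \<longlonglongrightarrow> g (c * x))"
proof -
  have gs: "square_integrable g" by (rule free_kernel_square_integrable[OF g])
  define Y where "Y j x = g x - partial_fourier (r0 j) g x" for j x
  have Ys: "square_integrable (Y j)" for j unfolding Y_def by (intro square_integrable_minus gs square_integrable_partial_fourier)
  have "(\<lambda>j. energy (Y j)) \<longlonglongrightarrow> 0" unfolding Y_def
    using LIMSEQ_subseq_LIMSEQ[OF fourier_series_L2[OF gs] assms(3)] by (simp add: o_def)
  from energy_AE_subseq[OF Ys this] obtain r :: "nat \<Rightarrow> nat" where r: "strict_mono r" "AE x in torus. (\<lambda>n. Y (r n) x) \<longlonglongrightarrow> 0" by blast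
  have "AE x in lebesgue. (\<lambda>n. Y (r n) x) \<longlonglongrightarrow> 0"
  proof (rule AE_torus_periodic[OF r(2)])
    fix x
    have "Y j (x + 2 * pi) = Y j x" for j
      using g by (simp add: Y_def partial_fourier_def char_periodic free_kernel_def periodic_def)
    then show "((\<lambda>n. Y (r n) (x + 2 * pi)) \<longlonglongrightarrow> 0) = ((\<lambda>n. Y (r n) x) \<longlonglongrightarrow> 0)" by simp
  qed
  from AE_lebesgue_affine[OF this c, of 0] have "AE x in lebesgue. (\<lambda>n. Y (r n) (c * x)) \<longlonglongrightarrow> 0" by simp
  then have "AE x in lebesgue. (\<lambda>j. partial_fourier (r0 (r j)) g (c * x)) \<longlonglongrightarrow> g (c * x)"
  proof eventually_elim
    case (elim x)
    from tendsto_diff[OF tendsto_const[of "g (c * x)"] elim] show ?case by (simp add: Y_def)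
  qed
  then show ?thesis using r(1) by blast
qed

definition step_remainder :: "real \<Rightarrow> nat \<Rightarrow> real \<Rightarrow> complex" where
  "step_remainder t n x = step_evolution t (2 * pi * real n + x) - step_evolution t (2 * pi * real n)
    - 2 * of_real t / \<i> * (cis ((2 * pi * real n + x)\<^sup>2 / (4 * t)) - cis ((2 * pi * real n)\<^sup>2 / (4 * t))) / (2 * pi * real n)"

lemma step_evolution_asymptotic:
  assumes t: "t > 0" and ab: "0 < a" "0 < b"
  shows "cmod (step_evolution t b - step_evolution t a - 2 * of_real t / \<i> * (cis (b\<^sup>2 / (4 * t)) / b - cis (a\<^sup>2 / (4 * t)) / a)) \<le> 2 * t * \<bar>1 / a - 1 / b\<bar>"
proof -
  have *: "cmod (step_evolution t b - step_evolution t a - 2 * of_real t / \<i> * (cis (b\<^sup>2 / (4 * t)) / b - cis (a\<^sup>2 / (4 * t)) / a)) \<le> 2 * t * \<bar>1 / a - 1 / b\<bar>"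
    if ab: "0 < a" "a \<le> b" for a b
  proof -
    define z where "z = 2 * sqrt t"
    have z: "z > 0" "z * z = 4 * t" using t by (simp_all add: z_def)
    have zc: "complex_of_real z * complex_of_real z = 4 * complex_of_real t" unfolding of_real_mult[symmetric] z(2) by simp
    have b: "b > 0" using ab by simp
    define D where "D = fresnel (b / z) - fresnel (a / z) - (cis ((b / z)\<^sup>2) / (2 * \<i> * (b / z)) - cis ((a / z)\<^sup>2) / (2 * \<i> * (a / z)))"
    have "cmod D \<le> 1 / (2 * (a / z)) - 1 / (2 * (b / z))"
      unfolding D_def using ab z by (intro fresnel_asymptotic) (auto simp: divide_right_mono)
    then have "z * cmod D \<le> z * (1 / (2 * (a / z)) - 1 / (2 * (b / z)))" using z by (intro mult_left_mono) auto
    also have "\<dots> = z * z / 2 * (1 / a - 1 / b)" using z ab b by (simp add: field_simps)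
    also have "\<dots> = 2 * t * (1 / a - 1 / b)" unfolding z by simp
    also have "\<dots> \<le> 2 * t * \<bar>1 / a - 1 / b\<bar>" using t by (intro mult_left_mono) auto
    finally have 1: "cmod (of_real z * D) \<le> 2 * t * \<bar>1 / a - 1 / b\<bar>" using z by (simp add: norm_mult)
    have sq: "(y / z)\<^sup>2 = y\<^sup>2 / (4 * t)" for y using z(2) by (simp add: power2_eq_square)
    have "of_real z * (w / (2 * \<i> * (y / z))) = 2 * of_real t / \<i> * (w / y)" if "y > 0" for w :: complex and y :: real
    proof -
      have "of_real z * (w / (2 * \<i> * (y / z))) = (of_real z * of_real z) * w / (2 * \<i> * y)" using z(1) by simp
      also have "\<dots> = 2 * of_real t / \<i> * (w / y)" unfolding zc using that by (simp add: field_simps)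
      finally show ?thesis .
    qed
    then have "of_real z * D = step_evolution t b - step_evolution t a - 2 * of_real t / \<i> * (cis (b\<^sup>2 / (4 * t)) / b - cis (a\<^sup>2 / (4 * t)) / a)"
      unfolding D_def sq step_evolution_def z_def[symmetric] right_diff_distrib using ab b by (simp add: z_def)
    then show ?thesis using 1 by simp
  qed
  show ?thesis
  proof (cases "a \<le> b")
    case True
    then show ?thesis using *[of a b] ab by simp
  next
    case False
    have "step_evolution t b - step_evolution t a - 2 * of_real t / \<i> * (cis (b\<^sup>2 / (4 * t)) / b - cis (a\<^sup>2 / (4 * t)) / a) =
      - (step_evolution t a - step_evolution t b - 2 * of_real t / \<i> * (cis (a\<^sup>2 / (4 * t)) / a - cis (b\<^sup>2 / (4 * t)) / b))"
      by (simp add: right_diff_distrib)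
    then show ?thesis using *[of b a] ab False by (simp only: norm_minus_cancel abs_minus_commute)
  qed
qed

text \<open>The window for \<open>x\<close> keeps \<open>2 * pi * n + x\<close> above
  \<open>pi * n / 2\<close>. It is wider than [-\<pi>, \<pi>], so that two nearby points can later
  be treated together.\<close>

lemma norm_step_remainder_le:
  assumes t: "t > 0" and x: "\<bar>x\<bar> \<le> 3 * pi / 2" and n: "n > 0"
  shows "cmod (step_remainder t n x) \<le> 2 * t / (real n)\<^sup>2"
proof -
  define a where "a = 2 * pi * real n"
  define b where "b = a + x"
  have n1: "real n \<ge> 1" using n by simp
  then have pn: "pi \<le> pi * real n" by simp
  have a: "a > 0" using n1 by (simp add: a_def)
  have "b \<ge> 2 * pi * real n - 3 * pi / 2" using x unfolding b_def a_def by linarith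
  then have bn: "b \<ge> pi * real n / 2" using pn by linarith
  have b: "b > 0" using bn n1 by (smt (verit) pi_gt_zero mult_pos_pos half_gt_zero)
  have d: "\<bar>1 / a - 1 / b\<bar> \<le> (1 / 2) / (real n)\<^sup>2"
  proof -
    have "1 / a - 1 / b = (b - a) / (a * b)" using a b by (simp add: field_simps)
    then have "\<bar>1 / a - 1 / b\<bar> = \<bar>x\<bar> / (a * b)" using a b by (simp add: b_def)
    also have "\<dots> \<le> (3 * pi / 2) / (a * (pi * real n / 2))"
      using x a bn n1 by (intro frac_le mult_left_mono mult_pos_pos) auto
    also have "\<dots> = (3 / (2 * pi)) / (real n)\<^sup>2" by (simp add: a_def power2_eq_square)
    also have "\<dots> \<le> (1 / 2) / (real n)\<^sup>2" using pi_gt3 by (intro divide_right_mono) (auto simp: field_simps)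
    finally show ?thesis .
  qed
  have "step_remainder t n x = (step_evolution t b - step_evolution t a - 2 * of_real t / \<i> * (cis (b\<^sup>2 / (4 * t)) / b - cis (a\<^sup>2 / (4 * t)) / a))
     - 2 * of_real t / \<i> * cis (b\<^sup>2 / (4 * t)) * (1 / a - 1 / b)"
    unfolding step_remainder_def a_def[symmetric] b_def[symmetric] using a b by (simp add: field_simps)
  then have "cmod (step_remainder t n x) \<le> 2 * t * \<bar>1 / a - 1 / b\<bar> + cmod (2 * of_real t / \<i> * cis (b\<^sup>2 / (4 * t)) * (1 / a - 1 / b))"
    using order.trans[OF norm_triangle_ineq4 add_right_mono[OF step_evolution_asymptotic[OF t a b]]] by (simp only:)
  also have "cmod (2 * of_real t / \<i> * cis (b\<^sup>2 / (4 * t)) * (1 / a - 1 / b)) = 2 * t * \<bar>1 / a - 1 / b\<bar>"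
  proof -
    have "cmod (complex_of_real (1 / a - 1 / b)) = \<bar>1 / a - 1 / b\<bar>" by (rule norm_of_real)
    then show ?thesis using t by (simp add: norm_mult norm_divide)
  qed
  also have "2 * t * \<bar>1 / a - 1 / b\<bar> + 2 * t * \<bar>1 / a - 1 / b\<bar> \<le> 2 * t * ((1 / 2) / (real n)\<^sup>2) + 2 * t * ((1 / 2) / (real n)\<^sup>2)"
    using d t by (intro add_mono mult_left_mono) auto
  finally show ?thesis by simp
qed

text \<open>The part of the evolved sawtooth that is jointly continuous for t > 0. The term
  \<open>- \<i> * x\<close> is what remains, in the limit, of the linear correction in
  \<open>step_sum\<close> and of the unpaired translate.\<close>

definition kernel_regular :: "real \<Rightarrow> real \<Rightarrow> complex" where
  "kernel_regular t x = \<i> * pi / step_evolution_lim t *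
     (step_evolution t x + (\<Sum>m. step_remainder t (Suc m) x - step_remainder t (Suc m) (- x))) - \<i> * x"

lemma norm_remainder_pair_le:
  assumes t: "t > 0" and x: "\<bar>x\<bar> \<le> 3 * pi / 2"
  shows "cmod (step_remainder t (Suc m) x - step_remainder t (Suc m) (- x)) \<le> 4 * t * (1 / (real (Suc m))\<^sup>2)"
  using order.trans[OF norm_triangle_ineq4 add_mono[OF norm_step_remainder_le[OF t x, of "Suc m"] norm_step_remainder_le[OF t, of "-x" "Suc m"]]] x
  by simp

lemma summable_inverse_squares_Suc: "summable (\<lambda>m. C * (1 / (real (Suc m))\<^sup>2))"
  using inverse_squares_sums by (intro summable_mult) (auto simp: sums_iff)

lemma remainder_summable:
  assumes "t > 0" "\<bar>x\<bar> \<le> 3 * pi / 2"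
  shows "summable (\<lambda>m. step_remainder t (Suc m) x - step_remainder t (Suc m) (- x))"
  by (rule summable_comparison_test'[OF summable_inverse_squares_Suc norm_remainder_pair_le[OF assms]])

text \<open>By oddness the translates by m and - m combine to increments of the step evolution at 2
  \<pi> m. In their leading terms (2 \<pi> m + x)^2 / (4 t) = x^2 / (4 t) + \<pi>^2 m^2 / t + \<pi>
  m x / t, so these terms are the modes m and - m of the kernel at time - \<pi>^2 / t, taken at the
  point - \<pi> x / t. This plays the role of Poisson summation.\<close>

lemma step_sum_decomposition:
  assumes t: "t > 0" and gs: "free_kernel (- (pi\<^sup>2 / t)) g"
  shows "step_sum t N x = step_evolution t x + (\<Sum>m<N. step_remainder t (Suc m) x - step_remainder t (Suc m) (- x))
     - t / (\<i> * pi) * cis (x\<^sup>2 / (4 * t)) * partial_fourier N g (- pi / t * x)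
     - step_evolution t (2 * pi * real N + x) - step_evolution t (2 * pi * real N) / pi * (x - pi)"
proof -
  define E where "E = step_evolution t"
  define w where "w = - (t / (\<i> * pi)) * cis (x\<^sup>2 / (4 * t))"
  define G where "G n = E (x - 2 * pi * of_int n)" for n :: int
  define F where "F k = fourier_coeff g k * char k (- pi / t * x)" for k :: int
  \<comment> \<open>The range of \<open>step_sum\<close> is completed by the translate
    \<open>- int N\<close>, so that all translates except 0 pair up.\<close>
  have "G 0 + (\<Sum>m<N. G (int (Suc m)) + G (- int (Suc m))) = (\<Sum>n\<in>{-int N..int N}. G n)"
    by (rule sum_int_symmetric[symmetric])
  also have "{-int N..int N} = insert (- int N) {-int N+1..int N}" by auto
  also have "(\<Sum>n\<in>insert (- int N) {-int N+1..int N}. G n) = G (- int N) + (\<Sum>n\<in>{-int N+1..int N}. G n)" by simp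
  finally have 1: "(\<Sum>n\<in>{-int N+1..int N}. G n) = G 0 + (\<Sum>m<N. G (int (Suc m)) + G (- int (Suc m))) - G (- int N)" by simp
  have pair: "G (int (Suc m)) + G (- int (Suc m)) = (step_remainder t (Suc m) x - step_remainder t (Suc m) (- x)) + w * (F (int (Suc m)) + F (- int (Suc m)))" for m
  proof -
    define n where "n = real (Suc m)"
    have n: "n > 0" "n \<noteq> 0" by (simp_all add: n_def)
    have ph: "cis ((2 * pi * n + y)\<^sup>2 / (4 * t)) = cis (y\<^sup>2 / (4 * t)) * cis (pi\<^sup>2 / t * n\<^sup>2) * cis (pi / t * n * y)" for y
    proof -
      have "(2 * pi * n + y)\<^sup>2 / (4 * t) = y\<^sup>2 / (4 * t) + pi\<^sup>2 / t * n\<^sup>2 + pi / t * n * y"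
        using t by (simp add: field_simps power2_eq_square)
      then show ?thesis by (simp only: cis_mult)
    qed
    have F1: "F (int (Suc m)) = cis (pi\<^sup>2 / t * n\<^sup>2) / n * cis (- (pi / t * n * x))"
      using gs by (simp add: F_def free_kernel_def char_def n_def mult_ac)
    have F2: "F (- int (Suc m)) = - (cis (pi\<^sup>2 / t * n\<^sup>2) / n * cis (pi / t * n * x))"
    proof -
      have "F (- int (Suc m)) = cis (- (- (pi\<^sup>2 / t)) * (of_int (- int (Suc m)))\<^sup>2) / of_int (- int (Suc m)) * char (- int (Suc m)) (- pi / t * x)"
        using gs by (simp add: F_def free_kernel_def)
      moreover have "of_int (- int (Suc m)) = - n" by (simp add: n_def)
      moreover have "complex_of_int (- int (Suc m)) = - of_real n" by (simp add: n_def)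
      ultimately have "F (- int (Suc m)) = cis (pi\<^sup>2 / t * n\<^sup>2) / (- of_real n) * cis (- n * (- pi / t * x))"
        unfolding char_def by (simp only:) simp
      then show ?thesis by (simp add: mult_ac)
    qed
    have r: "step_remainder t (Suc m) y = E (2 * pi * n + y) - E (2 * pi * n) - 2 * of_real t / \<i> * (cis (y\<^sup>2 / (4 * t)) * cis (pi\<^sup>2 / t * n\<^sup>2) * cis (pi / t * n * y) - cis ((2 * pi * n)\<^sup>2 / (4 * t))) / (2 * pi * n)" for y
      unfolding step_remainder_def n_def[symmetric] E_def ph ..
    have G1: "G (int (Suc m)) = - E (2 * pi * n + (- x))"
    proof -
      have "x - 2 * pi * of_int (int (Suc m)) = - (2 * pi * n + (- x))" by (simp add: n_def)
      then show ?thesis unfolding G_def E_def by (simp only: step_evolution_minus)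
    qed
    have G2: "G (- int (Suc m)) = E (2 * pi * n + x)" unfolding G_def by (rule arg_cong[of _ _ E]) (simp add: n_def algebra_simps)
    show ?thesis unfolding G1 G2 F1 F2 r w_def using n
      by (simp add: field_simps power2_eq_square)
  qed
  have "partial_fourier N g (- pi / t * x) = (\<Sum>m<N. F (int (Suc m)) + F (- int (Suc m)))"
    unfolding partial_fourier_def F_def[symmetric] sum_int_symmetric using gs by (simp add: F_def free_kernel_def)
  moreover have "(\<Sum>m<N. R m + w * Q m) = (\<Sum>m<N. R m) + w * (\<Sum>m<N. Q m)" for R Q :: "nat \<Rightarrow> complex"
    by (simp only: sum.distrib sum_distrib_left)
  ultimately have "(\<Sum>m<N. G (int (Suc m)) + G (- int (Suc m))) = (\<Sum>m<N. step_remainder t (Suc m) x - step_remainder t (Suc m) (- x)) + w * partial_fourier N g (- pi / t * x)"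
    by (simp only: pair)
  moreover have "G 0 = step_evolution t x" "G (- int N) = step_evolution t (2 * pi * real N + x)" by (simp_all add: G_def E_def add.commute)
  ultimately show ?thesis unfolding step_sum_def using 1 by (simp add: G_def E_def w_def)
qed

text \<open>The decomposition of \<open>step_sum\<close> is passed to the limit along one
  subsequence on which both \<open>step_sum\<close> and the partial sums of the dual kernel converge
  almost everywhere.\<close>

theorem kernel_functional_equation:
  assumes t: "t > 0" and g: "free_kernel t g" and h: "free_kernel (- (pi\<^sup>2 / t)) h"
  shows "AE x in lebesgue. \<bar>x\<bar> \<le> 3 * pi / 2 \<longrightarrow>
     g x = kernel_regular t x - t / step_evolution_lim t * cis (x\<^sup>2 / (4 * t)) * h (- pi / t * x)"
proof -
  obtain r1 :: "nat \<Rightarrow> nat" where r1: "strict_mono r1" "AE x in lebesgue. (\<lambda>j. step_sum t (id (r1 j)) x) \<longlonglongrightarrow> step_evolution_lim t / (\<i> * pi) * g x"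
    using step_sum_kernel_AE_lebesgue[OF t g, of id] by (auto simp: strict_mono_def)
  have c: "- pi / t \<noteq> 0" using t by simp
  obtain r2 :: "nat \<Rightarrow> nat" where r2: "strict_mono r2" "AE x in lebesgue. (\<lambda>j. partial_fourier (r1 (r2 j)) h (- pi / t * x)) \<longlonglongrightarrow> h (- pi / t * x)"
    using kernel_partial_fourier_AE[OF h c r1(1)] by blast
  define r where "r = (\<lambda>j. r1 (r2 j))"
  have r: "strict_mono r" unfolding r_def using r1(1) r2(1) by (auto simp: strict_mono_def)
  show ?thesis using r1(2) r2(2)
  proof eventually_elim
    case (elim x)
    show ?case
    proof
      assume x: "\<bar>x\<bar> \<le> 3 * pi / 2"
      define fl where "fl = step_evolution_lim t"
      define S where "S = (\<Sum>m. step_remainder t (Suc m) x - step_remainder t (Suc m) (- x))"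
      have fl: "fl \<noteq> 0" unfolding fl_def by (rule step_evolution_lim_nz[OF t])
      have 1: "(\<lambda>j. step_sum t (r j) x) \<longlonglongrightarrow> fl / (\<i> * pi) * g x"
        unfolding fl_def r_def using LIMSEQ_subseq_LIMSEQ[OF elim(1) r2(1)] by (simp add: o_def)
      have S: "(\<lambda>N. \<Sum>m<N. step_remainder t (Suc m) x - step_remainder t (Suc m) (- x)) \<longlonglongrightarrow> S"
        unfolding S_def by (rule summable_LIMSEQ[OF remainder_summable[OF t x]])
      have "(\<lambda>j. step_evolution t x + (\<Sum>m<r j. step_remainder t (Suc m) x - step_remainder t (Suc m) (- x))
         - t / (\<i> * pi) * cis (x\<^sup>2 / (4 * t)) * partial_fourier (r j) h (- pi / t * x)
         - step_evolution t (2 * pi * real (r j) + x) - step_evolution t (2 * pi * real (r j)) / pi * (x - pi))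
         \<longlonglongrightarrow> step_evolution t x + S - t / (\<i> * pi) * cis (x\<^sup>2 / (4 * t)) * h (- pi / t * x) - fl - fl / pi * (x - pi)"
      proof (intro tendsto_diff tendsto_add tendsto_mult tendsto_const tendsto_divide)
        show "(\<lambda>j. \<Sum>m<r j. step_remainder t (Suc m) x - step_remainder t (Suc m) (- x)) \<longlonglongrightarrow> S"
          using LIMSEQ_subseq_LIMSEQ[OF S r] by (simp add: o_def)
        show "(\<lambda>j. partial_fourier (r j) h (- pi / t * x)) \<longlonglongrightarrow> h (- pi / t * x)" using elim(2) unfolding r_def .
        show "(\<lambda>j. step_evolution t (2 * pi * real (r j) + x)) \<longlonglongrightarrow> fl"
          unfolding fl_def using LIMSEQ_subseq_LIMSEQ[OF step_evolution_tendsto[OF t, of x] r] by (simp add: o_def)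
        show "(\<lambda>j. step_evolution t (2 * pi * real (r j))) \<longlonglongrightarrow> fl"
          unfolding fl_def using LIMSEQ_subseq_LIMSEQ[OF step_evolution_tendsto[OF t, of 0] r] by (simp add: o_def)
      qed auto
      then have "(\<lambda>j. step_sum t (r j) x) \<longlonglongrightarrow> step_evolution t x + S - t / (\<i> * pi) * cis (x\<^sup>2 / (4 * t)) * h (- pi / t * x) - fl - fl / pi * (x - pi)"
        unfolding step_sum_decomposition[OF t h, symmetric] .
      from LIMSEQ_unique[OF 1 this]
      have "fl / (\<i> * pi) * g x = step_evolution t x + S - t / (\<i> * pi) * cis (x\<^sup>2 / (4 * t)) * h (- pi / t * x) - fl / pi * x"
        by (simp add: field_simps)
      moreover have "g x = \<i> * pi / fl * (fl / (\<i> * pi) * g x)" using fl by simp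
      ultimately have "g x = \<i> * pi / fl * (step_evolution t x + S - t / (\<i> * pi) * cis (x\<^sup>2 / (4 * t)) * h (- pi / t * x) - fl / pi * x)"
        by (simp only:)
      also have "\<dots> = \<i> * pi / fl * (step_evolution t x + S) - \<i> * x - t / fl * cis (x\<^sup>2 / (4 * t)) * h (- pi / t * x)"
        using fl by (simp add: field_simps)
      finally show "g x = kernel_regular t x - t / step_evolution_lim t * cis (x\<^sup>2 / (4 * t)) * h (- pi / t * x)"
        unfolding kernel_regular_def S_def[symmetric] fl_def[symmetric] .
    qed
  qed
qed

section \<open>Bounded periodic functions and the symmetries of the kernel\<close>

lemma periodic_int:
  assumes "periodic g" shows "g (x + 2 * pi * of_int m) = g x"
proof -
  have 1: "g (x + 2*pi * real n) = g x" for x n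
  proof (induction n)
    case (Suc n)
    have "x + 2*pi * real (Suc n) = (x + 2*pi * real n) + 2 * pi" by (simp add: algebra_simps)
    then show ?case using assms Suc by (simp only: periodic_def)
  qed simp
  show ?thesis
  proof (cases "m \<ge> 0")
    case True
    then show ?thesis using 1[of x "nat m"] by simp
  next
    case False
    then show ?thesis using 1[of "x + 2*pi * of_int m" "nat (-m)"] by simp
  qed
qed

lemma bounded_borel_integrable_on:
  fixes g :: "real \<Rightarrow> complex"
  assumes "g \<in> borel_measurable borel" "bounded (range g)"
  shows "integrable (lebesgue_on {a..b}) g"
proof -
  obtain B where B: "\<And>x. cmod (g x) \<le> B" using assms(2) unfolding bounded_iff by auto
  have "finite_measure (lebesgue_on {a..b})"
    by (intro finite_measureI) (simp add: emeasure_restrict_space space_restrict_space emeasure_lborel_Icc_eq)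
  then show ?thesis
    by (rule finite_measure.integrable_const_bound[of _ _ B])
       (use assms B in \<open>auto intro!: measurable_restrict_space1 measurable_completion\<close>)
qed

lemma integral_periodic_shift:
  assumes per: "periodic g" and g: "g \<in> borel_measurable borel" "bounded (range g)"
  shows "(LINT x|torus. g (x + c)) = (LINT x|torus. g x)"
proof -
  have int: "g integrable_on {a..b}" for a b
    by (intro integrable_on_lebesgue_on bounded_borel_integrable_on g) auto
  obtain m :: int where m: "c + 2 * pi * of_int m \<in> {0..<2*pi}" using real_mod_2pi by blast
  define d where "d = c + 2 * pi * of_int m"
  have d: "0 \<le> d" "d < 2*pi" using m by (auto simp: d_def)
  have gd: "g (x + c) = g (x + d)" for x
    using periodic_int[OF per, of "x + c" m] by (simp add: d_def add.assoc)
  have s: "(\<lambda>x. g (x + d)) \<in> borel_measurable borel" "bounded (range (\<lambda>x. g (x + d)))"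
    using g by (auto intro: bounded_subset)
  have "(LINT x|torus. g (x + c)) = integral {0..2*pi} (\<lambda>x. g (x + d))"
    unfolding gd by (intro lebesgue_integral_eq_integral bounded_borel_integrable_on s) auto
  also have "\<dots> = integral {d..2*pi+d} g"
    using integral_shift_real_ivl[of d d "2*pi+d" g] by simp
  also have "\<dots> = integral {d..2*pi} g + integral {2*pi..2*pi+d} g"
    by (intro Henstock_Kurzweil_Integration.integral_combine[symmetric] int) (use d in auto)
  also have "integral {2*pi..2*pi+d} g = integral {0..d} (\<lambda>x. g (x + 2*pi))"
    using integral_shift_real_ivl[of "2*pi" "2*pi" "2*pi+d" g] by simp
  also have "\<dots> = integral {0..d} g" using per by (simp add: periodic_def)
  also have "integral {d..2*pi} g + integral {0..d} g = integral {0..2*pi} g"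
    using Henstock_Kurzweil_Integration.integral_combine[of 0 d "2*pi" g] int d by (simp add: add.commute)
  also have "\<dots> = (LINT x|torus. g x)"
    by (intro lebesgue_integral_eq_integral[symmetric] bounded_borel_integrable_on g) auto
  finally show ?thesis .
qed

text \<open>Actual functions rather than classes, since at rational times translates, finite sums
  and values at points are formed.\<close>

definition bounded_periodic :: "(real \<Rightarrow> complex) \<Rightarrow> bool" where
  "bounded_periodic g \<longleftrightarrow> periodic g \<and> bounded (range g) \<and> g \<in> borel_measurable borel"

lemma bounded_periodic_square_integrable:
  assumes "bounded_periodic g" shows "square_integrable g"
proof -
  obtain B where "\<forall>x. cmod (g x) \<le> B" using assms unfolding bounded_periodic_def bounded_iff by auto
  then show ?thesis using assms by (intro bounded_square_integrable[of g B] borel_torus) (auto simp: bounded_periodic_def)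
qed

lemma free_kernel_alt:
  "free_kernel t g \<longleftrightarrow> bounded_periodic g \<and> (\<forall>k. fourier_coeff g k = (if k = 0 then 0 else cis (- t * (of_int k)\<^sup>2) / of_int k))"
  by (auto simp: free_kernel_def bounded_periodic_def)

lemma borel_char: "char k \<in> borel_measurable borel"
  by (intro borel_measurable_continuous_onI continuous_char)

lemma bounded_periodic_char_mult:
  assumes "bounded_periodic g" shows "bounded_periodic (\<lambda>x. char k x * g x)"
  using assms borel_char[of k] unfolding bounded_periodic_def bounded_iff
  by (auto simp: periodic_def char_periodic norm_mult)

lemma bounded_periodic_translate:
  assumes "bounded_periodic g" shows "bounded_periodic (\<lambda>x. g (x + c))"
proof -
  have "g (x + 2 * pi + c) = g (x + c)" for x
    using assms unfolding bounded_periodic_def periodic_def by (metis add.assoc add.commute)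
  then show ?thesis using assms unfolding bounded_periodic_def bounded_iff periodic_def by auto
qed

lemma bounded_periodic_sum:
  assumes "\<And>i. i \<in> I \<Longrightarrow> bounded_periodic (g i)"
  shows "bounded_periodic (\<lambda>x. \<Sum>i\<in>I. a i * g i x)"
proof -
  have "\<exists>B. \<forall>i\<in>I. \<forall>x. cmod (g i x) \<le> B i"
    using assms unfolding bounded_periodic_def bounded_iff by (intro bchoice ballI) auto
  then obtain B where B: "\<And>i x. i \<in> I \<Longrightarrow> cmod (g i x) \<le> B i" by blast
  have "cmod (\<Sum>i\<in>I. a i * g i x) \<le> (\<Sum>i\<in>I. cmod (a i) * B i)" for x
    by (intro order.trans[OF norm_sum] sum_mono) (auto simp: norm_mult intro!: mult_left_mono B)
  then have "bounded (range (\<lambda>x. \<Sum>i\<in>I. a i * g i x))" unfolding bounded_iff by blast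
  moreover have "(\<lambda>x. \<Sum>i\<in>I. a i * g i x) \<in> borel_measurable borel"
    using assms by (intro borel_measurable_sum borel_measurable_times borel_measurable_const) (simp add: bounded_periodic_def)
  ultimately show ?thesis using assms unfolding bounded_periodic_def periodic_def by simp
qed

lemma fourier_coeff_translate:
  assumes "bounded_periodic g"
  shows "fourier_coeff (\<lambda>x. g (x + c)) k = char k c * fourier_coeff g k"
proof -
  have "(LINT x|torus. char (-k) x * g (x + c)) = (LINT x|torus. char k c * (char (-k) (x + c) * g (x + c)))"
  proof (intro Bochner_Integration.integral_cong refl)
    fix x
    have "char k c * char (-k) (x + c) = char (-k) x * (char k c * char (-k) c)" by (simp add: char_add_arg)
    also have "char k c * char (-k) c = 1" by (simp flip: char_add)
    finally show "char (-k) x * g (x + c) = char k c * (char (-k) (x + c) * g (x + c))" by simp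
  qed
  also have "\<dots> = char k c * (LINT x|torus. char (-k) (x + c) * g (x + c))" by simp
  also have "(LINT x|torus. char (-k) (x + c) * g (x + c)) = (LINT x|torus. char (-k) x * g x)"
    using bounded_periodic_char_mult[OF assms, of "-k"]
    by (intro integral_periodic_shift[of "\<lambda>x. char (-k) x * g x"]) (auto simp: bounded_periodic_def)
  finally show ?thesis by (simp add: fourier_coeff_torus)
qed

lemma fourier_coeff_sum:
  assumes "\<And>i. i \<in> I \<Longrightarrow> square_integrable (g i)"
  shows "fourier_coeff (\<lambda>x. \<Sum>i\<in>I. a i * g i x) k = (\<Sum>i\<in>I. a i * fourier_coeff (g i) k)"
proof -
  have "(LINT x|torus. char (-k) x * (\<Sum>i\<in>I. a i * g i x)) = (LINT x|torus. (\<Sum>i\<in>I. a i * (char (-k) x * g i x)))"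
    by (simp add: sum_distrib_left mult_ac)
  also have "\<dots> = (\<Sum>i\<in>I. a i * (LINT x|torus. char (-k) x * g i x))"
    using integrable_char_mult[OF assms] by (subst Bochner_Integration.integral_sum) auto
  finally show ?thesis by (simp add: fourier_coeff_torus sum_distrib_left mult_ac)
qed

lemma fourier_coeff_cnj: "fourier_coeff (\<lambda>x. cnj (g x)) k = cnj (fourier_coeff g (-k))"
proof -
  have "(LINT x|torus. char (-k) x * cnj (g x)) = (LINT x|torus. cnj (char k x * g x))" by (simp add: cnj_char)
  also have "\<dots> = cnj (LINT x|torus. char k x * g x)" by (rule Bochner_Integration.integral_cnj)
  finally show ?thesis by (simp add: fourier_coeff_torus)
qed

lemma AE_eq_of_fourier_coeff:
  assumes "bounded_periodic g" "bounded_periodic h" "\<And>k. fourier_coeff g k = fourier_coeff h k"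
  shows "AE x in lebesgue. g x = h x"
proof (rule AE_torus_periodic)
  show "AE x in torus. g x = h x" using assms by (intro fourier_coeff_eqI bounded_periodic_square_integrable)
qed (use assms in \<open>auto simp: bounded_periodic_def periodic_def\<close>)

lemma free_kernel_unique:
  "free_kernel t g \<Longrightarrow> free_kernel t h \<Longrightarrow> AE x in lebesgue. g x = h x"
  unfolding free_kernel_alt by (intro AE_eq_of_fourier_coeff) auto

text \<open>Since \<open>k\<^sup>2\<close> and \<open>k\<close> have the same parity, advancing time by \<open>\<pi>\<close> translates space by \<open>\<pi>\<close>.\<close>

lemma cis_pi_square: "cis (- (pi * of_int n) * (of_int k)\<^sup>2) = cis (of_int k * (pi * of_int n))"
proof -
  have "even (k * (k + 1) * n)" by simp
  then obtain j where j: "k * (k + 1) * n = 2 * j" unfolding dvd_def by blast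
  have "of_int k * (pi * of_int n) = - (pi * of_int n) * (of_int k)\<^sup>2 + pi * of_int (k * (k + 1) * n)"
    by (simp add: algebra_simps power2_eq_square)
  also have "pi * of_int (k * (k + 1) * n) = 2 * pi * of_int j" unfolding j by simp
  finally have "cis (of_int k * (pi * of_int n)) = cis (- (pi * of_int n) * (of_int k)\<^sup>2) * cis (2 * pi * of_int j)"
    by (simp only: cis_mult)
  then show ?thesis by simp
qed

lemma free_kernel_translate:
  assumes "free_kernel t g" shows "free_kernel (t + pi * of_int n) (\<lambda>x. g (x + pi * of_int n))"
proof -
  have b: "bounded_periodic g" using assms by (simp add: free_kernel_alt)
  have "cis (- (t + pi * of_int n) * (of_int k)\<^sup>2) = char k (pi * of_int n) * cis (- t * (of_int k)\<^sup>2)" for k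
  proof -
    have "- (t + pi * of_int n) * (of_int k)\<^sup>2 = - (pi * of_int n) * (of_int k)\<^sup>2 + - t * (of_int k)\<^sup>2"
      by (simp add: algebra_simps)
    then show ?thesis unfolding char_def using cis_pi_square[of n k] by (simp only: cis_mult[symmetric])
  qed
  then show ?thesis using assms bounded_periodic_translate[OF b] unfolding free_kernel_alt
    by (auto simp: fourier_coeff_translate[OF b])
qed

lemma bounded_periodic_cnj: "bounded_periodic g \<Longrightarrow> bounded_periodic (\<lambda>x. - cnj (g x))"
  unfolding bounded_periodic_def bounded_iff periodic_def
  by (auto intro: borel_measurable_continuous_on[of cnj] simp: continuous_on_cnj)

text \<open>Conjugation reverses time but also exchanges k and - k; the minus sign makes up for the
  oddness of 1 / k.\<close>

lemma free_kernel_cnj: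
  assumes "free_kernel t g" shows "free_kernel (- t) (\<lambda>x. - cnj (g x))"
proof -
  have "fourier_coeff (\<lambda>x. - cnj (g x)) k = - cnj (fourier_coeff g (-k))" for k
    using fourier_coeff_cmult[of "-1" "\<lambda>x. cnj (g x)" k] fourier_coeff_cnj[of g k] by simp
  then show ?thesis using assms bounded_periodic_cnj unfolding free_kernel_alt by (auto simp: cis_cnj)
qed

text \<open>The factor \<i> makes the coefficients 1 / k. The jump at multiples of 2 \<pi> is then 2
  \<pi> \<i>, which explains the divisor of the weights in
  \<open>jump_representation\<close>.\<close>

definition sawtooth :: "real \<Rightarrow> complex" where
  "sawtooth x = \<i> * (pi - (x - 2 * pi * of_int \<lfloor>x / (2 * pi)\<rfloor>))"

lemma sawtooth_eq: "0 \<le> x \<Longrightarrow> x < 2 * pi \<Longrightarrow> sawtooth x = \<i> * (complex_of_real pi - of_real x)"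
proof -
  assume "0 \<le> x" "x < 2 * pi"
  then have "\<lfloor>x / (2 * pi)\<rfloor> = 0" by (intro floor_unique) (auto simp: field_simps)
  then show ?thesis by (simp add: sawtooth_def)
qed

lemma sawtooth_periodic: "periodic sawtooth"
proof -
  have "(x + 2 * pi) / (2 * pi) = x / (2 * pi) + 1" for x by (simp add: field_simps)
  then show ?thesis by (simp add: periodic_def sawtooth_def algebra_simps)
qed

lemma sawtooth_neg: "- (2 * pi) \<le> x \<Longrightarrow> x < 0 \<Longrightarrow> sawtooth x = \<i> * (- pi - x)"
  using sawtooth_eq[of "x + 2 * pi"] sawtooth_periodic by (simp add: periodic_def algebra_simps)

lemma norm_sawtooth_le: "cmod (sawtooth x) \<le> pi"
proof -
  have "0 \<le> x - 2 * pi * of_int \<lfloor>x / (2 * pi)\<rfloor>" "x - 2 * pi * of_int \<lfloor>x / (2 * pi)\<rfloor> \<le> 2 * pi"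
    using floor_divide_lower[of "2*pi" x] floor_divide_upper[of "2*pi" x] by (auto simp: algebra_simps)
  then have "\<bar>pi - (x - 2 * pi * of_int \<lfloor>x / (2 * pi)\<rfloor>)\<bar> \<le> pi" by linarith
  moreover have "sawtooth x = \<i> * of_real (pi - (x - 2 * pi * of_int \<lfloor>x / (2 * pi)\<rfloor>))" by (simp add: sawtooth_def)
  ultimately show ?thesis by (simp only: norm_mult norm_of_real) simp
qed

lemma bounded_periodic_sawtooth: "bounded_periodic sawtooth"
  unfolding bounded_periodic_def
proof (intro conjI sawtooth_periodic)
  show "bounded (range sawtooth)" unfolding bounded_iff using norm_sawtooth_le by blast
  show "sawtooth \<in> borel_measurable borel" unfolding sawtooth_def by measurable
qed

lemma free_kernel_sawtooth: "free_kernel 0 sawtooth"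
proof -
  have "fourier_coeff sawtooth k = (if k = 0 then 0 else 1 / of_int k)" for k
  proof -
    define F where "F x = (if k = 0 then \<i> * (pi * x - x\<^sup>2 / 2) else char (-k) x / (- \<i> * of_int k) * (\<i> * (complex_of_real pi - of_real x)) + char (-k) x / (\<i> * (of_int k)\<^sup>2))" for x :: real
    have char': "(char (-k) has_vector_derivative (- \<i> * of_int k) * char (-k) x) (at x within S)" for x S
      unfolding has_vector_derivative_def char_def
      by (auto intro!: derivative_eq_intros simp: fun_eq_iff complex_eq_iff)
    have lin: "((\<lambda>x. \<i> * (complex_of_real pi - of_real x)) has_vector_derivative \<i> * (0 - 1)) (at x within S)" for x S
      by (intro has_vector_derivative_mult_right has_vector_derivative_diff has_vector_derivative_const)
         (auto intro!: derivative_eq_intros simp: has_vector_derivative_def scaleR_conv_of_real)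
    have F': "(F has_vector_derivative char (-k) x * (\<i> * (complex_of_real pi - of_real x))) (at x within {0..2*pi})" for x
    proof (cases "k = 0")
      case True
      have "((\<lambda>x. \<i> * (complex_of_real pi * of_real x - (of_real x)\<^sup>2 / 2)) has_vector_derivative \<i> * (complex_of_real pi - of_real x)) (at x within {0..2*pi})"
        unfolding has_vector_derivative_def
        by (auto intro!: derivative_eq_intros simp: fun_eq_iff scaleR_conv_of_real algebra_simps)
      then show ?thesis using True unfolding F_def[abs_def] by simp
    next
      case False
      have "((\<lambda>x. char (-k) x / (- \<i> * of_int k) * (\<i> * (complex_of_real pi - of_real x)) + char (-k) x / (\<i> * (of_int k)\<^sup>2)) has_vector_derivative
        (char (-k) x / (- \<i> * of_int k) * (\<i> * (0 - 1)) + (- \<i> * of_int k) * char (-k) x / (- \<i> * of_int k) * (\<i> * (complex_of_real pi - of_real x)))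
         + (- \<i> * of_int k) * char (-k) x / (\<i> * (of_int k)\<^sup>2)) (at x within {0..2*pi})"
        by (intro has_vector_derivative_add has_vector_derivative_mult has_vector_derivative_divide char' lin)
      moreover have "(char (-k) x / (- \<i> * of_int k) * (\<i> * (0 - 1)) + (- \<i> * of_int k) * char (-k) x / (- \<i> * of_int k) * (\<i> * (complex_of_real pi - of_real x)))
         + (- \<i> * of_int k) * char (-k) x / (\<i> * (of_int k)\<^sup>2) = char (-k) x * (\<i> * (complex_of_real pi - of_real x))"
        using False by (simp add: field_simps power2_eq_square)
      ultimately show ?thesis using False unfolding F_def[abs_def] by simp
    qed
    have hi: "((\<lambda>x. char (-k) x * (\<i> * (complex_of_real pi - of_real x))) has_integral (F (2*pi) - F 0)) {0..2*pi}"
      by (intro fundamental_theorem_of_calculus F') auto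
    have sq: "square_integrable (\<lambda>x. char (-k) x * (\<i> * (complex_of_real pi - of_real x)))"
      by (intro continuous_square_integrable continuous_intros)
    have "(LINT x|torus. char (-k) x * sawtooth x) = (LINT x|torus. char (-k) x * (\<i> * (complex_of_real pi - of_real x)))"
    proof (rule integral_cong_AE)
      show "AE x in torus. char (-k) x * sawtooth x = char (-k) x * (\<i> * (complex_of_real pi - of_real x))"
        by (rule AE_torus_interior[of "{}"]) (auto simp: sawtooth_eq)
      show "(\<lambda>x. char (-k) x * sawtooth x) \<in> borel_measurable torus"
        using bounded_periodic_char_mult[OF bounded_periodic_sawtooth] by (intro borel_torus) (auto simp: bounded_periodic_def)
      show "(\<lambda>x. char (-k) x * (\<i> * (complex_of_real pi - of_real x))) \<in> borel_measurable torus"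
        using sq by (simp add: square_integrable_def)
    qed
    also have "\<dots> = F (2*pi) - F 0" by (rule trans[OF integral_torus_eq[OF sq] integral_unique[OF hi]])
    also have "\<dots> = (if k = 0 then 0 else 2 * pi / of_int k)"
    proof (cases "k = 0")
      case True
      then show ?thesis by (simp add: F_def power2_eq_square)
    next
      case False
      have "char (-k) (2*pi) = 1" using char_periodic[of "-k" 0] by (simp add: char_def)
      moreover have "char (-k) 0 = 1" by (simp add: char_def)
      ultimately show ?thesis using False by (simp add: F_def field_simps)
    qed
    finally show ?thesis by (simp add: fourier_coeff_torus)
  qed
  then show ?thesis using bounded_periodic_sawtooth by (auto simp: free_kernel_alt)
qed

subsection \<open>Rational times\<close>

text \<open>At a rational multiple of \<open>\<pi>\<close> the multiplier \<open>cis (- t k\<^sup>2)\<close> is periodic in \<open>k\<close>, so its finite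
  Fourier inversion turns the propagator into a finite combination of translations.\<close>

definition superpose :: "nat \<Rightarrow> (nat \<Rightarrow> complex) \<Rightarrow> (real \<Rightarrow> complex) \<Rightarrow> real \<Rightarrow> complex" where
  "superpose q c f x = (\<Sum>j<q. c j * f (x + - (2 * pi * real j / real q)))"

definition resolves :: "real \<Rightarrow> nat \<Rightarrow> (nat \<Rightarrow> complex) \<Rightarrow> bool" where
  "resolves t q c \<longleftrightarrow> q > 0 \<and> (\<forall>k::int. cis (- t * (of_int k)\<^sup>2) = (\<Sum>j<q. c j * char k (- (2 * pi * real j / real q))))"

lemma sum_roots_of_unity:
  assumes q: "q > 0"
  shows "(\<Sum>j<q. cis (2 * pi * real j * of_int n / real q)) = (if int q dvd n then of_nat q else 0)"
proof (cases "int q dvd n")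
  case True
  then obtain m where m: "n = int q * m" by (elim dvdE)
  have "cis (2 * pi * real j * of_int n / real q) = 1" for j
  proof -
    have "2 * pi * real j * of_int n / real q = 2 * pi * of_int (int j * m)" using q by (simp add: m)
    then show ?thesis by (simp del: of_int_mult)
  qed
  then show ?thesis using True by simp
next
  case False
  define z where "z = cis (2 * pi * of_int n / real q)"
  have p: "cis (2 * pi * real j * of_int n / real q) = z ^ j" for j
    unfolding z_def Complex.DeMoivre by (rule arg_cong[of _ _ cis]) simp
  have "z ^ q = cis (2 * pi * of_int n)" unfolding z_def Complex.DeMoivre using q by simp
  then have zq: "z ^ q = 1" by simp
  have "z \<noteq> 1"
  proof
    assume "z = 1"
    then have "cos (2 * pi * of_int n / real q) = 1" unfolding z_def by (metis cis.sel(1) one_complex.sel(1))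
    then obtain m :: int where "2 * pi * of_int n / real q = 2 * pi * of_int m"
      unfolding cos_one_2pi_int by auto
    then have "of_int n = real q * of_int m" using q by (simp add: field_simps)
    then have "of_int n = (of_int (int q * m) :: real)" by simp
    then have "n = int q * m" by (simp only: of_int_eq_iff)
    then show False using False by simp
  qed
  then have "(\<Sum>j<q. z ^ j) = 0" using zq by (simp add: geometric_sum)
  then show ?thesis using False p by simp
qed

lemma resolves_exists:
  assumes "t \<in> pi_rationals" shows "\<exists>q c. resolves t q c"
proof -
  obtain r where r: "r \<in> \<rat>" "t = pi * r" using assms by (auto simp: pi_rationals_def)
  obtain a b :: int where ab: "b > 0" "r = of_int a / of_int b" using r(1) by (elim Rats_cases') auto
  \<comment> \<open>The period is \<open>2 * b\<close> rather than \<open>b\<close>: for t = \<pi> a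
    / b, replacing k by k + b m changes t k^2 by \<pi> a (2 k m + b m^2), which may be an odd
    multiple of \<pi>.\<close>
  define q where "q = nat (2 * b)"
  have q: "q > 0" "int q = 2 * b" "real q = 2 * of_int b" using ab by (auto simp: q_def)
  define E where "E k = cis (- t * (of_int k)\<^sup>2)" for k :: int
  have per: "E (k + int q * m) = E k" for k m
  proof -
    have "- t * (of_int (k + int q * m))\<^sup>2 = - t * (of_int k)\<^sup>2 + 2 * pi * of_int (- (2 * a * (k * m + b * m * m)))"
      unfolding r ab q using ab(1) by (simp add: field_simps power2_eq_square)
    then have "E (k + int q * m) = E k * cis (2 * pi * of_int (- (2 * a * (k * m + b * m * m))))"
      unfolding E_def by (simp only: cis_mult)
    then show ?thesis by (simp del: of_int_mult of_int_add of_int_minus)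
  qed
  \<comment> \<open>The finite Fourier transform of one period of the multiplier.\<close>
  define c where "c j = 1 / of_nat q * (\<Sum>m<q. E (int m) * cis (2 * pi * real j * real m / real q))" for j
  have "E k = (\<Sum>j<q. c j * char k (- (2 * pi * real j / real q)))" for k
  proof -
    have ph: "cis (2 * pi * real j * real m / real q) * char k (- (2 * pi * real j / real q)) = cis (2 * pi * real j * of_int (int m - k) / real q)" for j m
    proof -
      have "2 * pi * real j * real m / real q + of_int k * (- (2 * pi * real j / real q)) = 2 * pi * real j * of_int (int m - k) / real q"
        using q by (simp add: field_simps)
      then show ?thesis unfolding char_def by (simp only: cis_mult)
    qed
    have "(\<Sum>j<q. c j * char k (- (2 * pi * real j / real q))) =
      (\<Sum>j<q. \<Sum>m<q. 1 / of_nat q * E (int m) * cis (2 * pi * real j * of_int (int m - k) / real q))"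
      unfolding c_def ph[symmetric] by (simp add: sum_distrib_left sum_distrib_right mult_ac)
    also have "\<dots> = (\<Sum>m<q. 1 / of_nat q * E (int m) * (\<Sum>j<q. cis (2 * pi * real j * of_int (int m - k) / real q)))"
      by (subst sum.swap) (simp add: sum_distrib_left)
    also have "\<dots> = (\<Sum>m<q. if m = nat (k mod int q) then E k else 0)"
    proof (intro sum.cong refl)
      fix m assume "m \<in> {..<q}"
      then have m: "int m = int m mod int q" by simp
      have iff: "int q dvd int m - k \<longleftrightarrow> m = nat (k mod int q)"
      proof -
        have "int q dvd int m - k \<longleftrightarrow> int m mod int q = k mod int q" by (simp add: mod_eq_dvd_iff)
        also have "\<dots> \<longleftrightarrow> m = nat (k mod int q)" using m q by (metis nat_int pos_mod_sign int_nat_eq q(1) of_nat_0_less_iff)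
        finally show ?thesis .
      qed
      show "1 / of_nat q * E (int m) * (\<Sum>j<q. cis (2 * pi * real j * of_int (int m - k) / real q)) = (if m = nat (k mod int q) then E k else 0)"
      proof (cases "int q dvd int m - k")
        case True
        then obtain l where "int m - k = int q * l" by (elim dvdE)
        then have "int m = k + int q * l" by simp
        then have "E (int m) = E k" using per by metis
        then show ?thesis using True iff q(1) unfolding sum_roots_of_unity[OF q(1)] by simp
      next
        case False
        then show ?thesis using iff unfolding sum_roots_of_unity[OF q(1)] by simp
      qed
    qed
    also have "\<dots> = E k"
    proof -
      have "nat (k mod int q) < q" using q(1) by (metis nat_less_iff pos_mod_bound pos_mod_sign of_nat_0_less_iff)
      then show ?thesis by (simp add: sum.delta)
    qed
    finally show ?thesis by simp
  qed
  then show ?thesis using q(1) unfolding resolves_def E_def by blast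
qed

lemma bounded_periodic_superpose: "bounded_periodic f \<Longrightarrow> bounded_periodic (superpose q c f)"
  unfolding superpose_def[abs_def] by (intro bounded_periodic_sum bounded_periodic_translate)

lemma fourier_coeff_superpose:
  assumes "resolves t q c" "bounded_periodic f"
  shows "fourier_coeff (superpose q c f) k = cis (- t * (of_int k)\<^sup>2) * fourier_coeff f k"
proof -
  have "fourier_coeff (superpose q c f) k = (\<Sum>j<q. c j * (char k (- (2 * pi * real j / real q)) * fourier_coeff f k))"
    unfolding superpose_def[abs_def] fourier_coeff_translate[OF assms(2), symmetric]
    by (intro fourier_coeff_sum bounded_periodic_square_integrable bounded_periodic_translate assms)
  also have "\<dots> = (\<Sum>j<q. c j * char k (- (2 * pi * real j / real q))) * fourier_coeff f k"
    by (simp add: sum_distrib_right mult.assoc)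
  finally show ?thesis using assms(1) by (simp add: resolves_def)
qed

lemma free_kernel_superpose: "resolves t q c \<Longrightarrow> free_kernel t (superpose q c sawtooth)"
  using free_kernel_sawtooth bounded_periodic_superpose[OF bounded_periodic_sawtooth]
  by (auto simp: free_kernel_alt fourier_coeff_superpose[OF _ bounded_periodic_sawtooth])

lemma free_kernel_exists: "t \<in> pi_rationals \<Longrightarrow> \<exists>g. free_kernel t g"
  using resolves_exists free_kernel_superpose by blast

section \<open>Size, small times and continuity of the regular term\<close>

lemma norm_remainder_series_le:
  assumes t: "t > 0" and x: "\<bar>x\<bar> \<le> 3 * pi / 2"
  shows "cmod (\<Sum>m. step_remainder t (Suc m) x - step_remainder t (Suc m) (- x)) \<le> 8 * t"
proof -
  have "cmod (\<Sum>m. step_remainder t (Suc m) x - step_remainder t (Suc m) (- x)) \<le> (\<Sum>m. 4 * t * (1 / (real (Suc m))\<^sup>2))"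
    by (rule norm_suminf_le[OF norm_remainder_pair_le[OF t x] summable_inverse_squares_Suc])
  also have "\<dots> = 4 * t * (\<Sum>m. 1 / (real (Suc m))\<^sup>2)"
    using inverse_squares_sums by (intro suminf_mult) (auto simp: sums_iff)
  also have "(\<Sum>m. 1 / (real (Suc m))\<^sup>2) = pi\<^sup>2 / 6"
    using inverse_squares_sums by (simp add: sums_iff)
  also have "4 * t * (pi\<^sup>2 / 6) \<le> 4 * t * 2"
  proof (intro mult_left_mono)
    have "pi\<^sup>2 \<le> (3.2)\<^sup>2" using pi_approx by (intro power_mono) auto
    then show "pi\<^sup>2 / 6 \<le> 2" by (simp add: power2_eq_square)
  qed (use t in auto)
  finally show ?thesis by simp
qed

text \<open>The remainder series is O(t), while the limit it is divided by has modulus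
  \<open>sqrt (pi * t)\<close>.\<close>

lemma norm_remainder_part_le:
  assumes t: "t > 0" and x: "\<bar>x\<bar> \<le> 3 * pi / 2"
  shows "cmod (kernel_regular t x - (\<i> * pi * (fresnel (x / (2 * sqrt t)) / fresnel_lim) - \<i> * x)) \<le> 8 * sqrt pi * sqrt t"
proof -
  define S where "S = (\<Sum>m. step_remainder t (Suc m) x - step_remainder t (Suc m) (- x))"
  have "step_evolution t x / step_evolution_lim t = fresnel (x / (2 * sqrt t)) / fresnel_lim"
    using t by (simp add: step_evolution_def step_evolution_lim_def)
  then have "kernel_regular t x - (\<i> * pi * (fresnel (x / (2 * sqrt t)) / fresnel_lim) - \<i> * x) = \<i> * pi / step_evolution_lim t * S"
    unfolding kernel_regular_def S_def[symmetric] by (simp add: distrib_left flip: times_divide_eq_right)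
  also have "cmod \<dots> = pi / sqrt (pi * t) * cmod S"
    by (simp add: norm_mult norm_divide norm_step_evolution_lim[OF t])
  also have "\<dots> \<le> pi / sqrt (pi * t) * (8 * t)"
    using norm_remainder_series_le[OF t x] t unfolding S_def by (intro mult_left_mono) auto
  also have "\<dots> = 8 * sqrt pi * sqrt t"
  proof -
    have "t = sqrt t * sqrt t" "pi = sqrt pi * sqrt pi" using t by simp_all
    then show ?thesis using t by (simp add: real_sqrt_mult field_simps)
  qed
  finally show ?thesis .
qed

text \<open>The parts contribute 8, 32 and 8. The range up to 2 covers t up to \<pi> / 2, which is
  where times are moved by the symmetries.\<close>

lemma norm_kernel_regular_le:
  assumes t: "0 < t" "t \<le> 2" and x: "\<bar>x\<bar> \<le> 3 * pi / 2"
  shows "cmod (kernel_regular t x) \<le> 50"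
proof -
  define a where "a = \<i> * pi * (fresnel (x / (2 * sqrt t)) / fresnel_lim)"
  have sp: "sqrt pi \<le> 2" using pi_less_4 real_le_lsqrt[of 2 pi] by simp
  have sp0: "sqrt pi > 0" by simp
  have "cmod a = pi * (cmod (fresnel (x / (2 * sqrt t))) / (sqrt pi / 2))"
    unfolding a_def by (simp add: norm_mult norm_divide norm_fresnel_lim)
  also have "\<dots> \<le> pi * (2 / (sqrt pi / 2))"
    by (intro mult_left_mono divide_right_mono norm_fresnel_le) auto
  also have "\<dots> = 4 * sqrt pi"
  proof -
    have "pi = sqrt pi * sqrt pi" by simp
    then show ?thesis using sp0 by (simp add: field_simps)
  qed
  finally have a: "cmod a \<le> 8" using sp by linarith
  have st: "sqrt t \<le> 2" using t real_le_lsqrt[of 2 t] by simp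
  have "8 * sqrt pi * sqrt t \<le> 8 * 2 * 2" using sp st t by (intro mult_mono) auto
  then have r: "cmod (kernel_regular t x - (a - \<i> * x)) \<le> 32"
    using norm_remainder_part_le[OF t(1) x] unfolding a_def[symmetric] by linarith
  have ix: "cmod (\<i> * complex_of_real x) \<le> 8" using x pi_less_4 by (simp add: norm_mult)
  have "cmod (kernel_regular t x) = cmod ((kernel_regular t x - (a - \<i> * x)) + a - \<i> * x)" by simp
  also have "\<dots> \<le> cmod ((kernel_regular t x - (a - \<i> * x)) + a) + cmod (\<i> * complex_of_real x)" by (rule norm_triangle_ineq4)
  also have "\<dots> \<le> cmod (kernel_regular t x - (a - \<i> * x)) + cmod a + cmod (\<i> * complex_of_real x)"
    by (intro add_right_mono norm_triangle_ineq)
  finally show ?thesis using a r ix by linarith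
qed

text \<open>For small t the Fresnel quotient is close to the sign of x, and \<i> (\<pi> sgn x - x)
  is the sawtooth on [-\<pi>, \<pi>] away from 0. The bound degenerates only towards the jump at
  0.\<close>

lemma kernel_regular_near_sawtooth:
  assumes t: "t > 0" and x: "0 < \<bar>x\<bar>" "\<bar>x\<bar> \<le> pi"
  shows "cmod (kernel_regular t x - sawtooth x) \<le> sqrt t * (8 / \<bar>x\<bar> + 16)"
proof -
  define s where "s = sgn x"
  have s: "\<bar>s\<bar> = 1" "x = s * \<bar>x\<bar>" using x by (auto simp: s_def sgn_if)
  define z where "z = \<bar>x\<bar> / (2 * sqrt t)"
  have z: "z > 0" using x t by (simp add: z_def)
  have saw: "sawtooth x = \<i> * pi * s - \<i> * x"
    using x sawtooth_eq[of x] sawtooth_neg[of x] by (cases "x > 0") (auto simp: s_def sgn_if algebra_simps)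
  have fr: "fresnel (x / (2 * sqrt t)) = s * fresnel z"
    unfolding z_def using x by (cases "x > 0") (auto simp: s_def sgn_if fresnel_minus)
  have lim0: "fresnel_lim \<noteq> 0" using norm_fresnel_lim by auto
  define D where "D = \<i> * pi * (fresnel (x / (2 * sqrt t)) / fresnel_lim) - \<i> * x - sawtooth x"
  have "D = \<i> * pi * s * ((fresnel z - fresnel_lim) / fresnel_lim)"
    unfolding D_def saw fr using lim0 by (simp add: field_simps)
  then have "cmod D = pi * (cmod (fresnel z - fresnel_lim) / (sqrt pi / 2))"
    using s by (simp add: norm_mult norm_divide norm_fresnel_lim)
  also have "\<dots> \<le> pi * ((1 / z) / (sqrt pi / 2))"
    using norm_fresnel_minus_lim_le[OF z] by (intro mult_left_mono divide_right_mono) auto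
  also have "\<dots> = 2 * sqrt pi * (2 * sqrt t / \<bar>x\<bar>)"
  proof -
    have "pi = sqrt pi * sqrt pi" by simp
    then have "pi / sqrt pi = sqrt pi" by (metis nonzero_mult_div_cancel_right pi_gt_zero real_sqrt_gt_0_iff less_irrefl)
    then show ?thesis using x t unfolding z_def by (simp add: field_simps)
  qed
  finally have 1: "cmod D \<le> 2 * sqrt pi * (2 * sqrt t / \<bar>x\<bar>)" .
  have sp: "sqrt pi \<le> 2" using pi_less_4 real_le_lsqrt[of 2 pi] by simp
  have "\<bar>x\<bar> \<le> 3 * pi / 2" using x by linarith
  note rem = norm_remainder_part_le[OF t this]
  have "cmod (kernel_regular t x - sawtooth x) = cmod ((kernel_regular t x - (\<i> * pi * (fresnel (x / (2 * sqrt t)) / fresnel_lim) - \<i> * x)) + D)"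
    unfolding D_def by simp
  also have "\<dots> \<le> 8 * sqrt pi * sqrt t + 2 * sqrt pi * (2 * sqrt t / \<bar>x\<bar>)"
    using rem 1 norm_triangle_ineq add_mono order.trans by blast
  also have "\<dots> \<le> 8 * 2 * sqrt t + 2 * 2 * (2 * sqrt t / \<bar>x\<bar>)"
    using sp t by (intro add_mono mult_mono) auto
  also have "\<dots> = sqrt t * (8 / \<bar>x\<bar> + 16)" by (simp add: field_simps)
  finally show ?thesis .
qed

text \<open>Weierstrass test: the bound on the remainders is uniform for t in a compact
  range.\<close>

lemma continuous_kernel_regular:
  assumes t1: "0 < t1"
  shows "continuous_on ({t1..t2} \<times> {- (3*pi/2)..3*pi/2}) (\<lambda>p. kernel_regular (fst p) (snd p))"
proof -
  let ?K = "{t1..t2} \<times> {- (3*pi/2)..3*pi/2}"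
  have nz: "\<And>p. p \<in> ?K \<Longrightarrow> fst p > 0" using t1 by auto
  have s1: "continuous_on ?K (\<lambda>p. 2 * sqrt (fst p))" "\<forall>p\<in>?K. 2 * sqrt (fst p) \<noteq> 0"
    using t1 by (auto intro!: continuous_intros)
  have s2: "continuous_on ?K (\<lambda>p. 4 * fst p)" "\<forall>p\<in>?K. 4 * fst p \<noteq> 0"
    using t1 by (auto intro!: continuous_intros)
  have s3: "continuous_on ?K (\<lambda>p. 2 * complex_of_real (sqrt (fst p)))" "continuous_on ?K (\<lambda>p. 2 * complex_of_real (fst p) / \<i>)"
    by (auto intro!: continuous_intros)
  have ev: "continuous_on ?K (\<lambda>p. step_evolution (fst p) (f p))" if "continuous_on ?K f" for f
    unfolding step_evolution_def
    by (rule continuous_on_mult[OF s3(1) continuous_on_fresnel_compose[OF continuous_on_divide[OF that s1]]])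
  have ph: "continuous_on ?K (\<lambda>p. cis ((f p)\<^sup>2 / (4 * fst p)))" if "continuous_on ?K f" for f
    by (rule continuous_on_cis[OF continuous_on_divide[OF continuous_on_power[OF that] s2]])
  have rem: "continuous_on ?K (\<lambda>p. step_remainder (fst p) (Suc m) (f p))" if "continuous_on ?K f" for f m
  proof -
    have c: "continuous_on ?K (\<lambda>p. 2 * pi * real (Suc m))" "continuous_on ?K (\<lambda>p. 2 * pi * real (Suc m) + f p)"
      by (auto intro!: continuous_intros that)
    have n0: "\<forall>p\<in>?K. complex_of_real (2 * pi * real (Suc m)) \<noteq> 0" by (simp only: of_real_eq_0_iff) simp
    show ?thesis unfolding step_remainder_def
      by (rule continuous_on_diff[OF continuous_on_diff[OF ev[OF c(2)] ev[OF c(1)]]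
           continuous_on_divide[OF continuous_on_mult[OF s3(2) continuous_on_diff[OF ph[OF c(2)] ph[OF c(1)]]] continuous_on_const n0]])
  qed
  have "uniform_limit ?K (\<lambda>N p. \<Sum>m<N. step_remainder (fst p) (Suc m) (snd p) - step_remainder (fst p) (Suc m) (- snd p))
     (\<lambda>p. \<Sum>m. step_remainder (fst p) (Suc m) (snd p) - step_remainder (fst p) (Suc m) (- snd p)) sequentially"
  proof (rule Weierstrass_m_test[where M="\<lambda>m. 4 * t2 * (1 / (real (Suc m))\<^sup>2)"])
    fix m p assume p: "p \<in> ?K"
    then have "cmod (step_remainder (fst p) (Suc m) (snd p) - step_remainder (fst p) (Suc m) (- snd p)) \<le> 4 * fst p * (1 / (real (Suc m))\<^sup>2)"
      using nz[OF p] by (intro norm_remainder_pair_le) auto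
    also have "\<dots> \<le> 4 * t2 * (1 / (real (Suc m))\<^sup>2)" using p by (intro mult_right_mono) auto
    finally show "cmod (step_remainder (fst p) (Suc m) (snd p) - step_remainder (fst p) (Suc m) (- snd p)) \<le> 4 * t2 * (1 / (real (Suc m))\<^sup>2)" .
  qed (rule summable_inverse_squares_Suc)
  moreover have sd: "continuous_on ?K snd" "continuous_on ?K (\<lambda>p. - snd p)" by (auto intro!: continuous_intros)
  ultimately have ser: "continuous_on ?K (\<lambda>p. \<Sum>m. step_remainder (fst p) (Suc m) (snd p) - step_remainder (fst p) (Suc m) (- snd p))"
    by (intro uniform_limit_theorem[OF _ _ sequentially_bot])
       (auto intro!: always_eventually continuous_on_sum continuous_on_diff[OF rem[OF sd(1)] rem[OF sd(2)]])
  have lim: "continuous_on ?K (\<lambda>p. \<i> * pi / step_evolution_lim (fst p))"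
  proof (rule continuous_on_divide[OF continuous_on_const])
    show "continuous_on ?K (\<lambda>p. step_evolution_lim (fst p))"
      unfolding step_evolution_lim_def by (rule continuous_on_mult[OF s3(1) continuous_on_const])
    show "\<forall>p\<in>?K. step_evolution_lim (fst p) \<noteq> 0" using nz step_evolution_lim_nz by blast
  qed
  have "continuous_on ?K (\<lambda>p. \<i> * complex_of_real (snd p))" by (auto intro!: continuous_intros)
  from continuous_on_diff[OF continuous_on_mult[OF lim continuous_on_add[OF ev[OF sd(1)] ser]] this]
  show ?thesis unfolding kernel_regular_def .
qed

lemma pi_rationals_iff: "pi * r \<in> pi_rationals \<longleftrightarrow> r \<in> \<rat>"
  by (auto simp: pi_rationals_def)

text \<open>This modulus is the contraction factor of the functional equation; it is less than 1 for
  t < \<pi>.\<close>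

lemma norm_dual_factor: "t > 0 \<Longrightarrow> cmod (t / step_evolution_lim t * cis a) = sqrt (t / pi)"
proof -
  assume t: "t > 0"
  then have "t = sqrt t * sqrt t" by simp
  then have "t / sqrt (pi * t) = sqrt t / sqrt pi" using t by (simp add: real_sqrt_mult field_simps)
  then show ?thesis using t by (simp add: norm_mult norm_divide norm_step_evolution_lim real_sqrt_divide)
qed

section \<open>Uniform bound at rational times\<close>

lemma AE_periodic_window:
  assumes "AE x in lebesgue. \<bar>x\<bar> \<le> pi \<longrightarrow> P x" and per: "\<And>x m. P (x + 2 * pi * of_int m) = P x"
  shows "AE x in lebesgue. P x"
proof -
  have "AE x in lebesgue. \<forall>m::int. \<bar>1 * x + 2 * pi * of_int m\<bar> \<le> pi \<longrightarrow> P (1 * x + 2 * pi * of_int m)"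
    unfolding AE_all_countable by (intro allI AE_lebesgue_affine[OF assms(1)]) auto
  then show ?thesis
  proof eventually_elim
    case (elim x)
    obtain m :: int where "x + pi + 2 * pi * of_int m \<in> {0..<2*pi}" using real_mod_2pi by blast
    then have "\<bar>x + 2 * pi * of_int m\<bar> \<le> pi" by auto
    then show ?case using elim per[of x m] by auto
  qed
qed

text \<open>Induction on the denominator: one application of the functional equation sends \<open>p/q\<close> with
  \<open>\<bar>p/q\<bar> \<le> 1/2\<close> to \<open>-q/p\<close> and contracts by \<open>sqrt \<bar>p/q\<bar>\<close>.\<close>

lemma kernel_bound_denominator:
  "q > 0 \<Longrightarrow> free_kernel (pi * (of_int p / of_nat q)) g \<Longrightarrow> AE x in lebesgue. cmod (g x) \<le> 200"
proof (induction q arbitrary: p g rule: less_induct)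
  case (less q)
  \<comment> \<open>A time shift by a multiple of \<pi> brings the fraction into [-1/2, 1/2] and
    keeps the denominator.\<close>
  define n where "n = round (real_of_int p / real q)"
  define p' where "p' = p - n * int q"
  have pq: "real_of_int p' / real q = real_of_int p / real q - n" using less.prems(1) by (simp add: p'_def field_simps)
  have half: "\<bar>real_of_int p' / real q\<bar> \<le> 1 / 2"
    unfolding pq n_def using of_int_round_abs_le[of "real_of_int p / real q"] by (simp add: abs_minus_commute)
  have *: "AE x in lebesgue. cmod (g x) \<le> 200"
    if p: "real_of_int p / real q \<le> 1 / 2" "p > 0" and g: "free_kernel (pi * (of_int p / of_nat q)) g" for p g
  proof -
    define t where "t = pi * (of_int p / of_nat q)"
    have t: "t > 0" using p less.prems(1) by (simp add: t_def)
    have "t \<le> pi * (1 / 2)" unfolding t_def using p by (intro mult_left_mono) auto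
    then have t2: "t \<le> 2" using pi_less_4 by linarith
    have pq: "nat p < q"
    proof -
      have "real_of_int p \<le> real q / 2" using p less.prems(1) by (simp add: field_simps)
      then show ?thesis using p(2) by linarith
    qed
    have inv: "- (pi\<^sup>2 / t) = pi * (of_int (- int q) / of_nat (nat p))"
      using p less.prems(1) by (simp add: t_def power2_eq_square)
    have "- (pi\<^sup>2 / t) \<in> pi_rationals" unfolding inv pi_rationals_iff by auto
    then obtain h where h: "free_kernel (- (pi\<^sup>2 / t)) h" using free_kernel_exists by blast
    have hb: "AE x in lebesgue. cmod (h x) \<le> 200" using less.IH[OF pq _ h[unfolded inv]] p(2) by simp
    have "AE x in lebesgue. cmod (h (- pi / t * x + 0)) \<le> 200" by (rule AE_lebesgue_affine[OF hb]) (use t in auto)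
    with kernel_functional_equation[OF t g[folded t_def] h]
    have "AE x in lebesgue. \<bar>x\<bar> \<le> pi \<longrightarrow> cmod (g x) \<le> 200"
    proof eventually_elim
      case (elim x)
      show ?case
      proof
        assume "\<bar>x\<bar> \<le> pi"
        then have x: "\<bar>x\<bar> \<le> 3 * pi / 2" by linarith
        \<comment> \<open>The constant 200 is the fixed point of B = 50 + 3/4 B, where 50 bounds the
          regular term and 3/4 is a convenient bound for sqrt (1/2).\<close>
        have "sqrt (t / pi) \<le> 3 / 4"
        proof (rule real_le_lsqrt)
          have "t / pi \<le> 1 / 2" using p by (simp add: t_def)
          then show "t / pi \<le> (3 / 4)\<^sup>2" by (rule order.trans) (simp add: power2_eq_square)
        qed (use t in auto)
        then have "cmod (t / step_evolution_lim t * cis (x\<^sup>2 / (4 * t)) * h (- pi / t * x)) \<le> 3 / 4 * 200"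
          using elim(2) unfolding norm_mult[of "_ * _" "h _"] norm_dual_factor[OF t] by (intro mult_mono) auto
        moreover have gx: "g x = kernel_regular t x - t / step_evolution_lim t * cis (x\<^sup>2 / (4 * t)) * h (- pi / t * x)"
          using elim(1) x by blast
        ultimately show "cmod (g x) \<le> 200"
          unfolding gx using norm_kernel_regular_le[OF t t2 x] norm_triangle_ineq4[of "kernel_regular t x" "t / step_evolution_lim t * cis (x\<^sup>2 / (4 * t)) * h (- pi / t * x)"]
          by linarith
      qed
    qed
    then show ?thesis
      by (rule AE_periodic_window) (use g in \<open>simp add: free_kernel_def periodic_int\<close>)
  qed
  define g' where "g' x = g (x + pi * of_int (- n))" for x
  have t': "pi * (of_int p / of_nat q) + pi * of_int (- n) = pi * (of_int p' / of_nat q)"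
    unfolding pq by (simp add: algebra_simps)
  have g': "free_kernel (pi * (of_int p' / of_nat q)) g'"
    using free_kernel_translate[OF less.prems(2), of "- n"] unfolding t' g'_def .
  have "AE x in lebesgue. cmod (g' x) \<le> 200"
  proof (cases "p' = 0")
    case True
    then have "AE x in lebesgue. g' x = sawtooth x" using free_kernel_unique[OF _ free_kernel_sawtooth] g' by simp
    then show ?thesis
    proof eventually_elim
      case (elim x)
      then show ?case using norm_sawtooth_le[of x] pi_less_4 by simp
    qed
  next
    case False
    show ?thesis
    proof (cases "p' > 0")
      case True
      then show ?thesis using *[of p' g'] g' half by (simp add: abs_le_iff)
    next
      case neg: False
      have "- (pi * (of_int p' / of_nat q)) = pi * (of_int (- p') / of_nat q)" by simp
      then have "free_kernel (pi * (of_int (- p') / of_nat q)) (\<lambda>x. - cnj (g' x))"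
        using free_kernel_cnj[OF g'] by (simp only:)
      then have "AE x in lebesgue. cmod (- cnj (g' x)) \<le> 200"
        using False neg half by (intro *[of "- p'"]) (auto simp: abs_le_iff)
      then show ?thesis by simp
    qed
  qed
  then have "AE x in lebesgue. cmod (g' (1 * x + pi * of_int n)) \<le> 200" by (rule AE_lebesgue_affine) auto
  then show ?case by (simp add: g'_def algebra_simps)
qed

theorem kernel_bound:
  assumes "t \<in> pi_rationals" "free_kernel t g"
  shows "AE x in lebesgue. cmod (g x) \<le> 200"
proof -
  obtain r where r: "r \<in> \<rat>" "t = pi * r" using assms(1) by (auto simp: pi_rationals_def)
  obtain a b :: int where ab: "b > 0" "r = of_int a / of_int b" using r(1) by (elim Rats_cases') auto
  have "t = pi * (of_int a / of_nat (nat b))" using r ab by simp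
  then show ?thesis using assms(2) ab(1) by (intro kernel_bound_denominator[of "nat b" a]) auto
qed

subsection \<open>Oscillation near irrational times\<close>

text \<open>Kernels are determined only up to null sets, hence the exceptional set. Comparing two
  functions at two different points measures the oscillation in time and in space at once.\<close>

definition near_agree :: "real \<Rightarrow> real \<Rightarrow> (real \<Rightarrow> complex) \<Rightarrow> (real \<Rightarrow> complex) \<Rightarrow> bool" where
  "near_agree \<epsilon> \<delta> g h \<longleftrightarrow> (\<exists>N\<in>null_sets lebesgue. \<forall>x y. x \<notin> N \<longrightarrow> y \<notin> N \<longrightarrow> \<bar>x - y\<bar> < \<delta> \<longrightarrow> cmod (g x - h y) \<le> \<epsilon>)"

lemma near_agreeI:
  assumes "AE x in lebesgue. P x" "AE x in lebesgue. Q x"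
    and "\<And>x y. P x \<Longrightarrow> Q y \<Longrightarrow> \<bar>x - y\<bar> < \<delta> \<Longrightarrow> cmod (g x - h y) \<le> \<epsilon>"
  shows "near_agree \<epsilon> \<delta> g h"
proof -
  obtain N1 where N1: "{x. \<not> P x} \<subseteq> N1" "N1 \<in> null_sets lebesgue" using assms(1) unfolding eventually_ae_filter by auto
  obtain N2 where N2: "{x. \<not> Q x} \<subseteq> N2" "N2 \<in> null_sets lebesgue" using assms(2) unfolding eventually_ae_filter by auto
  show ?thesis unfolding near_agree_def
    by (rule bexI[of _ "N1 \<union> N2"]) (use N1 N2 assms(3) in blast)+
qed

lemma near_agreeD:
  assumes "near_agree \<epsilon> \<delta> g h"
  shows "\<exists>P. (AE x in lebesgue. P x) \<and> (\<forall>x y. P x \<longrightarrow> P y \<longrightarrow> \<bar>x - y\<bar> < \<delta> \<longrightarrow> cmod (g x - h y) \<le> \<epsilon>)"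
proof -
  obtain N where N: "N \<in> null_sets lebesgue" "\<forall>x y. x \<notin> N \<longrightarrow> y \<notin> N \<longrightarrow> \<bar>x - y\<bar> < \<delta> \<longrightarrow> cmod (g x - h y) \<le> \<epsilon>"
    using assms unfolding near_agree_def by blast
  then show ?thesis using AE_not_in[OF N(1)] by (intro exI[of _ "\<lambda>x. x \<notin> N"]) auto
qed

text \<open>A Cauchy condition at time \<pi> r0, uniform in space, over rational times only, because
  kernels have been constructed only there.\<close>

definition kernel_oscillation_le :: "real \<Rightarrow> real \<Rightarrow> bool" where
  "kernel_oscillation_le r0 \<epsilon> \<longleftrightarrow> (\<exists>\<delta>>0. \<forall>r\<in>\<rat>. \<forall>r'\<in>\<rat>. \<bar>r - r0\<bar> < \<delta> \<longrightarrow> \<bar>r' - r0\<bar> < \<delta> \<longrightarrow>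
     (\<forall>g g'. free_kernel (pi * r) g \<longrightarrow> free_kernel (pi * r') g' \<longrightarrow> near_agree \<epsilon> \<delta> g g'))"

lemma near_agree_weaken:
  assumes "near_agree \<epsilon> \<delta> g h" "\<epsilon> \<le> \<epsilon>'" shows "near_agree \<epsilon>' \<delta> g h"
proof -
  obtain N where N: "N \<in> null_sets lebesgue" "\<And>x y. x \<notin> N \<Longrightarrow> y \<notin> N \<Longrightarrow> \<bar>x - y\<bar> < \<delta> \<Longrightarrow> cmod (g x - h y) \<le> \<epsilon>"
    using assms(1) unfolding near_agree_def by blast
  show ?thesis unfolding near_agree_def
    by (rule bexI[OF _ N(1)], intro allI impI, rule order.trans[OF N(2) assms(2)])
qed

lemma kernel_oscillation_le_mono:
  assumes "kernel_oscillation_le r0 \<epsilon>" "\<epsilon> \<le> \<epsilon>'" shows "kernel_oscillation_le r0 \<epsilon>'"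
proof -
  obtain \<delta> where \<delta>: "\<delta> > 0" and *: "\<And>r r' g g'. r \<in> \<rat> \<Longrightarrow> r' \<in> \<rat> \<Longrightarrow> \<bar>r - r0\<bar> < \<delta> \<Longrightarrow> \<bar>r' - r0\<bar> < \<delta> \<Longrightarrow>
     free_kernel (pi * r) g \<Longrightarrow> free_kernel (pi * r') g' \<Longrightarrow> near_agree \<epsilon> \<delta> g g'"
    using assms unfolding kernel_oscillation_le_def by blast
  have "near_agree \<epsilon>' \<delta> g g'" if r: "r \<in> \<rat>" "r' \<in> \<rat>" "\<bar>r - r0\<bar> < \<delta>" "\<bar>r' - r0\<bar> < \<delta>"
    and g: "free_kernel (pi * r) g" "free_kernel (pi * r') g'" for r r' g g'
    by (rule near_agree_weaken[OF *[OF r g] assms(2)])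
  then show ?thesis using \<delta> unfolding kernel_oscillation_le_def by blast
qed

lemma kernel_oscillation_le_shift:
  assumes "kernel_oscillation_le r0 \<epsilon>" shows "kernel_oscillation_le (r0 + of_int n) \<epsilon>"
proof -
  obtain \<delta> where \<delta>: "\<delta> > 0" and *: "\<And>r r' g g'. r \<in> \<rat> \<Longrightarrow> r' \<in> \<rat> \<Longrightarrow> \<bar>r - r0\<bar> < \<delta> \<Longrightarrow> \<bar>r' - r0\<bar> < \<delta> \<Longrightarrow>
     free_kernel (pi * r) g \<Longrightarrow> free_kernel (pi * r') g' \<Longrightarrow> near_agree \<epsilon> \<delta> g g'"
    using assms unfolding kernel_oscillation_le_def by blast
  have "near_agree \<epsilon> \<delta> g g'" if r: "r \<in> \<rat>" "r' \<in> \<rat>" "\<bar>r - (r0 + of_int n)\<bar> < \<delta>" "\<bar>r' - (r0 + of_int n)\<bar> < \<delta>"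
    and g: "free_kernel (pi * r) g" "free_kernel (pi * r') g'" for r r' g g'
  proof -
    have e: "pi * r + pi * of_int (- n) = pi * (r - of_int n)" for r by (simp add: algebra_simps)
    have "near_agree \<epsilon> \<delta> (\<lambda>x. g (x + pi * of_int (- n))) (\<lambda>x. g' (x + pi * of_int (- n)))"
      using r free_kernel_translate[OF g(1), of "- n"] free_kernel_translate[OF g(2), of "- n"] unfolding e
      by (intro *[of "r - of_int n" "r' - of_int n"]) (auto simp: algebra_simps)
    from near_agreeD[OF this] obtain P where P: "AE x in lebesgue. P x"
      "\<And>x y. P x \<Longrightarrow> P y \<Longrightarrow> \<bar>x - y\<bar> < \<delta> \<Longrightarrow> cmod (g (x + pi * of_int (- n)) - g' (y + pi * of_int (- n))) \<le> \<epsilon>"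
      by blast
    have A: "AE x in lebesgue. P (1 * x + pi * of_int n)" by (rule AE_lebesgue_affine[OF P(1)]) auto
    show ?thesis
    proof (rule near_agreeI[OF A A])
      fix x y assume "P (1 * x + pi * of_int n)" "P (1 * y + pi * of_int n)" "\<bar>x - y\<bar> < \<delta>"
      then show "cmod (g x - g' y) \<le> \<epsilon>" using P(2)[of "x + pi * of_int n" "y + pi * of_int n"] by simp
    qed
  qed
  then show ?thesis using \<delta> unfolding kernel_oscillation_le_def by blast
qed

lemma kernel_oscillation_le_minus:
  assumes "kernel_oscillation_le r0 \<epsilon>" shows "kernel_oscillation_le (- r0) \<epsilon>"
proof -
  obtain \<delta> where \<delta>: "\<delta> > 0" and *: "\<And>r r' g g'. r \<in> \<rat> \<Longrightarrow> r' \<in> \<rat> \<Longrightarrow> \<bar>r - r0\<bar> < \<delta> \<Longrightarrow> \<bar>r' - r0\<bar> < \<delta> \<Longrightarrow>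
     free_kernel (pi * r) g \<Longrightarrow> free_kernel (pi * r') g' \<Longrightarrow> near_agree \<epsilon> \<delta> g g'"
    using assms unfolding kernel_oscillation_le_def by blast
  have "near_agree \<epsilon> \<delta> g g'" if r: "r \<in> \<rat>" "r' \<in> \<rat>" "\<bar>r - (- r0)\<bar> < \<delta>" "\<bar>r' - (- r0)\<bar> < \<delta>"
    and g: "free_kernel (pi * r) g" "free_kernel (pi * r') g'" for r r' g g'
  proof -
    have "near_agree \<epsilon> \<delta> (\<lambda>x. - cnj (g x)) (\<lambda>x. - cnj (g' x))"
      using r free_kernel_cnj[OF g(1)] free_kernel_cnj[OF g(2)]
      by (intro *[of "- r" "- r'"]) auto
    moreover have "cmod (- cnj a - - cnj b) = cmod (a - b)" for a b
    proof -
      have "- cnj a - - cnj b = - cnj (a - b)" by simp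
      then show ?thesis by (simp only: norm_minus_cancel complex_mod_cnj)
    qed
    ultimately show ?thesis unfolding near_agree_def by simp
  qed
  then show ?thesis using \<delta> unfolding kernel_oscillation_le_def by blast
qed

text \<open>Start of the iteration, from twice the uniform bound.\<close>

lemma kernel_oscillation_le_trivial: "kernel_oscillation_le r0 400"
proof -
  have "near_agree 400 1 g g'" if r: "r \<in> \<rat>" "r' \<in> \<rat>" and g: "free_kernel (pi * r) g" "free_kernel (pi * r') g'" for r r' g g'
  proof (rule near_agreeI[OF kernel_bound[OF _ g(1)] kernel_bound[OF _ g(2)]])
    fix x y assume "cmod (g x) \<le> 200" "cmod (g' y) \<le> 200"
    then show "cmod (g x - g' y) \<le> 400" using norm_triangle_ineq4[of "g x" "g' y"] by linarith
  qed (use r pi_rationals_iff in auto)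
  then show ?thesis unfolding kernel_oscillation_le_def by (intro exI[of _ 1]) auto
qed

lemma uniformly_continuous_compact_pair:
  fixes F :: "real \<times> real \<Rightarrow> 'a::metric_space"
  assumes "continuous_on K F" "compact K" "e > 0"
  shows "\<exists>d>0. \<forall>p\<in>K. \<forall>q\<in>K. \<bar>fst p - fst q\<bar> + \<bar>snd p - snd q\<bar> < d \<longrightarrow> dist (F p) (F q) < e"
proof -
  obtain d where d: "d > 0" "\<And>p q. p \<in> K \<Longrightarrow> q \<in> K \<Longrightarrow> dist q p < d \<Longrightarrow> dist (F q) (F p) < e"
    using compact_uniformly_continuous[OF assms(1,2)] assms(3) unfolding uniformly_continuous_on_def by metis
  have le: "dist p q \<le> \<bar>fst p - fst q\<bar> + \<bar>snd p - snd q\<bar>" for p q :: "real \<times> real"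
    unfolding dist_prod_def using sqrt_sum_squares_le_sum_abs[of "dist (fst p) (fst q)" "dist (snd p) (snd q)"]
    by (simp add: dist_real_def)
  show ?thesis
  proof (intro exI[of _ d] conjI ballI impI d(1))
    fix p q assume "p \<in> K" "q \<in> K" "\<bar>fst p - fst q\<bar> + \<bar>snd p - snd q\<bar> < d"
    then show "dist (F p) (F q) < e" using d(2)[of q p] le[of p q] by auto
  qed
qed

text \<open>The functional equations at two nearby points of space-time are subtracted. The regular
  term and the factor \<open>W\<close> vary little by uniform continuity, and the dual kernels, at
  times near - 1 / r0, differ by at most \<epsilon>. The budget is \<epsilon>/40 for the regular
  term, 200 \<epsilon>/8000 for the factor and 3/4 \<epsilon> for the dual kernels.\<close>

lemma kernel_oscillation_le_step:
  assumes r0: "0 < r0" "r0 < 1 / 2" and \<epsilon>: "\<epsilon> > 0" and osc: "kernel_oscillation_le (- 1 / r0) \<epsilon>"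
  shows "kernel_oscillation_le r0 (4 / 5 * \<epsilon>)"
proof -
  obtain \<delta>1 where \<delta>1: "\<delta>1 > 0" and osc1: "\<And>r r' g g'. r \<in> \<rat> \<Longrightarrow> r' \<in> \<rat> \<Longrightarrow> \<bar>r - - 1 / r0\<bar> < \<delta>1 \<Longrightarrow> \<bar>r' - - 1 / r0\<bar> < \<delta>1 \<Longrightarrow>
     free_kernel (pi * r) g \<Longrightarrow> free_kernel (pi * r') g' \<Longrightarrow> near_agree \<epsilon> \<delta>1 g g'"
    using osc unfolding kernel_oscillation_le_def by blast
  define t0 where "t0 = pi * r0"
  have t0: "t0 > 0" using r0 by (simp add: t0_def)
  define K where "K = {t0/2..2*t0} \<times> {- (3*pi/2)..3*pi/2}"
  have K: "compact K" unfolding K_def by (intro compact_Times compact_Icc)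
  have Kpos: "\<And>p. p \<in> K \<Longrightarrow> fst p > 0" using t0 by (auto simp: K_def)
  define W where "W t x = t / step_evolution_lim t * cis (x\<^sup>2 / (4 * t))" for t x
  have contA: "continuous_on K (\<lambda>p. kernel_regular (fst p) (snd p))"
    unfolding K_def using t0 by (intro continuous_kernel_regular) auto
  have c1: "continuous_on K (\<lambda>p. complex_of_real (fst p))" "continuous_on K (\<lambda>p. step_evolution_lim (fst p))"
    unfolding step_evolution_lim_def
    by (intro continuous_on_mult continuous_on_const continuous_on_of_real continuous_on_real_sqrt continuous_on_fst continuous_on_id)+
  have c2: "continuous_on K (\<lambda>p. (snd p)\<^sup>2)" "continuous_on K (\<lambda>p. 4 * fst p)" by (auto intro!: continuous_intros)
  have c3: "\<forall>p\<in>K. step_evolution_lim (fst p) \<noteq> 0" "\<forall>p\<in>K. 4 * fst p \<noteq> 0" "\<forall>p\<in>K. fst p \<noteq> 0"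
  proof -
    show "\<forall>p\<in>K. step_evolution_lim (fst p) \<noteq> 0" using Kpos step_evolution_lim_nz by blast
    show "\<forall>p\<in>K. fst p \<noteq> 0" using Kpos by (metis less_irrefl)
    then show "\<forall>p\<in>K. 4 * fst p \<noteq> 0" by simp
  qed
  have contW: "continuous_on K (\<lambda>p. W (fst p) (snd p))"
    unfolding W_def
    by (rule continuous_on_mult[OF continuous_on_divide[OF c1 c3(1)] continuous_on_cis[OF continuous_on_divide[OF c2 c3(2)]]])
  have contP: "continuous_on K (\<lambda>p. - pi / fst p * snd p)"
    by (rule continuous_on_mult[OF continuous_on_divide[OF continuous_on_const continuous_on_fst[OF continuous_on_id] c3(3)] continuous_on_snd[OF continuous_on_id]])
  obtain dA where dA: "dA > 0" "\<forall>p\<in>K. \<forall>q\<in>K. \<bar>fst p - fst q\<bar> + \<bar>snd p - snd q\<bar> < dA \<longrightarrow> dist (kernel_regular (fst p) (snd p)) (kernel_regular (fst q) (snd q)) < \<epsilon> / 40"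
    using uniformly_continuous_compact_pair[OF contA K, of "\<epsilon> / 40"] \<epsilon> by auto
  obtain dW where dW: "dW > 0" "\<forall>p\<in>K. \<forall>q\<in>K. \<bar>fst p - fst q\<bar> + \<bar>snd p - snd q\<bar> < dW \<longrightarrow> dist (W (fst p) (snd p)) (W (fst q) (snd q)) < \<epsilon> / 8000"
    using uniformly_continuous_compact_pair[OF contW K, of "\<epsilon> / 8000"] \<epsilon> by auto
  obtain dP where dP: "dP > 0" "\<forall>p\<in>K. \<forall>q\<in>K. \<bar>fst p - fst q\<bar> + \<bar>snd p - snd q\<bar> < dP \<longrightarrow> dist (- pi / fst p * snd p) (- pi / fst q * snd q) < \<delta>1"
    using uniformly_continuous_compact_pair[OF contP K \<delta>1] by auto
  have "isCont (\<lambda>r. - 1 / r) r0" using r0 by (intro continuous_intros) auto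
  then obtain dI where dI: "dI > 0" "\<And>r. \<bar>r - r0\<bar> < dI \<Longrightarrow> \<bar>- 1 / r - - 1 / r0\<bar> < \<delta>1"
    using \<delta>1 unfolding continuous_at_eps_delta dist_real_def by metis
  define d where "d = Min {dA, dW, dP}"
  have d: "d > 0" "d \<le> dA" "d \<le> dW" "d \<le> dP" using dA(1) dW(1) dP(1) by (auto simp: d_def)
  \<comment> \<open>As \<pi> < 4, the times differ by at most 8 \<delta>, so d / 16 keeps the total
    distance below d. The entry 1/16 gives r' < 9/16, hence sqrt r' at most 3/4, and r0 / 2 keeps
    the times between t0 / 2 and 2 t0.\<close>
  define \<delta> where "\<delta> = Min {d / 16, dI, r0 / 2, 1 / 16}"
  have \<delta>: "\<delta> > 0" "\<delta> \<le> d / 16" "\<delta> \<le> dI" "\<delta> \<le> r0 / 2" "\<delta> \<le> 1 / 16" using d dI(1) r0 by (auto simp: \<delta>_def)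
  have main: "near_agree (4 / 5 * \<epsilon>) \<delta> g g'" if r: "r \<in> \<rat>" "r' \<in> \<rat>" "\<bar>r - r0\<bar> < \<delta>" "\<bar>r' - r0\<bar> < \<delta>"
    and g: "free_kernel (pi * r) g" "free_kernel (pi * r') g'" for r r' g g'
  proof -
    define t where "t = pi * r" define t' where "t' = pi * r'"
    have rpos: "r > r0 / 2" "r' > r0 / 2" "r < 2 * r0" "r' < 2 * r0" using r \<delta> r0 by linarith+
    have r'0: "r > 0" "r' > 0" using rpos r0 by linarith+
    then have t: "t > 0" "t' > 0" by (simp_all add: t_def t'_def)
    have tK: "t \<in> {t0/2..2*t0}" "t' \<in> {t0/2..2*t0}" using rpos by (simp_all add: t_def t'_def t0_def)
    have inv: "- (pi\<^sup>2 / t) = pi * (- 1 / r)" "- (pi\<^sup>2 / t') = pi * (- 1 / r')"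
      using r'0 by (simp_all add: t_def t'_def power2_eq_square)
    have ir: "- 1 / r \<in> \<rat>" "- 1 / r' \<in> \<rat>" using r by auto
    obtain h where h: "free_kernel (- (pi\<^sup>2 / t)) h" using free_kernel_exists pi_rationals_iff ir(1) unfolding inv by blast
    obtain h' where h': "free_kernel (- (pi\<^sup>2 / t')) h'" using free_kernel_exists pi_rationals_iff ir(2) unfolding inv by blast
    have "near_agree \<epsilon> \<delta>1 h h'"
      using osc1[OF ir dI(2) dI(2) h[unfolded inv] h'[unfolded inv]] r \<delta> by linarith
    from near_agreeD[OF this] obtain P where P: "AE x in lebesgue. P x" "\<And>x y. P x \<Longrightarrow> P y \<Longrightarrow> \<bar>x - y\<bar> < \<delta>1 \<Longrightarrow> cmod (h x - h' y) \<le> \<epsilon>"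
      by blast
    have hb: "AE x in lebesgue. cmod (h x) \<le> 200"
    proof (rule kernel_bound[OF _ h])
      show "- (pi\<^sup>2 / t) \<in> pi_rationals" unfolding inv pi_rationals_iff by (rule ir(1))
    qed
    have c: "- pi / t \<noteq> 0" "- pi / t' \<noteq> 0" using t by auto
    define \<Phi> where "\<Phi> x \<longleftrightarrow> (\<bar>x\<bar> \<le> 3 * pi / 2 \<longrightarrow> g x = kernel_regular t x - W t x * h (- pi / t * x)) \<and> cmod (h (- pi / t * x)) \<le> 200 \<and> P (- pi / t * x)" for x
    define \<Psi> where "\<Psi> x \<longleftrightarrow> (\<bar>x\<bar> \<le> 3 * pi / 2 \<longrightarrow> g' x = kernel_regular t' x - W t' x * h' (- pi / t' * x)) \<and> P (- pi / t' * x)" for x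
    have \<Phi>: "AE x in lebesgue. \<Phi> x"
      unfolding \<Phi>_def W_def using kernel_functional_equation[OF t(1) g(1)[folded t_def] h] AE_lebesgue_affine[OF hb c(1), of 0] AE_lebesgue_affine[OF P(1) c(1), of 0]
      by eventually_elim simp
    have \<Psi>: "AE x in lebesgue. \<Psi> x"
      unfolding \<Psi>_def W_def using kernel_functional_equation[OF t(2) g(2)[folded t'_def] h'] AE_lebesgue_affine[OF P(1) c(2), of 0]
      by eventually_elim simp
    have \<Phi>m: "AE x in lebesgue. \<forall>m::int. \<Phi> (1 * x + 2 * pi * of_int m)"
      unfolding AE_all_countable by (intro allI AE_lebesgue_affine[OF \<Phi>]) auto
    have \<Psi>m: "AE x in lebesgue. \<forall>m::int. \<Psi> (1 * x + 2 * pi * of_int m)"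
      unfolding AE_all_countable by (intro allI AE_lebesgue_affine[OF \<Psi>]) auto
    show ?thesis
    proof (rule near_agreeI[OF \<Phi>m \<Psi>m])
      fix x y assume xy: "\<forall>m::int. \<Phi> (1 * x + 2 * pi * of_int m)" "\<forall>m::int. \<Psi> (1 * y + 2 * pi * of_int m)" "\<bar>x - y\<bar> < \<delta>"
      obtain m :: int where m: "x + pi + 2 * pi * of_int m \<in> {0..<2*pi}" using real_mod_2pi by blast
      define x' where "x' = x + 2 * pi * of_int m"
      \<comment> \<open>The same multiple of 2 \<pi> moves both points. \<open>y'\<close> may leave
        [-\<pi>, \<pi>] but not the wider window of the functional equation.\<close>
      define y' where "y' = y + 2 * pi * of_int m"
      have "\<bar>x'\<bar> \<le> pi" using m by (auto simp: x'_def)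
      moreover have xy': "\<bar>x' - y'\<bar> < \<delta>" using xy(3) by (simp add: x'_def y'_def)
      ultimately have xw: "\<bar>x'\<bar> \<le> 3 * pi / 2" "\<bar>y'\<bar> \<le> 3 * pi / 2" using \<delta>(5) pi_gt3 by linarith+
      have \<Phi>x: "\<Phi> x'" "\<Psi> y'" using xy(1,2) by (auto simp: x'_def y'_def)
      have gx: "g x = g x'" "g' y = g' y'" using g by (simp_all add: x'_def y'_def free_kernel_def periodic_int)
      have inK: "(t, x') \<in> K" "(t', y') \<in> K" using tK xw by (auto simp: K_def)
      have "\<bar>t - t'\<bar> = pi * \<bar>r - r'\<bar>" unfolding t_def t'_def by (simp add: abs_mult flip: right_diff_distrib)
      also have "\<dots> \<le> 4 * (2 * \<delta>)" using r pi_less_4 by (intro mult_mono) auto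
      finally have dist: "\<bar>fst (t, x') - fst (t', y')\<bar> + \<bar>snd (t, x') - snd (t', y')\<bar> < d"
        using xy' \<delta> d by simp
      have "\<bar>fst (t, x') - fst (t', y')\<bar> + \<bar>snd (t, x') - snd (t', y')\<bar> < dA"
        "\<bar>fst (t, x') - fst (t', y')\<bar> + \<bar>snd (t, x') - snd (t', y')\<bar> < dW"
        "\<bar>fst (t, x') - fst (t', y')\<bar> + \<bar>snd (t, x') - snd (t', y')\<bar> < dP"
        using dist d by linarith+
      note dist3 = dA(2)[THEN bspec, OF inK(1), THEN bspec, OF inK(2), THEN mp, OF this(1)]
        dW(2)[THEN bspec, OF inK(1), THEN bspec, OF inK(2), THEN mp, OF this(2)]
        dP(2)[THEN bspec, OF inK(1), THEN bspec, OF inK(2), THEN mp, OF this(3)]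
      have A: "cmod (kernel_regular t x' - kernel_regular t' y') \<le> \<epsilon> / 40"
        using dist3(1) by (simp add: dist_norm)
      have Wd: "cmod (W t x' - W t' y') \<le> \<epsilon> / 8000"
        using dist3(2) by (simp add: dist_norm)
      have Pd: "\<bar>- pi / t * x' - - pi / t' * y'\<bar> < \<delta>1"
        using dist3(3) by (simp add: dist_real_def)
      have hd: "cmod (h (- pi / t * x') - h' (- pi / t' * y')) \<le> \<epsilon>" using P(2)[OF _ _ Pd] \<Phi>x by (auto simp: \<Phi>_def \<Psi>_def)
      have hB: "cmod (h (- pi / t * x')) \<le> 200" using \<Phi>x by (auto simp: \<Phi>_def)
      have Wn: "cmod (W t' y') \<le> 3 / 4"
      proof -
        have "cmod (W t' y') = sqrt (t' / pi)" unfolding W_def by (rule norm_dual_factor[OF t(2)])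
        also have "\<dots> \<le> 3 / 4"
        proof (rule real_le_lsqrt)
          have "t' / pi = r'" by (simp add: t'_def)
          then show "t' / pi \<le> (3 / 4)\<^sup>2" using r(4) \<delta>(5) r0 by (simp add: power2_eq_square abs_if split: if_splits)
        qed (use t in auto)
        finally show ?thesis .
      qed
      have "g x - g' y = (kernel_regular t x' - kernel_regular t' y') - (W t x' - W t' y') * h (- pi / t * x')
          - W t' y' * (h (- pi / t * x') - h' (- pi / t' * y'))"
        using \<Phi>x xw unfolding gx \<Phi>_def \<Psi>_def by (simp add: algebra_simps)
      also have "cmod \<dots> \<le> cmod (kernel_regular t x' - kernel_regular t' y') + cmod ((W t x' - W t' y') * h (- pi / t * x'))
          + cmod (W t' y' * (h (- pi / t * x') - h' (- pi / t' * y')))"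
        by (rule order.trans[OF norm_triangle_ineq4 add_right_mono[OF norm_triangle_ineq4]])
      also have "\<dots> \<le> \<epsilon> / 40 + \<epsilon> / 8000 * 200 + 3 / 4 * \<epsilon>"
        unfolding norm_mult using A Wd hB Wn hd \<epsilon> by (intro add_mono mult_mono) auto
      also have "\<dots> = 4 / 5 * \<epsilon>" by simp
      finally show "cmod (g x - g' y) \<le> 4 / 5 * \<epsilon>" .
    qed
  qed
  then show ?thesis using \<delta>(1) unfolding kernel_oscillation_le_def by blast
qed

text \<open>The hypothesis ranges over all irrational points because the step at r calls it at - 1 /
  r. Translation and reflection first bring the point into (0, 1/2), whose ends are excluded by
  irrationality.\<close>

lemma kernel_oscillation_le_contract:
  assumes osc: "\<And>r0. r0 \<notin> \<rat> \<Longrightarrow> kernel_oscillation_le r0 \<epsilon>" and \<epsilon>: "\<epsilon> > 0" and r0: "r0 \<notin> \<rat>"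
  shows "kernel_oscillation_le r0 (4 / 5 * \<epsilon>)"
proof -
  have pos: "kernel_oscillation_le r (4 / 5 * \<epsilon>)" if "0 < r" "r < 1 / 2" "r \<notin> \<rat>" for r
  proof (rule kernel_oscillation_le_step[OF that(1,2) \<epsilon> osc])
    show "- 1 / r \<notin> \<rat>"
    proof
      assume a: "- 1 / r \<in> \<rat>"
      have "- 1 / (- 1 / r) \<in> \<rat>" by (rule Rats_divide[OF _ a]) auto
      then show False using that by simp
    qed
  qed
  define n where "n = round r0"
  define r where "r = r0 - of_int n"
  have r: "r \<notin> \<rat>"
  proof
    assume "r \<in> \<rat>"
    then have "r + of_int n \<in> \<rat>" by (intro Rats_add) auto
    then show False using r0 by (simp add: r_def)
  qed
  have "\<bar>r\<bar> \<le> 1 / 2" unfolding r_def n_def using of_int_round_abs_le[of r0] by (simp add: abs_minus_commute)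
  moreover have "r \<noteq> 0" "r \<noteq> 1 / 2" "r \<noteq> - 1 / 2"
  proof -
    have "(0::real) \<in> \<rat>" "(1 / 2 :: real) \<in> \<rat>" "(- 1 / 2 :: real) \<in> \<rat>" by (auto intro!: Rats_divide simp del: minus_divide_left)
    then show "r \<noteq> 0" "r \<noteq> 1 / 2" "r \<noteq> - 1 / 2" using r by blast+
  qed
  ultimately have "0 < r \<and> r < 1 / 2 \<or> 0 < - r \<and> - r < 1 / 2" by linarith
  then have "kernel_oscillation_le r (4 / 5 * \<epsilon>)"
  proof
    assume "0 < - r \<and> - r < 1 / 2"
    moreover have "- r \<notin> \<rat>" using r by simp
    ultimately show ?thesis using kernel_oscillation_le_minus[OF pos[of "- r"]] by simp
  qed (use pos r in auto)
  from kernel_oscillation_le_shift[OF this, of n] show ?thesis by (simp add: r_def)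
qed

theorem kernel_oscillation_irrational:
  assumes "r0 \<notin> \<rat>" "\<epsilon> > 0" shows "kernel_oscillation_le r0 \<epsilon>"
proof -
  have iter: "kernel_oscillation_le r ((4 / 5) ^ n * 400)" if "r \<notin> \<rat>" for n r
    using that
  proof (induction n arbitrary: r)
    case 0
    then show ?case using kernel_oscillation_le_trivial by simp
  next
    case (Suc n)
    have "kernel_oscillation_le r (4 / 5 * ((4 / 5) ^ n * 400))"
      by (rule kernel_oscillation_le_contract[OF Suc.IH]) (use Suc.prems in auto)
    then show ?case by (simp add: mult.assoc)
  qed
  have "\<exists>n. (4 / 5 :: real) ^ n < \<epsilon> / 400" by (rule real_arch_pow_inv) (use assms in auto)
  then obtain n where "(4 / 5 :: real) ^ n < \<epsilon> / 400" ..
  then have n: "(4 / 5) ^ n * 400 \<le> \<epsilon>" by simp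
  show ?thesis by (rule kernel_oscillation_le_mono[OF iter[OF assms(1)] n])
qed

text \<open>Away from 0 the regular term is within O(sqrt t) of the sawtooth, and the dual term is
  sqrt r times a kernel bounded by 200. Negative times follow by conjugation.\<close>

theorem kernel_near_zero:
  assumes \<eta>: "\<eta> > 0" and \<epsilon>: "\<epsilon> > 0"
  shows "\<exists>\<delta>>0. \<forall>r\<in>\<rat>. \<bar>r\<bar> < \<delta> \<longrightarrow> (\<forall>g. free_kernel (pi * r) g \<longrightarrow>
     (AE x in lebesgue. \<eta> \<le> \<bar>x\<bar> \<longrightarrow> \<bar>x\<bar> \<le> pi \<longrightarrow> cmod (g x - sawtooth x) \<le> \<epsilon>))"
proof -
  \<comment> \<open>The two errors together are at most \<open>sqrt r * D\<close>; the leading 2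
    bounds \<open>sqrt pi\<close>.\<close>
  define D where "D = 2 * (8 / \<eta> + 16) + 200"
  have D: "D > 0" using \<eta> by (simp add: D_def add_pos_pos)
  define \<delta> where "\<delta> = (\<epsilon> / D)\<^sup>2"
  have \<delta>: "\<delta> > 0" using \<epsilon> D by (simp add: \<delta>_def)
  have pos: "AE x in lebesgue. \<eta> \<le> \<bar>x\<bar> \<longrightarrow> \<bar>x\<bar> \<le> pi \<longrightarrow> cmod (g x - sawtooth x) \<le> \<epsilon>"
    if r: "r \<in> \<rat>" "0 < r" "r < \<delta>" and g: "free_kernel (pi * r) g" for r g
  proof -
    define t where "t = pi * r"
    have t: "t > 0" using r by (simp add: t_def)
    have inv: "- (pi\<^sup>2 / t) = pi * (- 1 / r)" using r by (simp add: t_def power2_eq_square)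
    have tq: "- (pi\<^sup>2 / t) \<in> pi_rationals" unfolding inv pi_rationals_iff using r by auto
    then obtain h where h: "free_kernel (- (pi\<^sup>2 / t)) h" using free_kernel_exists by blast
    have c: "- pi / t \<noteq> 0" using t by simp
    show ?thesis
      using kernel_functional_equation[OF t g[folded t_def] h] AE_lebesgue_affine[OF kernel_bound[OF tq h] c, of 0]
    proof eventually_elim
      case (elim x)
      show ?case
      proof (intro impI)
        assume x: "\<eta> \<le> \<bar>x\<bar>" "\<bar>x\<bar> \<le> pi"
        have x': "\<bar>x\<bar> \<le> 3 * pi / 2" using x by linarith
        have sr: "sqrt t = sqrt pi * sqrt r" by (simp add: t_def real_sqrt_mult)
        have sp: "sqrt pi \<le> 2" using pi_less_4 real_le_lsqrt[of 2 pi] by simp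
        have "cmod (kernel_regular t x - sawtooth x) \<le> sqrt t * (8 / \<bar>x\<bar> + 16)"
          using x \<eta> by (intro kernel_regular_near_sawtooth t) auto
        also have "\<dots> \<le> (2 * sqrt r) * (8 / \<eta> + 16)"
          unfolding sr using x \<eta> sp r by (intro mult_mono add_mono divide_left_mono) auto
        finally have 1: "cmod (kernel_regular t x - sawtooth x) \<le> (2 * sqrt r) * (8 / \<eta> + 16)" .
        have "cmod (t / step_evolution_lim t * cis (x\<^sup>2 / (4 * t)) * h (- pi / t * x)) \<le> sqrt r * 200"
          using elim(2) unfolding norm_mult[of "_ * _" "h _"] norm_dual_factor[OF t] using r by (intro mult_mono) (auto simp: t_def)
        moreover have gx: "g x - sawtooth x = (kernel_regular t x - sawtooth x) - t / step_evolution_lim t * cis (x\<^sup>2 / (4 * t)) * h (- pi / t * x)"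
          using elim(1) x' by simp
        ultimately have "cmod (g x - sawtooth x) \<le> (2 * sqrt r) * (8 / \<eta> + 16) + sqrt r * 200"
          unfolding gx using 1 norm_triangle_ineq4[of "kernel_regular t x - sawtooth x" "t / step_evolution_lim t * cis (x\<^sup>2 / (4 * t)) * h (- pi / t * x)"] by linarith
        also have "\<dots> = sqrt r * D" by (simp add: D_def algebra_simps)
        also have "\<dots> \<le> sqrt \<delta> * D" using r D by (intro mult_right_mono) auto
        also have "\<dots> = \<epsilon>" using \<epsilon> D by (simp add: \<delta>_def)
        finally show "cmod (g x - sawtooth x) \<le> \<epsilon>" .
      qed
    qed
  qed
  have "AE x in lebesgue. \<eta> \<le> \<bar>x\<bar> \<longrightarrow> \<bar>x\<bar> \<le> pi \<longrightarrow> cmod (g x - sawtooth x) \<le> \<epsilon>"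
    if r: "r \<in> \<rat>" "\<bar>r\<bar> < \<delta>" and g: "free_kernel (pi * r) g" for r g
  proof -
    consider "r > 0" | "r = 0" | "r < 0" by linarith
    then show ?thesis
    proof cases
      case 1
      then show ?thesis using pos r g by auto
    next
      case 2
      then have "AE x in lebesgue. g x = sawtooth x" using free_kernel_unique[OF _ free_kernel_sawtooth] g by simp
      then show ?thesis by eventually_elim (use \<epsilon> in auto)
    next
      case 3
      have "free_kernel (pi * (- r)) (\<lambda>x. - cnj (g x))" using free_kernel_cnj[OF g] by simp
      then have "AE x in lebesgue. \<eta> \<le> \<bar>x\<bar> \<longrightarrow> \<bar>x\<bar> \<le> pi \<longrightarrow> cmod (- cnj (g x) - sawtooth x) \<le> \<epsilon>"
        using 3 r by (intro pos[of "- r"]) auto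
      moreover have "cmod (- cnj (g x) - sawtooth x) = cmod (g x - sawtooth x)" for x
      proof -
        have "- cnj (g x) - sawtooth x = - cnj (g x - sawtooth x)" by (simp add: sawtooth_def)
        then show ?thesis by (simp only: norm_minus_cancel complex_mod_cnj)
      qed
      ultimately show ?thesis by simp
    qed
  qed
  then show ?thesis using \<delta> by blast
qed

subsection \<open>Functions of bounded variation\<close>

text \<open>Bounded variation expressed by a monotone function on the whole line. Its increments
  telescope over subdivisions, which is how the sums over jumps are bounded.\<close>

definition bv_major :: "(real \<Rightarrow> complex) \<Rightarrow> (real \<Rightarrow> real) \<Rightarrow> bool" where
  "bv_major f v \<longleftrightarrow> mono v \<and> (\<forall>x y. x \<le> y \<longrightarrow> cmod (f y - f x) \<le> v y - v x)"

text \<open>The witness is the total variation on [0, x]. Appending x and y to a subdivision of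
  [0, x] gives one of [0, y] whose sum is larger by at least the increment of
  \<open>f\<close>.\<close>

lemma BV_variation_function:
  assumes "f \<in> BV"
  shows "\<exists>v. \<forall>x y. 0 \<le> x \<longrightarrow> x \<le> y \<longrightarrow> y \<le> 2 * pi \<longrightarrow> cmod (f y - f x) \<le> v y - (v x :: real)"
proof -
  obtain B where B: "\<And>(n::nat) (z :: nat \<Rightarrow> real). mono_on {..n} z \<Longrightarrow> z ` {..n} \<subseteq> {0..2*pi} \<Longrightarrow>
     (\<Sum>i<n. cmod (f (z (Suc i)) - f (z i))) \<le> B"
    using assms unfolding BV_def by auto
  define S where "S x = {s. \<exists>(n::nat) z. mono_on {..n} z \<and> z ` {..n} \<subseteq> {0..x} \<and> s = (\<Sum>i<n. cmod (f (z (Suc i)) - f (z i)))}" for x :: real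
  have "cmod (f y - f x) \<le> Sup (S y) - Sup (S x)" if xy: "0 \<le> x" "x \<le> y" "y \<le> 2 * pi" for x y
  proof -
    have bdd: "bdd_above (S y)"
    proof (rule bdd_aboveI[of _ B])
      fix s assume "s \<in> S y"
      then obtain n z where "mono_on {..n} z" "z ` {..n} \<subseteq> {0..y}" "s = (\<Sum>i<n. cmod (f (z (Suc i)) - f (z i)))"
        unfolding S_def by blast
      then show "s \<le> B" using B[of n z] xy by fastforce
    qed
    have ne: "S x \<noteq> {}"
    proof -
      have "(\<Sum>i<0. cmod (f 0 - f 0)) \<in> S x" unfolding S_def using xy
        by (intro CollectI exI[of _ 0] exI[of _ "\<lambda>_. 0"]) (auto intro: mono_onI)
      then show ?thesis by blast
    qed
    have "Sup (S x) \<le> Sup (S y) - cmod (f y - f x)"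
    proof (rule cSup_least[OF ne])
      fix s assume "s \<in> S x"
      then obtain n z where z: "mono_on {..n} z" "z ` {..n} \<subseteq> {0..x}" "s = (\<Sum>i<n. cmod (f (z (Suc i)) - f (z i)))"
        unfolding S_def by blast
      have z0: "z i \<in> {0..x}" if "i \<le> n" for i using z(2) that by auto
      define z' where "z' i = (if i \<le> n then z i else if i = Suc n then x else y)" for i
      have "mono_on {..n+2} z'"
      proof (rule mono_onI)
        fix i j assume ij: "i \<in> {..n+2}" "j \<in> {..n+2}" "i \<le> j"
        show "z' i \<le> z' j"
        proof (cases "j \<le> n")
          case True
          then show ?thesis using z(1) ij unfolding z'_def mono_on_def by auto
        next
          case False
          then show ?thesis using z0[of i] ij xy unfolding z'_def by (auto simp: not_le)
        qed
      qed
      moreover have "z' ` {..n+2} \<subseteq> {0..y}" using z0 xy unfolding z'_def by fastforce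
      ultimately have mem: "(\<Sum>i<n+2. cmod (f (z' (Suc i)) - f (z' i))) \<in> S y" unfolding S_def by blast
      have "(\<Sum>i<n+2. cmod (f (z' (Suc i)) - f (z' i))) = (\<Sum>i<n. cmod (f (z' (Suc i)) - f (z' i))) + cmod (f x - f (z n)) + cmod (f y - f x)"
        by (simp add: z'_def)
      moreover have "(\<Sum>i<n. cmod (f (z' (Suc i)) - f (z' i))) = s" unfolding z(3) by (intro sum.cong refl) (simp add: z'_def)
      ultimately have "s + cmod (f y - f x) \<le> (\<Sum>i<n+2. cmod (f (z' (Suc i)) - f (z' i)))" by simp
      also have "\<dots> \<le> Sup (S y)" by (rule cSup_upper[OF mem bdd])
      finally show "s \<le> Sup (S y) - cmod (f y - f x)" by simp
    qed
    then show ?thesis by simp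
  qed
  then show ?thesis by (intro exI[of _ "\<lambda>x. Sup (S x)"]) blast
qed

text \<open>The variation function of one period is extended to the line by adding its total
  increment once per period.\<close>

lemma BV_bv_major:
  assumes "f \<in> BV" shows "\<exists>v. bv_major f v"
proof -
  have per: "periodic f" using assms by (simp add: BV_def)
  obtain v where v: "\<And>x y. 0 \<le> x \<Longrightarrow> x \<le> y \<Longrightarrow> y \<le> 2 * pi \<Longrightarrow> cmod (f y - f x) \<le> v y - (v x :: real)"
    using BV_variation_function[OF assms] by blast
  have vm: "v x \<le> v y" if "0 \<le> x" "x \<le> y" "y \<le> 2 * pi" for x y using v[OF that] norm_ge_zero[of "f y - f x"] by linarith
  define m where "m x = \<lfloor>x / (2*pi)\<rfloor>" for x :: real
  define r where "r x = x - 2 * pi * of_int (m x)" for x :: real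
  have r: "0 \<le> r x" "r x < 2 * pi" for x
    unfolding r_def m_def using floor_divide_lower[of "2*pi" x] floor_divide_upper[of "2*pi" x] by (auto simp: algebra_simps)
  have fr: "f x = f (r x)" for x using periodic_int[OF per, of x "- m x"] by (simp add: r_def)
  have f0: "f (2 * pi) = f 0" using per unfolding periodic_def by (metis add_0)
  define V where "V = v (2 * pi) - v 0"
  have V: "V \<ge> 0" using vm[of 0 "2*pi"] by (simp add: V_def)
  define w where "w x = v (r x) + of_int (m x) * V" for x
  have w: "cmod (f y - f x) \<le> w y - w x" if "x \<le> y" for x y
  proof -
    have mm: "m x \<le> m y" unfolding m_def using that by (intro floor_mono divide_right_mono) auto
    show ?thesis
    proof (cases "m x = m y")
      case True
      then have "r x \<le> r y" using that by (simp add: r_def)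
      then have "cmod (f (r y) - f (r x)) \<le> v (r y) - v (r x)" using r[of x] r[of y] by (intro v) auto
      then show ?thesis using True by (simp add: w_def fr[symmetric])
    next
      case False
      then have "1 \<le> (of_int (m y) - of_int (m x) :: real)" using mm by linarith
      then have VV: "V \<le> (of_int (m y) - of_int (m x)) * V" using V mult_right_mono[of 1 "of_int (m y) - of_int (m x)" V] by simp
      have "f y - f x = (f (r y) - f 0) + (f (2 * pi) - f (r x))" using f0 fr[of x] fr[of y] by simp
      then have "cmod (f y - f x) \<le> cmod (f (r y) - f 0) + cmod (f (2 * pi) - f (r x))" by (simp only: norm_triangle_ineq)
      also have "\<dots> \<le> (v (r y) - v 0) + (v (2*pi) - v (r x))" using r[of x] r[of y] by (intro add_mono v) auto
      also have "\<dots> \<le> w y - w x" using VV by (simp add: w_def V_def algebra_simps)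
      finally show ?thesis .
    qed
  qed
  have "mono w"
  proof (rule monoI)
    fix x y :: real assume "x \<le> y"
    then show "w x \<le> w y" using w[of x y] norm_ge_zero[of "f y - f x"] by linarith
  qed
  then show ?thesis using w unfolding bv_major_def by blast
qed

lemma bv_major_isCont: "bv_major f v \<Longrightarrow> isCont v x \<Longrightarrow> isCont f x"
proof -
  assume f: "bv_major f v" and c: "isCont v x"
  have "\<bar>y - x\<bar> = \<bar>y - x\<bar> \<Longrightarrow> cmod (f y - f x) \<le> \<bar>v y - v x\<bar>" for y
    using f unfolding bv_major_def by (cases "x \<le> y") (metis abs_ge_self order.trans, metis abs_ge_self abs_minus_commute linear norm_minus_commute order.trans)
  then have le: "cmod (f y - f x) \<le> \<bar>v y - v x\<bar>" for y by simp
  have "((\<lambda>y. f y - f x) \<longlongrightarrow> 0) (at x)"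
  proof (rule Lim_null_comparison)
    show "\<forall>\<^sub>F y in at x. norm (f y - f x) \<le> \<bar>v y - v x\<bar>" using le by (intro always_eventually) auto
    have "((\<lambda>y. v y - v x) \<longlongrightarrow> 0) (at x)" using c unfolding isCont_def by (rule LIM_zero)
    then show "((\<lambda>y. \<bar>v y - v x\<bar>) \<longlongrightarrow> 0) (at x)" by (rule tendsto_rabs_zero)
  qed
  then show ?thesis unfolding isCont_def by (rule LIM_zero_cancel)
qed

lemma bv_major_countable:
  assumes "bv_major f v" shows "countable {x. \<not> isCont f x}"
proof (rule countable_subset)
  show "{x. \<not> isCont f x} \<subseteq> {x. \<not> isCont v x}" using bv_major_isCont[OF assms] by blast
  show "countable {x. \<not> isCont v x}" using assms by (intro mono_ctble_discont) (simp add: bv_major_def)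
qed

lemma bv_major_bounded_periodic:
  assumes "bv_major f v" "periodic f" shows "bounded_periodic f"
  unfolding bounded_periodic_def
proof (intro conjI assms(2))
  show "f \<in> borel_measurable borel"
  proof (rule borel_measurable_continuous_countable_exceptions[OF bv_major_countable[OF assms(1)]])
    show "continuous_on (- {x. \<not> isCont f x}) f" by (auto intro!: continuous_at_imp_continuous_on)
  qed
  have "cmod (f x) \<le> cmod (f 0) + (v (2 * pi) - v 0)" for x
  proof -
    obtain m :: int where m: "x + 2 * pi * of_int m \<in> {0..<2*pi}" using real_mod_2pi by blast
    define y where "y = x + 2 * pi * of_int m"
    have "f x = f y" using periodic_int[OF assms(2)] by (simp add: y_def)
    moreover have "cmod (f y - f 0) \<le> v y - v 0" "v y \<le> v (2*pi)"
      using m assms(1) by (auto simp: bv_major_def y_def mono_def)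
    ultimately show ?thesis using norm_triangle_ineq2[of "f y" "f 0"] by auto
  qed
  then show "bounded (range f)" unfolding bounded_iff by blast
qed

lemma bv_major_translate: "bv_major f v \<Longrightarrow> bv_major (\<lambda>x. f (x + c)) (\<lambda>x. v (x + c))"
  unfolding bv_major_def mono_def by auto

lemma bv_major_sum:
  assumes "\<And>j. j \<in> J \<Longrightarrow> bv_major (f j) (v j)"
  shows "bv_major (\<lambda>x. \<Sum>j\<in>J. a j * f j x) (\<lambda>x. \<Sum>j\<in>J. cmod (a j) * v j x)"
  unfolding bv_major_def
proof (intro conjI allI impI)
  show "mono (\<lambda>x. \<Sum>j\<in>J. cmod (a j) * v j x)"
    using assms unfolding bv_major_def mono_def by (auto intro!: sum_mono mult_left_mono)
  fix x y :: real assume xy: "x \<le> y"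
  have "cmod ((\<Sum>j\<in>J. a j * f j y) - (\<Sum>j\<in>J. a j * f j x)) = cmod (\<Sum>j\<in>J. a j * (f j y - f j x))"
    by (simp add: sum_subtractf right_diff_distrib)
  also have "\<dots> \<le> (\<Sum>j\<in>J. cmod (a j) * (v j y - v j x))"
    using assms xy unfolding bv_major_def
    by (intro order.trans[OF norm_sum] sum_mono) (auto simp: norm_mult intro!: mult_left_mono)
  also have "\<dots> = (\<Sum>j\<in>J. cmod (a j) * v j y) - (\<Sum>j\<in>J. cmod (a j) * v j x)"
    by (simp add: sum_subtractf right_diff_distrib)
  finally show "cmod ((\<Sum>j\<in>J. a j * f j y) - (\<Sum>j\<in>J. a j * f j x)) \<le> (\<Sum>j\<in>J. cmod (a j) * v j y) - (\<Sum>j\<in>J. cmod (a j) * v j x)" .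
qed

lemma bv_major_superpose:
  assumes "bv_major f v" shows "\<exists>w. bv_major (superpose q c f) w"
  using bv_major_sum[of "{..<q}" "\<lambda>j x. f (x + - (2 * pi * real j / real q))" "\<lambda>j x. v (x + - (2 * pi * real j / real q))" c,
    OF bv_major_translate[OF assms]]
  unfolding superpose_def[abs_def] by blast

text \<open>A jump of the majorant at a continuity point of \<open>f\<close> is superfluous and can be removed.\<close>

lemma bv_major_continuous_at:
  assumes f: "bv_major f v" and c: "isCont f a"
  shows "\<exists>w. bv_major f w \<and> isCont w a"
proof -
  have v: "\<And>x y. x \<le> y \<Longrightarrow> v x \<le> v y" "\<And>x y. x \<le> y \<Longrightarrow> cmod (f y - f x) \<le> v y - v x"
    using f by (auto simp: bv_major_def mono_def)
  define L where "L = (SUP x\<in>{..<a}. v x)"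
  define R where "R = (INF x\<in>{a<..}. v x)"
  have bL: "bdd_above (v ` {..<a})" by (rule bdd_aboveI2[of _ _ "v a"]) (auto intro: v)
  have bR: "bdd_below (v ` {a<..})" by (rule bdd_belowI2[of _ "v a"]) (auto intro: v)
  have L: "v x \<le> L" if "x < a" for x unfolding L_def using that by (intro cSUP_upper bL) auto
  have R: "R \<le> v x" if "a < x" for x unfolding R_def using that by (intro cINF_lower bR) auto
  have L': "\<exists>x<a. L - e < v x" if "e > 0" for e
  proof -
    have "{..<a} \<noteq> {}" using lt_ex by auto
    then show ?thesis using less_cSUP_iff[OF _ bL, of "L - e"] that unfolding L_def by auto
  qed
  have R': "\<exists>x>a. v x < R + e" if "e > 0" for e
  proof -
    have "{a<..} \<noteq> {}" using gt_ex by auto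
    then show ?thesis using cINF_less_iff[OF _ bR, of "R + e"] that unfolding R_def by auto
  qed
  define w where "w x = (if x < a then v x else if x = a then L else v x - (R - L))" for x
  have near: "\<exists>\<delta>>0. \<forall>x. \<bar>x - a\<bar> < \<delta> \<longrightarrow> cmod (f x - f a) < e" if "e > 0" for e
    using c that unfolding continuous_at_eps_delta by (simp add: dist_norm)
  have left: "cmod (f a - f x) \<le> L - v x" if x: "x < a" for x
  proof (rule field_le_epsilon)
    fix e :: real assume "e > 0"
    then obtain \<delta> where \<delta>: "\<delta> > 0" "\<And>x. \<bar>x - a\<bar> < \<delta> \<Longrightarrow> cmod (f x - f a) < e" using near by blast
    define y where "y = max x (a - \<delta> / 2)"
    have y: "x \<le> y" "y < a" "\<bar>y - a\<bar> < \<delta>" using x \<delta>(1) by (auto simp: y_def)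
    have "cmod (f a - f x) \<le> cmod (f a - f y) + cmod (f y - f x)" using norm_triangle_ineq[of "f a - f y" "f y - f x"] by simp
    also have "\<dots> \<le> e + (v y - v x)" using \<delta>(2)[OF y(3)] v(2)[OF y(1)] by (auto simp: norm_minus_commute)
    finally show "cmod (f a - f x) \<le> L - v x + e" using L[OF y(2)] by simp
  qed
  have right: "cmod (f x - f a) \<le> v x - R" if x: "a < x" for x
  proof (rule field_le_epsilon)
    fix e :: real assume "e > 0"
    then obtain \<delta> where \<delta>: "\<delta> > 0" "\<And>x. \<bar>x - a\<bar> < \<delta> \<Longrightarrow> cmod (f x - f a) < e" using near by blast
    define y where "y = min x (a + \<delta> / 2)"
    have y: "y \<le> x" "a < y" "\<bar>y - a\<bar> < \<delta>" using x \<delta>(1) by (auto simp: y_def)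
    have "cmod (f x - f a) \<le> cmod (f x - f y) + cmod (f y - f a)" using norm_triangle_ineq[of "f x - f y" "f y - f a"] by simp
    also have "\<dots> \<le> (v x - v y) + e" using \<delta>(2)[OF y(3)] v(2)[OF y(1)] by auto
    finally show "cmod (f x - f a) \<le> v x - R + e" using R[OF y(2)] by simp
  qed
  have w: "cmod (f y - f x) \<le> w y - w x" if xy: "x \<le> y" for x y
  proof -
    consider "y < a" | "x < a" "y = a" | "x < a" "a < y" | "x = a" "y = a" | "x = a" "a < y" | "a < x" using xy by linarith
    then show ?thesis
    proof cases
      case 3
      have "cmod (f y - f x) \<le> cmod (f y - f a) + cmod (f a - f x)" using norm_triangle_ineq[of "f y - f a" "f a - f x"] by simp
      then show ?thesis using left[of x] right[of y] 3 by (simp add: w_def)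
    qed (use v(2)[OF xy] left[of x] right[of y] xy in \<open>auto simp: w_def\<close>)
  qed
  have "mono w"
  proof (rule monoI)
    fix x y :: real assume "x \<le> y"
    then show "w x \<le> w y" using w[of x y] norm_ge_zero[of "f y - f x"] by linarith
  qed
  moreover have "isCont w a" unfolding continuous_at_eps_delta
  proof (intro allI impI)
    fix e :: real assume e: "e > 0"
    obtain x1 where x1: "x1 < a" "L - e < v x1" using L'[OF e] by blast
    obtain x2 where x2: "x2 > a" "v x2 < R + e" using R'[OF e] by blast
    have "dist (w x) (w a) < e" if x: "dist x a < min (a - x1) (x2 - a)" for x
    proof -
      have "x1 \<le> x" "x \<le> x2" using x by (auto simp: dist_real_def)
      then have "w x1 \<le> w x" "w x \<le> w x2" using \<open>mono w\<close> by (auto simp: mono_def)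
      then show ?thesis using x1 x2 by (auto simp: dist_real_def w_def split: if_splits)
    qed
    then show "\<exists>d>0. \<forall>x. dist x a < d \<longrightarrow> dist (w x) (w a) < e"
      using x1(1) x2(1) by (intro exI[of _ "min (a - x1) (x2 - a)"]) auto
  qed
  ultimately show ?thesis using w unfolding bv_major_def by blast
qed

lemma isCont_real_eps:
  assumes "isCont (g :: real \<Rightarrow> complex) x" "e > 0"
  shows "\<exists>d>0. \<forall>z. \<bar>z - x\<bar> < d \<longrightarrow> cmod (g z - g x) < e"
  using assms unfolding continuous_at_eps_delta by (simp add: dist_norm)

lemma AE_lebesgue_obtain:
  assumes "AE x in lebesgue. P x" and "a < (b::real)"
  shows "\<exists>x. a < x \<and> x < b \<and> P x"
proof (rule ccontr)
  assume *: "\<not> ?thesis"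
  obtain N where N: "{x. \<not> P x} \<subseteq> N" "N \<in> null_sets lebesgue" using assms(1) unfolding eventually_ae_filter by auto
  have "{a<..<b} \<subseteq> N" using * N(1) by auto
  then have "negligible {a<..<b}" using N(2) negligible_subset by (auto simp: negligible_iff_null_sets[symmetric])
  then show False using assms(2) negligible_interval(2)[of a b] by (simp add: box_real)
qed

text \<open>The increment of \<open>g\<close> is approximated at points of agreement inside [x, y],
  between which the monotone majorant grows no more than from x to y.\<close>

lemma bv_major_AE_eq:
  assumes f: "bv_major f v" and g: "continuous_on UNIV g" and ae: "AE x in lebesgue. f x = g x"
  shows "bv_major g v"
  unfolding bv_major_def
proof (intro conjI allI impI)
  show "mono v" using f by (simp add: bv_major_def)
  fix x y :: real assume xy: "x \<le> y"
  show "cmod (g y - g x) \<le> v y - v x"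
  proof (cases "x = y")
    case False
    show ?thesis
    proof (rule field_le_epsilon)
      fix e :: real assume "e > 0"
      then have e: "e / 2 > 0" by simp
      have c: "isCont g z" for z using g by (simp add: continuous_on_eq_continuous_at)
      obtain d1 where d1: "d1 > 0" "\<And>z. \<bar>z - x\<bar> < d1 \<Longrightarrow> cmod (g z - g x) < e / 2"
        using isCont_real_eps[OF c e] by blast
      obtain d2 where d2: "d2 > 0" "\<And>z. \<bar>z - y\<bar> < d2 \<Longrightarrow> cmod (g z - g y) < e / 2"
        using isCont_real_eps[OF c e] by blast
      define m where "m = (x + y) / 2"
      have m: "x < m" "m < y" using xy False by (auto simp: m_def)
      obtain x' where x': "x < x'" "x' < min (x + d1) m" "f x' = g x'" using AE_lebesgue_obtain[OF ae, of x "min (x + d1) m"] d1 m by auto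
      obtain y' where y': "max (y - d2) m < y'" "y' < y" "f y' = g y'" using AE_lebesgue_obtain[OF ae, of "max (y - d2) m" y] d2 m by auto
      have "x' \<le> y'" using x' y' by auto
      then have 1: "cmod (g y' - g x') \<le> v y' - v x'" using f x'(3) y'(3) unfolding bv_major_def by metis
      have 2: "v y' \<le> v y" "v x \<le> v x'" using f x' y' by (auto simp: bv_major_def mono_def)
      have "cmod (g x' - g x) < e / 2" "cmod (g y' - g y) < e / 2" using d1(2)[of x'] d2(2)[of y'] x' y' by auto
      moreover have "cmod (g y - g x) \<le> cmod (g y' - g x') + cmod (g y' - g y) + cmod (g x' - g x)"
      proof -
        have "g y - g x = ((g y' - g x') - (g y' - g y)) + (g x' - g x)" by simp
        then show ?thesis using norm_triangle_ineq[of "(g y' - g x') - (g y' - g y)" "g x' - g x"] norm_triangle_ineq4[of "g y' - g x'" "g y' - g y"] by simp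
      qed
      ultimately show "cmod (g y - g x) \<le> v y - v x + e" using 1 2 by linarith
    qed
  qed simp
qed

subsection \<open>Jump representation\<close>

text \<open>Equality is asked for on the finite set only. One sawtooth jump is placed between
  consecutive nodes, of the size of the increment of \<open>f\<close> there. By periodicity the
  increments sum to 0, so the slopes of the sawtooths cancel. The positions \<open>z\<close> are
  free within the gaps and can thus avoid a null set.\<close>

lemma jump_representation:
  fixes X :: "real set"
  assumes per: "periodic f" and X: "finite X" "X \<noteq> {}" "\<And>x y. x \<in> X \<Longrightarrow> y \<in> X \<Longrightarrow> x < y + 2 * pi"
    and ae: "AE z in lebesgue. P z"
  shows "\<exists>m \<xi> z C. (\<forall>i\<le>m. \<xi> i < z i \<and> z i < \<xi> (Suc i) \<and> P (z i)) \<and> \<xi> ` {..m} = X \<and> \<xi> (Suc m) = \<xi> 0 + 2 * pi \<and>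
    (\<forall>x\<in>X. f x = C + (\<Sum>i\<le>m. (f (\<xi> (Suc i)) - f (\<xi> i)) / (2 * pi * \<i>) * sawtooth (x - z i)))"
proof -
  define xs where "xs = sorted_list_of_set X"
  have xs: "set xs = X" "sorted_wrt (<) xs" "distinct xs" using X(1) by (auto simp: xs_def)
  have len: "length xs > 0" using xs(1) X(2) by auto
  define m where "m = length xs - 1"
  define \<xi> where "\<xi> i = (if i \<le> m then xs ! i else xs ! 0 + 2 * pi)" for i
  have img: "\<xi> ` {..m} = X"
  proof -
    have lm: "length xs = Suc m" using len by (simp add: m_def)
    have 1: "\<xi> ` {..m} = (!) xs ` {..m}" unfolding \<xi>_def by (intro image_cong) auto
    have 2: "{..m} = {..<length xs}" unfolding lm lessThan_Suc_atMost ..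
    have 3: "(!) xs ` {..<length xs} = set xs" by (auto simp: set_conv_nth)
    show ?thesis unfolding 1 unfolding 2 3 by (rule xs(1))
  qed
  have last: "\<xi> (Suc m) = \<xi> 0 + 2 * pi" by (simp add: \<xi>_def)
  have inX: "\<xi> i \<in> X" if "i \<le> m" for i using img that by auto
  have incr: "\<xi> i < \<xi> (Suc i)" if "i \<le> m" for i
  proof (cases "i = m")
    case True
    then show ?thesis using last X(3)[OF inX inX, of m 0] by simp
  next
    case False
    then show ?thesis using that xs(2) len unfolding \<xi>_def m_def by (auto simp: sorted_wrt_iff_nth_less)
  qed
  have mono: "\<xi> i \<le> \<xi> j" if "i \<le> j" "j \<le> Suc m" for i j
    using that
  proof (induction j)
    case (Suc j)
    then show ?case using incr[of j] by (cases "i = Suc j") (auto simp: le_Suc_eq)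
  qed simp
  have "\<forall>i. \<exists>y. i \<le> m \<longrightarrow> \<xi> i < y \<and> y < \<xi> (Suc i) \<and> P y" using AE_lebesgue_obtain[OF ae incr] by blast
  then obtain z where z: "\<And>i. i \<le> m \<Longrightarrow> \<xi> i < z i \<and> z i < \<xi> (Suc i) \<and> P (z i)" by metis
  define D where "D i = f (\<xi> (Suc i)) - f (\<xi> i)" for i
  have Dsum: "(\<Sum>i<l. D i) = f (\<xi> l) - f (\<xi> 0)" for l
    unfolding D_def by (rule sum_lessThan_telescope)
  have D0: "(\<Sum>i\<le>m. D i) = 0"
  proof -
    have "(\<Sum>i\<le>m. D i) = (\<Sum>i<Suc m. D i)" by (simp add: lessThan_Suc_atMost)
    also have "\<dots> = 0" unfolding Dsum last using per by (simp add: periodic_def)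
    finally show ?thesis .
  qed
  \<comment> \<open>The second term compensates the constants \<open>\<i> * z i\<close> left over
    from the shifted sawtooths.\<close>
  define C where "C = f (\<xi> 0) - (\<Sum>i\<le>m. D i * z i) / (2 * pi)"
  have "f x = C + (\<Sum>i\<le>m. D i / (2 * pi * \<i>) * sawtooth (x - z i))" if x: "x \<in> X" for x
  proof -
    obtain l where l: "l \<le> m" "x = \<xi> l" using x img by auto
    have saw: "sawtooth (x - z i) = \<i> * pi * (if i < l then 1 else -1) - \<i> * x + \<i> * z i" if i: "i \<le> m" for i
    proof (cases "i < l")
      case True
      have "z i < \<xi> l" using z[OF i] mono[of "Suc i" l] True l by simp
      moreover have "x - z i < 2 * pi" using z[OF i] X(3)[OF x inX[OF i]] by linarith
      ultimately show ?thesis using True sawtooth_eq[of "x - z i"] l by (simp add: algebra_simps)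
    next
      case False
      have 1: "x - z i < 0" using z[OF i] mono[of l i] False l i by simp
      have "\<xi> (Suc i) \<le> \<xi> (Suc m)" using mono[of "Suc i" "Suc m"] i by simp
      then have "z i < \<xi> 0 + 2 * pi" using z[OF i] last by linarith
      moreover have "\<xi> 0 \<le> x" using mono[of 0 l] l by simp
      ultimately have "- (2 * pi) \<le> x - z i" by linarith
      then show ?thesis using False 1 sawtooth_neg[of "x - z i"] by (simp add: algebra_simps)
    qed
    have "(\<Sum>i\<le>m. D i / (2 * pi * \<i>) * sawtooth (x - z i)) =
      (\<Sum>i\<le>m. (if i < l then D i else 0) - D i * (1 / 2 + x / (2 * pi)) + D i * z i / (2 * pi))"
    proof (intro sum.cong refl)
      fix i assume "i \<in> {..m}"
      then have i: "i \<le> m" by simp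
      show "D i / (2 * pi * \<i>) * sawtooth (x - z i) = (if i < l then D i else 0) - D i * (1 / 2 + x / (2 * pi)) + D i * z i / (2 * pi)"
        unfolding saw[OF i] by (cases "i < l") (simp_all add: field_simps)
    qed
    also have "\<dots> = (\<Sum>i\<le>m. if i < l then D i else 0) - (\<Sum>i\<le>m. D i) * (1 / 2 + x / (2 * pi)) + (\<Sum>i\<le>m. D i * z i) / (2 * pi)"
      by (simp add: sum.distrib sum_subtractf sum_distrib_right sum_divide_distrib)
    also have "(\<Sum>i\<le>m. if i < l then D i else 0) = (\<Sum>i<l. D i)"
    proof -
      have "{i \<in> {..m}. i < l} = {..<l}" using l by auto
      then show ?thesis by (simp add: sum.inter_filter[symmetric])
    qed
    finally show ?thesis unfolding D0 Dsum C_def l(2) by simp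
  qed
  then have B: "\<forall>x\<in>X. f x = C + (\<Sum>i\<le>m. (f (\<xi> (Suc i)) - f (\<xi> i)) / (2 * pi * \<i>) * sawtooth (x - z i))"
    unfolding D_def by (rule ballI)
  have A: "\<forall>i\<le>m. \<xi> i < z i \<and> z i < \<xi> (Suc i) \<and> P (z i)" using z by simp
  show ?thesis
    by (rule exI[of _ m], rule exI[of _ \<xi>], rule exI[of _ z], rule exI[of _ C], intro conjI A img last B)
qed

definition residue_from :: "real \<Rightarrow> real \<Rightarrow> real" where
  "residue_from a p = p + 2 * pi * of_int (- \<lfloor>(p - a) / (2 * pi)\<rfloor>)"

lemma residue_from_bounds: "a \<le> residue_from a p" "residue_from a p < a + 2 * pi"
  using floor_divide_lower[of "2*pi" "p - a"] floor_divide_upper[of "2*pi" "p - a"]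
  by (auto simp: residue_from_def algebra_simps)

lemma periodic_residue_from: "periodic g \<Longrightarrow> g (residue_from a p + - y) = g (p + - y)"
  using periodic_int[of g "p + - y"] unfolding residue_from_def by (metis add.assoc add.commute)

lemma superpose_jumps:
  assumes r: "resolves t q c"
    and f: "\<And>j. j < q \<Longrightarrow> f (x + - (2 * pi * real j / real q)) = C + (\<Sum>i\<in>I. w i * s (x + - (2 * pi * real j / real q) - z i))"
  shows "superpose q c f x = C + (\<Sum>i\<in>I. w i * superpose q c s (x - z i))"
proof -
  \<comment> \<open>Frequency 0: the evolution preserves constants.\<close>
  have c1: "(\<Sum>j<q. c j) = 1"
  proof -
    have "cis (- t * (of_int 0)\<^sup>2) = (\<Sum>j<q. c j * char 0 (- (2 * pi * real j / real q)))" using r unfolding resolves_def by blast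
    then show ?thesis by simp
  qed
  have "superpose q c f x = (\<Sum>j<q. c j * (C + (\<Sum>i\<in>I. w i * s (x + - (2 * pi * real j / real q) - z i))))"
    unfolding superpose_def by (intro sum.cong refl) (simp only: f lessThan_iff)
  also have "\<dots> = (\<Sum>j<q. c j) * C + (\<Sum>j<q. \<Sum>i\<in>I. w i * (c j * s (x - z i + - (2 * pi * real j / real q))))"
    by (simp add: distrib_left sum.distrib sum_distrib_right sum_distrib_left mult_ac algebra_simps)
  also have "(\<Sum>j<q. \<Sum>i\<in>I. w i * (c j * s (x - z i + - (2 * pi * real j / real q)))) = (\<Sum>i\<in>I. w i * superpose q c s (x - z i))"
    by (subst sum.swap) (simp add: superpose_def sum_distrib_left)
  finally show ?thesis using c1 by simp
qed

text \<open>Each of the two evolutions evaluates \<open>f\<close> at finitely many points. All these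
  points modulo 2 \<pi>, together with the prescribed nodes, form one finite set, so a single jump
  representation serves both evolutions and its constant cancels.\<close>

lemma superpose_difference:
  assumes per: "periodic f" and r: "resolves t q c" and r': "resolves t' q' c'"
    and P: "AE z in lebesgue. P z" and E: "finite E" "E \<subseteq> {a..<a + 2 * pi}"
  shows "\<exists>(m::nat) \<xi> z. (\<forall>i\<le>m. \<xi> i < z i \<and> z i < \<xi> (Suc i) \<and> P (z i)) \<and> E \<subseteq> \<xi> ` {..m} \<and> \<xi> 0 = a \<and> \<xi> (Suc m) = a + 2 * pi \<and>
    superpose q c f x - superpose q' c' f x' = (\<Sum>i\<le>m. (f (\<xi> (Suc i)) - f (\<xi> i)) / (2 * pi * \<i>) *
       (superpose q c sawtooth (x - z i) - superpose q' c' sawtooth (x' - z i)))"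
proof -
  define p where "p j = x + - (2 * pi * real j / real q)" for j
  define p' where "p' j = x' + - (2 * pi * real j / real q')" for j
  define X where "X = insert a (E \<union> residue_from a ` p ` {..<q} \<union> residue_from a ` p' ` {..<q'})"
  have X: "finite X" "X \<noteq> {}" using E by (auto simp: X_def)
  have Xa: "X \<subseteq> {a..<a + 2 * pi}" using E(2) residue_from_bounds by (auto simp: X_def)
  have XX: "y < y' + 2 * pi" if "y \<in> X" "y' \<in> X" for y y' proof -
    have "y \<in> {a..<a + 2 * pi}" "y' \<in> {a..<a + 2 * pi}" using that Xa by blast+
    then show ?thesis by auto
  qed
  obtain m \<xi> z C where m: "\<forall>i\<le>m. \<xi> i < z i \<and> z i < \<xi> (Suc i) \<and> P (z i)" "\<xi> ` {..m} = X" "\<xi> (Suc m) = \<xi> 0 + 2 * pi"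
    and rep: "\<forall>y\<in>X. f y = C + (\<Sum>i\<le>m. (f (\<xi> (Suc i)) - f (\<xi> i)) / (2 * pi * \<i>) * sawtooth (y - z i))"
    using jump_representation[OF per X XX P] by blast
  have mono: "\<xi> 0 \<le> \<xi> j" if "j \<le> m" for j
    using that
  proof (induction j)
    case (Suc j)
    have "\<xi> j < \<xi> (Suc j)" using m(1) Suc.prems by (metis Suc_leD less_trans)
    then show ?case using Suc by simp
  qed simp
  have "\<xi> 0 = a"
  proof -
    obtain j where j: "j \<le> m" "\<xi> j = a" using m(2) unfolding X_def by (metis atMost_iff imageE insertI1)
    have "\<xi> 0 \<in> X" using m(2) by blast
    then show ?thesis using mono[OF j(1)] j(2) Xa by fastforce
  qed
  define w where "w i = (f (\<xi> (Suc i)) - f (\<xi> i)) / (2 * pi * \<i>)" for i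
  have rep': "f y = C + (\<Sum>i\<le>m. w i * sawtooth (y - z i))" if "residue_from a y \<in> X" for y
  proof -
    have "f y = f (residue_from a y)" using periodic_residue_from[OF per, of a y 0] by simp
    also have "\<dots> = C + (\<Sum>i\<le>m. w i * sawtooth (residue_from a y - z i))" using rep that unfolding w_def by blast
    also have "\<dots> = C + (\<Sum>i\<le>m. w i * sawtooth (y - z i))"
      using periodic_residue_from[OF sawtooth_periodic, of a y] by simp
    finally show ?thesis .
  qed
  have "superpose q c f x = C + (\<Sum>i\<le>m. w i * superpose q c sawtooth (x - z i))"
    by (rule superpose_jumps[OF r], rule rep') (auto simp: X_def p_def)
  moreover have "superpose q' c' f x' = C + (\<Sum>i\<le>m. w i * superpose q' c' sawtooth (x' - z i))"
    by (rule superpose_jumps[OF r'], rule rep') (auto simp: X_def p'_def)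
  ultimately have "superpose q c f x - superpose q' c' f x' = (\<Sum>i\<le>m. w i * (superpose q c sawtooth (x - z i) - superpose q' c' sawtooth (x' - z i)))"
    by (simp add: right_diff_distrib sum_subtractf)
  moreover have "E \<subseteq> \<xi> ` {..m}" unfolding m(2) X_def by blast
  ultimately show ?thesis using m(1,3) \<open>\<xi> 0 = a\<close> unfolding w_def
    by (intro exI[of _ m] exI[of _ \<xi>] exI[of _ z]) simp
qed

lemma norm_jump_sum_le:
  assumes f: "bv_major f v" and \<xi>: "\<And>i. i \<le> m \<Longrightarrow> \<xi> i \<le> \<xi> (Suc i)" and \<phi>: "\<And>i. i \<le> m \<Longrightarrow> cmod (\<phi> i) \<le> e i"
  shows "cmod (\<Sum>i\<le>m. (f (\<xi> (Suc i)) - f (\<xi> i)) / (2 * pi * \<i>) * \<phi> i) \<le> (\<Sum>i\<le>m. (v (\<xi> (Suc i)) - v (\<xi> i)) * e i)"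
proof (rule order.trans[OF norm_sum sum_mono])
  fix i assume "i \<in> {..m}"
  then have i: "i \<le> m" by simp
  have d: "cmod (f (\<xi> (Suc i)) - f (\<xi> i)) \<le> v (\<xi> (Suc i)) - v (\<xi> i)" using f \<xi>[OF i] by (simp add: bv_major_def)
  have "cmod ((f (\<xi> (Suc i)) - f (\<xi> i)) / (2 * pi * \<i>)) = cmod (f (\<xi> (Suc i)) - f (\<xi> i)) / (2 * pi)"
    by (simp add: norm_divide norm_mult)
  also have "\<dots> \<le> cmod (f (\<xi> (Suc i)) - f (\<xi> i)) / 1"
    using pi_gt3 by (intro divide_left_mono) auto
  finally have "cmod ((f (\<xi> (Suc i)) - f (\<xi> i)) / (2 * pi * \<i>)) \<le> cmod (f (\<xi> (Suc i)) - f (\<xi> i))" by simp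
  then have "cmod ((f (\<xi> (Suc i)) - f (\<xi> i)) / (2 * pi * \<i>)) \<le> v (\<xi> (Suc i)) - v (\<xi> i)" using d by simp
  then show "cmod ((f (\<xi> (Suc i)) - f (\<xi> i)) / (2 * pi * \<i>) * \<phi> i) \<le> (v (\<xi> (Suc i)) - v (\<xi> i)) * e i"
    unfolding norm_mult[of _ "\<phi> i"] using \<phi>[OF i] order.trans[OF norm_ge_zero d] by (intro mult_mono) auto
qed

text \<open>The jump positions are chosen so that \<open>x - z i\<close> and \<open>x' - z i\<close>
  avoid the exceptional set of the kernels. The estimate then holds at every point, with the
  variation over one period as the total weight.\<close>

lemma superpose_oscillation_irrational:
  assumes per: "periodic f" and f: "bv_major f v" and r0: "r0 \<notin> \<rat>" and \<epsilon>: "\<epsilon> > 0"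
  shows "\<exists>\<delta>>0. \<forall>r r' q c q' c' x x'. r \<in> \<rat> \<longrightarrow> r' \<in> \<rat> \<longrightarrow> \<bar>r - r0\<bar> < \<delta> \<longrightarrow> \<bar>r' - r0\<bar> < \<delta> \<longrightarrow>
     resolves (pi * r) q c \<longrightarrow> resolves (pi * r') q' c' \<longrightarrow> \<bar>x - x'\<bar> < \<delta> \<longrightarrow>
     cmod (superpose q c f x - superpose q' c' f x') \<le> \<epsilon>"
proof -
  define V where "V = v (2 * pi) - v 0"
  have V: "V \<ge> 0" using f by (simp add: V_def bv_major_def mono_def)
  define e where "e = \<epsilon> / (V + 1)"
  have e: "e > 0" using \<epsilon> V by (simp add: e_def)
  obtain \<delta> where \<delta>: "\<delta> > 0" and osc: "\<And>r r' g g'. r \<in> \<rat> \<Longrightarrow> r' \<in> \<rat> \<Longrightarrow> \<bar>r - r0\<bar> < \<delta> \<Longrightarrow> \<bar>r' - r0\<bar> < \<delta> \<Longrightarrow>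
     free_kernel (pi * r) g \<Longrightarrow> free_kernel (pi * r') g' \<Longrightarrow> near_agree e \<delta> g g'"
    using kernel_oscillation_irrational[OF r0 e] unfolding kernel_oscillation_le_def by blast
  have "cmod (superpose q c f x - superpose q' c' f x') \<le> \<epsilon>"
    if r: "r \<in> \<rat>" "r' \<in> \<rat>" "\<bar>r - r0\<bar> < \<delta>" "\<bar>r' - r0\<bar> < \<delta>" and s: "resolves (pi * r) q c" "resolves (pi * r') q' c'" and x: "\<bar>x - x'\<bar> < \<delta>"
    for r r' q c q' c' x x'
  proof -
    obtain P where P: "AE x in lebesgue. P x"
      "\<And>x y. P x \<Longrightarrow> P y \<Longrightarrow> \<bar>x - y\<bar> < \<delta> \<Longrightarrow> cmod (superpose q c sawtooth x - superpose q' c' sawtooth y) \<le> e"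
      using near_agreeD[OF osc[OF r free_kernel_superpose[OF s(1)] free_kernel_superpose[OF s(2)]]] by blast
    have Pz: "AE z in lebesgue. P (-1 * z + x) \<and> P (-1 * z + x')"
      using AE_lebesgue_affine[OF P(1), of "-1" x] AE_lebesgue_affine[OF P(1), of "-1" x'] by (auto elim: eventually_elim2)
    obtain m :: nat and \<xi> z where m: "\<forall>i\<le>m. \<xi> i < z i \<and> z i < \<xi> (Suc i) \<and> P (-1 * z i + x) \<and> P (-1 * z i + x')" "\<xi> 0 = 0" "\<xi> (Suc m) = 0 + 2 * pi"
      "superpose q c f x - superpose q' c' f x' = (\<Sum>i\<le>m. (f (\<xi> (Suc i)) - f (\<xi> i)) / (2 * pi * \<i>) *
       (superpose q c sawtooth (x - z i) - superpose q' c' sawtooth (x' - z i)))"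
      using superpose_difference[OF per s Pz, of "{}" 0 x x'] by auto
    have "cmod (superpose q c f x - superpose q' c' f x') \<le> (\<Sum>i\<le>m. (v (\<xi> (Suc i)) - v (\<xi> i)) * e)"
      unfolding m(4)
    proof (rule norm_jump_sum_le[OF f])
      fix i assume "i \<le> m"
      then have i: "\<xi> i < z i \<and> z i < \<xi> (Suc i)" "P (x - z i)" "P (x' - z i)" using m(1) by auto
      show "\<xi> i \<le> \<xi> (Suc i)" using i by simp
      show "cmod (superpose q c sawtooth (x - z i) - superpose q' c' sawtooth (x' - z i)) \<le> e"
        using P(2)[OF i(2,3)] x by simp
    qed
    also have "\<dots> = (\<Sum>i<Suc m. v (\<xi> (Suc i)) - v (\<xi> i)) * e" by (simp only: sum_distrib_right lessThan_Suc_atMost)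
    also have "\<dots> = V * e" unfolding sum_lessThan_telescope[of "\<lambda>i. v (\<xi> i)"] m(2,3) V_def by simp
    also have "\<dots> \<le> \<epsilon>" using V \<epsilon> by (simp add: e_def field_simps)
    finally show ?thesis .
  qed
  then show ?thesis using \<delta> by blast
qed

lemma resolves_0: "resolves 0 1 (\<lambda>_. 1)"
  by (simp add: resolves_def char_def)

lemma superpose_trivial: "superpose 1 (\<lambda>_. 1) f x = f x"
  by (simp add: superpose_def)

text \<open>Jumps far from x0 are governed by \<open>kernel_near_zero\<close>. For jumps within 2
  \<eta> of x0 the kernel is merely bounded, but their total weight is an increment of the majorant
  near x0, where the majorant may be taken continuous.\<close>

lemma superpose_near_zero:
  assumes per: "periodic f" and f: "bv_major f v0" and c: "isCont f x0" and \<epsilon>: "\<epsilon> > 0"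
  shows "\<exists>\<delta>>0. \<forall>r q c x. r \<in> \<rat> \<longrightarrow> \<bar>r\<bar> < \<delta> \<longrightarrow> resolves (pi * r) q c \<longrightarrow> \<bar>x - x0\<bar> < \<delta> \<longrightarrow>
     cmod (superpose q c f x - f x) \<le> \<epsilon>"
proof -
  obtain v where v: "bv_major f v" "isCont v x0" using bv_major_continuous_at[OF f c] by blast
  have vm: "v x \<le> v y" if "x \<le> y" for x y using v(1) that by (simp add: bv_major_def mono_def)
  define V where "V = v (x0 + pi) - v (x0 - pi)"
  have V: "V \<ge> 0" using vm[of "x0 - pi" "x0 + pi"] by (simp add: V_def)
  define e1 where "e1 = \<epsilon> / (2 * (V + 1))"
  have e1: "e1 > 0" using \<epsilon> V by (simp add: e1_def)
  \<comment> \<open>Near x0 the kernel differs from the sawtooth by at most 200 + 4 = 204, and the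
    majorant grows by at most \<open>2 * e2\<close>; 408/1000 is below 1/2.\<close>
  define e2 where "e2 = \<epsilon> / 1000"
  have e2: "e2 > 0" using \<epsilon> by (simp add: e2_def)
  obtain d where d: "d > 0" "\<And>x. \<bar>x - x0\<bar> < d \<Longrightarrow> \<bar>v x - v x0\<bar> < e2"
    using v(2) e2 unfolding continuous_at_eps_delta by (auto simp: dist_real_def)
  define \<eta> where "\<eta> = min (d / 3) 1"
  have \<eta>: "\<eta> > 0" "2 * \<eta> < d" "\<eta> \<le> 1" using d(1) by (auto simp: \<eta>_def min_def)
  obtain \<delta>0 where \<delta>0: "\<delta>0 > 0" and nz: "\<And>r g. r \<in> \<rat> \<Longrightarrow> \<bar>r\<bar> < \<delta>0 \<Longrightarrow> free_kernel (pi * r) g \<Longrightarrow>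
     (AE x in lebesgue. \<eta> \<le> \<bar>x\<bar> \<longrightarrow> \<bar>x\<bar> \<le> pi \<longrightarrow> cmod (g x - sawtooth x) \<le> e1)"
    using kernel_near_zero[OF \<eta>(1) e1] by blast
  define \<delta> where "\<delta> = min \<delta>0 \<eta>"
  have \<delta>: "\<delta> > 0" "\<delta> \<le> \<delta>0" "\<delta> \<le> \<eta>" using \<delta>0 \<eta> by (auto simp: \<delta>_def)
  have "cmod (superpose q c f x - f x) \<le> \<epsilon>" if r: "r \<in> \<rat>" "\<bar>r\<bar> < \<delta>" and s: "resolves (pi * r) q c" and x: "\<bar>x - x0\<bar> < \<delta>" for r q c x
  proof -
    define g where "g = superpose q c sawtooth"
    have g: "free_kernel (pi * r) g" unfolding g_def by (rule free_kernel_superpose[OF s])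
    have gper: "periodic g" using g by (simp add: free_kernel_def)
    define P where "P y \<longleftrightarrow> cmod (g y) \<le> 200 \<and> (\<forall>n::int. \<eta> \<le> \<bar>1 * y + 2 * pi * of_int n\<bar> \<longrightarrow> \<bar>1 * y + 2 * pi * of_int n\<bar> \<le> pi \<longrightarrow> cmod (g (1 * y + 2 * pi * of_int n) - sawtooth (1 * y + 2 * pi * of_int n)) \<le> e1)" for y
    have gb: "AE y in lebesgue. cmod (g y) \<le> 200" using r(1) by (intro kernel_bound[OF _ g]) (simp add: pi_rationals_iff)
    have r0: "\<bar>r\<bar> < \<delta>0" using r(2) \<delta> by simp
    have "AE y in lebesgue. \<forall>n::int. \<eta> \<le> \<bar>1 * y + 2 * pi * of_int n\<bar> \<longrightarrow> \<bar>1 * y + 2 * pi * of_int n\<bar> \<le> pi \<longrightarrow> cmod (g (1 * y + 2 * pi * of_int n) - sawtooth (1 * y + 2 * pi * of_int n)) \<le> e1"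
      unfolding AE_all_countable by (intro allI AE_lebesgue_affine[OF nz[OF r(1) r0 g]]) auto
    with gb have "AE y in lebesgue. P y" unfolding P_def by eventually_elim blast
    from AE_lebesgue_affine[OF this, of "-1" x] have Pz: "AE z in lebesgue. P (-1 * z + x)" by simp
    \<comment> \<open>The ends of the critical interval are forced to be nodes, so that every gap
      lies entirely inside or outside it.\<close>
    have x01: "{x0 - pi, x0 - 2 * \<eta>, x0 + 2 * \<eta>} \<subseteq> {x0 - pi..<x0 - pi + 2 * pi}" using \<eta> pi_gt3 by auto
    obtain m :: nat and \<xi> z where m: "\<forall>i\<le>m. \<xi> i < z i \<and> z i < \<xi> (Suc i) \<and> P (-1 * z i + x)"
      "{x0 - pi, x0 - 2 * \<eta>, x0 + 2 * \<eta>} \<subseteq> \<xi> ` {..m}" "\<xi> 0 = x0 - pi" "\<xi> (Suc m) = x0 - pi + 2 * pi"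
      "superpose q c f x - superpose 1 (\<lambda>_. 1) f x = (\<Sum>i\<le>m. (f (\<xi> (Suc i)) - f (\<xi> i)) / (2 * pi * \<i>) *
       (superpose q c sawtooth (x - z i) - superpose 1 (\<lambda>_. 1) sawtooth (x - z i)))"
      using superpose_difference[OF per s resolves_0 Pz _ x01, of x x] by blast
    have incr: "\<xi> i < \<xi> (Suc i)" if "i \<le> m" for i using m(1) that by (meson less_trans)
    have mono: "\<xi> i \<le> \<xi> j" if "i \<le> j" "j \<le> Suc m" for i j
      using that
    proof (induction j)
      case (Suc j)
      then show ?case using incr[of j] by (cases "i = Suc j") (auto simp: le_Suc_eq)
    qed simp
    \<comment> \<open>The majorant frozen outside the critical interval: its increments count only
      the jumps near x0 and still telescope.\<close>
    define w where "w y = v (min (max y (x0 - 2 * \<eta>)) (x0 + 2 * \<eta>))" for y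
    have wm: "w y \<le> w y'" if "y \<le> y'" for y y' unfolding w_def using that by (intro vm) auto
    have step: "(v (\<xi> (Suc i)) - v (\<xi> i)) * (if \<bar>z i - x0\<bar> < 2 * \<eta> then 204 else e1) \<le>
        (v (\<xi> (Suc i)) - v (\<xi> i)) * e1 + (w (\<xi> (Suc i)) - w (\<xi> i)) * 204" if i: "i \<le> m" for i
    proof (cases "\<bar>z i - x0\<bar> < 2 * \<eta>")
      case False
      then show ?thesis using wm[of "\<xi> i" "\<xi> (Suc i)"] incr[OF i] by simp
    next
      case True
      have zi: "\<xi> i < z i" "z i < \<xi> (Suc i)" using m(1) i by auto
      obtain l where l: "l \<le> m" "\<xi> l = x0 - 2 * \<eta>" using m(2) by auto
      obtain u where u: "u \<le> m" "\<xi> u = x0 + 2 * \<eta>" using m(2) by auto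
      have "x0 - 2 * \<eta> \<le> \<xi> i"
      proof (rule ccontr)
        assume "\<not> x0 - 2 * \<eta> \<le> \<xi> i"
        then have "\<not> l \<le> i" using mono[of l i] l i by auto
        then have "\<xi> (Suc i) \<le> \<xi> l" using l by (intro mono) auto
        then show False using zi True l by linarith
      qed
      moreover have "\<xi> (Suc i) \<le> x0 + 2 * \<eta>"
      proof (rule ccontr)
        assume "\<not> \<xi> (Suc i) \<le> x0 + 2 * \<eta>"
        then have "\<not> Suc i \<le> u" using mono[of "Suc i" u] u by auto
        then have "\<xi> u \<le> \<xi> i" using i by (intro mono) auto
        then show False using zi True u by linarith
      qed
      ultimately have "w (\<xi> i) = v (\<xi> i)" "w (\<xi> (Suc i)) = v (\<xi> (Suc i))" using incr[OF i] by (simp_all add: w_def)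
      moreover have "0 \<le> (v (\<xi> (Suc i)) - v (\<xi> i)) * e1" using vm[of "\<xi> i" "\<xi> (Suc i)"] incr[OF i] e1 by simp
      ultimately show ?thesis using True by simp
    qed
    have "cmod (superpose q c f x - f x) \<le> (\<Sum>i\<le>m. (v (\<xi> (Suc i)) - v (\<xi> i)) * (if \<bar>z i - x0\<bar> < 2 * \<eta> then 204 else e1))"
      using m(5) unfolding superpose_trivial g_def[symmetric]
    proof (simp only:, intro norm_jump_sum_le[OF v(1)])
      fix i assume i: "i \<le> m"
      show "\<xi> i \<le> \<xi> (Suc i)" using incr[OF i] by simp
      have zi: "\<xi> i < z i" "z i < \<xi> (Suc i)" "P (x - z i)" using m(1) i by auto
      have zr: "x0 - pi < z i" "z i < x0 + pi" using mono[of 0 i] mono[of "Suc i" "Suc m"] zi i m(3,4) by auto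
      show "cmod (g (x - z i) - sawtooth (x - z i)) \<le> (if \<bar>z i - x0\<bar> < 2 * \<eta> then 204 else e1)"
      proof (cases "\<bar>z i - x0\<bar> < 2 * \<eta>")
        case True
        have "cmod (g (x - z i)) \<le> 200" using zi(3) by (simp add: P_def)
        moreover have "cmod (sawtooth (x - z i)) \<le> 4" using norm_sawtooth_le[of "x - z i"] pi_less_4 by linarith
        ultimately show ?thesis using True norm_triangle_ineq4[of "g (x - z i)" "sawtooth (x - z i)"] by simp
      next
        case False
        have xx: "\<bar>x - x0\<bar> < \<eta>" using x \<delta> by simp
        \<comment> \<open>\<open>x - z i\<close> has modulus below \<pi> + \<eta>, so one of the
          shifts 0, -1, 1 brings it into [-\<pi>, \<pi>]; since \<eta> is at most 1, it stays at
          distance at least \<eta> from the jump at 0.\<close>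
        obtain n :: int where n: "\<eta> \<le> \<bar>x - z i + 2 * pi * of_int n\<bar>" "\<bar>x - z i + 2 * pi * of_int n\<bar> \<le> pi"
        proof (cases "\<bar>x - z i\<bar> \<le> pi")
          case True
          then show ?thesis using that[of 0] False xx by auto
        next
          case big: False
          show ?thesis
          proof (cases "x - z i > pi")
            case True
            then show ?thesis using that[of "-1"] zr xx \<eta> pi_gt3 by auto
          next
            case False
            then show ?thesis using that[of 1] big zr xx \<eta> pi_gt3 by auto
          qed
        qed
        have "cmod (g (x - z i + 2 * pi * of_int n) - sawtooth (x - z i + 2 * pi * of_int n)) \<le> e1"
          using zi(3) n unfolding P_def by simp
        then show ?thesis using False by (simp add: periodic_int[OF gper] periodic_int[OF sawtooth_periodic])
      qed
    qed
    also have "\<dots> \<le> (\<Sum>i\<le>m. (v (\<xi> (Suc i)) - v (\<xi> i)) * e1 + (w (\<xi> (Suc i)) - w (\<xi> i)) * 204)"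
      using step by (intro sum_mono) auto
    also have "\<dots> = (\<Sum>i<Suc m. v (\<xi> (Suc i)) - v (\<xi> i)) * e1 + (\<Sum>i<Suc m. w (\<xi> (Suc i)) - w (\<xi> i)) * 204"
      by (simp only: sum.distrib sum_distrib_right lessThan_Suc_atMost)
    also have "(\<Sum>i<Suc m. v (\<xi> (Suc i)) - v (\<xi> i)) = V"
      unfolding sum_lessThan_telescope[of "\<lambda>i. v (\<xi> i)"] m(3,4) V_def by (simp add: add.commute)
    also have "(\<Sum>i<Suc m. w (\<xi> (Suc i)) - w (\<xi> i)) = v (x0 + 2 * \<eta>) - v (x0 - 2 * \<eta>)"
      unfolding sum_lessThan_telescope[of "\<lambda>i. w (\<xi> i)"] m(3,4) using \<eta> pi_gt3 by (simp add: w_def)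
    also have "V * e1 + (v (x0 + 2 * \<eta>) - v (x0 - 2 * \<eta>)) * 204 \<le> \<epsilon> / 2 + (e2 + e2) * 204"
    proof (intro add_mono mult_right_mono)
      show "V * e1 \<le> \<epsilon> / 2" using V \<epsilon> by (simp add: e1_def field_simps)
      show "v (x0 + 2 * \<eta>) - v (x0 - 2 * \<eta>) \<le> e2 + e2" using d(2)[of "x0 + 2 * \<eta>"] d(2)[of "x0 - 2 * \<eta>"] \<eta> by auto
    qed auto
    also have "\<dots> \<le> \<epsilon>" using \<epsilon> by (simp add: e2_def)
    finally show ?thesis .
  qed
  then show ?thesis using \<delta>(1) by blast
qed

subsection \<open>Continuity of the free evolution\<close>

text \<open>\<open>rational_limit r0 f a x0\<close>: the evolution of \<open>f\<close> at rational times tends to \<open>a\<close> at the point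
  \<open>(\<pi> r0, x0)\<close>.\<close>

definition rational_limit :: "real \<Rightarrow> (real \<Rightarrow> complex) \<Rightarrow> complex \<Rightarrow> real \<Rightarrow> bool" where
  "rational_limit r0 f a x0 \<longleftrightarrow> (\<forall>\<epsilon>>0. \<exists>\<delta>>0. \<forall>r q c x. r \<in> \<rat> \<longrightarrow> \<bar>r - r0\<bar> < \<delta> \<longrightarrow> resolves (pi * r) q c \<longrightarrow> \<bar>x - x0\<bar> < \<delta> \<longrightarrow>
     cmod (superpose q c f x - a) \<le> \<epsilon>)"

lemma rational_limitD:
  assumes "rational_limit r0 f a x0" "\<epsilon> > 0"
  obtains \<delta> where "\<delta> > 0" "\<And>r q c x. r \<in> \<rat> \<Longrightarrow> \<bar>r - r0\<bar> < \<delta> \<Longrightarrow> resolves (pi * r) q c \<Longrightarrow> \<bar>x - x0\<bar> < \<delta> \<Longrightarrow>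
     cmod (superpose q c f x - a) \<le> \<epsilon>"
  using assms unfolding rational_limit_def by meson

lemma rational_near: "\<delta> > 0 \<Longrightarrow> \<exists>r\<in>\<rat>. \<bar>r - r0\<bar> < (\<delta>::real)"
  using Rats_dense_in_real[of r0 "r0 + \<delta>"] by force

lemma resolves_rational: "r \<in> \<rat> \<Longrightarrow> \<exists>q c. resolves (pi * r) q c"
  by (rule resolves_exists) (simp add: pi_rationals_iff)

text \<open>The values at two nearby points of space-time are compared through one rational time
  close enough to both times.\<close>

lemma rational_limit_jointly_continuous:
  assumes G: "\<And>r x. rational_limit r f (G (pi * r) x) x"
  shows "continuous_on UNIV (\<lambda>(t, x). G t x)"
  unfolding continuous_on_iff
proof (intro ballI allI impI)
  fix p :: "real \<times> real" and e :: real assume e: "e > 0"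
  obtain t0 x0 where p: "p = (t0, x0)" by fastforce
  define r0 where "r0 = t0 / pi"
  have t0: "t0 = pi * r0" by (simp add: r0_def)
  have e3: "e / 3 > 0" using e by simp
  obtain \<delta> where \<delta>: "\<delta> > 0" "\<And>r q c x. r \<in> \<rat> \<Longrightarrow> \<bar>r - r0\<bar> < \<delta> \<Longrightarrow> resolves (pi * r) q c \<Longrightarrow> \<bar>x - x0\<bar> < \<delta> \<Longrightarrow>
     cmod (superpose q c f x - G (pi * r0) x0) \<le> e / 3"
    using rational_limitD[OF G[of r0 x0] e3] by blast
  have "cmod (G t x - G t0 x0) < e" if d: "\<bar>t - t0\<bar> < \<delta>" "\<bar>x - x0\<bar> < \<delta>" for t x
  proof -
    define r where "r = t / pi"
    have t: "t = pi * r" by (simp add: r_def)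
    have "\<bar>r - r0\<bar> = \<bar>t - t0\<bar> / pi" unfolding r_def r0_def by (simp add: abs_divide flip: diff_divide_distrib)
    also have "\<dots> \<le> \<bar>t - t0\<bar> / 1" using pi_gt3 by (intro divide_left_mono) auto
    finally have rr: "\<bar>r - r0\<bar> < \<delta>" using d by simp
    obtain \<delta>' where \<delta>': "\<delta>' > 0" "\<And>r' q c y. r' \<in> \<rat> \<Longrightarrow> \<bar>r' - r\<bar> < \<delta>' \<Longrightarrow> resolves (pi * r') q c \<Longrightarrow> \<bar>y - x\<bar> < \<delta>' \<Longrightarrow>
       cmod (superpose q c f y - G (pi * r) x) \<le> e / 3"
      using rational_limitD[OF G[of r x] e3] by blast
    define \<delta>'' where "\<delta>'' = min \<delta>' (\<delta> - \<bar>r - r0\<bar>)"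
    have "\<delta>'' > 0" using \<delta>' rr by (simp add: \<delta>''_def)
    then obtain r' where r': "r' \<in> \<rat>" "\<bar>r' - r\<bar> < \<delta>''" using rational_near by blast
    have r'0: "\<bar>r' - r0\<bar> < \<delta>" "\<bar>r' - r\<bar> < \<delta>'" using r'(2) by (auto simp: \<delta>''_def)
    obtain q c where qc: "resolves (pi * r') q c" using resolves_rational[OF r'(1)] by blast
    have "cmod (superpose q c f x - G t x) \<le> e / 3" unfolding t by (rule \<delta>'(2)[OF r'(1) r'0(2) qc]) (use \<delta>' in auto)
    moreover have "cmod (superpose q c f x - G t0 x0) \<le> e / 3" unfolding t0 by (rule \<delta>(2)[OF r'(1) r'0(1) qc d(2)])
    moreover have "cmod (G t x - G t0 x0) \<le> cmod (superpose q c f x - G t0 x0) + cmod (superpose q c f x - G t x)"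
      using norm_triangle_ineq4[of "superpose q c f x - G t0 x0" "superpose q c f x - G t x"] by simp
    ultimately show ?thesis using e by linarith
  qed
  moreover have "\<bar>t - t0\<bar> \<le> dist (t, x) p" "\<bar>x - x0\<bar> \<le> dist (t, x) p" for t x
    using dist_fst_le[of "(t, x)" p] dist_snd_le[of "(t, x)" p] by (auto simp: p dist_real_def)
  ultimately have "dist (t, x) p < \<delta> \<Longrightarrow> dist (G t x) (G t0 x0) < e" for t x
    unfolding dist_norm by (meson le_less_trans)
  then show "\<exists>d>0. \<forall>p'\<in>UNIV. dist p' p < d \<longrightarrow> dist (case p' of (t, x) \<Rightarrow> G t x) (case p of (t, x) \<Rightarrow> G t x) < e"
    using \<delta>(1) by (intro exI[of _ \<delta>]) (auto simp: p)
qed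

lemma fourier_coeff_le_sup:
  assumes "square_integrable g" "square_integrable h" "\<And>x. cmod (g x - h x) \<le> e"
  shows "cmod (fourier_coeff g k - fourier_coeff h k) \<le> e"
proof -
  define d where "d = (\<lambda>x. char (-k) x * (g x - h x))"
  have i: "integrable torus d" unfolding d_def by (intro integrable_char_mult square_integrable_minus assms)
  have "fourier_coeff g k - fourier_coeff h k = 1 / (2*pi) * (LINT x|torus. d x)"
    unfolding fourier_coeff_diff[OF assms(1,2), symmetric] d_def by (rule fourier_coeff_torus)
  then have "cmod (fourier_coeff g k - fourier_coeff h k) = 1 / (2*pi) * cmod (LINT x|torus. d x)" by (simp add: norm_divide)
  also have "\<dots> \<le> 1 / (2*pi) * (LINT x|torus. e)"
  proof (intro mult_left_mono order.trans[OF integral_norm_bound] integral_mono)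
    show "integrable torus (\<lambda>x. cmod (d x))" using i by simp
    show "integrable torus (\<lambda>x. e)" by (rule finite_measure.integrable_const[OF finite_measure_torus])
    show "cmod (d x) \<le> e" for x using assms(3)[of x] by (simp add: d_def norm_mult)
  qed auto
  also have "\<dots> = e" by (simp add: measure_torus_space)
  finally show ?thesis .
qed

lemma continuous_bounded_periodic:
  assumes "continuous_on UNIV g" "periodic g" shows "bounded_periodic g"
  unfolding bounded_periodic_def
proof (intro conjI assms(2))
  show "g \<in> borel_measurable borel" by (rule borel_measurable_continuous_onI[OF assms(1)])
  have "bounded (g ` {0..2*pi})"
    by (intro compact_imp_bounded compact_continuous_image continuous_on_subset[OF assms(1)]) auto
  moreover have "range g \<subseteq> g ` {0..2*pi}"
  proof
    fix w assume "w \<in> range g"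
    then obtain x where x: "w = g x" by blast
    have "w = g (residue_from 0 x)" using periodic_residue_from[OF assms(2), of 0 x 0] x by simp
    then show "w \<in> g ` {0..2*pi}" using residue_from_bounds[of 0 x] by auto
  qed
  ultimately show "bounded (range g)" by (rule bounded_subset)
qed

text \<open>Coefficients pass to uniform limits, and the multiplier is continuous in time.\<close>

lemma uniform_rational_limit_coeff:
  assumes g: "square_integrable g" and f: "bounded_periodic f"
    and lim: "\<And>\<epsilon>. \<epsilon> > 0 \<Longrightarrow> \<exists>\<delta>>0. \<forall>r q c x. r \<in> \<rat> \<longrightarrow> \<bar>r - r0\<bar> < \<delta> \<longrightarrow> resolves (pi * r) q c \<longrightarrow> cmod (superpose q c f x - g x) \<le> \<epsilon>"
  shows "fourier_coeff g k = cis (- (pi * r0) * (of_int k)\<^sup>2) * fourier_coeff f k"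
proof -
  define E where "E r = cis (- (pi * r) * (of_int k)\<^sup>2) * fourier_coeff f k" for r
  have le: "cmod (fourier_coeff g k - E r0) \<le> 0 + e" if e: "e > 0" for e
  proof -
    have "continuous_on UNIV E" unfolding E_def by (intro continuous_intros)
    then have ic: "isCont E r0" by (simp add: continuous_on_eq_continuous_at)
    obtain d where d: "d > 0" "\<And>r. \<bar>r - r0\<bar> < d \<Longrightarrow> cmod (E r - E r0) < e / 2"
      using isCont_real_eps[OF ic, of "e / 2"] e by auto
    obtain \<delta> where \<delta>: "\<delta> > 0" "\<And>r q c x. r \<in> \<rat> \<Longrightarrow> \<bar>r - r0\<bar> < \<delta> \<Longrightarrow> resolves (pi * r) q c \<Longrightarrow> cmod (superpose q c f x - g x) \<le> e / 2"
      using lim[of "e / 2"] e by (meson half_gt_zero)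
    obtain r where r: "r \<in> \<rat>" "\<bar>r - r0\<bar> < min d \<delta>" using rational_near[of "min d \<delta>" r0] d(1) \<delta>(1) by auto
    obtain q c where qc: "resolves (pi * r) q c" using resolves_rational[OF r(1)] by blast
    have "cmod (fourier_coeff (superpose q c f) k - fourier_coeff g k) \<le> e / 2"
      using \<delta>(2)[OF r(1) _ qc] r(2)
      by (intro fourier_coeff_le_sup g bounded_periodic_square_integrable bounded_periodic_superpose f) auto
    moreover have "fourier_coeff (superpose q c f) k = E r" unfolding E_def by (rule fourier_coeff_superpose[OF qc f])
    ultimately have "cmod (E r - fourier_coeff g k) \<le> e / 2" by simp
    moreover have "cmod (E r - E r0) < e / 2" using d(2) r(2) by simp
    ultimately show ?thesis using norm_triangle_ineq4[of "E r - E r0" "E r - fourier_coeff g k"] by simp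
  qed
  have "cmod (fourier_coeff g k - E r0) \<le> 0" by (rule field_le_epsilon[OF le])
  then show ?thesis by (simp add: E_def)
qed

text \<open>By the oscillation bound the evolutions along rational times tending to r0 form a Cauchy
  sequence at each point. Their limit inherits the bound, with the point allowed to vary; continuity
  is drawn from this later.\<close>

lemma free_evolution_irrational_limit:
  assumes per: "periodic f" and f: "bv_major f v" and r0: "r0 \<notin> \<rat>"
  shows "\<exists>g. \<forall>\<epsilon>>0. \<exists>\<delta>>0. \<forall>r q c x x'. r \<in> \<rat> \<longrightarrow> \<bar>r - r0\<bar> < \<delta> \<longrightarrow> resolves (pi * r) q c \<longrightarrow> \<bar>x - x'\<bar> < \<delta> \<longrightarrow>
     cmod (superpose q c f x - g x') \<le> \<epsilon>"
proof -
  have "\<forall>n. \<exists>r\<in>\<rat>. \<bar>r - r0\<bar> < 1 / real (Suc n)" by (intro allI rational_near) simp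
  then obtain \<rho> where \<rho>: "\<And>n. \<rho> n \<in> \<rat>" "\<And>n. \<bar>\<rho> n - r0\<bar> < 1 / real (Suc n)" by metis
  have "\<forall>n. \<exists>qc. resolves (pi * \<rho> n) (fst qc) (snd qc)" using resolves_rational[OF \<rho>(1)] by (metis fst_conv snd_conv)
  then obtain QC where QC: "\<And>n. resolves (pi * \<rho> n) (fst (QC n)) (snd (QC n))" by metis
  define F where "F n = superpose (fst (QC n)) (snd (QC n)) f" for n
  have near: "\<exists>N. \<forall>n\<ge>N. \<bar>\<rho> n - r0\<bar> < \<delta>" if "\<delta> > 0" for \<delta>
  proof -
    obtain N where N: "1 / real (Suc N) < \<delta>" using \<open>\<delta> > 0\<close> nat_approx_posE by blast
    have "\<bar>\<rho> n - r0\<bar> < \<delta>" if "n \<ge> N" for n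
    proof -
      have "1 / real (Suc n) \<le> 1 / real (Suc N)" using that by (simp add: frac_le)
      then show ?thesis using \<rho>(2)[of n] N by linarith
    qed
    then show ?thesis by blast
  qed
  note osc = superpose_oscillation_irrational[OF per f r0]
  have "convergent (\<lambda>n. F n x)" for x
  proof (rule Cauchy_convergent, rule metric_CauchyI)
    fix e :: real assume e: "e > 0"
    obtain \<delta> where \<delta>: "\<delta> > 0" "\<And>r r' q c q' c' x x'. r \<in> \<rat> \<Longrightarrow> r' \<in> \<rat> \<Longrightarrow> \<bar>r - r0\<bar> < \<delta> \<Longrightarrow> \<bar>r' - r0\<bar> < \<delta> \<Longrightarrow>
       resolves (pi * r) q c \<Longrightarrow> resolves (pi * r') q' c' \<Longrightarrow> \<bar>x - x'\<bar> < \<delta> \<Longrightarrow> cmod (superpose q c f x - superpose q' c' f x') \<le> e / 2"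
      using osc[of "e / 2"] e by (meson half_gt_zero)
    obtain N where N: "\<forall>n\<ge>N. \<bar>\<rho> n - r0\<bar> < \<delta>" using near[OF \<delta>(1)] by blast
    have "dist (F m x) (F n x) < e" if "m \<ge> N" "n \<ge> N" for m n
      using \<delta>(2)[OF \<rho>(1) \<rho>(1) _ _ QC QC, of m n x x] N that e \<delta>(1) unfolding F_def dist_norm by fastforce
    then show "\<exists>N. \<forall>m\<ge>N. \<forall>n\<ge>N. dist (F m x) (F n x) < e" by blast
  qed
  then have lim: "(\<lambda>n. F n x) \<longlonglongrightarrow> lim (\<lambda>n. F n x)" for x by (simp add: convergent_LIMSEQ_iff)
  define g where "g x = lim (\<lambda>n. F n x)" for x
  have "\<exists>\<delta>>0. \<forall>r q c x x'. r \<in> \<rat> \<longrightarrow> \<bar>r - r0\<bar> < \<delta> \<longrightarrow> resolves (pi * r) q c \<longrightarrow> \<bar>x - x'\<bar> < \<delta> \<longrightarrow>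
     cmod (superpose q c f x - g x') \<le> \<epsilon>" if \<epsilon>: "\<epsilon> > 0" for \<epsilon>
  proof -
    obtain \<delta> where \<delta>: "\<delta> > 0" "\<And>r r' q c q' c' x x'. r \<in> \<rat> \<Longrightarrow> r' \<in> \<rat> \<Longrightarrow> \<bar>r - r0\<bar> < \<delta> \<Longrightarrow> \<bar>r' - r0\<bar> < \<delta> \<Longrightarrow>
       resolves (pi * r) q c \<Longrightarrow> resolves (pi * r') q' c' \<Longrightarrow> \<bar>x - x'\<bar> < \<delta> \<Longrightarrow> cmod (superpose q c f x - superpose q' c' f x') \<le> \<epsilon>"
      using osc[OF \<epsilon>] by meson
    obtain N where N: "\<forall>n\<ge>N. \<bar>\<rho> n - r0\<bar> < \<delta>" using near[OF \<delta>(1)] by blast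
    have "cmod (superpose q c f x - g x') \<le> \<epsilon>"
      if r: "r \<in> \<rat>" "\<bar>r - r0\<bar> < \<delta>" and qc: "resolves (pi * r) q c" and x: "\<bar>x - x'\<bar> < \<delta>" for r q c x x'
    proof (rule tendsto_upperbound)
      show "(\<lambda>n. cmod (superpose q c f x - F n x')) \<longlonglongrightarrow> cmod (superpose q c f x - g x')"
        unfolding g_def by (intro tendsto_intros lim)
      show "\<forall>\<^sub>F n in sequentially. cmod (superpose q c f x - F n x') \<le> \<epsilon>"
        using eventually_ge_at_top[of N]
      proof eventually_elim
        case (elim n)
        then show ?case unfolding F_def using \<delta>(2)[OF r(1) \<rho>(1) r(2) _ qc QC x] N by blast
      qed
    qed simp
    then show ?thesis using \<delta>(1) by blast
  qed
  then show ?thesis by blast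
qed

lemma small_differences_continuous:
  fixes g :: "real \<Rightarrow> complex"
  assumes "\<And>\<epsilon>. \<epsilon> > 0 \<Longrightarrow> \<exists>\<delta>>0. \<forall>x x'. \<bar>x - x'\<bar> < \<delta> \<longrightarrow> cmod (g x - g x') \<le> \<epsilon>"
  shows "continuous_on UNIV g"
  unfolding continuous_on_iff
proof (intro ballI allI impI)
  fix x' e :: real assume e: "e > 0"
  obtain \<delta> where "\<delta> > 0" "\<And>x x'. \<bar>x - x'\<bar> < \<delta> \<Longrightarrow> cmod (g x - g x') \<le> e / 2" using assms[of "e / 2"] e by auto
  then show "\<exists>d>0. \<forall>x\<in>UNIV. dist x x' < d \<longrightarrow> dist (g x) (g x') < e"
    using e by (intro exI[of _ \<delta>]) (force simp: dist_norm)
qed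

lemma free_evolution_irrational:
  assumes per: "periodic f" and f: "bv_major f v" and r0: "r0 \<notin> \<rat>"
  shows "\<exists>g. continuous_on UNIV g \<and> periodic g \<and> (\<forall>k. fourier_coeff g k = cis (- (pi * r0) * (of_int k)\<^sup>2) * fourier_coeff f k)
     \<and> (\<forall>x0. rational_limit r0 f (g x0) x0)"
proof -
  obtain g where g: "\<And>\<epsilon>. \<epsilon> > 0 \<Longrightarrow> \<exists>\<delta>>0. \<forall>r q c x x'. r \<in> \<rat> \<longrightarrow> \<bar>r - r0\<bar> < \<delta> \<longrightarrow> resolves (pi * r) q c \<longrightarrow> \<bar>x - x'\<bar> < \<delta> \<longrightarrow>
     cmod (superpose q c f x - g x') \<le> \<epsilon>"
    using free_evolution_irrational_limit[OF assms] by blast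
  have bp: "bounded_periodic f" by (rule bv_major_bounded_periodic[OF f per])
  have diff: "\<exists>\<delta>>0. \<exists>s. periodic s \<and> (\<forall>x x'. \<bar>x - x'\<bar> < \<delta> \<longrightarrow> cmod (s x - g x') \<le> \<epsilon>)" if \<epsilon>: "\<epsilon> > 0" for \<epsilon>
  proof -
    obtain \<delta> where \<delta>: "\<delta> > 0" "\<forall>r q c x x'. r \<in> \<rat> \<longrightarrow> \<bar>r - r0\<bar> < \<delta> \<longrightarrow> resolves (pi * r) q c \<longrightarrow> \<bar>x - x'\<bar> < \<delta> \<longrightarrow>
       cmod (superpose q c f x - g x') \<le> \<epsilon>" using g[OF \<epsilon>] by blast
    obtain r where r: "r \<in> \<rat>" "\<bar>r - r0\<bar> < \<delta>" using rational_near[OF \<delta>(1)] by blast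
    obtain q c where qc: "resolves (pi * r) q c" using resolves_rational[OF r(1)] by blast
    have "periodic (superpose q c f)" using bounded_periodic_superpose[OF bp] by (simp add: bounded_periodic_def)
    then show ?thesis using \<delta> r qc by blast
  qed
  have cont: "continuous_on UNIV g"
  proof (rule small_differences_continuous)
    fix \<epsilon> :: real assume "\<epsilon> > 0"
    then obtain \<delta> s where \<delta>: "\<delta> > 0" "\<forall>x x'. \<bar>x - x'\<bar> < \<delta> \<longrightarrow> cmod (s x - g x') \<le> \<epsilon> / 2" using diff[of "\<epsilon> / 2"] by auto
    have "cmod (g x - g x') \<le> \<epsilon>" if "\<bar>x - x'\<bar> < \<delta>" for x x'
    proof -
      have "cmod (s x - g x') \<le> \<epsilon> / 2" "cmod (s x - g x) \<le> \<epsilon> / 2" using \<delta> that by auto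
      then show ?thesis using norm_triangle_ineq4[of "s x - g x'" "s x - g x"] by simp
    qed
    then show "\<exists>\<delta>>0. \<forall>x x'. \<bar>x - x'\<bar> < \<delta> \<longrightarrow> cmod (g x - g x') \<le> \<epsilon>" using \<delta>(1) by blast
  qed
  have gper: "periodic g"
    unfolding periodic_def
  proof
    fix x
    have "cmod (g (x + 2 * pi) - g x) \<le> 0"
    proof (rule field_le_epsilon)
      fix \<epsilon> :: real assume "\<epsilon> > 0"
      then obtain \<delta> s where \<delta>: "\<delta> > 0" "periodic s" "\<forall>x x'. \<bar>x - x'\<bar> < \<delta> \<longrightarrow> cmod (s x - g x') \<le> \<epsilon> / 2" using diff[of "\<epsilon> / 2"] by auto
      have "cmod (s (x + 2 * pi) - g (x + 2 * pi)) \<le> \<epsilon> / 2" "cmod (s x - g x) \<le> \<epsilon> / 2" using \<delta> by auto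
      moreover have "s (x + 2 * pi) = s x" using \<delta>(2) by (simp add: periodic_def)
      ultimately show "cmod (g (x + 2 * pi) - g x) \<le> 0 + \<epsilon>" using norm_triangle_ineq4[of "s x - g x" "s x - g (x + 2 * pi)"] by simp
    qed
    then show "g (x + 2 * pi) = g x" by simp
  qed
  have sq: "square_integrable g" by (intro continuous_square_integrable continuous_on_subset[OF cont]) auto
  have coeff: "fourier_coeff g k = cis (- (pi * r0) * (of_int k)\<^sup>2) * fourier_coeff f k" for k
  proof (rule uniform_rational_limit_coeff[OF sq bp])
    fix \<epsilon> :: real assume "\<epsilon> > 0"
    then obtain \<delta> where \<delta>: "\<delta> > 0" "\<forall>r q c x x'. r \<in> \<rat> \<longrightarrow> \<bar>r - r0\<bar> < \<delta> \<longrightarrow> resolves (pi * r) q c \<longrightarrow> \<bar>x - x'\<bar> < \<delta> \<longrightarrow>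
       cmod (superpose q c f x - g x') \<le> \<epsilon>" using g by blast
    then show "\<exists>\<delta>>0. \<forall>r q c x. r \<in> \<rat> \<longrightarrow> \<bar>r - r0\<bar> < \<delta> \<longrightarrow> resolves (pi * r) q c \<longrightarrow> cmod (superpose q c f x - g x) \<le> \<epsilon>"
      by (intro exI[of _ \<delta>]) simp
  qed
  have "rational_limit r0 f (g x0) x0" for x0 unfolding rational_limit_def using g by meson
  then show ?thesis using cont gper coeff by blast
qed

lemma continuous_AE_eq:
  assumes "continuous_on UNIV g" "continuous_on UNIV h" "AE x in lebesgue. g x = (h x :: complex)"
  shows "g x = h (x :: real)"
proof -
  have "closed {x. g x = h x}" by (intro closed_Collect_eq assms)
  then show ?thesis using mem_closed_if_AE_lebesgue[of "{x. g x = h x}" x] assms(3) by simp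
qed

lemma continuous_superpose:
  assumes "continuous_on UNIV f" shows "continuous_on UNIV (superpose q c f)"
  unfolding superpose_def by (intro continuous_intros continuous_on_compose2[OF assms]) auto

text \<open>Group property: the evolution to r is that of \<open>g\<close>, the state at r0, over
  the time r - r0, and \<open>g\<close> is again continuous with a majorant. So time 0 suffices.
  Both superpositions have the same coefficients and are continuous, hence agree everywhere.\<close>

lemma rational_limit_rational:
  assumes per: "periodic f" and f: "bv_major f v" and cont: "continuous_on UNIV f"
    and r0: "r0 \<in> \<rat>" and s0: "resolves (pi * r0) q0 c0"
  shows "rational_limit r0 f (superpose q0 c0 f x0) x0"
  unfolding rational_limit_def
proof (intro allI impI)
  fix \<epsilon> :: real assume \<epsilon>: "\<epsilon> > 0"
  have bp: "bounded_periodic f" by (rule bv_major_bounded_periodic[OF f per])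
  define g where "g = superpose q0 c0 f"
  have g: "bounded_periodic g" unfolding g_def by (rule bounded_periodic_superpose[OF bp])
  have gc: "continuous_on UNIV g" unfolding g_def by (rule continuous_superpose[OF cont])
  obtain w where w: "bv_major g w" unfolding g_def using bv_major_superpose[OF f] by blast
  have ic: "isCont g x0" using gc by (simp add: continuous_on_eq_continuous_at)
  obtain d where d: "d > 0" "\<And>x. \<bar>x - x0\<bar> < d \<Longrightarrow> cmod (g x - g x0) < \<epsilon> / 2"
    using isCont_real_eps[OF ic, of "\<epsilon> / 2"] \<epsilon> by auto
  obtain \<delta> where \<delta>: "\<delta> > 0" "\<And>r q c x. r \<in> \<rat> \<Longrightarrow> \<bar>r\<bar> < \<delta> \<Longrightarrow> resolves (pi * r) q c \<Longrightarrow> \<bar>x - x0\<bar> < \<delta> \<Longrightarrow> cmod (superpose q c g x - g x) \<le> \<epsilon> / 2"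
    using superpose_near_zero[OF _ w ic, of "\<epsilon> / 2"] g \<epsilon> unfolding bounded_periodic_def by (meson half_gt_zero)
  have "cmod (superpose q c f x - g x0) \<le> \<epsilon>"
    if r: "r \<in> \<rat>" "\<bar>r - r0\<bar> < min \<delta> d" and s: "resolves (pi * r) q c" and x: "\<bar>x - x0\<bar> < min \<delta> d" for r q c x
  proof -
    have rr: "r - r0 \<in> \<rat>" using r r0 by simp
    obtain q1 c1 where s1: "resolves (pi * (r - r0)) q1 c1" using resolves_rational[OF rr] by blast
    have "AE y in lebesgue. superpose q c f y = superpose q1 c1 g y"
    proof (rule AE_eq_of_fourier_coeff)
      fix k
      have "cis (- (pi * r) * (of_int k)\<^sup>2) = cis (- (pi * (r - r0)) * (of_int k)\<^sup>2) * cis (- (pi * r0) * (of_int k)\<^sup>2)"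
        unfolding cis_mult by (rule arg_cong[of _ _ cis]) (simp add: algebra_simps)
      then show "fourier_coeff (superpose q c f) k = fourier_coeff (superpose q1 c1 g) k"
        unfolding fourier_coeff_superpose[OF s bp] fourier_coeff_superpose[OF s1 g] unfolding g_def fourier_coeff_superpose[OF s0 bp] by simp
    qed (intro bounded_periodic_superpose bp g)+
    then have eq: "superpose q c f x = superpose q1 c1 g x"
      by (intro continuous_AE_eq continuous_superpose cont gc)
    have "cmod (superpose q1 c1 g x - g x) \<le> \<epsilon> / 2" using r x by (intro \<delta>(2)[OF rr _ s1]) auto
    moreover have "cmod (g x - g x0) < \<epsilon> / 2" using d(2) x by simp
    ultimately show ?thesis unfolding eq using norm_triangle_ineq[of "superpose q1 c1 g x - g x" "g x - g x0"] by simp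
  qed
  then show "\<exists>\<delta>>0. \<forall>r q c x. r \<in> \<rat> \<longrightarrow> \<bar>r - r0\<bar> < \<delta> \<longrightarrow> resolves (pi * r) q c \<longrightarrow> \<bar>x - x0\<bar> < \<delta> \<longrightarrow> cmod (superpose q c f x - superpose q0 c0 f x0) \<le> \<epsilon>"
    using \<delta>(1) d(1) unfolding g_def by (intro exI[of _ "min \<delta> d"]) auto
qed

theorem free_evolution_continuous:
  assumes per: "periodic f" and f: "bv_major f v" and cont: "continuous_on UNIV f"
  shows "\<exists>G. continuous_on UNIV (\<lambda>(t, x). G t x) \<and> (\<forall>t. periodic (G t)) \<and>
    (\<forall>t k. fourier_coeff (G t) k = cis (- t * (of_int k)\<^sup>2) * fourier_coeff f k)"
proof -
  have bp: "bounded_periodic f" by (rule bv_major_bounded_periodic[OF f per])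
  have "\<exists>g. periodic g \<and> (\<forall>k. fourier_coeff g k = cis (- (pi * r) * (of_int k)\<^sup>2) * fourier_coeff f k) \<and> (\<forall>x. rational_limit r f (g x) x)" for r
  proof (cases "r \<in> \<rat>")
    case True
    then obtain q c where qc: "resolves (pi * r) q c" using resolves_rational by blast
    have "periodic (superpose q c f)" using bounded_periodic_superpose[OF bp] by (simp add: bounded_periodic_def)
    then show ?thesis using fourier_coeff_superpose[OF qc bp] rational_limit_rational[OF per f cont True qc] by blast
  next
    case False
    then show ?thesis using free_evolution_irrational[OF per f] by blast
  qed
  then obtain g where g: "\<And>r. periodic (g r)" "\<And>r k. fourier_coeff (g r) k = cis (- (pi * r) * (of_int k)\<^sup>2) * fourier_coeff f k"
    "\<And>r x. rational_limit r f (g r x) x" by metis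
  have "continuous_on UNIV (\<lambda>(t, x). (\<lambda>t. g (t / pi)) t x)"
    by (rule rational_limit_jointly_continuous[where f=f]) (simp add: g(3))
  moreover have "fourier_coeff (g (t / pi)) k = cis (- t * (of_int k)\<^sup>2) * fourier_coeff f k" for t k
    using g(2)[of "t / pi" k] by simp
  ultimately show ?thesis using g(1) by (intro exI[of _ "\<lambda>t. g (t / pi)"]) auto
qed

subsection \<open>Smoothing of the Duhamel term\<close>

lemma japanese_ge_1: "1 \<le> japanese x" by (simp add: japanese_def)

lemma japanese_pos: "0 < japanese x" by (simp add: japanese_def add_pos_nonneg)

lemma japanese_add_le: "japanese (x + y) \<le> japanese x * japanese y"
proof -
  have "\<bar>x + y\<bar> \<le> \<bar>x\<bar> + \<bar>y\<bar> + \<bar>x\<bar> * \<bar>y\<bar>" using abs_triangle_ineq[of x y] by (simp add: add_increasing2)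
  then show ?thesis by (simp add: japanese_def algebra_simps)
qed

text \<open>The product is at most the power - (1 + \<sigma>) of the smaller of the two
  numbers.\<close>

lemma powr_minus_mult_le:
  fixes x y \<sigma> :: real
  assumes "1 \<le> x" "1 \<le> y" "0 \<le> \<sigma>"
  shows "x powr (-1) * y powr (-\<sigma>) \<le> x powr (-(1+\<sigma>)) + y powr (-(1+\<sigma>))"
proof -
  have e: "z powr (-1) * z powr (-\<sigma>) = z powr (-(1+\<sigma>))" for z :: real
    using powr_add[of z "-1" "-\<sigma>"] by simp
  show ?thesis
  proof (cases "x \<le> y")
    case True
    have "y powr (-\<sigma>) \<le> x powr (-\<sigma>)" using powr_mono2'[of "-\<sigma>" x y] True assms by simp
    then have "x powr (-1) * y powr (-\<sigma>) \<le> x powr (-1) * x powr (-\<sigma>)" by (rule mult_left_mono) simp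
    then show ?thesis unfolding e using powr_ge_zero[of y "-(1+\<sigma>)"] by linarith
  next
    case False
    have "x powr (-1) \<le> y powr (-1)" using powr_mono2'[of "-1" y x] False assms by simp
    then have "x powr (-1) * y powr (-\<sigma>) \<le> y powr (-1) * y powr (-\<sigma>)" by (rule mult_right_mono) simp
    then show ?thesis unfolding e using powr_ge_zero[of x "-(1+\<sigma>)"] by linarith
  qed
qed

lemma abs_mult_le_squares: "\<bar>x * y\<bar> \<le> x\<^sup>2 + (y::real)\<^sup>2"
proof -
  have "0 \<le> (\<bar>x\<bar> - \<bar>y\<bar>)\<^sup>2" "0 \<le> \<bar>x\<bar> * \<bar>y\<bar>" by auto
  then have "2 * (\<bar>x\<bar> * \<bar>y\<bar>) \<le> x\<^sup>2 + y\<^sup>2" by (simp add: power2_diff)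
  then show ?thesis using \<open>0 \<le> \<bar>x\<bar> * \<bar>y\<bar>\<close> by (simp only: abs_mult)
qed

lemma summable_on_mult_l2:
  fixes a b :: "'a \<Rightarrow> real"
  assumes "(\<lambda>x. (a x)\<^sup>2) summable_on A" "(\<lambda>x. (b x)\<^sup>2) summable_on A" "\<And>x. x \<in> A \<Longrightarrow> 0 \<le> a x" "\<And>x. x \<in> A \<Longrightarrow> 0 \<le> b x"
  shows "(\<lambda>x. a x * b x) summable_on A"
proof (rule summable_on_comparison_test[OF summable_on_add[OF assms(1,2)]])
  fix x assume "x \<in> A"
  then show "0 \<le> a x * b x" using assms by simp
  show "a x * b x \<le> (a x)\<^sup>2 + (b x)\<^sup>2" using abs_mult_le_squares[of "a x" "b x"] by linarith
qed

text \<open>The kernel left over after one integration by parts in time; in the coordinates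
  \<open>l = k - m\<close>, \<open>j = k + m\<close> it is dominated by a product.\<close>

definition resolvent_weight :: "(int \<Rightarrow> real) \<Rightarrow> real \<Rightarrow> int \<Rightarrow> int \<Rightarrow> real" where
  "resolvent_weight p \<sigma> k m = (if k\<^sup>2 = m\<^sup>2 then 0 else p (k - m) / \<bar>of_int (k\<^sup>2 - m\<^sup>2)\<bar> * japanese m powr (-\<sigma>))"

text \<open>With l = k - m and j = k + m the denominator is l j. The sum over l converges as a
  product of the square summable sequences p l and 1 / l. The sum over j converges because 2 m = j -
  l turns the decay in m into a gain \<sigma> beyond 1 / j. Only pairs of equal parity occur, a
  subset of all (l, j).\<close>

lemma resolvent_weight_summable:
  assumes p: "\<And>l. 0 \<le> p l" "(\<lambda>l. (p l)\<^sup>2) summable_on UNIV" and \<sigma>: "0 < \<sigma>"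
  shows "(\<lambda>(k, m). resolvent_weight p \<sigma> k m) summable_on UNIV \<times> UNIV"
proof -
  define Z where "Z = infsum (\<lambda>j::int. japanese j powr (-(1+\<sigma>))) UNIV"
  have Z: "((\<lambda>j::int. japanese j powr (-(1+\<sigma>))) has_sum Z) UNIV"
    unfolding Z_def by (intro has_sum_infsum japanese_summable) (use \<sigma> in simp)
  define c where "c = 2 * 2 powr \<sigma>"
  define g where "g l j = p l / \<bar>of_int l\<bar> * (c * (japanese j powr (-(1+\<sigma>)) + japanese (of_int (j - l)) powr (-(1+\<sigma>))))" for l j :: int
  have "(\<lambda>(l, j). g l j) summable_on UNIV \<times> UNIV"
  proof (rule summable_on_SigmaI)
    fix l :: int
    have bij: "bij_betw (\<lambda>j. j - l) (UNIV::int set) UNIV" by (rule bij_betwI[of _ _ _ "\<lambda>j. j + l"]) auto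
    have "((\<lambda>j::int. japanese (of_int (j - l)) powr (-(1+\<sigma>))) has_sum Z) UNIV"
      using has_sum_reindex_bij_betw[OF bij, of "\<lambda>j. japanese (of_int j) powr (-(1+\<sigma>))" Z] Z by simp
    from has_sum_cmult_right[OF has_sum_cmult_right[OF has_sum_add[OF Z this]], of "p l / \<bar>of_int l\<bar>" c]
    show "((\<lambda>j. case (l, j) of (l, j) \<Rightarrow> g l j) has_sum p l / \<bar>of_int l\<bar> * (c * (Z + Z))) UNIV"
      unfolding g_def prod.case .
  next
    have "(\<lambda>l. p l * \<bar>1 / of_int l\<bar>) summable_on UNIV"
      using p inverse_square_summable[of 1] by (intro summable_on_mult_l2) (auto simp: power_divide)
    from summable_on_cmult_left[OF this, of "c * (Z + Z)"]
    show "(\<lambda>l. p l / \<bar>of_int l\<bar> * (c * (Z + Z))) summable_on UNIV" by simp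
  qed (use p in \<open>auto simp: g_def c_def\<close>)
  then have "(\<lambda>(l, j). g l j) summable_on range (\<lambda>(k::int, m). (k - m, k + m))"
    by (rule summable_on_subset_banach) auto
  moreover have "inj (\<lambda>(k::int, m). (k - m, k + m))" by (auto simp: inj_on_def)
  ultimately have gs: "(\<lambda>(k, m). g (k - m) (k + m)) summable_on UNIV \<times> UNIV"
    using summable_on_reindex[of "\<lambda>(k::int, m). (k - m, k + m)" UNIV "\<lambda>(l, j). g l j"] by (simp add: o_def case_prod_unfold)
  have le: "resolvent_weight p \<sigma> k m \<le> g (k - m) (k + m)" for k m
  proof (cases "k\<^sup>2 = m\<^sup>2")
    case True
    then show ?thesis using p by (simp add: resolvent_weight_def g_def c_def)
  next
    case False
    define j where "j = k + m"
    define l where "l = k - m"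
    have kk: "of_int (k\<^sup>2 - m\<^sup>2) = (of_int l * of_int j :: real)" by (simp add: l_def j_def power2_eq_square algebra_simps)
    have j0: "j \<noteq> 0"
    proof
      assume "j = 0"
      then have "k = - m" by (simp add: j_def)
      then show False using False by simp
    qed
    then have j1: "1 \<le> \<bar>real_of_int j\<bar>" by linarith
    then have "japanese j \<le> 2 * \<bar>real_of_int j\<bar>" by (simp add: japanese_def)
    then have 1: "1 / \<bar>real_of_int j\<bar> \<le> 2 * japanese j powr (-1)"
      using j1 japanese_pos[of j] by (simp add: powr_minus divide_simps)
    have "japanese (of_int (j - l)) \<le> 2 * japanese m" by (simp add: japanese_def j_def l_def)
    then have "(2 * japanese m) powr (-\<sigma>) \<le> japanese (of_int (j - l)) powr (-\<sigma>)"
      using \<sigma> japanese_pos by (intro powr_mono2') auto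
    then have "2 powr (-\<sigma>) * japanese m powr (-\<sigma>) \<le> japanese (of_int (j - l)) powr (-\<sigma>)"
      using japanese_pos[of m] by (simp add: powr_mult)
    from mult_left_mono[OF this, of "2 powr \<sigma>"]
    have 2: "japanese m powr (-\<sigma>) \<le> 2 powr \<sigma> * japanese (of_int (j - l)) powr (-\<sigma>)"
      by (simp add: mult.assoc[symmetric] powr_add[symmetric])
    have "1 / \<bar>real_of_int j\<bar> * japanese m powr (-\<sigma>) \<le> (2 * japanese j powr (-1)) * (2 powr \<sigma> * japanese (of_int (j - l)) powr (-\<sigma>))"
      using 1 2 by (intro mult_mono) auto
    also have "\<dots> = c * (japanese j powr (-1) * japanese (of_int (j - l)) powr (-\<sigma>))" by (simp add: c_def)
    also have "\<dots> \<le> c * (japanese j powr (-(1+\<sigma>)) + japanese (of_int (j - l)) powr (-(1+\<sigma>)))"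
      using \<sigma> japanese_ge_1 by (intro mult_left_mono powr_minus_mult_le) (auto simp: c_def)
    finally have "p l / \<bar>of_int l\<bar> * (1 / \<bar>real_of_int j\<bar> * japanese m powr (-\<sigma>)) \<le> g l j"
      unfolding g_def using p by (intro mult_left_mono) auto
    moreover have "resolvent_weight p \<sigma> k m = p l / \<bar>of_int l\<bar> * (1 / \<bar>real_of_int j\<bar> * japanese m powr (-\<sigma>))"
      using False unfolding resolvent_weight_def kk by (simp add: l_def abs_mult)
    ultimately show ?thesis by (simp add: l_def j_def)
  qed
  show ?thesis
    by (rule summable_on_comparison_test[OF gs]) (use le p in \<open>auto simp: resolvent_weight_def\<close>)
qed

section \<open>Sobolev bounds for the coefficients of products\<close>

definition Hs_energy :: "real \<Rightarrow> (real \<Rightarrow> complex) \<Rightarrow> real" where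
  "Hs_energy s g = infsum (\<lambda>k::int. japanese k powr (2 * s) * (cmod (fourier_coeff g k))\<^sup>2) UNIV"

lemma Hs_energy_nonneg: "0 \<le> Hs_energy s g" unfolding Hs_energy_def by (intro infsum_nonneg) auto

lemma Hs_norm_squared: "(Hs_norm s g)\<^sup>2 = Hs_energy s g"
  using Hs_energy_nonneg[of s g] by (simp add: Hs_norm_def Hs_energy_def)

lemma Hs_square_integrable: "g \<in> Hs s \<Longrightarrow> square_integrable g"
  unfolding Hs_def square_integrable_def set_integrable_def
  by (auto intro!: measurable_restrict_space1 simp: integrable_restrict_space)

lemma Hs_summable: "g \<in> Hs s \<Longrightarrow> (\<lambda>k::int. japanese k powr (2 * s) * (cmod (fourier_coeff g k))\<^sup>2) summable_on UNIV"
  by (simp add: Hs_def)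

lemma Hs_sum_le:
  assumes "g \<in> Hs s" "finite F"
  shows "(\<Sum>k\<in>F. japanese k powr (2 * s) * (cmod (fourier_coeff g k))\<^sup>2) \<le> Hs_energy s g"
  unfolding Hs_energy_def by (rule finite_sum_le_infsum) (use Hs_summable[OF assms(1)] assms(2) in auto)

lemma Hs_diff_weighted_le:
  assumes "g \<in> Hs s" "h \<in> Hs s"
  shows "japanese k powr (2 * s) * (cmod (fourier_coeff (\<lambda>x. g x - h x) k))\<^sup>2 \<le>
    2 * (japanese k powr (2 * s) * (cmod (fourier_coeff g k))\<^sup>2) + 2 * (japanese k powr (2 * s) * (cmod (fourier_coeff h k))\<^sup>2)"
proof -
  have "fourier_coeff (\<lambda>x. g x - h x) k = fourier_coeff g k + - fourier_coeff h k"
    using fourier_coeff_diff[OF assms[THEN Hs_square_integrable]] by simp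
  then have "(cmod (fourier_coeff (\<lambda>x. g x - h x) k))\<^sup>2 \<le> 2 * (cmod (fourier_coeff g k))\<^sup>2 + 2 * (cmod (fourier_coeff h k))\<^sup>2"
    using norm_add_squared_le[of "fourier_coeff g k" "- fourier_coeff h k"] by simp
  from mult_left_mono[OF this, of "japanese k powr (2 * s)"] show ?thesis by (simp add: algebra_simps)
qed

lemma Hs_diff: assumes "g \<in> Hs s" "h \<in> Hs s" shows "(\<lambda>x. g x - h x) \<in> Hs s"
proof -
  have sq: "square_integrable (\<lambda>x. g x - h x)" using assms by (intro square_integrable_minus Hs_square_integrable)
  have "(\<lambda>k::int. japanese k powr (2 * s) * (cmod (fourier_coeff (\<lambda>x. g x - h x) k))\<^sup>2) summable_on UNIV"
    by (rule summable_on_comparison_test[OF summable_on_add[OF summable_on_cmult_right[OF Hs_summable[OF assms(1)]] summable_on_cmult_right[OF Hs_summable[OF assms(2)]]]])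
       (use Hs_diff_weighted_le[OF assms] in auto)
  moreover have "set_integrable lebesgue {0..2*pi} (\<lambda>x. (cmod (g x - h x))\<^sup>2)"
    using sq by (auto simp: square_integrable_def set_integrable_def integrable_restrict_space)
  ultimately show ?thesis using assms by (auto simp: Hs_def periodic_def)
qed

lemma Hs_energy_le:
  assumes "g \<in> Hs s" "h \<in> Hs s"
  shows "Hs_energy s g \<le> 2 * Hs_energy s (\<lambda>x. g x - h x) + 2 * Hs_energy s h"
proof -
  have d: "(\<lambda>x. g x - h x) \<in> Hs s" by (rule Hs_diff[OF assms])
  have "Hs_energy s g \<le> infsum (\<lambda>k::int. 2 * (japanese k powr (2 * s) * (cmod (fourier_coeff (\<lambda>x. g x - h x) k))\<^sup>2) + 2 * (japanese k powr (2 * s) * (cmod (fourier_coeff h k))\<^sup>2)) UNIV"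
    unfolding Hs_energy_def
  proof (rule infsum_mono)
    fix k :: int
    have "fourier_coeff g k = fourier_coeff (\<lambda>x. g x - h x) k + fourier_coeff h k"
      using fourier_coeff_diff[OF assms[THEN Hs_square_integrable]] by simp
    then have "(cmod (fourier_coeff g k))\<^sup>2 \<le> 2 * (cmod (fourier_coeff (\<lambda>x. g x - h x) k))\<^sup>2 + 2 * (cmod (fourier_coeff h k))\<^sup>2"
      using norm_add_squared_le[of "fourier_coeff (\<lambda>x. g x - h x) k" "fourier_coeff h k"] by simp
    from mult_left_mono[OF this, of "japanese k powr (2 * s)"]
    show "japanese k powr (2 * s) * (cmod (fourier_coeff g k))\<^sup>2 \<le>
      2 * (japanese k powr (2 * s) * (cmod (fourier_coeff (\<lambda>x. g x - h x) k))\<^sup>2) + 2 * (japanese k powr (2 * s) * (cmod (fourier_coeff h k))\<^sup>2)"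
      by (simp add: algebra_simps)
  qed (intro Hs_summable assms(1) summable_on_add summable_on_cmult_right d assms(2))+
  also have "\<dots> = 2 * Hs_energy s (\<lambda>x. g x - h x) + 2 * Hs_energy s h"
    unfolding Hs_energy_def
    by (subst infsum_add) (auto intro!: summable_on_cmult_right Hs_summable d assms(2) simp: infsum_cmult_right')
  finally show ?thesis .
qed

text \<open>Continuity bounds the energy near each time; bisection makes the bound uniform on a
  compact interval.\<close>

lemma continuous_in_Hs_bounded:
  assumes "continuous_in_Hs s u"
  shows "\<exists>C. \<forall>t. \<bar>t\<bar> \<le> T \<longrightarrow> Hs_energy s (u t) \<le> C"
proof -
  have uH: "\<And>t. u t \<in> Hs s" and lim: "\<And>t. ((\<lambda>t'. Hs_norm s (\<lambda>x. u t' x - u t x)) \<longlongrightarrow> 0) (at t)"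
    using assms by (auto simp: continuous_in_Hs_def)
  show ?thesis
  proof (cases "0 \<le> T")
    case False
    then show ?thesis by auto
  next
    case True
    then have "- T \<le> T" by simp
    then have "\<exists>C. \<forall>t\<in>{-T..T}. Hs_energy s (u t) \<le> C"
    proof (induction rule: Bolzano)
      case (trans a b c)
      then obtain C1 C2 where "\<forall>t\<in>{a..b}. Hs_energy s (u t) \<le> C1" "\<forall>t\<in>{b..c}. Hs_energy s (u t) \<le> C2" by blast
      then have "\<forall>t\<in>{a..c}. Hs_energy s (u t) \<le> max C1 C2" by (metis atLeastAtMost_iff le_max_iff_disj linear)
      then show ?case by blast
    next
      case (local t)
      have "\<forall>\<^sub>F t' in at t. Hs_norm s (\<lambda>x. u t' x - u t x) < 1" using lim[of t] by (rule order_tendstoD) simp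
      then obtain d where d: "d > 0" "\<And>t'. t' \<noteq> t \<Longrightarrow> dist t' t < d \<Longrightarrow> Hs_norm s (\<lambda>x. u t' x - u t x) < 1"
        unfolding eventually_at by auto
      have le: "Hs_energy s (u t') \<le> 2 * 1 + 2 * Hs_energy s (u t)" if "dist t' t < d" for t'
      proof (cases "t' = t")
        case True
        then show ?thesis using Hs_energy_nonneg[of s "u t"] by simp
      next
        case False
        have "0 \<le> Hs_norm s (\<lambda>x. u t' x - u t x)" unfolding Hs_norm_def by (intro real_sqrt_ge_zero infsum_nonneg) auto
        then have "(Hs_norm s (\<lambda>x. u t' x - u t x))\<^sup>2 \<le> 1\<^sup>2" using d(2)[OF False that] by (intro power_mono) auto
        then show ?thesis using Hs_energy_le[OF uH[of t'] uH[of t]] by (simp add: Hs_norm_squared)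
      qed
      show ?case
      proof (rule exI[of _ d], intro conjI allI impI d(1))
        fix a b assume ab: "a \<le> t \<and> t \<le> b \<and> b - a < d"
        have "\<forall>t'\<in>{a..b}. Hs_energy s (u t') \<le> 2 * 1 + 2 * Hs_energy s (u t)"
          using ab by (intro ballI le) (auto simp: dist_real_def)
        then show "\<exists>C. \<forall>t\<in>{a..b}. Hs_energy s (u t) \<le> C" by blast
      qed
    qed
    then obtain C where C: "\<forall>t\<in>{-T..T}. Hs_energy s (u t) \<le> C" by blast
    then have "Hs_energy s (u t) \<le> C" if "\<bar>t\<bar> \<le> T" for t using that by (auto simp: abs_le_iff)
    then show ?thesis by blast
  qed
qed

lemma Hs_coeff_le:
  assumes "g \<in> Hs s"
  shows "cmod (fourier_coeff g k) \<le> sqrt (Hs_energy s g) * japanese k powr (- s)"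
proof -
  have "japanese k powr (2 * s) * (cmod (fourier_coeff g k))\<^sup>2 \<le> Hs_energy s g"
    using Hs_sum_le[OF assms, of "{k}"] by simp
  then have "(japanese k powr s * cmod (fourier_coeff g k))\<^sup>2 \<le> Hs_energy s g"
    using japanese_pos[of k] by (simp add: power_mult_distrib powr_power mult.commute)
  then have "japanese k powr s * cmod (fourier_coeff g k) \<le> sqrt (Hs_energy s g)" by (rule real_le_rsqrt)
  then show ?thesis using japanese_pos[of k] by (simp add: powr_minus divide_simps mult.commute)
qed

lemma Hs_mono_sum:
  assumes "g \<in> Hs s" "\<sigma> \<le> s" "finite F"
  shows "(\<Sum>k\<in>F. japanese (real_of_int k) powr (2 * \<sigma>) * (cmod (fourier_coeff g k))\<^sup>2) \<le> Hs_energy s g"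
proof (rule order.trans[OF sum_mono Hs_sum_le[OF assms(1,3)]])
  fix k :: int assume "k \<in> F"
  show "japanese k powr (2 * \<sigma>) * (cmod (fourier_coeff g k))\<^sup>2 \<le> japanese k powr (2 * s) * (cmod (fourier_coeff g k))\<^sup>2"
    using assms(2) japanese_ge_1 by (intro mult_right_mono powr_mono) auto
qed

text \<open>The bracket of k is at most the product of those of k - m and m, so decay in k is paid
  for by weights on the two factors before Cauchy-Schwarz. This gives decay of the coefficients
  although the product is merely integrable.\<close>

lemma convolution_sum_le:
  fixes g h :: "real \<Rightarrow> complex" and k :: int
  assumes g: "g \<in> Hs s1" "\<sigma> \<le> s1" and h: "h \<in> Hs s2" "\<sigma> \<le> s2" and \<sigma>: "0 \<le> \<sigma>" and F: "finite F"
  shows "(\<Sum>m\<in>F. cmod (fourier_coeff g (k - m)) * cmod (fourier_coeff h m)) \<le> sqrt (Hs_energy s1 g) * sqrt (Hs_energy s2 h) * japanese k powr (-\<sigma>)"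
proof -
  define a where "a m = japanese (of_int (k - m)) powr \<sigma> * cmod (fourier_coeff g (k - m))" for m
  define b where "b m = japanese m powr \<sigma> * cmod (fourier_coeff h m)" for m :: int
  have sq: "(japanese x powr \<sigma> * y)\<^sup>2 = japanese x powr (2 * \<sigma>) * y\<^sup>2" for x y
    using japanese_pos[of x] by (simp add: power_mult_distrib powr_power mult.commute)
  have "cmod (fourier_coeff g (k - m)) * cmod (fourier_coeff h m) \<le> japanese k powr (-\<sigma>) * (a m * b m)" for m
  proof -
    have "japanese k \<le> japanese (of_int (k - m)) * japanese m" using japanese_add_le[of "of_int (k - m)" "of_int m"] by simp
    then have "japanese k powr \<sigma> \<le> (japanese (of_int (k - m)) * japanese m) powr \<sigma>"
      using \<sigma> japanese_pos[of k] by (intro powr_mono2) auto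
    also have "\<dots> = japanese (of_int (k - m)) powr \<sigma> * japanese m powr \<sigma>"
      using japanese_pos[of m] japanese_pos[of "of_int (k - m)"] by (simp add: powr_mult)
    finally have "japanese k powr \<sigma> \<le> japanese (of_int (k - m)) powr \<sigma> * japanese m powr \<sigma>" .
    from mult_right_mono[OF this, of "cmod (fourier_coeff g (k - m)) * cmod (fourier_coeff h m)"]
    have "japanese k powr \<sigma> * (cmod (fourier_coeff g (k - m)) * cmod (fourier_coeff h m)) \<le> a m * b m"
      unfolding a_def b_def by (simp only: mult.assoc mult.left_commute mult_nonneg_nonneg norm_ge_zero)
    then show ?thesis using japanese_pos[of k] by (simp add: powr_minus divide_simps mult.commute)
  qed
  then have "(\<Sum>m\<in>F. cmod (fourier_coeff g (k - m)) * cmod (fourier_coeff h m)) \<le> (\<Sum>m\<in>F. japanese k powr (-\<sigma>) * (a m * b m))" by (rule sum_mono)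
  also have "\<dots> = japanese k powr (-\<sigma>) * (\<Sum>m\<in>F. a m * b m)" by (simp add: sum_distrib_left)
  also have "(\<Sum>m\<in>F. a m * b m) \<le> sqrt (Hs_energy s1 g * Hs_energy s2 h)"
  proof (rule real_le_rsqrt, rule order.trans[OF Cauchy_Schwarz_ineq_sum], rule mult_mono)
    have "(\<Sum>m\<in>F. (a m)\<^sup>2) = (\<Sum>l\<in>(\<lambda>m. k - m) ` F. japanese (real_of_int l) powr (2 * \<sigma>) * (cmod (fourier_coeff g l))\<^sup>2)"
      unfolding a_def sq by (subst sum.reindex) (auto simp: inj_on_def)
    also have "\<dots> \<le> Hs_energy s1 g" using F by (intro Hs_mono_sum g) auto
    finally show "(\<Sum>m\<in>F. (a m)\<^sup>2) \<le> Hs_energy s1 g" .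
    show "(\<Sum>m\<in>F. (b m)\<^sup>2) \<le> Hs_energy s2 h" unfolding b_def sq by (intro Hs_mono_sum h F)
  qed (auto intro: Hs_energy_nonneg sum_nonneg)
  finally show ?thesis using japanese_pos[of k] by (simp add: real_sqrt_mult mult_left_mono mult.commute)
qed

lemma fourier_coeff_mult_le:
  assumes g: "g \<in> Hs s1" "\<sigma> \<le> s1" and h: "h \<in> Hs s2" "\<sigma> \<le> s2" and \<sigma>: "0 \<le> \<sigma>"
  shows "cmod (fourier_coeff (\<lambda>x. g x * h x) k) \<le> sqrt (Hs_energy s1 g) * sqrt (Hs_energy s2 h) * japanese k powr (-\<sigma>)"
proof (rule tendsto_upperbound)
  show "(\<lambda>M. cmod (\<Sum>m\<in>{-int M..int M}. fourier_coeff g (k - m) * fourier_coeff h m)) \<longlonglongrightarrow> cmod (fourier_coeff (\<lambda>x. g x * h x) k)"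
    by (intro tendsto_norm fourier_coeff_mult Hs_square_integrable[OF g(1)] Hs_square_integrable[OF h(1)])
  have "cmod (\<Sum>m\<in>{-int M..int M}. fourier_coeff g (k - m) * fourier_coeff h m) \<le> sqrt (Hs_energy s1 g) * sqrt (Hs_energy s2 h) * japanese k powr (-\<sigma>)" for M
    using order.trans[OF norm_sum, of "\<lambda>m. fourier_coeff g (k - m) * fourier_coeff h m" "{-int M..int M}"]
      convolution_sum_le[OF g h \<sigma>, of "{-int M..int M}" k] by (simp add: norm_mult)
  then show "\<forall>\<^sub>F M in sequentially. cmod (\<Sum>m\<in>{-int M..int M}. fourier_coeff g (k - m) * fourier_coeff h m) \<le> sqrt (Hs_energy s1 g) * sqrt (Hs_energy s2 h) * japanese k powr (-\<sigma>)"
    by (intro always_eventually allI)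
qed simp

lemma summable_on_tail:
  fixes a :: "int \<Rightarrow> real"
  assumes a: "a summable_on UNIV" "\<And>k. 0 \<le> a k" and "e > 0"
  shows "\<exists>K. finite K \<and> (\<forall>F. finite F \<longrightarrow> F \<inter> K = {} \<longrightarrow> sum a F \<le> e)"
proof -
  have "(sum a \<longlongrightarrow> infsum a UNIV) (finite_subsets_at_top UNIV)"
    using a(1) has_sum_def has_sum_infsum by blast
  then have "\<forall>\<^sub>F F in finite_subsets_at_top UNIV. dist (sum a F) (infsum a UNIV) < e"
    using assms(3) tendstoD by blast
  then obtain K where K: "finite K" "dist (sum a K) (infsum a UNIV) < e"
    unfolding eventually_finite_subsets_at_top by blast
  have "sum a F \<le> e" if "finite F" "F \<inter> K = {}" for F
  proof -
    have "sum a F + sum a K = sum a (F \<union> K)" using that K by (intro sum.union_disjoint[symmetric]) auto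
    also have "\<dots> \<le> infsum a UNIV" using that K a by (intro finite_sum_le_infsum) auto
    finally show ?thesis using K(2) by (auto simp: dist_real_def)
  qed
  then show ?thesis using K(1) by blast
qed

text \<open>Uniformity in \<open>h\<close>: the truncation error is controlled by the tail of \<open>g\<close> alone.\<close>

lemma fourier_coeff_mult_uniform:
  fixes k :: int
  assumes g: "g \<in> Hs s1" "0 \<le> s1" and e: "e > 0"
  shows "\<exists>M0. \<forall>M\<ge>M0. \<forall>h\<in>Hs s2. 0 \<le> s2 \<longrightarrow> cmod (fourier_coeff (\<lambda>x. g x * h x) k - (\<Sum>m\<in>{-int M..int M}. fourier_coeff g (k - m) * fourier_coeff h m))
    \<le> e * sqrt (Hs_energy s2 h)"
proof -
  define a where "a m = (cmod (fourier_coeff g (k - m)))\<^sup>2" for m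
  have "(\<lambda>l. (cmod (fourier_coeff g l))\<^sup>2) summable_on UNIV" by (rule fourier_coeff_summable[OF Hs_square_integrable[OF g(1)]])
  moreover have bij: "bij_betw (\<lambda>m. k - m) (UNIV::int set) UNIV" by (rule bij_betwI[of _ _ _ "\<lambda>m. k - m"]) auto
  ultimately have "a summable_on UNIV" unfolding a_def
    using summable_on_reindex_bij_betw[OF bij, of "\<lambda>l. (cmod (fourier_coeff g l))\<^sup>2"] by simp
  then obtain K where K: "finite K" "\<And>F. finite F \<Longrightarrow> F \<inter> K = {} \<Longrightarrow> sum a F \<le> e\<^sup>2"
    using summable_on_tail[of a "e\<^sup>2"] e unfolding a_def by (metis zero_le_power2 zero_less_power)
  obtain M0 where M0: "K \<subseteq> {-int M0..int M0}" using finite_int_subset_interval[OF K(1)] by blast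
  have "cmod (fourier_coeff (\<lambda>x. g x * h x) k - (\<Sum>m\<in>{-int M..int M}. fourier_coeff g (k - m) * fourier_coeff h m)) \<le> e * sqrt (Hs_energy s2 h)"
    if M: "M \<ge> M0" and h: "h \<in> Hs s2" "0 \<le> s2" for M h
  proof (rule tendsto_upperbound)
    let ?S = "\<lambda>M. \<Sum>m\<in>{-int M..int M}. fourier_coeff g (k - m) * fourier_coeff h m"
    show "(\<lambda>M'. cmod (?S M' - ?S M)) \<longlonglongrightarrow> cmod (fourier_coeff (\<lambda>x. g x * h x) k - ?S M)"
      by (intro tendsto_intros fourier_coeff_mult Hs_square_integrable[OF g(1)] Hs_square_integrable[OF h(1)])
    show "\<forall>\<^sub>F M' in sequentially. cmod (?S M' - ?S M) \<le> e * sqrt (Hs_energy s2 h)"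
      using eventually_ge_at_top[of M]
    proof eventually_elim
      case (elim M')
      define F where "F = {-int M'..int M'} - {-int M..int M}"
      have "?S M' - ?S M = (\<Sum>m\<in>F. fourier_coeff g (k - m) * fourier_coeff h m)"
        unfolding F_def using elim by (intro sum_diff[symmetric]) auto
      then have "cmod (?S M' - ?S M) \<le> (\<Sum>m\<in>F. cmod (fourier_coeff g (k - m)) * cmod (fourier_coeff h m))"
        by (simp only:) (intro order.trans[OF norm_sum] sum_mono, simp add: norm_mult)
      also have "\<dots> \<le> sqrt (e\<^sup>2 * Hs_energy s2 h)"
      proof (rule real_le_rsqrt, rule order.trans[OF Cauchy_Schwarz_ineq_sum], rule mult_mono)
        have "F \<inter> K = {}" using M0 M unfolding F_def by fastforce
        then show "(\<Sum>m\<in>F. (cmod (fourier_coeff g (k - m)))\<^sup>2) \<le> e\<^sup>2" using K(2)[of F] unfolding a_def F_def by simp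
        show "(\<Sum>m\<in>F. (cmod (fourier_coeff h m))\<^sup>2) \<le> Hs_energy s2 h"
          using Hs_mono_sum[OF h(1), of 0 F] h(2) japanese_pos unfolding F_def by (simp add: less_imp_neq[OF japanese_pos, symmetric])
      qed (auto intro: sum_nonneg)
      also have "\<dots> = e * sqrt (Hs_energy s2 h)" using e by (simp add: real_sqrt_mult)
      finally show ?case .
    qed
  qed simp
  then show ?thesis by blast
qed

lemma norm_diff_le_vector_derivative_bound:
  fixes F :: "real \<Rightarrow> complex"
  assumes F: "\<And>x. \<bar>x\<bar> \<le> T \<Longrightarrow> (F has_vector_derivative F' x) (at x)"
    and B: "\<And>x. \<bar>x\<bar> \<le> T \<Longrightarrow> cmod (F' x) \<le> B" and t: "\<bar>t\<bar> \<le> T"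
  shows "cmod (F t - F 0) \<le> T * B"
proof -
  have d: "((\<lambda>x. B * x) has_vector_derivative B) (at x within S)" for x :: real and S
    by (auto intro!: derivative_eq_intros simp: has_real_derivative_iff_has_vector_derivative[symmetric])
  have "0 \<le> B" using order.trans[OF norm_ge_zero B[OF t]] .
  then have le: "B * \<bar>t\<bar> \<le> T * B" using mult_right_mono[OF t, of B] by (simp add: mult.commute)
  show ?thesis
  proof (cases "0 \<le> t")
    case True
    have "cmod (F t - F 0) \<le> B * t - B * 0"
      by (rule norm_diff_le_integral_bound[OF True has_vector_derivative_at_within[OF F] d B]) (use t True in auto)
    then show ?thesis using le True by simp
  next
    case False
    then have "t \<le> 0" by simp
    have "cmod (F 0 - F t) \<le> B * 0 - B * t"
      by (rule norm_diff_le_integral_bound[OF \<open>t \<le> 0\<close> has_vector_derivative_at_within[OF F] d B]) (use t False in auto)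
    then show ?thesis using le False by (simp add: norm_minus_commute)
  qed
qed

lemma fourier_coeff_minus_const:
  assumes "square_integrable g"
  shows "fourier_coeff (\<lambda>x. g x - c) k = (if k = 0 then fourier_coeff g 0 - c else fourier_coeff g k)"
proof -
  have "fourier_coeff (\<lambda>x. c * char 0 x) k = (if k = 0 then c else 0)"
    unfolding fourier_coeff_cmult by (simp add: fourier_coeff_torus integral_char)
  then show ?thesis using fourier_coeff_diff[OF assms square_integrable_char[of c 0], of k] by auto
qed

lemma Hs_minus_mean:
  assumes "g \<in> Hs s" shows "(\<lambda>x. g x - fourier_coeff g 0) \<in> Hs s"
proof -
  have sg: "square_integrable g" by (rule Hs_square_integrable[OF assms])
  have sq: "square_integrable (\<lambda>x. g x - fourier_coeff g 0)"
    using square_integrable_minus[OF sg square_integrable_char[of "fourier_coeff g 0" 0]] by simp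
  have "(\<lambda>k::int. japanese k powr (2 * s) * (cmod (fourier_coeff (\<lambda>x. g x - fourier_coeff g 0) k))\<^sup>2) summable_on UNIV"
    by (rule summable_on_comparison_test[OF Hs_summable[OF assms]]) (auto simp: fourier_coeff_minus_const[OF sg])
  moreover have "set_integrable lebesgue {0..2*pi} (\<lambda>x. (cmod (g x - fourier_coeff g 0))\<^sup>2)"
    using sq by (auto simp: square_integrable_def set_integrable_def integrable_restrict_space)
  ultimately show ?thesis using assms by (auto simp: Hs_def periodic_def)
qed

section \<open>Interaction picture and integration by parts in time\<close>

locale schroedinger_flow =
  fixes f V :: "real \<Rightarrow> complex" and u :: "real \<Rightarrow> real \<Rightarrow> complex" and s \<epsilon> :: real
  assumes f_L2: "square_integrable f" and V_Hs: "V \<in> Hs \<epsilon>" and \<epsilon>_pos: "0 < \<epsilon>" and s_pos: "0 < s"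
    and u_cont: "continuous_in_Hs s u" and u_duhamel: "duhamel f V u"
begin

definition "V0 = fourier_coeff V 0"
definition "Vp x = V x - V0"
definition "\<sigma> = min s \<epsilon>"
definition "w t k = fourier_coeff (\<lambda>x. Vp x * u t x) k"
text \<open>The propagator is undone together with the mean of the potential, so that this
  coefficient moves only through \<open>forcing\<close>.\<close>

definition "\<alpha> k t = exp (\<i> * of_real t * ((of_int k)\<^sup>2 + V0)) * fourier_coeff (u t) k"
definition "forcing k t = exp (\<i> * of_real t * ((of_int k)\<^sup>2 + V0)) * w t k"

lemma \<sigma>: "0 < \<sigma>" "\<sigma> \<le> s" "\<sigma> \<le> \<epsilon>" using \<epsilon>_pos s_pos by (auto simp: \<sigma>_def)

lemma Vp_Hs: "Vp \<in> Hs \<epsilon>" unfolding Vp_def[abs_def] V0_def by (rule Hs_minus_mean[OF V_Hs])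

lemma Vp_mean: "fourier_coeff Vp 0 = 0"
  unfolding Vp_def[abs_def] V0_def by (simp add: fourier_coeff_minus_const[OF Hs_square_integrable[OF V_Hs]])

lemma u_Hs: "u t \<in> Hs s" using u_cont by (simp add: continuous_in_Hs_def)

lemma w_diff: "w t k - w t' k = fourier_coeff (\<lambda>x. Vp x * (u t x - u t' x)) k"
proof (rule LIMSEQ_unique)
  have sq: "square_integrable Vp" "square_integrable (u t)" for t using Vp_Hs u_Hs by (auto intro: Hs_square_integrable)
  show "(\<lambda>M. \<Sum>m\<in>{-int M..int M}. fourier_coeff Vp (k - m) * fourier_coeff (\<lambda>x. u t x - u t' x) m) \<longlonglongrightarrow> fourier_coeff (\<lambda>x. Vp x * (u t x - u t' x)) k"
    by (rule fourier_coeff_mult[OF sq(1) square_integrable_minus[OF sq(2) sq(2)]])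
  have "(\<lambda>M. (\<Sum>m\<in>{-int M..int M}. fourier_coeff Vp (k - m) * fourier_coeff (u t) m) -
      (\<Sum>m\<in>{-int M..int M}. fourier_coeff Vp (k - m) * fourier_coeff (u t') m)) \<longlonglongrightarrow> w t k - w t' k"
    unfolding w_def by (intro tendsto_diff fourier_coeff_mult[OF sq(1) sq(2)])
  then show "(\<lambda>M. \<Sum>m\<in>{-int M..int M}. fourier_coeff Vp (k - m) * fourier_coeff (\<lambda>x. u t x - u t' x) m) \<longlonglongrightarrow> w t k - w t' k"
    by (simp add: fourier_coeff_diff[OF sq(2) sq(2)] right_diff_distrib sum_subtractf)
qed

lemma w_continuous: "isCont (\<lambda>t. w t k) t"
proof -
  have lim: "((\<lambda>t'. Hs_norm s (\<lambda>x. u t' x - u t x)) \<longlongrightarrow> 0) (at t)" using u_cont by (simp add: continuous_in_Hs_def)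
  have "((\<lambda>t'. w t' k - w t k) \<longlongrightarrow> 0) (at t)"
  proof (rule Lim_null_comparison)
    have "cmod (w t' k - w t k) \<le> sqrt (Hs_energy \<epsilon> Vp) * Hs_norm s (\<lambda>x. u t' x - u t x) * japanese k powr (-\<sigma>)" for t'
      unfolding w_diff using fourier_coeff_mult_le[OF Vp_Hs \<sigma>(3) Hs_diff[OF u_Hs u_Hs] \<sigma>(2), of t' t k] \<sigma>(1)
      by (simp add: Hs_norm_def Hs_energy_def)
    then show "\<forall>\<^sub>F t' in at t. cmod (w t' k - w t k) \<le> sqrt (Hs_energy \<epsilon> Vp) * Hs_norm s (\<lambda>x. u t' x - u t x) * japanese k powr (-\<sigma>)"
      by (intro always_eventually allI)
    show "((\<lambda>t'. sqrt (Hs_energy \<epsilon> Vp) * Hs_norm s (\<lambda>x. u t' x - u t x) * japanese k powr (-\<sigma>)) \<longlongrightarrow> 0) (at t)"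
      using tendsto_mult_left_zero[OF tendsto_mult_right_zero[OF lim]] .
  qed
  then show ?thesis unfolding isCont_def by (simp add: LIM_zero_iff)
qed

lemma forcing_continuous: "continuous_on S (forcing k)"
proof -
  have "continuous_on S (\<lambda>t. w t k)" by (intro continuous_at_imp_continuous_on ballI w_continuous)
  moreover have "continuous_on S (\<lambda>t. exp (\<i> * of_real t * ((of_int k)\<^sup>2 + V0)))" by (intro continuous_intros)
  ultimately show ?thesis unfolding forcing_def[abs_def] by (intro continuous_on_mult)
qed

lemma \<alpha>_integral: "\<alpha> k t = fourier_coeff f k - \<i> * (LBINT t'=ereal 0..ereal t. forcing k t')"
proof -
  let ?e = "\<lambda>t. exp (\<i> * of_real t * ((of_int k)\<^sup>2 + V0))"
  let ?n = "\<lambda>t. exp (- \<i> * of_real t * ((of_int k)\<^sup>2 + V0))"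
  have en: "?e t * ?n t = 1" for t by (simp flip: exp_add)
  have "schroedinger_mult (t - t') V0 (fourier_coeff (\<lambda>x. (V x - V0) * u t' x)) k = ?n t * forcing k t'" for t'
  proof -
    have "exp (- \<i> * of_real (t - t') * ((of_int k)\<^sup>2 + V0)) = ?n t * ?e t'"
      by (simp add: algebra_simps flip: exp_add)
    then show ?thesis unfolding schroedinger_mult_def forcing_def w_def Vp_def by (simp add: mult.assoc)
  qed
  then have "fourier_coeff (u t) k = ?n t * fourier_coeff f k - \<i> * (LBINT t'=ereal 0..ereal t. ?n t * forcing k t')"
    using u_duhamel unfolding duhamel_def Let_def V0_def[symmetric] by (simp add: schroedinger_mult_def)
  also have "\<dots> = ?n t * (fourier_coeff f k - \<i> * (LBINT t'=ereal 0..ereal t. forcing k t'))"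
    by (simp only: interval_lebesgue_integral_mult_right right_diff_distrib mult.left_commute)
  finally have "\<alpha> k t = (?e t * ?n t) * (fourier_coeff f k - \<i> * (LBINT t'=ereal 0..ereal t. forcing k t'))"
    unfolding \<alpha>_def by (simp only: mult.assoc)
  then show ?thesis unfolding en by simp
qed

lemma \<alpha>_0: "\<alpha> k 0 = fourier_coeff f k" using \<alpha>_integral[of k 0] by simp

lemma \<alpha>_derivative: "(\<alpha> k has_vector_derivative - \<i> * forcing k t) (at t)"
proof -
  define R where "R = \<bar>t\<bar> + 1"
  have "((\<lambda>v. LBINT y=ereal 0..ereal v. forcing k y) has_vector_derivative forcing k t) (at t within {-R..R})"
    by (rule interval_integral_FTC2[OF _ _ forcing_continuous]) (auto simp: R_def)
  then have "((\<lambda>v. LBINT y=ereal 0..ereal v. forcing k y) has_vector_derivative forcing k t) (at t)"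
    using at_within_interior[of t "{-R..R}"] by (simp add: R_def abs_if split: if_splits)
  from has_vector_derivative_diff[OF has_vector_derivative_const has_vector_derivative_mult_right[OF this]]
  have "((\<lambda>v. fourier_coeff f k - \<i> * (LBINT y=ereal 0..ereal v. forcing k y)) has_vector_derivative 0 - \<i> * forcing k t) (at t)" .
  moreover have "\<alpha> k = (\<lambda>v. fourier_coeff f k - \<i> * (LBINT y=ereal 0..ereal v. forcing k y))" by (rule ext) (rule \<alpha>_integral)
  ultimately show ?thesis by simp
qed

text \<open>The potential may be complex valued; its mean is then not real and the factor not
  unimodular, but it stays bounded for bounded times, uniformly in \<open>k\<close>.\<close>

lemma norm_exp_le: "cmod (exp (\<i> * of_real t * ((of_int k)\<^sup>2 + V0))) \<le> exp (\<bar>t\<bar> * cmod V0)"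
proof -
  have "(\<i> * of_real t * ((of_int k)\<^sup>2 + V0)) = \<i> * of_real (t * (of_int k)\<^sup>2) + \<i> * of_real t * V0" by (simp add: algebra_simps)
  then have "cmod (exp (\<i> * of_real t * ((of_int k)\<^sup>2 + V0))) = exp (- t * Im V0)" by simp
  also have "- t * Im V0 \<le> \<bar>t\<bar> * cmod V0"
  proof -
    have "- t * Im V0 \<le> \<bar>t\<bar> * \<bar>Im V0\<bar>" using abs_ge_self[of "- t * Im V0"] by (simp add: abs_mult)
    also have "\<dots> \<le> \<bar>t\<bar> * cmod V0" by (intro mult_left_mono abs_Im_le_cmod) simp
    finally show ?thesis .
  qed
  finally show ?thesis by simp
qed

lemma local_bounds:
  obtains C D E where "0 \<le> C" "0 \<le> D" "0 \<le> E" "\<And>t. \<bar>t\<bar> \<le> T \<Longrightarrow> sqrt (Hs_energy s (u t)) \<le> C"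
    "\<And>t k. \<bar>t\<bar> \<le> T \<Longrightarrow> cmod (\<alpha> k t) \<le> D * japanese k powr (-\<sigma>)"
    "\<And>t k. \<bar>t\<bar> \<le> T \<Longrightarrow> cmod (forcing k t) \<le> D * japanese k powr (-\<sigma>)"
    "\<And>t k. \<bar>t\<bar> \<le> T \<Longrightarrow> cmod (exp (\<i> * of_real t * ((of_int k)\<^sup>2 + V0))) \<le> E"
proof -
  obtain C0 where C0: "\<And>t. \<bar>t\<bar> \<le> T \<Longrightarrow> Hs_energy s (u t) \<le> C0" using continuous_in_Hs_bounded[OF u_cont, of T] by blast
  define C where "C = sqrt (max C0 0)"
  have C: "sqrt (Hs_energy s (u t)) \<le> C" if "\<bar>t\<bar> \<le> T" for t using C0[OF that] by (auto simp: C_def)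
  have C_nonneg: "0 \<le> C" by (simp add: C_def)
  define E where "E = exp (T * cmod V0)"
  have E: "cmod (exp (\<i> * of_real t * ((of_int k)\<^sup>2 + V0))) \<le> E" if "\<bar>t\<bar> \<le> T" for t and k :: int
    using norm_exp_le[of t k] mult_right_mono[OF that norm_ge_zero[of V0]] unfolding E_def by (meson exp_le_cancel_iff order.trans)
  have E_nonneg: "0 \<le> E" by (simp add: E_def)
  define S where "S = sqrt (Hs_energy \<epsilon> Vp)"
  have S: "0 \<le> S" using Hs_energy_nonneg by (simp add: S_def)
  define D where "D = E * (C + S * C)"
  have \<alpha>: "cmod (\<alpha> k t) \<le> D * japanese k powr (-\<sigma>)" if t: "\<bar>t\<bar> \<le> T" for t k
  proof -
    have "cmod (fourier_coeff (u t) k) \<le> sqrt (Hs_energy s (u t)) * japanese k powr (- s)" by (rule Hs_coeff_le[OF u_Hs])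
    also have "\<dots> \<le> C * japanese k powr (-\<sigma>)" using \<sigma>(2) japanese_ge_1[of k] by (intro mult_mono C t powr_mono C_nonneg) auto
    also have "\<dots> \<le> (C + S * C) * japanese k powr (-\<sigma>)" using S C_nonneg by (intro mult_right_mono) auto
    finally have "cmod (\<alpha> k t) \<le> E * ((C + S * C) * japanese k powr (-\<sigma>))"
      unfolding \<alpha>_def norm_mult by (intro mult_mono E[OF t]) (auto simp: E_nonneg)
    then show ?thesis by (simp add: D_def mult.assoc)
  qed
  have forcing: "cmod (forcing k t) \<le> D * japanese k powr (-\<sigma>)" if t: "\<bar>t\<bar> \<le> T" for t k
  proof -
    have "cmod (w t k) \<le> S * sqrt (Hs_energy s (u t)) * japanese k powr (-\<sigma>)"
      unfolding w_def S_def using fourier_coeff_mult_le[OF Vp_Hs \<sigma>(3) u_Hs \<sigma>(2), of t k] \<sigma>(1) by simp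
    also have "\<dots> \<le> S * C * japanese k powr (-\<sigma>)" using S by (intro mult_right_mono mult_left_mono C t) auto
    also have "\<dots> \<le> (C + S * C) * japanese k powr (-\<sigma>)" using C_nonneg by (intro mult_right_mono) auto
    finally have "cmod (forcing k t) \<le> E * ((C + S * C) * japanese k powr (-\<sigma>))"
      unfolding forcing_def norm_mult by (intro mult_mono E[OF t]) (auto simp: E_nonneg)
    then show ?thesis by (simp add: D_def mult.assoc)
  qed
  show ?thesis by (rule that[OF C_nonneg _ E_nonneg C \<alpha> forcing E]) (use S C_nonneg E_nonneg in \<open>auto simp: D_def\<close>)
qed

definition "weight k m = resolvent_weight (\<lambda>l. cmod (fourier_coeff Vp l)) \<sigma> k m"
definition "weight_sum k = infsum (weight k) UNIV"

lemma weight_nonneg: "0 \<le> weight k m" by (simp add: weight_def resolvent_weight_def)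

lemma weight_summable: "(\<lambda>(k, m). weight k m) summable_on UNIV \<times> UNIV"
  unfolding weight_def
  by (intro resolvent_weight_summable fourier_coeff_summable Hs_square_integrable[OF Vp_Hs] \<sigma>(1)) simp

lemma weight_row_summable: "weight k summable_on UNIV"
  using summable_on_SigmaD1[OF weight_summable, of k] by simp

lemma weight_sum_summable: "weight_sum summable_on UNIV"
  using summable_on_SigmaD[OF weight_summable] weight_row_summable unfolding weight_sum_def by simp

lemma weight_sum_nonneg: "0 \<le> weight_sum k" unfolding weight_sum_def by (intro infsum_nonneg weight_nonneg)

lemma sum_weight_le: "finite F \<Longrightarrow> sum (weight k) F \<le> weight_sum k"
  unfolding weight_sum_def by (intro finite_sum_le_infsum weight_row_summable) (auto simp: weight_nonneg)

text \<open>Integration by parts in time of the nonresonant terms \<open>m\<^sup>2 \<noteq> k\<^sup>2\<close>. Of the two resonances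
  \<open>m = k\<close> drops out since \<open>Vp\<close> has mean zero, and \<open>m = - k\<close> stays.\<close>

lemma smoothing_step:
  assumes D: "\<And>t k. \<bar>t\<bar> \<le> T \<Longrightarrow> cmod (\<alpha> k t) \<le> D * japanese k powr (-\<sigma>)"
    "\<And>t k. \<bar>t\<bar> \<le> T \<Longrightarrow> cmod (forcing k t) \<le> D * japanese k powr (-\<sigma>)" and "0 \<le> D"
    and S: "\<And>\<tau>. \<bar>\<tau>\<bar> \<le> T \<Longrightarrow> cmod (\<alpha> (-k) \<tau>) \<le> S"
    and M: "\<bar>k\<bar> \<le> int M"
    and err: "\<And>\<tau>. \<bar>\<tau>\<bar> \<le> T \<Longrightarrow> cmod (exp (\<i> * of_real \<tau> * ((of_int k)\<^sup>2 + V0)) *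
      (w \<tau> k - (\<Sum>m\<in>{-int M..int M}. fourier_coeff Vp (k - m) * fourier_coeff (u \<tau>) m))) \<le> e"
    and t: "\<bar>t\<bar> \<le> T"
  shows "cmod (\<alpha> k t - fourier_coeff f k) \<le> T * (cmod (fourier_coeff Vp (2 * k)) * S + e) + (T + 2) * (D * weight_sum k)"
proof -
  define N where "N = {m\<in>{-int M..int M}. m\<^sup>2 \<noteq> k\<^sup>2}"
  have finN: "finite N" unfolding N_def by (rule finite_subset[of _ "{-int M..int M}"]) auto
  define n :: "int \<Rightarrow> complex" where "n m = of_int (k\<^sup>2 - m\<^sup>2)" for m
  have n0: "n m \<noteq> (0::complex)" if "m \<in> N" for m
    using that unfolding N_def n_def by (simp only: of_int_eq_0_iff) auto
  define E where "E m \<tau> = exp (\<i> * of_real \<tau> * n m)" for m and \<tau> :: real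
  have normE: "cmod (E m \<tau>) = 1" for m \<tau>
  proof -
    have "E m \<tau> = cis (\<tau> * of_int (k\<^sup>2 - m\<^sup>2))" unfolding E_def n_def cis_conv_exp by (simp add: mult.assoc)
    then show ?thesis by simp
  qed
  have dE: "(E m has_vector_derivative \<i> * n m * E m \<tau>) (at \<tau>)" for m \<tau>
    unfolding E_def by (rule has_vector_derivative_real_field) (auto intro!: derivative_eq_intros)
  define c where "c m = fourier_coeff Vp (k - m) / n m" for m
  have cw: "cmod (c m) * japanese m powr (-\<sigma>) = weight k m" if "m \<in> N" for m
    using that unfolding c_def weight_def resolvent_weight_def n_def N_def by (auto simp: norm_divide simp del: of_int_diff of_int_power)
  \<comment> \<open>The boundary term of the integration by parts. In the derivative of \<alpha> k +
    Q the nonresonant terms with \<alpha> m cancel up to the truncation error; instead the forcing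
    appears, divided by k^2 - m^2.\<close>
  define Q where "Q \<tau> = (\<Sum>m\<in>N. c m * (E m \<tau> * \<alpha> m \<tau>))" for \<tau>
  define Q' where "Q' \<tau> = (\<Sum>m\<in>N. c m * (E m \<tau> * (- \<i> * forcing m \<tau>) + \<i> * n m * E m \<tau> * \<alpha> m \<tau>))" for \<tau>
  have dQ: "(Q has_vector_derivative Q' \<tau>) (at \<tau>)" for \<tau>
    unfolding Q_def[abs_def] Q'_def
    by (intro has_vector_derivative_sum has_vector_derivative_mult_right has_vector_derivative_mult dE \<alpha>_derivative)
  have weighted: "cmod (\<Sum>m\<in>N. c m * (E m \<tau> * z m)) \<le> D * weight_sum k" if "\<And>m. cmod (z m) \<le> D * japanese m powr (-\<sigma>)" for z :: "int \<Rightarrow> complex" and \<tau>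
  proof -
    have "cmod (\<Sum>m\<in>N. c m * (E m \<tau> * z m)) \<le> (\<Sum>m\<in>N. D * weight k m)"
    proof (intro order.trans[OF norm_sum] sum_mono)
      fix m assume "m \<in> N"
      have "cmod (c m) * cmod (z m) \<le> cmod (c m) * (D * japanese m powr (-\<sigma>))" by (intro mult_left_mono that) simp
      also have "\<dots> = D * weight k m" using cw[OF \<open>m \<in> N\<close>] by (simp add: mult.left_commute)
      finally show "cmod (c m * (E m \<tau> * z m)) \<le> D * weight k m" by (simp add: norm_mult normE)
    qed
    also have "\<dots> \<le> D * weight_sum k" unfolding sum_distrib_left[symmetric] using \<open>0 \<le> D\<close> finN by (intro mult_left_mono sum_weight_le)
    finally show ?thesis .
  qed
  have Qle: "cmod (Q \<tau>) \<le> D * weight_sum k" if "\<bar>\<tau>\<bar> \<le> T" for \<tau> unfolding Q_def by (rule weighted) (rule D(1)[OF that])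
  have bound: "cmod (- \<i> * forcing k \<tau> + Q' \<tau>) \<le> cmod (fourier_coeff Vp (2 * k)) * S + e + D * weight_sum k" if \<tau>: "\<bar>\<tau>\<bar> \<le> T" for \<tau>
  proof -
    let ?x = "\<lambda>k::int. exp (\<i> * of_real \<tau> * ((of_int k)\<^sup>2 + V0))"
    have xE: "?x k * fourier_coeff (u \<tau>) m = E m \<tau> * \<alpha> m \<tau>" for m
    proof -
      have "?x k = E m \<tau> * ?x m" unfolding E_def n_def by (simp add: algebra_simps flip: exp_add)
      then show ?thesis by (simp add: \<alpha>_def)
    qed
    define P where "P m = fourier_coeff Vp (k - m) * (E m \<tau> * \<alpha> m \<tau>)" for m
    define err where "err = ?x k * (w \<tau> k - (\<Sum>m\<in>{-int M..int M}. fourier_coeff Vp (k - m) * fourier_coeff (u \<tau>) m))"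
    have "forcing k \<tau> = err + (\<Sum>m\<in>{-int M..int M}. P m)"
      unfolding err_def forcing_def P_def xE[symmetric] by (simp add: right_diff_distrib sum_distrib_left mult.left_commute)
    also have "(\<Sum>m\<in>{-int M..int M}. P m) = (\<Sum>m\<in>N. P m) + (\<Sum>m\<in>{-int M..int M} - N. P m)"
      by (subst sum.subset_diff[of N]) (auto simp: N_def)
    also have "(\<Sum>m\<in>{-int M..int M} - N. P m) = P (- k)"
    proof -
      have Pk: "P k = 0" by (simp add: P_def Vp_mean)
      \<comment> \<open>M is at least the modulus of k, so both resonant indices are in range. For k
        = 0 they coincide, and the mean zero of \<open>Vp\<close> makes the term vanish.\<close>
      have "{-int M..int M} - N = {k, - k}" using M unfolding N_def by (auto simp: power2_eq_iff)
      then show ?thesis using Pk by (cases "k = 0") auto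
    qed
    finally have f: "forcing k \<tau> = err + ((\<Sum>m\<in>N. P m) + P (- k))" .
    have "c m * (\<i> * n m * E m \<tau> * \<alpha> m \<tau>) = \<i> * P m" if "m \<in> N" for m
      using n0[OF that] by (simp add: c_def P_def)
    then have "Q' \<tau> = (\<Sum>m\<in>N. c m * (E m \<tau> * (- \<i> * forcing m \<tau>)) + \<i> * P m)"
      unfolding Q'_def by (intro sum.cong refl) (simp only: distrib_left)
    then have q: "Q' \<tau> = (\<Sum>m\<in>N. c m * (E m \<tau> * (- \<i> * forcing m \<tau>))) + \<i> * (\<Sum>m\<in>N. P m)"
      by (simp only: sum.distrib sum_distrib_left)
    have "- \<i> * forcing k \<tau> + Q' \<tau> = - \<i> * P (- k) + - \<i> * err + (\<Sum>m\<in>N. c m * (E m \<tau> * (- \<i> * forcing m \<tau>)))"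
      unfolding f q by (simp add: algebra_simps)
    then have "cmod (- \<i> * forcing k \<tau> + Q' \<tau>) \<le> cmod (- \<i> * P (- k)) + cmod (- \<i> * err) + cmod (\<Sum>m\<in>N. c m * (E m \<tau> * (- \<i> * forcing m \<tau>)))"
      by (simp only:) (intro order.trans[OF norm_triangle_ineq] add_mono norm_triangle_ineq order_refl)
    also have "\<dots> \<le> cmod (fourier_coeff Vp (2 * k)) * S + e + D * weight_sum k"
    proof (intro add_mono)
      show "cmod (- \<i> * P (- k)) \<le> cmod (fourier_coeff Vp (2 * k)) * S"
        unfolding P_def by (simp add: norm_mult normE mult_left_mono[OF S[OF \<tau>]])
      show "cmod (- \<i> * err) \<le> e" using assms(6)[OF \<tau>] by (simp add: norm_mult err_def)
      show "cmod (\<Sum>m\<in>N. c m * (E m \<tau> * (- \<i> * forcing m \<tau>))) \<le> D * weight_sum k"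
        by (rule weighted) (simp add: norm_mult D(2)[OF \<tau>])
    qed
    finally show ?thesis .
  qed
  have "cmod ((\<alpha> k t + Q t) - (\<alpha> k 0 + Q 0)) \<le> T * (cmod (fourier_coeff Vp (2 * k)) * S + e + D * weight_sum k)"
    by (rule norm_diff_le_vector_derivative_bound[OF has_vector_derivative_add[OF \<alpha>_derivative dQ] bound t])
  moreover have "\<alpha> k t - fourier_coeff f k = ((\<alpha> k t + Q t) - (\<alpha> k 0 + Q 0)) + Q 0 - Q t" by (simp add: \<alpha>_0)
  moreover have "cmod (Q 0) \<le> D * weight_sum k" "cmod (Q t) \<le> D * weight_sum k" using Qle t by auto
  ultimately have "cmod (\<alpha> k t - fourier_coeff f k) \<le> T * (cmod (fourier_coeff Vp (2 * k)) * S + e + D * weight_sum k) + D * weight_sum k + D * weight_sum k"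
    using norm_triangle_ineq4[of "((\<alpha> k t + Q t) - (\<alpha> k 0 + Q 0)) + Q 0" "Q t"]
      norm_triangle_ineq[of "(\<alpha> k t + Q t) - (\<alpha> k 0 + Q 0)" "Q 0"] by simp
  then show ?thesis by (simp add: algebra_simps)
qed

lemma smoothing:
  assumes T: "0 \<le> T"
  obtains D where "0 \<le> D" "\<And>t k. \<bar>t\<bar> \<le> T \<Longrightarrow> cmod (\<alpha> k t) \<le> D"
   "\<And>k S t. (\<And>\<tau>. \<bar>\<tau>\<bar> \<le> T \<Longrightarrow> cmod (\<alpha> (-k) \<tau>) \<le> S) \<Longrightarrow> \<bar>t\<bar> \<le> T \<Longrightarrow>
     cmod (\<alpha> k t - fourier_coeff f k) \<le> T * cmod (fourier_coeff Vp (2 * k)) * S + D * weight_sum k"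
proof -
  obtain C D E where b: "0 \<le> C" "0 \<le> D" "0 \<le> E" "\<And>t. \<bar>t\<bar> \<le> T \<Longrightarrow> sqrt (Hs_energy s (u t)) \<le> C"
    "\<And>t k. \<bar>t\<bar> \<le> T \<Longrightarrow> cmod (\<alpha> k t) \<le> D * japanese k powr (-\<sigma>)"
    "\<And>t k. \<bar>t\<bar> \<le> T \<Longrightarrow> cmod (forcing k t) \<le> D * japanese k powr (-\<sigma>)"
    "\<And>t k. \<bar>t\<bar> \<le> T \<Longrightarrow> cmod (exp (\<i> * of_real t * ((of_int k)\<^sup>2 + V0))) \<le> E"
    using local_bounds[of T] by blast
  have "cmod (\<alpha> k t - fourier_coeff f k) \<le> T * cmod (fourier_coeff Vp (2 * k)) * S + (T + 2) * D * weight_sum k"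
    if S: "\<And>\<tau>. \<bar>\<tau>\<bar> \<le> T \<Longrightarrow> cmod (\<alpha> (-k) \<tau>) \<le> S" and t: "\<bar>t\<bar> \<le> T" for k S t
  proof (rule field_le_epsilon)
    fix e :: real assume "e > 0"
    \<comment> \<open>Scaled so that the truncation error, multiplied by the time and by the bounds
      E and C, is at most \<open>e\<close>; the added ones keep the divisor positive.\<close>
    define e' where "e' = e / ((T + 1) * ((E + 1) * (C + 1)))"
    have e': "e' > 0" unfolding e'_def using \<open>e > 0\<close> T b(1,3) by (intro divide_pos_pos mult_pos_pos) auto
    obtain M0 where M0: "\<forall>M\<ge>M0. \<forall>h\<in>Hs s. 0 \<le> s \<longrightarrow>
       cmod (fourier_coeff (\<lambda>x. Vp x * h x) k - (\<Sum>m\<in>{-int M..int M}. fourier_coeff Vp (k - m) * fourier_coeff h m)) \<le> e' * sqrt (Hs_energy s h)"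
      using fourier_coeff_mult_uniform[OF Vp_Hs less_imp_le[OF \<epsilon>_pos] e', where k=k and ?s2.0=s] by (elim exE) (rule that)
    define M where "M = max M0 (nat \<bar>k\<bar>)"
    have M: "M \<ge> M0" "\<bar>k\<bar> \<le> int M" by (auto simp: M_def)
    have err: "cmod (exp (\<i> * of_real \<tau> * ((of_int k)\<^sup>2 + V0)) *
      (w \<tau> k - (\<Sum>m\<in>{-int M..int M}. fourier_coeff Vp (k - m) * fourier_coeff (u \<tau>) m))) \<le> (E + 1) * (e' * (C + 1))" if "\<bar>\<tau>\<bar> \<le> T" for \<tau>
      unfolding norm_mult
    proof (rule mult_mono)
      show "cmod (exp (\<i> * of_real \<tau> * ((of_int k)\<^sup>2 + V0))) \<le> E + 1" using b(7)[OF that, of k] by simp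
      have "e' * sqrt (Hs_energy s (u \<tau>)) \<le> e' * (C + 1)" using b(4)[OF that] e' by (intro mult_left_mono) auto
      then show "cmod (w \<tau> k - (\<Sum>m\<in>{-int M..int M}. fourier_coeff Vp (k - m) * fourier_coeff (u \<tau>) m)) \<le> e' * (C + 1)"
        using M0[rule_format, OF M(1) u_Hs[of \<tau>] less_imp_le[OF s_pos]] unfolding w_def by linarith
    qed (use b(3) in auto)
    have "cmod (\<alpha> k t - fourier_coeff f k) \<le> T * (cmod (fourier_coeff Vp (2 * k)) * S + (E + 1) * (e' * (C + 1))) + (T + 2) * (D * weight_sum k)"
      by (rule smoothing_step[OF b(5,6,2) S M(2) err t])
    moreover have "T * ((E + 1) * (e' * (C + 1))) \<le> (T + 1) * ((E + 1) * (e' * (C + 1)))"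
      using b(1,3) e' by (intro mult_right_mono) auto
    moreover have "(T + 1) * ((E + 1) * (e' * (C + 1))) = e"
    proof -
      have "(T + 1) * ((E + 1) * (C + 1)) \<noteq> 0" using T b(1,3) by simp
      then show ?thesis unfolding e'_def by (simp add: field_simps)
    qed
    ultimately show "cmod (\<alpha> k t - fourier_coeff f k) \<le> T * cmod (fourier_coeff Vp (2 * k)) * S + (T + 2) * D * weight_sum k + e"
      by (simp add: distrib_left mult.assoc)
  qed
  moreover have "cmod (\<alpha> k t) \<le> (T + 2) * D" if "\<bar>t\<bar> \<le> T" for k t
  proof -
    have "japanese k powr (-\<sigma>) \<le> 1" using \<sigma>(1) japanese_ge_1[of k] powr_mono[of "-\<sigma>" 0 "japanese k"] by simp
    then have "D * japanese k powr (-\<sigma>) \<le> D * 1" using b(2) by (intro mult_left_mono)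
    also have "\<dots> \<le> (T + 2) * D" using b(2) T mult_right_mono[of 1 "T + 2" D] by simp
    finally show ?thesis using b(5)[OF that, of k] by linarith
  qed
  ultimately show ?thesis using that[of "(T + 2) * D"] b(2) T by simp
qed

end

subsection \<open>The continuous correction\<close>

lemma fourier_coeff_char: "fourier_coeff (char j) k = (if j = k then 1 else 0)"
proof -
  have "char (- k) x * char j x = char (j - k) x" for x by (simp flip: char_add)
  then show ?thesis by (simp add: fourier_coeff_torus integral_char)
qed

lemma fourier_coeff_trig_sum:
  assumes "finite F" "k \<in> F"
  shows "fourier_coeff (\<lambda>x. \<Sum>j\<in>F. a j * char j x) k = a k"
proof -
  have "square_integrable (char j)" for j using square_integrable_char[of 1 j] by simp
  then have "fourier_coeff (\<lambda>x. \<Sum>j\<in>F. a j * char j x) k = (\<Sum>j\<in>F. a j * (if j = k then 1 else 0))"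
    by (simp only: fourier_coeff_sum fourier_coeff_char)
  also have "\<dots> = (\<Sum>j\<in>F. if j = k then a k else 0)" by (intro sum.cong) auto
  finally show ?thesis using assms by simp
qed

lemma fourier_coeff_add:
  assumes "square_integrable g" "square_integrable h"
  shows "fourier_coeff (\<lambda>x. g x + h x) k = fourier_coeff g k + fourier_coeff h k"
  using fourier_coeff_diff[OF square_integrable_add[OF assms] assms(2), of k] by simp

lemma fourier_coeff_AE_cong:
  assumes "square_integrable g" "square_integrable h" "AE x in lebesgue. g x = h x"
  shows "fourier_coeff g k = fourier_coeff h k"
proof -
  have "AE x in torus. g x = h x" using assms(3) by (auto simp: AE_torus_iff_lebesgue)
  then have "(LINT x|torus. char (-k) x * g x) = (LINT x|torus. char (-k) x * h x)"
    using assms by (intro integral_cong_AE) (auto simp: square_integrable_def)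
  then show ?thesis by (simp add: fourier_coeff_torus)
qed

lemma summable_on_double_index:
  fixes a :: "int \<Rightarrow> real"
  assumes "a summable_on UNIV" shows "(\<lambda>k. a (2 * k)) summable_on UNIV"
proof -
  have "a summable_on range (\<lambda>k. 2 * k)" by (rule summable_on_subset_banach[OF assms]) simp
  then show ?thesis using summable_on_reindex[of "\<lambda>k::int. 2 * k" UNIV a] by (simp add: inj_on_def o_def)
qed

lemma summable_on_uminus_index:
  fixes a :: "int \<Rightarrow> real"
  assumes "a summable_on UNIV" shows "(\<lambda>k. a (- k)) summable_on UNIV"
  using summable_on_reindex_bij_betw[of uminus "UNIV::int set" UNIV a] assms bij_uminus by simp

lemma continuous_on_function_series:
  fixes a :: "int \<Rightarrow> 'a::topological_space \<Rightarrow> complex"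
  assumes "\<And>k y. y \<in> Y \<Longrightarrow> cmod (a k y) \<le> b k" "b summable_on UNIV" "\<And>k. continuous_on Y (a k)"
  shows "continuous_on Y (\<lambda>y. infsum (\<lambda>k. a k y) UNIV)"
proof (rule uniform_limit_theorem)
  show "uniform_limit Y (\<lambda>F y. \<Sum>k\<in>F. a k y) (\<lambda>y. infsum (\<lambda>k. a k y) UNIV) (finite_subsets_at_top UNIV)"
    using assms(1,2) by (intro Weierstrass_m_test_general) auto
  show "\<forall>\<^sub>F F in finite_subsets_at_top UNIV. continuous_on Y (\<lambda>y. \<Sum>k\<in>F. a k y)"
    by (intro always_eventually allI continuous_on_sum assms(3))
qed simp

lemma fourier_coeff_function_series:
  fixes a :: "int \<Rightarrow> complex"
  assumes le: "\<And>k. cmod (a k) \<le> b k" and b: "b summable_on UNIV"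
  shows "fourier_coeff (\<lambda>x. infsum (\<lambda>k. a k * char k x) UNIV) k = a k"
proof -
  define g where "g x = infsum (\<lambda>k. a k * char k x) UNIV" for x
  have "continuous_on UNIV g" unfolding g_def
    by (rule continuous_on_function_series[OF _ b]) (auto simp: norm_mult le intro!: continuous_intros)
  then have sq: "square_integrable g" by (intro continuous_square_integrable) (auto intro: continuous_on_subset)
  have "uniform_limit UNIV (\<lambda>F x. \<Sum>j\<in>F. a j * char j x) g (finite_subsets_at_top UNIV)"
    unfolding g_def using le b by (intro Weierstrass_m_test_general) (auto simp: norm_mult)
  note lim = uniform_limitD[OF this]
  have "cmod (fourier_coeff g k - a k) \<le> e" if "e > 0" for e
  proof -
    have "\<forall>\<^sub>F F in finite_subsets_at_top UNIV. finite F \<and> {k} \<subseteq> F" unfolding eventually_finite_subsets_at_top by (rule exI[of _ "{k}"]) auto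
    then have "\<forall>\<^sub>F F in finite_subsets_at_top UNIV. (finite F \<and> {k} \<subseteq> F) \<and> (\<forall>x\<in>UNIV. dist (\<Sum>j\<in>F. a j * char j x) (g x) < e)"
      using lim[OF that] by (rule eventually_conj)
    from eventually_happens'[OF finite_subsets_at_top_neq_bot this]
    obtain F where F: "finite F" "k \<in> F" "\<And>x. dist (\<Sum>j\<in>F. a j * char j x) (g x) < e" by auto
    have "cmod (fourier_coeff g k - fourier_coeff (\<lambda>x. \<Sum>j\<in>F. a j * char j x) k) \<le> e"
    proof (rule fourier_coeff_le_sup[OF sq square_integrable_sum[OF square_integrable_char]])
      show "cmod (g x - (\<Sum>j\<in>F. a j * char j x)) \<le> e" for x
        using F(3)[of x] by (simp add: dist_norm norm_minus_commute)
    qed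
    then show ?thesis unfolding fourier_coeff_trig_sum[OF F(1,2), of a] .
  qed
  then have "cmod (fourier_coeff g k - a k) \<le> 0" by (rule dense_ge)
  then have "fourier_coeff g k = a k" by simp
  then show ?thesis unfolding g_def[abs_def] .
qed

context schroedinger_flow
begin

text \<open>With S k the supremum of the modulus of \<alpha> k over the time interval, the smoothing
  bound controls S k by the coefficient of f, \<nu> k S (- k) and a summable term, where \<nu> is
  square summable. Off a finite set \<nu> is at most 1/2 and the pair k, - k closes up. So S is
  bounded by coefficients of f plus summable terms, and the remaining factor \<nu> makes the product
  with the square summable part summable.\<close>

lemma summable_smoothing:
  assumes T: "0 \<le> T"
  shows "\<exists>b. b summable_on UNIV \<and> (\<forall>k t. \<bar>t\<bar> \<le> T \<longrightarrow> cmod (\<alpha> k t - fourier_coeff f k) \<le> b k)"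
proof -
  obtain D where D: "0 \<le> D" "\<And>t k. \<bar>t\<bar> \<le> T \<Longrightarrow> cmod (\<alpha> k t) \<le> D"
   "\<And>k S t. (\<And>\<tau>. \<bar>\<tau>\<bar> \<le> T \<Longrightarrow> cmod (\<alpha> (-k) \<tau>) \<le> S) \<Longrightarrow> \<bar>t\<bar> \<le> T \<Longrightarrow>
     cmod (\<alpha> k t - fourier_coeff f k) \<le> T * cmod (fourier_coeff Vp (2 * k)) * S + D * weight_sum k"
    using smoothing[OF T] by blast
  define \<nu> where "\<nu> k = T * cmod (fourier_coeff Vp (2 * k))" for k
  have \<nu>: "0 \<le> \<nu> k" for k using T by (simp add: \<nu>_def)
  have \<nu>2: "(\<lambda>k. (\<nu> k)\<^sup>2) summable_on UNIV"
  proof -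
    have "(\<lambda>k. (cmod (fourier_coeff Vp k))\<^sup>2) summable_on UNIV" by (intro fourier_coeff_summable Hs_square_integrable[OF Vp_Hs])
    from summable_on_cmult_right[OF summable_on_double_index[OF this], of "T\<^sup>2"]
    show ?thesis by (simp add: \<nu>_def power_mult_distrib)
  qed
  have "\<exists>K. finite K \<and> (\<forall>F. finite F \<longrightarrow> F \<inter> K = {} \<longrightarrow> (\<Sum>k\<in>F. (\<nu> k)\<^sup>2) \<le> (1/2)\<^sup>2)"
    by (rule summable_on_tail[OF \<nu>2]) auto
  then obtain K0 where K0: "finite K0" "\<forall>F. finite F \<longrightarrow> F \<inter> K0 = {} \<longrightarrow> (\<Sum>k\<in>F. (\<nu> k)\<^sup>2) \<le> (1/2)\<^sup>2"
    by (elim exE conjE) (rule that)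
  have half: "\<nu> k \<le> 1/2" if "k \<notin> K0" for k
  proof (rule power2_le_imp_le)
    show "(\<nu> k)\<^sup>2 \<le> (1/2)\<^sup>2" using K0(2)[rule_format, of "{k}"] that by simp
  qed simp
  \<comment> \<open>Made symmetric because the inequalities at k and - k are used together.\<close>
  define K where "K = K0 \<union> uminus ` K0"
  have K: "finite K" "\<And>k. k \<notin> K \<Longrightarrow> \<nu> k \<le> 1/2 \<and> \<nu> (- k) \<le> 1/2"
  proof -
    show "finite K" using K0(1) by (simp add: K_def)
    fix k assume k: "k \<notin> K"
    then have "- k \<notin> K0" unfolding K_def using image_eqI[of k uminus "- k" K0] by auto
    then show "\<nu> k \<le> 1/2 \<and> \<nu> (- k) \<le> 1/2" using k half by (simp add: K_def)
  qed
  define S where "S k = (SUP \<tau>\<in>{-T..T}. cmod (\<alpha> k \<tau>))" for k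
  have bdd: "bdd_above ((\<lambda>\<tau>. cmod (\<alpha> k \<tau>)) ` {-T..T})" for k using D(2) by (intro bdd_aboveI2[of _ _ D]) auto
  have S_ub: "cmod (\<alpha> k t) \<le> S k" if "\<bar>t\<bar> \<le> T" for k t
    unfolding S_def using that by (intro cSUP_upper bdd) auto
  have le: "cmod (\<alpha> k t - fourier_coeff f k) \<le> \<nu> k * S (- k) + D * weight_sum k" if "\<bar>t\<bar> \<le> T" for k t
    unfolding \<nu>_def by (rule D(3)[OF S_ub that])
  have S_le: "S k \<le> cmod (fourier_coeff f k) + \<nu> k * S (- k) + D * weight_sum k" for k
    unfolding S_def[of k]
  proof (rule cSUP_least)
    show "{-T..T} \<noteq> {}" using T by simp
    fix \<tau> assume "\<tau> \<in> {-T..T}"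
    then have "cmod (\<alpha> k \<tau> - fourier_coeff f k) \<le> \<nu> k * S (- k) + D * weight_sum k" by (intro le) auto
    then show "cmod (\<alpha> k \<tau>) \<le> cmod (fourier_coeff f k) + \<nu> k * S (- k) + D * weight_sum k"
      using norm_triangle_sub[of "\<alpha> k \<tau>" "fourier_coeff f k"] by linarith
  qed
  have S_nonneg: "0 \<le> S k" for k using order.trans[OF norm_ge_zero S_ub[of 0 k]] T by simp
  define A where "A k = cmod (fourier_coeff f k) + cmod (fourier_coeff f (- k)) + D * (weight_sum k + weight_sum (- k))" for k
  \<comment> \<open>The inequalities at k and - k are added, and half of S k + S (- k) moves to the
    left-hand side.\<close>
  have absorb: "S (- k) \<le> 2 * A k" if "k \<notin> K" for k
  proof -
    have "\<nu> k * S (- k) \<le> 1/2 * S (- k)" "\<nu> (- k) * S k \<le> 1/2 * S k"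
      using K(2)[OF that] S_nonneg by (intro mult_right_mono; simp)+
    then show ?thesis using S_le[of k] S_le[of "- k"] S_nonneg[of k] by (simp add: A_def distrib_left)
  qed
  define F where "F k = cmod (fourier_coeff f k) + cmod (fourier_coeff f (- k))" for k
  define W where "W k = D * (weight_sum k + weight_sum (- k))" for k
  \<comment> \<open>On the finite set K the bound before absorption is kept; finitely many terms do
    not affect summability.\<close>
  define b where "b k = (2 * (\<nu> k * F k) + W k + D * weight_sum k) + (if k \<in> K then \<nu> k * S (- k) else 0)" for k
  have W_nonneg: "0 \<le> W k" for k unfolding W_def using D(1) weight_sum_nonneg by simp
  have "cmod (\<alpha> k t - fourier_coeff f k) \<le> b k" if t: "\<bar>t\<bar> \<le> T" for k t
  proof (cases "k \<in> K")
    case True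
    have "0 \<le> \<nu> k * F k" using \<nu> by (simp add: F_def)
    then show ?thesis using True le[OF t, of k] W_nonneg[of k] by (simp add: b_def)
  next
    case False
    have "\<nu> k * S (- k) \<le> \<nu> k * (2 * (F k + W k))"
      using absorb[OF False] \<nu> by (intro mult_left_mono) (auto simp: A_def F_def W_def)
    also have "\<dots> \<le> 2 * (\<nu> k * F k) + W k"
      using mult_right_mono[of "\<nu> k" "1/2" "W k"] K(2)[OF False] W_nonneg[of k] by (simp add: algebra_simps)
    finally show ?thesis using False le[OF t, of k] by (simp add: b_def)
  qed
  moreover have "b summable_on UNIV"
  proof -
    have f2: "(\<lambda>k. (cmod (fourier_coeff f k))\<^sup>2) summable_on UNIV" by (rule fourier_coeff_summable[OF f_L2])
    have "(\<lambda>k. \<nu> k * cmod (fourier_coeff f k) + \<nu> k * cmod (fourier_coeff f (- k))) summable_on UNIV"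
      by (intro summable_on_add summable_on_mult_l2 \<nu>2 f2 summable_on_uminus_index[OF f2] \<nu>) auto
    then have 1: "(\<lambda>k. \<nu> k * F k) summable_on UNIV" by (simp add: F_def distrib_left)
    have 2: "W summable_on UNIV" unfolding W_def
      by (intro summable_on_cmult_right summable_on_add weight_sum_summable summable_on_uminus_index)
    have "(\<lambda>k. if k \<in> K then \<nu> k * S (- k) else 0) summable_on K" using K(1) by simp
    then have 3: "(\<lambda>k. if k \<in> K then \<nu> k * S (- k) else 0) summable_on UNIV"
      by (subst summable_on_cong_neutral[where T=K]) auto
    show ?thesis unfolding b_def
      by (intro summable_on_add summable_on_cmult_right 1 2 3 weight_sum_summable)
  qed
  ultimately show ?thesis by blast
qed

text \<open>The summable majorant depends on the length of the time interval, so uniform convergence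
  and continuity are obtained on an open strip around each point.\<close>

lemma continuous_correction:
  "\<exists>v. continuous_on UNIV (\<lambda>(t, x). v t x) \<and> (\<forall>t. periodic (v t)) \<and>
    (\<forall>t k. fourier_coeff (v t) k = cis (- t * (of_int k)\<^sup>2) * (\<alpha> k t - fourier_coeff f k))"
proof -
  define a where "a t k = cis (- t * (of_int k)\<^sup>2) * (\<alpha> k t - fourier_coeff f k)" for t and k :: int
  define v where "v t x = infsum (\<lambda>k. a t k * char k x) UNIV" for t x
  have b: "\<exists>b. b summable_on UNIV \<and> (\<forall>k t. \<bar>t\<bar> \<le> T \<longrightarrow> cmod (a t k) \<le> b k)" if "0 \<le> T" for T
    using summable_smoothing[OF that] by (simp add: a_def norm_mult)
  have "isCont (\<alpha> k) t" for k t using \<alpha>_derivative by (rule has_vector_derivative_continuous)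
  then have ca: "continuous_on X (\<lambda>t. a t k)" for k X
    unfolding a_def by (intro continuous_intros continuous_at_imp_continuous_on) auto
  have summand: "continuous_on X (\<lambda>(t, x). a t k * char k x)" for X k
    unfolding case_prod_unfold
    by (intro continuous_on_mult continuous_on_compose2[OF ca[of UNIV]] continuous_on_compose2[OF continuous_char[of UNIV]] continuous_intros) auto
  have "isCont (\<lambda>(t, x). v t x) p" for p
  proof -
    define Y where "Y = {- (\<bar>fst p\<bar> + 1)<..<\<bar>fst p\<bar> + 1} \<times> (UNIV :: real set)"
    obtain b where b: "b summable_on UNIV" "\<And>k t. \<bar>t\<bar> \<le> \<bar>fst p\<bar> + 1 \<Longrightarrow> cmod (a t k) \<le> b k"
      using b[of "\<bar>fst p\<bar> + 1"] by auto
    have "continuous_on Y (\<lambda>y. infsum (\<lambda>k. (\<lambda>(t, x). a t k * char k x) y) UNIV)"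
      by (rule continuous_on_function_series[OF _ b(1) summand]) (auto simp: Y_def norm_mult intro!: b(2))
    then have "continuous_on Y (\<lambda>(t, x). v t x)" by (simp add: v_def case_prod_unfold)
    moreover have "open Y" unfolding Y_def by (intro open_Times) auto
    moreover have "p \<in> Y" by (cases p) (auto simp: Y_def)
    ultimately show ?thesis by (simp add: continuous_on_eq_continuous_at)
  qed
  then have "continuous_on UNIV (\<lambda>(t, x). v t x)" by (simp add: continuous_at_imp_continuous_on)
  moreover have "periodic (v t)" for t unfolding periodic_def v_def by (simp add: char_periodic)
  moreover have "fourier_coeff (v t) k = a t k" for t k
  proof -
    obtain b where "b summable_on UNIV" "\<And>k. cmod (a t k) \<le> b k" using b[of "\<bar>t\<bar>"] by auto
    then show ?thesis unfolding v_def by (intro fourier_coeff_function_series)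
  qed
  ultimately show ?thesis unfolding a_def by blast
qed

lemma solution_AE_eq:
  assumes g: "square_integrable g" "periodic g" "\<And>k. fourier_coeff g k = cis (- t * (of_int k)\<^sup>2) * fourier_coeff f k"
    and v: "square_integrable v" "periodic v" "\<And>k. fourier_coeff v k = cis (- t * (of_int k)\<^sup>2) * (\<alpha> k t - fourier_coeff f k)"
  shows "AE x in lebesgue. u t x = exp (- \<i> * of_real t * V0) * (g x + v x)"
proof (rule AE_torus_periodic)
  show "AE x in torus. u t x = exp (- \<i> * of_real t * V0) * (g x + v x)"
  proof (rule fourier_coeff_eqI)
    fix k
    let ?e = "exp (\<i> * of_real t * ((of_int k)\<^sup>2 + V0))"
    have "exp (- \<i> * of_real t * V0) * cis (- t * (of_int k)\<^sup>2) * ?e = 1"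
      by (simp add: cis_conv_exp algebra_simps flip: exp_add)
    then have "exp (- \<i> * of_real t * V0) * (cis (- t * (of_int k)\<^sup>2) * \<alpha> k t) = fourier_coeff (u t) k"
      unfolding \<alpha>_def by (simp add: mult.assoc[symmetric])
    then show "fourier_coeff (u t) k = fourier_coeff (\<lambda>x. exp (- \<i> * of_real t * V0) * (g x + v x)) k"
      unfolding fourier_coeff_cmult fourier_coeff_add[OF g(1) v(1)] g(3) v(3) by (simp add: algebra_simps)
  qed (intro square_integrable_cmult square_integrable_add g v Hs_square_integrable[OF u_Hs])+
  have "periodic (u t)" using u_Hs by (simp add: Hs_def)
  then show "(u t (x + 2 * pi) = exp (- \<i> * of_real t * V0) * (g (x + 2 * pi) + v (x + 2 * pi))) =
      (u t x = exp (- \<i> * of_real t * V0) * (g x + v x))" for x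
    using g(2) v(2) by (simp add: periodic_def)
qed

end

subsection \<open>The solution\<close>

lemma continuous_on_slice:
  assumes "continuous_on UNIV (\<lambda>(t, x). g t x)" shows "continuous_on UNIV (g t)"
proof -
  have "continuous_on UNIV (Pair t)" by (intro continuous_on_Pair continuous_on_const continuous_on_id)
  from continuous_on_compose2[OF assms this] show ?thesis by simp
qed

theorem theorem1:
  fixes f V :: "real \<Rightarrow> complex" and u :: "real \<Rightarrow> real \<Rightarrow> complex" and s :: real
  assumes "f \<in> BV" and "V \<in> Hplus"
    and "0 < s" and "s < 1/2"
    and "solution s f V u"
  shows "(continuous_rep f \<longrightarrow> jointly_continuous_rep u) \<and>
    (\<not> continuous_rep f \<longrightarrow>
      (\<forall>t. t \<notin> pi_rationals \<longrightarrow> continuous_rep (u t)) \<and>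
      (\<forall>t. t \<in> pi_rationals \<longrightarrow>
         \<not> continuous_rep (u t) \<and> bounded_countably_discontinuous_rep (u t)))"
proof -
  obtain \<epsilon> where \<epsilon>: "0 < \<epsilon>" "V \<in> Hs \<epsilon>" using assms(2) by (auto simp: Hplus_def)
  have f_per: "periodic f" using assms(1) by (simp add: BV_def)
  obtain \<mu> where \<mu>: "bv_major f \<mu>" using BV_bv_major[OF assms(1)] by blast
  have f_bp: "bounded_periodic f" by (rule bv_major_bounded_periodic[OF \<mu> f_per])
  interpret schroedinger_flow f V u s \<epsilon>
    using assms(3,5) \<epsilon> bounded_periodic_square_integrable[OF f_bp] by unfold_locales (auto simp: solution_def)
  obtain v where v: "continuous_on UNIV (\<lambda>(t, x). v t x)" "\<And>t. periodic (v t)"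
    "\<And>t k. fourier_coeff (v t) k = cis (- t * (of_int k)\<^sup>2) * (\<alpha> k t - fourier_coeff f k)"
    using continuous_correction by blast
  have v_cont: "continuous_on UNIV (v t)" for t
    by (rule continuous_on_slice[OF v(1)])
  have v_bp: "bounded_periodic (v t)" for t by (rule continuous_bounded_periodic[OF v_cont v(2)])
  let ?e = "\<lambda>t::real. exp (- \<i> * of_real t * V0)"
  have u_eq: "ae_eq (u t) (\<lambda>x. ?e t * (g x + v t x))"
    if "bounded_periodic g" "\<And>k. fourier_coeff g k = cis (- t * (of_int k)\<^sup>2) * fourier_coeff f k" for g t
    unfolding ae_eq_def
    by (rule solution_AE_eq[OF _ _ that(2) _ v(2,3)])
       (use that(1) v_bp in \<open>auto intro: bounded_periodic_square_integrable simp: bounded_periodic_def\<close>)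
  have "jointly_continuous_rep u" if "continuous_rep f"
  proof -
    obtain g where g: "periodic g" "continuous_on UNIV g" "AE x in lebesgue. f x = g x"
      using \<open>continuous_rep f\<close> unfolding continuous_rep_def ae_eq_def by blast
    have "fourier_coeff g k = fourier_coeff f k" for k
      using fourier_coeff_AE_cong[OF _ _ g(3), of k] f_bp continuous_bounded_periodic[OF g(2,1)]
      by (simp add: bounded_periodic_square_integrable)
    moreover obtain G where G: "continuous_on UNIV (\<lambda>(t, x). G t x)" "\<And>t. periodic (G t)"
      "\<And>t k. fourier_coeff (G t) k = cis (- t * (of_int k)\<^sup>2) * fourier_coeff g k"
      using free_evolution_continuous[OF g(1) bv_major_AE_eq[OF \<mu> g(2,3)] g(2)] by auto
    moreover have "continuous_on UNIV (G t)" for t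
      by (rule continuous_on_slice[OF G(1)])
    ultimately have "ae_eq (u t) (\<lambda>x. ?e t * (G t x + v t x))" for t
      by (intro u_eq continuous_bounded_periodic) auto
    moreover have "continuous_on UNIV (\<lambda>(t, x). ?e t * (G t x + v t x))"
      using G(1) v(1) unfolding case_prod_unfold by (intro continuous_intros)
    moreover have "periodic (\<lambda>x. ?e t * (G t x + v t x))" for t
      using G(2) v(2) by (simp add: periodic_def)
    ultimately show ?thesis unfolding jointly_continuous_rep_def by (intro exI[of _ "\<lambda>t x. ?e t * (G t x + v t x)"]) simp
  qed
  moreover have "continuous_rep (u t)" if "t \<notin> pi_rationals" for t
  proof -
    have t: "t = pi * (t / pi)" by simp
    have "t / pi \<notin> \<rat>" using that pi_rationals_iff[of "t / pi"] by simp
    from free_evolution_irrational[OF f_per \<mu> this] obtain g where g: "continuous_on UNIV g" "periodic g"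
      "\<And>k. fourier_coeff g k = cis (- t * (of_int k)\<^sup>2) * fourier_coeff f k" by auto
    have "continuous_on UNIV (\<lambda>x. ?e t * (g x + v t x))" by (intro continuous_intros g v_cont)
    moreover have "periodic (\<lambda>x. ?e t * (g x + v t x))" using g(2) v(2) by (simp add: periodic_def)
    ultimately show ?thesis
      using u_eq[OF continuous_bounded_periodic[OF g(1,2)] g(3)] unfolding continuous_rep_def by blast
  qed
  \<comment> \<open>Discontinuity is proved in contrapositive form: a continuous representative at
    time t yields one of the initial datum.\<close>
  moreover have "bounded_countably_discontinuous_rep (u t)" and "continuous_rep (u t) \<Longrightarrow> continuous_rep f"
    if t: "t \<in> pi_rationals" for t
  proof -
    obtain q c where qc: "resolves t q c" using resolves_exists[OF t] by blast
    define g where "g = superpose q c f"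
    have g_bp: "bounded_periodic g" unfolding g_def by (rule bounded_periodic_superpose[OF f_bp])
    have g_coeff: "fourier_coeff g k = cis (- t * (of_int k)\<^sup>2) * fourier_coeff f k" for k
      unfolding g_def by (rule fourier_coeff_superpose[OF qc f_bp])
    have ae: "ae_eq (u t) (\<lambda>x. ?e t * (g x + v t x))" by (rule u_eq[OF g_bp g_coeff])
    show "bounded_countably_discontinuous_rep (u t)"
      unfolding bounded_countably_discontinuous_rep_def
    proof (intro exI[of _ "\<lambda>x. ?e t * (g x + v t x)"] conjI ae)
      show "periodic (\<lambda>x. ?e t * (g x + v t x))"
        using g_bp v(2) by (simp add: bounded_periodic_def periodic_def)
      obtain B B' where "\<And>x. cmod (g x) \<le> B" "\<And>x. cmod (v t x) \<le> B'"
        using g_bp v_bp[of t] unfolding bounded_periodic_def bounded_iff by auto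
      then have "cmod (?e t * (g x + v t x)) \<le> cmod (?e t) * (B + B')" for x
        unfolding norm_mult by (intro mult_left_mono order.trans[OF norm_triangle_ineq] add_mono) auto
      then show "bounded (range (\<lambda>x. ?e t * (g x + v t x)))" unfolding bounded_iff by blast
      obtain w where "bv_major g w" using bv_major_superpose[OF \<mu>] unfolding g_def by blast
      from bv_major_countable[OF this] show "countable {x. \<not> isCont (\<lambda>x. ?e t * (g x + v t x)) x}"
      proof (rule countable_subset[rotated])
        have "isCont (v t) x" for x using v_cont[of t] by (simp add: continuous_on_eq_continuous_at)
        then show "{x. \<not> isCont (\<lambda>x. ?e t * (g x + v t x)) x} \<subseteq> {x. \<not> isCont g x}"
          by (auto intro!: isCont_mult isCont_add)
      qed
    qed
    assume "continuous_rep (u t)"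
    then obtain h where h: "periodic h" "continuous_on UNIV h" "AE x in lebesgue. u t x = h x"
      unfolding continuous_rep_def ae_eq_def by blast
    \<comment> \<open>Removing the phase and the continuous correction leaves a continuous
      representative of the free evolution at time t.\<close>
    define G where "G x = exp (\<i> * of_real t * V0) * h x - v t x" for x
    have G_bp: "bounded_periodic G"
      unfolding G_def
      by (rule continuous_bounded_periodic) (use h(1) v(2) in \<open>auto simp: periodic_def intro!: continuous_intros h(2) v_cont\<close>)
    have G_cont: "continuous_on UNIV G" unfolding G_def by (intro continuous_intros h(2) v_cont)
    have "AE x in lebesgue. g x = G x"
      using h(3) ae unfolding ae_eq_def
    proof eventually_elim
      case (elim x)
      have e: "exp (\<i> * of_real t * V0) * ?e t = 1" by (simp flip: exp_add)
      have h: "h x = ?e t * (g x + v t x)" using elim by simp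
      have "exp (\<i> * of_real t * V0) * h x = g x + v t x" unfolding h mult.assoc[symmetric] e by (rule mult_1)
      then show ?case by (simp add: G_def)
    qed
    then have G_coeff: "fourier_coeff G k = cis (- t * (of_int k)\<^sup>2) * fourier_coeff f k" for k
      using fourier_coeff_AE_cong[of g G k] g_bp G_bp g_coeff by (simp add: bounded_periodic_square_integrable)
    \<comment> \<open>Back in time: - t is again in \<pi>\<rat>, so the backward evolution is a
      finite sum of translates, keeps G continuous and recovers f.\<close>
    have "- t \<in> pi_rationals" using t pi_rationals_iff[of "t / pi"] pi_rationals_iff[of "- (t / pi)"] by simp
    then obtain q' c' where qc': "resolves (- t) q' c'" using resolves_exists by blast
    define F where "F = superpose q' c' G"
    have F_bp: "bounded_periodic F" unfolding F_def by (rule bounded_periodic_superpose[OF G_bp])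
    have "fourier_coeff F k = fourier_coeff f k" for k
      unfolding F_def fourier_coeff_superpose[OF qc' G_bp] G_coeff by (simp add: cis_mult flip: mult.assoc)
    then have "AE x in lebesgue. f x = F x" by (intro AE_eq_of_fourier_coeff f_bp F_bp) simp
    moreover have "continuous_on UNIV F" unfolding F_def by (rule continuous_superpose[OF G_cont])
    ultimately show "continuous_rep f"
      using F_bp unfolding continuous_rep_def ae_eq_def bounded_periodic_def by blast
  qed
  ultimately show ?thesis by blast
qed

end
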